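(* Let $d>0$ and, for $j\in\{0,s,a\}$, let $H_j$ be the self-adjoint operator on $L^2_j(\Omega)$ associated with the closed quadratic form $q_j[\varphi]=\int_\Omega|\nabla\varphi|^2\,\mathrm{d}x$ with form domain $\mathcal{D}_j$, where $\Omega=\{(x,y)\in(0,\infty)^2:\ |x-y|<d\}$ and $\mathcal{D}_j$, $L^2_j(\Omega)$ are as defined in the context. Then for every $j\in\{0,s,a\}$ there is some $E_j\geq 0$ such that $$\sigma_{\mathrm{d}}(H_j)=\{E_j\},$$ and $E_j$ is an eigenvalue of $H_j$ of multiplicity one. In other words, the discrete spectrum of $H_j$ consists of exactly one eigenvalue, and this eigenvalue is simple.
   Context: Let $\mathbb{R}_+=(0,\infty)$, let $d>0$ be fixed, and set $$\Omega=\{(x,y)\in\mathbb{R}_+^2:\ |x-y|<d\},\qquad \partial\Omega_D=\{(x,y)\in\mathbb{R}_+^2:\ |x-y|=d\}.$$ Define the Hilbert spaces $L^2_0(\Omega):=L^2(\Omega)$ and $$L^2_s(\Omega):=\{\varphi\in L^2(\Omega):\ \varphi(x,y)=\varphi(y,x)\},\qquad L^2_a(\Omega):=\{\varphi\in L^2(\Omega):\ \varphi(x,y)=-\varphi(y,x)\}.$$ For $j\in\{0,s,a\}$ the quadratic form is $$q_j[\varphi]:=\int_\Omega|\nabla\varphi|^2\,\mathrm{d}x,\qquad \mathcal{D}_j=\{\varphi\in H^1(\Omega):\ \varphi\in L^2_j(\Omega)\ \text{and}\ \varphi|_{\partial\Omega_D}=0\},$$ where $\mathrm{d}x$ denotes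 two-dimensional Lebesgue measure and $\varphi|_{\partial\Omega_D}$ is understood in the sense of traces. (No condition is imposed on the parts of $\partial\Omega$ lying on the coordinate axes.) This is a closed, positive form with dense domain in $L^2_j(\Omega)$, and $H_j$ denotes the self-adjoint operator on $L^2_j(\Omega)$ associated with it; it acts as a version of the two-dimensional Laplacian $-\Delta$. The discrete spectrum $\sigma_{\mathrm{d}}(\cdot)$ of a self-adjoint operator is the set of isolated points of its spectrum that are eigenvalues of finite multiplicity. *)

theory Defs
  imports "HOL-Analysis.Analysis"
begin

section \<open>Square-integrable functions\<close>

text \<open>
  Elements of \<open>L\<^sup>2(M)\<close> are represented by functions, and equality in \<open>L\<^sup>2(M)\<close> by equality
  almost everywhere. All notions below are invariant under changes on null sets.
\<close>

definition L2 :: "'a measure \<Rightarrow> ('a \<Rightarrow> complex) set" where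
  "L2 M = {f \<in> borel_measurable M. integrable M (\<lambda>p. (cmod (f p))\<^sup>2)}"

definition l2_inner :: "'a measure \<Rightarrow> ('a \<Rightarrow> complex) \<Rightarrow> ('a \<Rightarrow> complex) \<Rightarrow> complex" where
  "l2_inner M f g = (LINT p|M. cnj (f p) * g p)"

definition l2_norm :: "'a measure \<Rightarrow> ('a \<Rightarrow> complex) \<Rightarrow> real" where
  "l2_norm M f = sqrt (LINT p|M. (cmod (f p))\<^sup>2)"

text \<open>
  \<open>V\<close>, viewed modulo equality almost everywhere, has a basis of exactly \<open>n\<close> elements.
\<close>

definition has_dim_ae :: "'a measure \<Rightarrow> ('a \<Rightarrow> complex) set \<Rightarrow> nat \<Rightarrow> bool" where
  "has_dim_ae M V n \<longleftrightarrow>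
     (\<exists>b :: nat \<Rightarrow> 'a \<Rightarrow> complex.
        (\<forall>i<n. b i \<in> V) \<and>
        (\<forall>c :: nat \<Rightarrow> complex. (AE p in M. (\<Sum>i<n. c i * b i p) = 0) \<longrightarrow> (\<forall>i<n. c i = 0)) \<and>
        (\<forall>f\<in>V. \<exists>c :: nat \<Rightarrow> complex. AE p in M. f p = (\<Sum>i<n. c i * b i p)))"


section \<open>Unbounded operators and their spectra\<close>

text \<open>
  An operator \<open>T\<close> in a closed subspace \<open>V\<close> of \<open>L\<^sup>2(M)\<close> is given by its graph, the set of all
  pairs \<open>(\<phi>, \<eta>)\<close> such that \<open>\<phi>\<close> is in the domain and \<open>T \<phi> = \<eta>\<close> almost everywhere.
\<close>

type_synonym 'a operator = "(('a \<Rightarrow> complex) \<times> ('a \<Rightarrow> complex)) set"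

text \<open>
  The operator associated with a sesquilinear form \<open>a\<close> (antilinear in the first argument) with
  form domain \<open>D\<close>: its domain consists of those \<open>\<phi> \<in> D\<close> for which some \<open>\<eta> \<in> V\<close> satisfies
  \<open>a \<psi> \<phi> = \<langle>\<psi>, \<eta>\<rangle>\<close> for all \<open>\<psi> \<in> D\<close>, and it maps \<open>\<phi>\<close> to \<open>\<eta>\<close>. If the form is densely defined,
  closed and nonnegative, this is the self-adjoint operator of the first representation theorem.
\<close>

definition form_operator ::
  "'a measure \<Rightarrow> ('a \<Rightarrow> complex) set \<Rightarrow> ('a \<Rightarrow> complex) set \<Rightarrow>
     (('a \<Rightarrow> complex) \<Rightarrow> ('a \<Rightarrow> complex) \<Rightarrow> complex) \<Rightarrow> 'a operator" where
  "form_operator M V D a =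
     {(\<phi>, \<eta>). \<phi> \<in> D \<and> \<eta> \<in> V \<and> (\<forall>\<psi>\<in>D. a \<psi> \<phi> = l2_inner M \<psi> \<eta>)}"

text \<open>
  \<open>z\<close> is in the resolvent set if \<open>T - z\<close> maps its domain onto \<open>V\<close> and has a bounded inverse;
  injectivity is contained in the norm estimate.
\<close>

definition resolvent_set ::
  "'a measure \<Rightarrow> ('a \<Rightarrow> complex) set \<Rightarrow> 'a operator \<Rightarrow> complex set" where
  "resolvent_set M V T =
     {z. (\<forall>\<eta>\<in>V. \<exists>(\<phi>, \<psi>)\<in>T. AE p in M. \<psi> p - z * \<phi> p = \<eta> p) \<and>
         (\<exists>C. \<forall>(\<phi>, \<psi>)\<in>T. l2_norm M \<phi> \<le> C * l2_norm M (\<lambda>p. \<psi> p - z * \<phi> p))}"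

definition spectrum ::
  "'a measure \<Rightarrow> ('a \<Rightarrow> complex) set \<Rightarrow> 'a operator \<Rightarrow> complex set" where
  "spectrum M V T = - resolvent_set M V T"

definition eigenspace :: "'a measure \<Rightarrow> 'a operator \<Rightarrow> complex \<Rightarrow> ('a \<Rightarrow> complex) set" where
  "eigenspace M T z = {\<phi>. \<exists>\<psi>. (\<phi>, \<psi>) \<in> T \<and> (AE p in M. \<psi> p = z * \<phi> p)}"

definition is_eigenvalue :: "'a measure \<Rightarrow> 'a operator \<Rightarrow> complex \<Rightarrow> bool" where
  "is_eigenvalue M T z \<longleftrightarrow> (\<exists>\<phi>\<in>eigenspace M T z. \<not> (AE p in M. \<phi> p = 0))"

definition has_multiplicity :: "'a measure \<Rightarrow> 'a operator \<Rightarrow> complex \<Rightarrow> nat \<Rightarrow> bool" where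
  "has_multiplicity M T z n \<longleftrightarrow> has_dim_ae M (eigenspace M T z) n"

definition discrete_spectrum ::
  "'a measure \<Rightarrow> ('a \<Rightarrow> complex) set \<Rightarrow> 'a operator \<Rightarrow> complex set" where
  "discrete_spectrum M V T =
     {z. z isolated_in spectrum M V T \<and> is_eigenvalue M T z \<and> (\<exists>n. has_multiplicity M T z n)}"


section \<open>Sobolev functions on open sets\<close>

fun times_cont_diff :: "nat \<Rightarrow> ('a::euclidean_space \<Rightarrow> complex) \<Rightarrow> bool" where
  "times_cont_diff 0 f \<longleftrightarrow> continuous_on UNIV f"
| "times_cont_diff (Suc k) f \<longleftrightarrow>
     f differentiable_on UNIV \<and>
     (\<forall>v\<in>Basis. times_cont_diff k (\<lambda>p. frechet_derivative f (at p) v))"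

text \<open>The space of smooth functions on the whole space with compact support in \<open>U\<close>.\<close>

definition test_functions :: "'a::euclidean_space set \<Rightarrow> ('a \<Rightarrow> complex) set" where
  "test_functions U =
     {f. (\<forall>k. times_cont_diff k f) \<and>
         compact (closure {p. f p \<noteq> 0}) \<and> closure {p. f p \<noteq> 0} \<subseteq> U}"

definition is_weak_deriv ::
  "'a::euclidean_space set \<Rightarrow> 'a \<Rightarrow> ('a \<Rightarrow> complex) \<Rightarrow> ('a \<Rightarrow> complex) \<Rightarrow> bool" where
  "is_weak_deriv U v f g \<longleftrightarrow>
     (\<forall>\<phi>\<in>test_functions U.
        (LINT p|lebesgue_on U. f p * frechet_derivative \<phi> (at p) v) =
        - (LINT p|lebesgue_on U. g p * \<phi> p))"

definition H1 :: "'a::euclidean_space set \<Rightarrow> ('a \<Rightarrow> complex) set" where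
  "H1 U = {f \<in> L2 (lebesgue_on U). \<forall>v\<in>Basis. \<exists>g\<in>L2 (lebesgue_on U). is_weak_deriv U v f g}"

text \<open>For \<open>f \<in> H\<^sup>1(U)\<close> and \<open>v \<in> Basis\<close> the weak derivative is unique up to null sets.\<close>

definition weak_deriv ::
  "'a::euclidean_space set \<Rightarrow> 'a \<Rightarrow> ('a \<Rightarrow> complex) \<Rightarrow> 'a \<Rightarrow> complex" where
  "weak_deriv U v f = (SOME g. g \<in> L2 (lebesgue_on U) \<and> is_weak_deriv U v f g)"

definition H1_norm :: "'a::euclidean_space set \<Rightarrow> ('a \<Rightarrow> complex) \<Rightarrow> real" where
  "H1_norm U f =
     sqrt ((l2_norm (lebesgue_on U) f)\<^sup>2 + (\<Sum>v\<in>Basis. (l2_norm (lebesgue_on U) (weak_deriv U v f))\<^sup>2))"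

text \<open>The quadratic form \<open>\<integral>|\<nabla>f|\<^sup>2\<close> and its associated sesquilinear form.\<close>

definition dirichlet_energy :: "'a::euclidean_space set \<Rightarrow> ('a \<Rightarrow> complex) \<Rightarrow> real" where
  "dirichlet_energy U f = (LINT p|lebesgue_on U. (\<Sum>v\<in>Basis. (cmod (weak_deriv U v f p))\<^sup>2))"

definition dirichlet_form ::
  "'a::euclidean_space set \<Rightarrow> ('a \<Rightarrow> complex) \<Rightarrow> ('a \<Rightarrow> complex) \<Rightarrow> complex" where
  "dirichlet_form U f g =
     (LINT p|lebesgue_on U. (\<Sum>v\<in>Basis. cnj (weak_deriv U v f p) * weak_deriv U v g p))"

lemma dirichlet_form_diagonal: "dirichlet_form U f f = of_real (dirichlet_energy U f)"
proof -
  have "cnj z * z = of_real ((cmod z)\<^sup>2)" for z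
    by (metis complex_norm_square mult.commute)
  then show ?thesis
    unfolding dirichlet_form_def dirichlet_energy_def
    by (simp flip: of_real_sum of_real_power)
qed


section \<open>The operators on the half-strip\<close>

definition Omega :: "real \<Rightarrow> (real \<times> real) set" where
  "Omega d = {(x, y). 0 < x \<and> 0 < y \<and> \<bar>x - y\<bar> < d}"

definition Omega_measure :: "real \<Rightarrow> (real \<times> real) measure" where
  "Omega_measure d = lebesgue_on (Omega d)"

definition boundary_D :: "real \<Rightarrow> (real \<times> real) set" where
  "boundary_D d = {(x, y). 0 < x \<and> 0 < y \<and> \<bar>x - y\<bar> = d}"

text \<open>
  For \<open>t > 0\<close> this runs through the upper ray of \<open>boundary_D d\<close>, for \<open>t < 0\<close> through the lower
  one, in both cases with speed \<open>sqrt 2\<close>. The value at \<open>0\<close> is irrelevant for the measure.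
\<close>

definition boundary_param :: "real \<Rightarrow> real \<Rightarrow> real \<times> real" where
  "boundary_param d t = (if 0 < t then (t, t + d) else (d - t, - t))"

lemma boundary_param_image:
  assumes "d > 0"
  shows "boundary_param d ` (- {0}) = boundary_D d"
proof
  show "boundary_param d ` (- {0}) \<subseteq> boundary_D d"
    using assms by (auto simp: boundary_param_def boundary_D_def)
  show "boundary_D d \<subseteq> boundary_param d ` (- {0})"
  proof
    fix p assume p: "p \<in> boundary_D d"
    obtain x y where xy: "p = (x, y)" by (cases p)
    have "p = boundary_param d (if x < y then x else - y)" "(if x < y then x else - y) \<noteq> 0"
      using p assms by (auto simp: xy boundary_param_def boundary_D_def)
    then show "p \<in> boundary_param d ` (- {0})" by blast
  qed
qed

text \<open>Arc length on \<open>boundary_D d\<close>, as a measure on the plane.\<close>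

definition boundary_measure :: "real \<Rightarrow> (real \<times> real) measure" where
  "boundary_measure d = scale_measure (ennreal (sqrt 2)) (distr lborel borel (boundary_param d))"

text \<open>
  The trace on \<open>boundary_D d\<close> is the continuous extension to \<open>H\<^sup>1\<close> of the restriction map
  defined on smooth functions of compact support in the plane (the support may meet the boundary);
  these are dense in \<open>H\<^sup>1(Omega d)\<close>, since \<open>Omega d\<close> is a Lipschitz domain. The following is the graph
  of that extension.
\<close>

definition has_trace ::
  "real \<Rightarrow> (real \<times> real \<Rightarrow> complex) \<Rightarrow> (real \<times> real \<Rightarrow> complex) \<Rightarrow> bool" where
  "has_trace d f g \<longleftrightarrow>
     f \<in> H1 (Omega d) \<and> g \<in> L2 (boundary_measure d) \<and>
     (\<exists>F. (\<forall>n. F n \<in> test_functions UNIV) \<and>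
          (\<lambda>n. H1_norm (Omega d) (\<lambda>p. F n p - f p)) \<longlonglongrightarrow> 0 \<and>
          (\<lambda>n. l2_norm (boundary_measure d) (\<lambda>p. F n p - g p)) \<longlonglongrightarrow> 0)"

text \<open>The three cases \<open>0\<close>, \<open>s\<close>, \<open>a\<close>: no symmetry, symmetric, antisymmetric.\<close>

datatype sector = Sector_0 | Sector_s | Sector_a

fun has_sector_symmetry :: "real \<Rightarrow> sector \<Rightarrow> (real \<times> real \<Rightarrow> complex) \<Rightarrow> bool" where
  "has_sector_symmetry d Sector_0 f \<longleftrightarrow> True"
| "has_sector_symmetry d Sector_s f \<longleftrightarrow> (AE (x, y) in Omega_measure d. f (x, y) = f (y, x))"
| "has_sector_symmetry d Sector_a f \<longleftrightarrow> (AE (x, y) in Omega_measure d. f (x, y) = - f (y, x))"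

definition L2_sector :: "real \<Rightarrow> sector \<Rightarrow> (real \<times> real \<Rightarrow> complex) set" where
  "L2_sector d j = {f \<in> L2 (Omega_measure d). has_sector_symmetry d j f}"

definition form_domain :: "real \<Rightarrow> sector \<Rightarrow> (real \<times> real \<Rightarrow> complex) set" where
  "form_domain d j = {f \<in> H1 (Omega d). f \<in> L2_sector d j \<and> has_trace d f (\<lambda>_. 0)}"

definition H_op :: "real \<Rightarrow> sector \<Rightarrow> (real \<times> real) operator" where
  "H_op d j =
     form_operator (Omega_measure d) (L2_sector d j) (form_domain d j) (dirichlet_form (Omega d))"

end

theory Submission
  imports Defs
begin

text \<open>
  In the coordinates \<open>s = x + y\<close>, \<open>t = x - y\<close> the half-strip is \<open>|t| < min s d\<close>. Put \<open>\<omega> = pi / d\<close> in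
  the antisymmetric sector and \<open>\<omega> = pi / (2 d)\<close> otherwise, the lowest frequency of the cross section
  \<open>(- d, d)\<close> with Dirichlet conditions and the given parity, and \<open>\<Lambda> = 2 \<omega>\<^sup>2\<close>. The theorem follows
  from three facts.

  On functions orthogonal to one fixed function \<open>g\<close> the form is bounded below by \<open>\<Lambda>\<close>, hence there
  is at most one eigenvalue below \<open>\<Lambda>\<close>, counted with multiplicity. Here \<open>g\<close> is the indicator
  function of the square \<open>(0, d)\<^sup>2\<close>, in the antisymmetric sector of a parallelogram inside
  \<open>d / 2 < s \<le> d\<close>. On this set the form satisfies the Neumann Poincare inequality with
  constant \<open>\<Lambda>\<close>; on the rest of the half-strip each segment in the direction of \<open>t\<close> has an end
  where the function vanishes and is so short that the one-dimensional inequality suffices.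

  Some function has energy below \<open>\<Lambda>\<close>: the product of the ground state of the cross section with
  a function of \<open>s\<close> that decays slowly. Hence there is an eigenvalue \<open>E < \<Lambda>\<close>, and the rest of the
  spectrum near \<open>E\<close> is empty.

  Wave packets travelling along the strip, multiplied by the ground state of the cross section,
  show that \<open>[\<Lambda>, \<infinity>)\<close> is in the spectrum, so that no point of it is isolated.
\<close>

text \<open>The half-strip is unbounded, so a minimising sequence could escape to infinity. The
  bound on the hyperplane prevents this: once minimisers are scaled to scalar product 1 with
  \<open>g\<close>, their differences are orthogonal to \<open>g\<close>, where the shifted form
  controls the norm, so the sequence is Cauchy.

  Zero trace is given by test functions that may be nonzero on the boundary and whose boundary norms
  tend to 0. The one-dimensional bounds therefore carry boundary terms with a tangent that is finite
  only for frequencies \<theta> < \<omega>. The approximation is removed first; only then does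
  \<theta> tend to \<omega>.

  The factor 2 in \<Lambda> arises because |grad f|^2 = 2 (|f_s|^2 + |f_t|^2).

  An antisymmetric function has mean zero on the square, whose indicator then gives no condition. On
  the half t > 0 a section 0 < t < s has a Dirichlet end at 0 and a free end at s; its lowest
  frequency pi / (2 s) falls below pi / d once s > d / 2. For d / 2 < s \<le> d a piece of length d
  / 2 is cut off at the free end, and these pieces form the parallelogram.\<close>

section \<open>Sesquilinear forms\<close>

text \<open>\<open>cb c f d g\<close> stands for the linear combination \<open>c f + d g\<close>: functions with complex values are not an
  instance of a class of complex vector spaces.\<close>

locale hform =
  fixes cb :: "complex \<Rightarrow> 'v \<Rightarrow> complex \<Rightarrow> 'v \<Rightarrow> 'v"
    and S :: "'v set" and h :: "'v \<Rightarrow> 'v \<Rightarrow> complex"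
  assumes cb_closed: "\<lbrakk>f \<in> S; g \<in> S\<rbrakk> \<Longrightarrow> cb c f d g \<in> S"
    and lin: "\<lbrakk>x \<in> S; f \<in> S; g \<in> S\<rbrakk> \<Longrightarrow> h x (cb c f d g) = c * h x f + d * h x g"
    and sym: "\<lbrakk>x \<in> S; y \<in> S\<rbrakk> \<Longrightarrow> h y x = cnj (h x y)"
    and pos: "x \<in> S \<Longrightarrow> 0 \<le> Re (h x x)"
begin

abbreviation q :: "'v \<Rightarrow> real" where "q x \<equiv> Re (h x x)"
abbreviation diff :: "'v \<Rightarrow> 'v \<Rightarrow> 'v" where "diff f g \<equiv> cb 1 f (- 1) g"

lemma antilin:
  assumes "x \<in> S" "f \<in> S" "g \<in> S"
  shows "h (cb c f d g) x = cnj c * h f x + cnj d * h g x"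
proof -
  have "h (cb c f d g) x = cnj (h x (cb c f d g))"
    using assms by (intro sym cb_closed)
  also have "\<dots> = cnj c * h f x + cnj d * h g x"
    using assms by (simp add: lin sym[of x f] sym[of x g])
  finally show ?thesis .
qed

lemma im0: "x \<in> S \<Longrightarrow> h x x = of_real (q x)"
  using sym[of x x] by (simp add: complex_eq_iff)

lemma q_cb:
  assumes "f \<in> S" "g \<in> S"
  shows "q (cb c f d g) = (cmod c)\<^sup>2 * q f + (cmod d)\<^sup>2 * q g + 2 * Re (cnj c * d * h f g)"
proof -
  have "h (cb c f d g) (cb c f d g) =
     cnj c * c * h f f + cnj d * d * h g g + (cnj c * d * h f g + cnj (cnj c * d * h f g))"
    using assms by (simp add: lin antilin cb_closed sym[of f g] algebra_simps)
  also have "cnj c * c * h f f = of_real ((cmod c)\<^sup>2 * q f)"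
    using im0[OF assms(1)] by (metis complex_norm_square mult.commute of_real_mult)
  also have "cnj d * d * h g g = of_real ((cmod d)\<^sup>2 * q g)"
    using im0[OF assms(2)] by (metis complex_norm_square mult.commute of_real_mult)
  finally have "q (cb c f d g) = Re (of_real ((cmod c)\<^sup>2 * q f) + of_real ((cmod d)\<^sup>2 * q g)
      + (cnj c * d * h f g + cnj (cnj c * d * h f g)))" by (rule arg_cong)
  moreover have "Re (w + cnj w) = 2 * Re w" for w by simp
  ultimately show ?thesis by (simp only: plus_complex.sel(1) Re_complex_of_real)
qed

lemma q_diff:
  assumes "f \<in> S" "g \<in> S"
  shows "q (diff f g) = q f + q g - 2 * Re (h f g)"
  using q_cb[OF assms, of 1 "-1"] by simp

text \<open>The form is only positive semidefinite, so \<open>q g = 0\<close> needs its own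
  argument. Positivity at \<open>f\<close> minus \<open>s\<close> times the conjugate of
  \<open>h f g\<close> times \<open>g\<close>, for real \<open>s\<close>, gives a polynomial in
  \<open>s\<close>: the choice \<open>1 / q g\<close> is the usual one, and for
  \<open>q g = 0\<close> the polynomial is affine, so that a large \<open>s\<close> forces
  \<open>h f g = 0\<close>.\<close>

lemma cauchy_schwarz_sq:
  assumes "f \<in> S" "g \<in> S"
  shows "(cmod (h f g))\<^sup>2 \<le> q f * q g"
proof -
  define X where "X = h f g"
  have ineq: "0 \<le> q f + s\<^sup>2 * (cmod X)\<^sup>2 * q g - 2 * s * (cmod X)\<^sup>2" for s :: real
  proof -
    have "0 \<le> q (cb 1 f (- of_real s * cnj X) g)" using assms by (intro pos cb_closed)
    also have "\<dots> = q f + s\<^sup>2 * (cmod X)\<^sup>2 * q g + 2 * Re (- of_real s * (cnj X * X))"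
      using assms by (subst q_cb) (auto simp: X_def norm_mult power_mult_distrib algebra_simps)
    also have "cnj X * X = of_real ((cmod X)\<^sup>2)" by (metis complex_norm_square mult.commute)
    finally show ?thesis by simp
  qed
  show ?thesis
  proof (cases "q g = 0")
    case True
    have "(cmod X)\<^sup>2 \<le> 0"
    proof (rule ccontr)
      assume "\<not> (cmod X)\<^sup>2 \<le> 0"
      then have p: "(cmod X)\<^sup>2 > 0" by simp
      define s where "s = (q f + 1) / (cmod X)\<^sup>2"
      have "s * (cmod X)\<^sup>2 = q f + 1" using p by (simp add: s_def)
      then show False using ineq[of s] True pos[OF assms(1)] by (simp add: mult.assoc)
    qed
    then show ?thesis using True X_def by simp
  next
    case False
    then have "q g > 0" using pos[OF assms(2)] by simp
    then show ?thesis using ineq[of "1 / q g"] by (simp add: X_def field_simps power2_eq_square)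
  qed
qed

lemma cauchy_schwarz:
  assumes "f \<in> S" "g \<in> S"
  shows "cmod (h f g) \<le> sqrt (q f) * sqrt (q g)"
  by (metis cauchy_schwarz_sq[OF assms] real_le_rsqrt real_sqrt_mult)

lemma triangle:
  assumes "f \<in> S" "g \<in> S"
  shows "sqrt (q (cb c f d g)) \<le> cmod c * sqrt (q f) + cmod d * sqrt (q g)"
proof (rule real_le_lsqrt)
  show "0 \<le> cmod c * sqrt (q f) + cmod d * sqrt (q g)" using pos assms by simp
  have "Re (cnj c * d * h f g) \<le> cmod (cnj c * d * h f g)" by (rule complex_Re_le_cmod)
  also have "\<dots> \<le> cmod c * cmod d * (sqrt (q f) * sqrt (q g))"
    unfolding norm_mult complex_mod_cnj using cauchy_schwarz[OF assms] by (intro mult_left_mono) auto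
  finally show "q (cb c f d g) \<le> (cmod c * sqrt (q f) + cmod d * sqrt (q g))\<^sup>2"
    using pos assms by (subst q_cb) (auto simp: power2_sum power_mult_distrib algebra_simps)
qed

lemma triangle_diff:
  assumes "f \<in> S" "g \<in> S" "k \<in> S"
  shows "sqrt (q (diff f k)) \<le> sqrt (q (diff f g)) + sqrt (q (diff g k))"
proof -
  \<comment> \<open>The locale states no laws for \<open>cb\<close> itself, so the two vectors are
    compared only through the form.\<close>
  have "q (diff f k) = q (cb 1 (diff f g) 1 (diff g k))"
    using assms by (simp add: lin antilin cb_closed algebra_simps)
  then show ?thesis using triangle[of "diff f g" "diff g k" 1 1] assms by (simp add: cb_closed)
qed

lemma diff_commute: "f \<in> S \<Longrightarrow> g \<in> S \<Longrightarrow> q (diff f g) = q (diff g f)"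
  by (simp add: lin antilin cb_closed algebra_simps)

lemma parallelogram:
  assumes "f \<in> S" "g \<in> S"
  shows "q (diff f g) = 2 * q f + 2 * q g - 4 * q (cb (1/2) f (1/2) g)"
  using assms by (simp add: lin antilin cb_closed algebra_simps)

lemma q_cb_le: "f \<in> S \<Longrightarrow> g \<in> S \<Longrightarrow> q (cb c f d g) \<le> 2 * (cmod c)\<^sup>2 * q f + 2 * (cmod d)\<^sup>2 * q g"
proof -
  assume A: "f \<in> S" "g \<in> S"
  have "0 \<le> q (cb c f (-d) g)" using A by (intro pos cb_closed)
  then show ?thesis using A by (simp add: q_cb[of f g c d] q_cb[of f g c "-d"] del: mult_minus_left mult_minus_right)
    (simp add: algebra_simps)
qed

text \<open>Convergence is measured by the seminorm \<open>q\<close>, because a limit in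
  \<open>S\<close> is determined only up to vectors on which \<open>q\<close> vanishes, such as
  functions that are zero almost everywhere. Cauchy-Schwarz turns it into convergence of the
  form.\<close>

lemma tendsto_right:
  assumes "\<And>n. f n \<in> S" "l \<in> S" "x \<in> S" "(\<lambda>n. q (diff (f n) l)) \<longlonglongrightarrow> 0"
  shows "(\<lambda>n. h x (f n)) \<longlonglongrightarrow> h x l"
proof -
  have B: "(\<lambda>n. sqrt (q x) * sqrt (q (diff (f n) l))) \<longlonglongrightarrow> 0"
    using tendsto_mult[OF tendsto_const tendsto_real_sqrt[OF assms(4)], of "sqrt (q x)"] by (simp only: real_sqrt_zero mult_zero_right)
  have A: "cmod (h x (f n) - h x l) \<le> sqrt (q x) * sqrt (q (diff (f n) l))" for n
    using cauchy_schwarz[OF assms(3) cb_closed[OF assms(1,2)], of 1 n "-1"]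
    by (simp only: lin[OF assms(3,1,2)]) simp
  show ?thesis
    by (rule LIM_zero_cancel, rule Lim_null_comparison[OF always_eventually[OF allI[OF A]] B])
qed

lemma tendsto_left:
  assumes "\<And>n. f n \<in> S" "l \<in> S" "x \<in> S" "(\<lambda>n. q (diff (f n) l)) \<longlonglongrightarrow> 0"
  shows "(\<lambda>n. h (f n) x) \<longlonglongrightarrow> h l x"
proof -
  have "h y x = cnj (h x y)" if "y \<in> S" for y using sym[OF assms(3) that] .
  then show ?thesis using tendsto_cnj[OF tendsto_right[OF assms]] assms(1,2) by simp
qed

lemma tendsto_sqrt_q:
  assumes "\<And>n. f n \<in> S" "l \<in> S" "(\<lambda>n. q (diff (f n) l)) \<longlonglongrightarrow> 0"
  shows "(\<lambda>n. sqrt (q (f n))) \<longlonglongrightarrow> sqrt (q l)"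
proof -
  have t: "\<bar>sqrt (q f) - sqrt (q g)\<bar> \<le> sqrt (q (diff f g))" if "f \<in> S" "g \<in> S" for f g
  proof -
    have e: "q (cb 1 (diff f g) 1 g) = q f" "q (cb 1 (diff g f) 1 f) = q g"
      using that by (simp_all add: lin antilin cb_closed algebra_simps)
    have "sqrt (q f) \<le> sqrt (q (diff f g)) + sqrt (q g)"
      using triangle[of "diff f g" g 1 1] that by (simp only: e cb_closed norm_one mult_1)
    moreover have "sqrt (q g) \<le> sqrt (q (diff f g)) + sqrt (q f)"
      using triangle[of "diff g f" f 1 1] that
      by (simp only: e cb_closed norm_one mult_1 diff_commute[of g f])
    ultimately show ?thesis by linarith
  qed
  have B: "(\<lambda>n. sqrt (q (diff (f n) l))) \<longlonglongrightarrow> 0"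
    using tendsto_real_sqrt[OF assms(3)] by (simp only: real_sqrt_zero)
  have A: "norm (sqrt (q (f n)) - sqrt (q l)) \<le> sqrt (q (diff (f n) l))" for n
    using t[OF assms(1,2)] by (simp only: real_norm_def)
  show ?thesis
    by (rule LIM_zero_cancel, rule Lim_null_comparison[OF always_eventually[OF allI[OF A]] B])
qed

lemma tendsto_q:
  assumes "\<And>n. f n \<in> S" "l \<in> S" "(\<lambda>n. q (diff (f n) l)) \<longlonglongrightarrow> 0"
  shows "(\<lambda>n. q (f n)) \<longlonglongrightarrow> q l"
  using tendsto_power[OF tendsto_sqrt_q[OF assms], of 2] by (simp only: real_sqrt_pow2 pos assms(1,2))

end

section \<open>The space of square-integrable functions and its completeness\<close>

abbreviation fcomb :: "complex \<Rightarrow> ('a \<Rightarrow> complex) \<Rightarrow> complex \<Rightarrow> ('a \<Rightarrow> complex) \<Rightarrow> 'a \<Rightarrow> complex" where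
  "fcomb c f d g \<equiv> (\<lambda>p. c * f p + d * g p)"

lemma L2_measurable: "f \<in> L2 M \<Longrightarrow> f \<in> borel_measurable M"
  and L2_integrable_sq: "f \<in> L2 M \<Longrightarrow> integrable M (\<lambda>p. (cmod (f p))\<^sup>2)"
  by (auto simp: L2_def)

lemma L2_fcomb:
  assumes "f \<in> L2 M" "g \<in> L2 M"
  shows "fcomb c f d g \<in> L2 M"
proof -
  have m: "f \<in> borel_measurable M" "g \<in> borel_measurable M"
    using assms by (auto simp: L2_def)
  have "integrable M (\<lambda>p. (cmod (c * f p + d * g p))\<^sup>2)"
  proof (rule Bochner_Integration.integrable_bound)
    show "integrable M (\<lambda>p. 2 * (cmod c)\<^sup>2 * (cmod (f p))\<^sup>2 + 2 * (cmod d)\<^sup>2 * (cmod (g p))\<^sup>2)"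
      using assms by (auto simp: L2_def)
    show "AE p in M. norm ((cmod (c * f p + d * g p))\<^sup>2)
        \<le> norm (2 * (cmod c)\<^sup>2 * (cmod (f p))\<^sup>2 + 2 * (cmod d)\<^sup>2 * (cmod (g p))\<^sup>2)"
    proof (rule AE_I2)
      fix p
      have "cmod (c * f p + d * g p) \<le> cmod c * cmod (f p) + cmod d * cmod (g p)"
        by (metis norm_mult norm_triangle_ineq)
      then have "(cmod (c * f p + d * g p))\<^sup>2 \<le> (cmod c * cmod (f p) + cmod d * cmod (g p))\<^sup>2"
        by (rule power_mono) simp
      also have "\<dots> \<le> 2 * (cmod c * cmod (f p))\<^sup>2 + 2 * (cmod d * cmod (g p))\<^sup>2"
        using sum_squares_bound[of "cmod c * cmod (f p)" "cmod d * cmod (g p)"] by (simp add: power2_sum)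
      finally show "norm ((cmod (c * f p + d * g p))\<^sup>2)
        \<le> norm (2 * (cmod c)\<^sup>2 * (cmod (f p))\<^sup>2 + 2 * (cmod d)\<^sup>2 * (cmod (g p))\<^sup>2)"
        by (simp add: power_mult_distrib)
    qed
  qed (use m in measurable)
  then show ?thesis using m by (auto simp: L2_def)
qed

lemma L2_prod_integrable:
  assumes "f \<in> L2 M" "g \<in> L2 M"
  shows "integrable M (\<lambda>p. f p * g p)" "integrable M (\<lambda>p. cnj (f p) * g p)"
proof -
  have m[measurable]: "f \<in> borel_measurable M" "g \<in> borel_measurable M"
    using assms by (auto simp: L2_def)
  have i: "integrable M (\<lambda>p. (cmod (f p))\<^sup>2 + (cmod (g p))\<^sup>2)"
    using assms by (auto simp: L2_def)
  have c: "continuous_on UNIV cnj" by (intro continuous_intros)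
  have [measurable]: "(\<lambda>p. cnj (f p)) \<in> borel_measurable M"
    by (rule borel_measurable_continuous_on[OF c m(1)])
  have le: "cmod x * cmod y \<le> (cmod x)\<^sup>2 + (cmod y)\<^sup>2" for x y
    using sum_squares_bound[of "cmod x" "cmod y"] mult_nonneg_nonneg[of "cmod x" "cmod y", OF norm_ge_zero norm_ge_zero]
    by linarith
  show "integrable M (\<lambda>p. f p * g p)" "integrable M (\<lambda>p. cnj (f p) * g p)"
    by (rule Bochner_Integration.integrable_bound[OF i]; auto simp: norm_mult intro!: le)+
qed

lemma l2_norm_inner:
  shows "l2_norm M f = sqrt (Re (l2_inner M f f))"
proof -
  have "cnj (f p) * f p = of_real ((cmod (f p))\<^sup>2)" for p
    by (metis complex_norm_square mult.commute)
  then have "l2_inner M f f = of_real (LINT p|M. (cmod (f p))\<^sup>2)"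
    unfolding l2_inner_def by (simp flip: of_real_power)
  then show ?thesis by (simp add: l2_norm_def)
qed

lemma l2_norm_sq: "(l2_norm M f)\<^sup>2 = (LINT p|M. (cmod (f p))\<^sup>2)"
  by (simp add: l2_norm_def)

lemma l2_inner_self: "Re (l2_inner M f f) = (LINT p|M. (cmod (f p))\<^sup>2)"
  by (metis l2_norm_inner l2_norm_def real_sqrt_eq_iff)

lemma hform_L2: "hform fcomb (L2 M) (l2_inner M)"
proof
  fix x y f g c d
  show "fcomb c f d g \<in> L2 M" if "f \<in> L2 M" "g \<in> L2 M" using that by (rule L2_fcomb)
  show "l2_inner M x (fcomb c f d g) = c * l2_inner M x f + d * l2_inner M x g"
    if "x \<in> L2 M" "f \<in> L2 M" "g \<in> L2 M"
  proof -
    have "l2_inner M x (fcomb c f d g) = (LINT p|M. c * (cnj (x p) * f p) + d * (cnj (x p) * g p))"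
      unfolding l2_inner_def by (simp add: algebra_simps)
    also have "\<dots> = c * l2_inner M x f + d * l2_inner M x g"
      unfolding l2_inner_def
      by (subst Bochner_Integration.integral_add) (simp_all add: L2_prod_integrable that)
    finally show ?thesis .
  qed
  show "l2_inner M y x = cnj (l2_inner M x y)"
    unfolding l2_inner_def by (subst Bochner_Integration.integral_cnj[symmetric]) (simp add: mult.commute)
  show "0 \<le> Re (l2_inner M x x)" by (simp add: l2_inner_self)
qed

interpretation L2: hform fcomb "L2 M" "l2_inner M" for M
  by (rule hform_L2)

lemma l2_norm_zero_iff:
  assumes "f \<in> L2 M"
  shows "l2_norm M f = 0 \<longleftrightarrow> (AE p in M. f p = 0)"
  using integral_nonneg_eq_0_iff_AE[of M "\<lambda>p. (cmod (f p))\<^sup>2"] assms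
  by (auto simp: l2_norm_def L2_def)

lemma measurable_cnj [measurable]: "f \<in> borel_measurable M \<Longrightarrow> (\<lambda>p. cnj (f p)) \<in> borel_measurable M"
  by (rule borel_measurable_continuous_on[where f=cnj]) (auto intro!: continuous_intros)

lemma l2_inner_cong:
  assumes "f \<in> L2 M" "g \<in> L2 M" "x \<in> L2 M" "y \<in> L2 M"
    and "AE p in M. f p = g p" "AE p in M. x p = y p"
  shows "l2_inner M x f = l2_inner M y g"
  unfolding l2_inner_def
proof (rule integral_cong_AE)
  have [measurable]: "f \<in> borel_measurable M" "g \<in> borel_measurable M" "x \<in> borel_measurable M" "y \<in> borel_measurable M"
    using assms by (auto simp: L2_def)
  show "(\<lambda>p. cnj (x p) * f p) \<in> borel_measurable M" "(\<lambda>p. cnj (y p) * g p) \<in> borel_measurable M"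
    by measurable
  show "AE p in M. cnj (x p) * f p = cnj (y p) * g p"
    using assms(5,6) by eventually_elim simp
qed

lemma L2_congAE: "f \<in> L2 M \<Longrightarrow> g \<in> borel_measurable M \<Longrightarrow> AE p in M. f p = g p \<Longrightarrow> g \<in> L2 M"
  unfolding L2_def
  by (auto intro: integrable_cong_AE_imp)

text \<open>Riesz-Fischer for a fast Cauchy sequence. The sum of \<open>2 ^ n\<close> times the
  squared increments still has a finite integral, so almost everywhere the increments decay
  geometrically and the sequence converges pointwise; Fatou's lemma then bounds the distance to the
  limit at the original rate.\<close>

lemma L2_complete_aux:
  assumes f: "\<And>n. f n \<in> L2 M"
    and geo: "\<And>n m. n \<le> m \<Longrightarrow> Re (l2_inner M (\<lambda>p. f m p - f n p) (\<lambda>p. f m p - f n p)) \<le> (1/4)^n"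
  shows "\<exists>l\<in>L2 M. (\<lambda>n. Re (l2_inner M (\<lambda>p. f n p - l p) (\<lambda>p. f n p - l p))) \<longlonglongrightarrow> 0"
proof -
  have m[measurable]: "f n \<in> borel_measurable M" for n using f by (auto simp: L2_def)
  have i: "integrable M (\<lambda>p. (cmod (f m p - f n p))\<^sup>2)" for m n
    using L2_fcomb[OF f[of m] f[of n], of 1 "-1"] by (auto simp: L2_def)
  have nn: "(\<integral>\<^sup>+p. ennreal ((cmod (f m p - f n p))\<^sup>2) \<partial>M) \<le> ennreal ((1/4)^n)" if "n \<le> m" for m n
    using geo[OF that] i[of m n] by (simp add: nn_integral_eq_integral l2_inner_self)
  have "(\<integral>\<^sup>+p. (\<Sum>n. ennreal (2^n * (cmod (f (Suc n) p - f n p))\<^sup>2)) \<partial>M)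
      = (\<Sum>n. \<integral>\<^sup>+p. ennreal (2^n * (cmod (f (Suc n) p - f n p))\<^sup>2) \<partial>M)"
    by (rule nn_integral_suminf) measurable
  also have "\<dots> \<le> (\<Sum>n. ennreal ((1/2)^n))"
  proof (rule suminf_le)
    fix n
    have "(\<integral>\<^sup>+p. ennreal (2^n * (cmod (f (Suc n) p - f n p))\<^sup>2) \<partial>M)
       = ennreal (2^n) * (\<integral>\<^sup>+p. ennreal ((cmod (f (Suc n) p - f n p))\<^sup>2) \<partial>M)"
      by (subst nn_integral_cmult[symmetric]) (auto simp: ennreal_mult)
    also have "\<dots> \<le> ennreal (2^n) * ennreal ((1/4)^n)" by (intro mult_left_mono nn) auto
    also have "\<dots> = ennreal ((1/2)^n)"
      by (simp add: ennreal_mult[symmetric] power_mult_distrib[symmetric])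
    finally show "(\<integral>\<^sup>+p. ennreal (2^n * (cmod (f (Suc n) p - f n p))\<^sup>2) \<partial>M) \<le> ennreal ((1/2)^n)" .
  qed auto
  also have "\<dots> = ennreal (\<Sum>n. (1/2)^n)"
    by (rule suminf_ennreal2) (auto intro!: summable_geometric)
  finally have le: "(\<integral>\<^sup>+p. (\<Sum>n. ennreal (2^n * (cmod (f (Suc n) p - f n p))\<^sup>2)) \<partial>M) \<le> ennreal (\<Sum>n. (1/2)^n)" .
  from neq_top_trans[OF ennreal_neq_top le]
  have "(\<integral>\<^sup>+p. (\<Sum>n. ennreal (2^n * (cmod (f (Suc n) p - f n p))\<^sup>2)) \<partial>M) \<noteq> \<infinity>"
    by (simp only: infinity_ennreal_def not_False_eq_True)
  then have "AE p in M. (\<Sum>n. ennreal (2^n * (cmod (f (Suc n) p - f n p))\<^sup>2)) \<noteq> \<infinity>"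
    by (intro nn_integral_noteq_infinite) measurable
  then have conv: "AE p in M. convergent (\<lambda>n. f n p)"
  proof (rule AE_mp, intro AE_I2 impI)
    fix p assume A: "(\<Sum>n. ennreal (2^n * (cmod (f (Suc n) p - f n p))\<^sup>2)) \<noteq> \<infinity>"
    define C where "C = enn2real (\<Sum>n. ennreal (2^n * (cmod (f (Suc n) p - f n p))\<^sup>2))"
    have C0: "0 \<le> C" by (simp add: C_def)
    have ge: "a n \<le> (\<Sum>n. a n)" for a :: "nat \<Rightarrow> ennreal" and n
      using sum_le_suminf[of a "{n}"] by simp
    have "2^n * (cmod (f (Suc n) p - f n p))\<^sup>2 \<le> C" for n
    proof -
      have "ennreal (2^n * (cmod (f (Suc n) p - f n p))\<^sup>2) \<le> ennreal C"
        using ge[of "\<lambda>n. ennreal (2^n * (cmod (f (Suc n) p - f n p))\<^sup>2)" n] A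
        unfolding C_def by (subst ennreal_enn2real) (simp_all only: infinity_ennreal_def less_top)
      then show ?thesis by (subst (asm) ennreal_le_iff[OF C0])
    qed
    then have le: "(cmod (f (Suc n) p - f n p))\<^sup>2 \<le> C * (1/2)^n" for n
      by (simp add: power_divide field_simps)
    have "(sqrt C * (sqrt (1/2))^n)\<^sup>2 = C * ((sqrt (1/2))\<^sup>2)^n" for n
      unfolding power_mult_distrib power_mult[symmetric] mult.commute[of n 2] using C0 by simp
    then have "(cmod (f (Suc n) p - f n p))\<^sup>2 \<le> (sqrt C * (sqrt (1/2))^n)\<^sup>2" for n
      using le[of n] by simp
    then have b: "norm (f (Suc n) p - f n p) \<le> sqrt C * (sqrt (1/2))^n" for n
      by (rule power2_le_imp_le) (simp add: C0)
    have "sqrt (1/2::real) < 1" by (simp add: real_sqrt_divide)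
    then have "summable (\<lambda>n. sqrt C * (sqrt (1/2))^n)" by (intro summable_mult summable_geometric) auto
    then have "summable (\<lambda>n. f (Suc n) p - f n p)" by (rule summable_comparison_test'[where N=0]) (rule b)
    then have "convergent (\<lambda>n. \<Sum>i<n. f (Suc i) p - f i p)" by (simp add: summable_iff_convergent)
    then have "convergent (\<lambda>n. f n p - f 0 p)" by (simp only: sum_lessThan_telescope[of "\<lambda>n. f n p"])
    then show "convergent (\<lambda>n. f n p)" by (simp add: convergent_diff_const_right_iff)
  qed
  define l where "l = (\<lambda>p. lim (\<lambda>n. f n p))"
  have ml[measurable]: "l \<in> borel_measurable M" unfolding l_def by measurable
  have lim: "AE p in M. (\<lambda>n. f n p) \<longlonglongrightarrow> l p"
    using conv by eventually_elim (simp add: l_def convergent_LIMSEQ_iff)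
  have fat: "(\<integral>\<^sup>+p. ennreal ((cmod (f n p - l p))\<^sup>2) \<partial>M) \<le> ennreal ((1/4)^n)" for n
  proof -
    have "(\<integral>\<^sup>+p. ennreal ((cmod (f n p - l p))\<^sup>2) \<partial>M)
       = (\<integral>\<^sup>+p. liminf (\<lambda>m. ennreal ((cmod (f m p - f n p))\<^sup>2)) \<partial>M)"
    proof (rule nn_integral_cong_AE)
      show "AE p in M. ennreal ((cmod (f n p - l p))\<^sup>2) = liminf (\<lambda>m. ennreal ((cmod (f m p - f n p))\<^sup>2))"
        using lim
      proof eventually_elim
        case (elim p)
        have "(\<lambda>m. ennreal ((cmod (f m p - f n p))\<^sup>2)) \<longlonglongrightarrow> ennreal ((cmod (l p - f n p))\<^sup>2)"
          using elim by (intro tendsto_intros)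
        from lim_imp_Liminf[OF _ this] show ?case by (simp add: norm_minus_commute)
      qed
    qed
    also have "\<dots> \<le> liminf (\<lambda>m. \<integral>\<^sup>+p. ennreal ((cmod (f m p - f n p))\<^sup>2) \<partial>M)"
      by (rule nn_integral_liminf) measurable
    also have "\<dots> \<le> limsup (\<lambda>m. \<integral>\<^sup>+p. ennreal ((cmod (f m p - f n p))\<^sup>2) \<partial>M)"
      by (rule Liminf_le_Limsup) simp
    also have "\<dots> \<le> ennreal ((1/4)^n)"
      by (rule Limsup_bounded) (auto simp: eventually_sequentially intro!: exI[of _ n] nn)
    finally show ?thesis .
  qed
  have dl: "(\<lambda>p. f n p - l p) \<in> L2 M" for n
  proof -
    have "integrable M (\<lambda>p. (cmod (f n p - l p))\<^sup>2)"
      using fat[of n] by (intro integrableI_bounded) (auto simp: le_less_trans ennreal_less_top)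
    then show ?thesis by (auto simp: L2_def)
  qed
  have "l \<in> L2 M"
    using L2_fcomb[OF f[of 0] dl[of 0], of 1 "-1"] by (simp add: algebra_simps)
  moreover have "(\<lambda>n. Re (l2_inner M (\<lambda>p. f n p - l p) (\<lambda>p. f n p - l p))) \<longlonglongrightarrow> 0"
  proof (rule tendsto_sandwich)
    show "\<forall>\<^sub>F n in sequentially. Re (l2_inner M (\<lambda>p. f n p - l p) (\<lambda>p. f n p - l p)) \<le> (1/4)^n"
    proof (rule always_eventually, rule allI)
      fix n
      have "ennreal (LINT p|M. (cmod (f n p - l p))\<^sup>2) \<le> ennreal ((1/4)^n)"
        using fat[of n] dl[of n] by (subst nn_integral_eq_integral[symmetric]) (auto simp: L2_def)
      then show "Re (l2_inner M (\<lambda>p. f n p - l p) (\<lambda>p. f n p - l p)) \<le> (1/4)^n"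
        by (subst (asm) ennreal_le_iff) (auto simp: l2_inner_self)
    qed
    show "\<forall>\<^sub>F n in sequentially. 0 \<le> Re (l2_inner M (\<lambda>p. f n p - l p) (\<lambda>p. f n p - l p))"
      by (simp add: l2_inner_self)
    show "(\<lambda>n. (1/4::real)^n) \<longlonglongrightarrow> 0" by (rule LIMSEQ_power_zero) simp
  qed simp
  ultimately show ?thesis by blast
qed

lemma L2_complete:
  assumes f: "\<And>n. f n \<in> L2 M"
    and cau: "\<And>e. e > 0 \<Longrightarrow> \<exists>N. \<forall>m\<ge>N. \<forall>n\<ge>N. Re (l2_inner M (\<lambda>p. f m p - f n p) (\<lambda>p. f m p - f n p)) < e"
  shows "\<exists>l\<in>L2 M. (\<lambda>n. Re (l2_inner M (\<lambda>p. f n p - l p) (\<lambda>p. f n p - l p))) \<longlonglongrightarrow> 0"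
proof -
  let ?q = "\<lambda>g. Re (l2_inner M g g)"
  have "\<exists>N. \<forall>k. \<forall>m\<ge>N k. \<forall>n\<ge>N k. ?q (\<lambda>p. f m p - f n p) < (1/4)^k"
    using cau by (intro choice allI) simp
  then obtain N where N: "\<And>k m n. m \<ge> N k \<Longrightarrow> n \<ge> N k \<Longrightarrow> ?q (\<lambda>p. f m p - f n p) < (1/4)^k" by blast
  \<comment> \<open>The sum makes \<open>r\<close> monotone with \<open>r k \<ge> N k\<close>, and
    the summand \<open>k\<close> makes it tend to infinity; along \<open>r\<close> the sequence is
    Cauchy at the rate of \<open>L2_complete_aux\<close>.\<close>
  define r where "r k = (\<Sum>i\<le>k. N i) + k" for k
  have rN: "r k \<ge> N k" for k unfolding r_def by (intro trans_le_add1 member_le_sum) auto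
  have rmono: "r k \<le> r m" if "k \<le> m" for k m
    unfolding r_def using that by (intro add_mono sum_mono2) auto
  have rk: "r k \<ge> k" for k by (simp add: r_def)
  have "\<exists>l\<in>L2 M. (\<lambda>n. ?q (\<lambda>p. f (r n) p - l p)) \<longlonglongrightarrow> 0"
    using f by (intro L2_complete_aux less_imp_le[OF N]) (auto intro: order_trans[OF rN rmono] rN)
  then obtain l where l: "l \<in> L2 M" "(\<lambda>n. ?q (\<lambda>p. f (r n) p - l p)) \<longlonglongrightarrow> 0" by blast
  have "(\<lambda>n. ?q (\<lambda>p. f n p - l p)) \<longlonglongrightarrow> 0"
  proof (rule LIMSEQ_I)
    fix e :: real assume e: "0 < e"
    obtain N0 where N0: "\<And>m n. m \<ge> N0 \<Longrightarrow> n \<ge> N0 \<Longrightarrow> ?q (\<lambda>p. f m p - f n p) < e/4"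
      using cau[of "e/4"] e by auto
    obtain N1 where N1: "\<And>n. n \<ge> N1 \<Longrightarrow> ?q (\<lambda>p. f (r n) p - l p) < e/4"
    proof -
      have "eventually (\<lambda>n. ?q (\<lambda>p. f (r n) p - l p) < e/4) sequentially"
        using e by (intro order_tendstoD(2)[OF l(2)]) simp
      then show ?thesis using that unfolding eventually_sequentially by blast
    qed
    have "norm (?q (\<lambda>p. f n p - l p) - 0) < e" if n: "n \<ge> N0" for n
    proof -
      let ?k = "max N0 N1"
      have "?q (\<lambda>p. f n p - l p) = ?q (fcomb 1 (\<lambda>p. f n p - f (r ?k) p) 1 (\<lambda>p. f (r ?k) p - l p))"
        by simp
      also have "\<dots> \<le> 2 * ?q (\<lambda>p. f n p - f (r ?k) p) + 2 * ?q (\<lambda>p. f (r ?k) p - l p)"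
        using L2.q_cb_le[of "\<lambda>p. f n p - f (r ?k) p" M "\<lambda>p. f (r ?k) p - l p" 1 1]
          L2_fcomb[OF f[of n] f[of "r ?k"], of 1 "-1"] L2_fcomb[OF f[of "r ?k"] l(1), of 1 "-1"] by simp
      also have "\<dots> < e"
        using N0[OF n, of "r ?k"] N1[of ?k] rk[of ?k] by simp
      finally show ?thesis using L2.pos[OF L2_fcomb[OF f l(1), of 1 n "-1"]] by simp
    qed
    then show "\<exists>no. \<forall>n\<ge>no. norm (?q (\<lambda>p. f n p - l p) - 0) < e" by blast
  qed
  then show ?thesis using l(1) by blast
qed

lemma pos_mult_nonneg: "0 \<le> x * y \<Longrightarrow> 0 < x \<Longrightarrow> 0 \<le> (y::real)"
  by (simp add: zero_le_mult_iff)

section \<open>Closed forms bounded below on a hyperplane\<close>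

text \<open>\<open>complete\<close> says that the form \<open>a\<close> is closed: \<open>D\<close>
  is complete for the seminorm given by \<open>ip + a\<close>. The two limits are stated separately,
  so that continuity of either form can be applied.\<close>

locale form_space =
  fixes cb :: "complex \<Rightarrow> 'v \<Rightarrow> complex \<Rightarrow> 'v \<Rightarrow> 'v"
    and V D :: "'v set" and ip a :: "'v \<Rightarrow> 'v \<Rightarrow> complex"
  assumes V: "hform cb V ip" and A: "hform cb D a" and sub: "D \<subseteq> V"
    and complete: "\<And>f. \<lbrakk>\<And>n. f n \<in> D;
        \<And>e. e > 0 \<Longrightarrow> \<exists>N::nat. \<forall>m\<ge>N. \<forall>n\<ge>N.
           Re (ip (cb 1 (f m) (- 1) (f n)) (cb 1 (f m) (- 1) (f n)))
         + Re (a (cb 1 (f m) (- 1) (f n)) (cb 1 (f m) (- 1) (f n))) < e\<rbrakk>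
       \<Longrightarrow> \<exists>l\<in>D. (\<lambda>n. Re (ip (cb 1 (f n) (- 1) l) (cb 1 (f n) (- 1) l))) \<longlonglongrightarrow> 0
              \<and> (\<lambda>n. Re (a (cb 1 (f n) (- 1) l) (cb 1 (f n) (- 1) l))) \<longlonglongrightarrow> 0"
begin

sublocale V: hform cb V ip by (rule V)
sublocale D: hform cb D ip
proof
  interpret A: hform cb D a by (rule A)
  show "cb c f d g \<in> D" if "f \<in> D" "g \<in> D" for f g c d using that by (rule A.cb_closed)
next
  fix x y f g c d
  show "ip x (cb c f d g) = c * ip x f + d * ip x g" if "x \<in> D" "f \<in> D" "g \<in> D"
    using that sub by (intro V.lin) auto
  show "ip y x = cnj (ip x y)" if "x \<in> D" "y \<in> D" using that sub by (intro V.sym) auto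
  show "0 \<le> Re (ip x x)" if "x \<in> D" using that sub by (intro V.pos) auto
qed
sublocale A: hform cb D a by (rule A)

definition b :: "real \<Rightarrow> 'v \<Rightarrow> 'v \<Rightarrow> complex" where
  "b E x y = a x y - of_real E * ip x y"

definition eigen :: "real \<Rightarrow> 'v \<Rightarrow> bool" where
  "eigen E u \<longleftrightarrow> u \<in> D \<and> ip u u = 1 \<and> (\<forall>f\<in>D. a f u = of_real E * ip f u)"

lemma Re_b: "x \<in> D \<Longrightarrow> y \<in> D \<Longrightarrow> Re (b E x y) = Re (a x y) - E * Re (ip x y)"
  by (simp add: b_def)

lemma b_hform:
  assumes "\<And>x. x \<in> D \<Longrightarrow> E * D.q x \<le> A.q x"
  shows "hform cb D (b E)"
proof
  fix x y f g c d
  show "cb c f d g \<in> D" if "f \<in> D" "g \<in> D" using that by (rule A.cb_closed)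
  show "b E x (cb c f d g) = c * b E x f + d * b E x g" if "x \<in> D" "f \<in> D" "g \<in> D"
    using that by (simp add: b_def A.lin D.lin algebra_simps)
  show "b E y x = cnj (b E x y)" if "x \<in> D" "y \<in> D"
    using that by (simp add: b_def A.sym[of x y] D.sym[of x y])
  show "0 \<le> Re (b E x x)" if "x \<in> D" using assms[OF that] that by (simp add: b_def)
qed

text \<open>The solution minimises the energy functional \<open>J\<close>.\<close>

lemma riesz:
  assumes bE: "\<And>x. x \<in> D \<Longrightarrow> E * D.q x \<le> A.q x" and E0: "0 \<le> E"
    and K: "K \<subseteq> D" "k0 \<in> K" and Kcb: "\<And>f g c d. \<lbrakk>f \<in> K; g \<in> K\<rbrakk> \<Longrightarrow> cb c f d g \<in> K"
    and Kcl: "\<And>f l. \<lbrakk>\<And>n. f n \<in> K; l \<in> D; (\<lambda>n. D.q (D.diff (f n) l)) \<longlonglongrightarrow> 0\<rbrakk> \<Longrightarrow> l \<in> K"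
    and del: "0 < \<delta>" "\<And>x. x \<in> K \<Longrightarrow> \<delta> * D.q x \<le> Re (b E x x)"
    and eta: "\<eta> \<in> V"
  shows "\<exists>\<phi>\<in>K. \<forall>f\<in>K. b E f \<phi> = ip f \<eta>"
proof -
  interpret B: hform cb D "b E" using bE by (rule b_hform)
  define J where "J x = B.q x - 2 * Re (ip x \<eta>)" for x
  have KD: "x \<in> D" "x \<in> V" if "x \<in> K" for x using that K sub by auto
  \<comment> \<open>Completion of the square: with \<open>s\<close> and \<open>t\<close> the norms
    of \<open>x\<close> and \<open>\<eta>\<close>, the quantity \<delta> s^2 - 2 s t is at least -
    t^2 / \<delta>.\<close>
  have lb: "- V.q \<eta> / \<delta> \<le> J x" if x: "x \<in> K" for x
  proof -
    define s where "s = sqrt (D.q x)"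
    define t where "t = sqrt (V.q \<eta>)"
    have s: "D.q x = s\<^sup>2" "V.q \<eta> = t\<^sup>2" "0 \<le> s" "0 \<le> t"
      using V.pos[OF KD(2)[OF x]] V.pos[OF eta] by (auto simp: s_def t_def)
    have "Re (ip x \<eta>) \<le> s * t"
      using V.cauchy_schwarz[OF KD(2)[OF x] eta] complex_Re_le_cmod[of "ip x \<eta>"] by (simp add: s_def t_def)
    then have J: "\<delta> * s\<^sup>2 - 2 * (s * t) \<le> J x" using del(2)[OF x] by (simp add: J_def s(1))
    have "0 \<le> (\<delta> * s - t)\<^sup>2 / \<delta>" using del by simp
    also have "\<dots> = \<delta> * s\<^sup>2 - 2 * (s * t) + t\<^sup>2 / \<delta>"
      using del by (simp add: field_simps power2_eq_square)
    finally show ?thesis using J unfolding s(2) by simp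
  qed
  define m where "m = (INF x\<in>K. J x)"
  have bdd: "bdd_below (J ` K)" using lb by (auto intro!: bdd_belowI2)
  have mle: "m \<le> J x" if "x \<in> K" for x unfolding m_def using that bdd by (rule cINF_lower[rotated])
  have "\<exists>x\<in>K. J x < m + 1 / real (Suc n)" for n
    using cINF_less_iff[OF _ bdd, of "m + 1 / real (Suc n)"] K(2) unfolding m_def by auto
  then obtain p where pK: "\<And>n. p n \<in> K" and pJ: "\<And>n. J (p n) < m + 1 / real (Suc n)" by metis
  have pD: "p n \<in> D" "p n \<in> V" for n using KD pK by auto
  \<comment> \<open>The parallelogram law makes a minimising sequence Cauchy: the linear parts of
    \<open>J\<close> cancel, and the midpoint has \<open>J \<ge> m\<close>.\<close>
  have cau: "B.q (B.diff (p i) (p j)) \<le> 2 / real (Suc i) + 2 / real (Suc j)" for i j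
  proof -
    let ?mid = "cb (1/2) (p i) (1/2) (p j)"
    have "B.q (B.diff (p i) (p j)) = 2 * B.q (p i) + 2 * B.q (p j) - 4 * B.q ?mid"
      using pD by (intro B.parallelogram)
    also have "\<dots> = 2 * J (p i) + 2 * J (p j) - 4 * J ?mid"
      using pD eta by (simp add: J_def V.antilin)
    also have "\<dots> \<le> 2 / real (Suc i) + 2 / real (Suc j)"
      using pJ[of i] pJ[of j] mle[OF Kcb[OF pK pK, of "1/2" i "1/2" j]] by simp
    finally show ?thesis .
  qed
  have small: "\<exists>N. \<forall>m\<ge>N. \<forall>n\<ge>N. D.q (D.diff (p m) (p n)) + A.q (A.diff (p m) (p n)) < e"
    if e: "e > 0" for e
  proof -
    \<comment> \<open>On \<open>K\<close>, \<open>A.q = B.q + E * D.q\<close> and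
      \<open>D.q \<le> B.q / \<delta>\<close> give \<open>D.q + A.q \<le> C * B.q\<close>.\<close>
    define C where "C = 1 + (1 + E) / \<delta>"
    have C: "C > 0" using del E0 by (simp add: C_def add_pos_nonneg)
    obtain N where N: "4 * C / e < real N" using reals_Archimedean2 by blast
    have "D.q (D.diff (p i) (p j)) + A.q (A.diff (p i) (p j)) < e" if ij: "i \<ge> N" "j \<ge> N" for i j
    proof -
      let ?x = "cb 1 (p i) (- 1) (p j)"
      have xK: "?x \<in> K" using Kcb pK by blast
      have "D.q ?x \<le> B.q ?x / \<delta>" using del(2)[OF xK] del(1) by (simp add: field_simps)
      moreover have "A.q ?x = B.q ?x + E * D.q ?x" using xK KD by (simp add: Re_b)
      moreover have "E * D.q ?x \<le> E * (B.q ?x / \<delta>)" using calculation(1) E0 by (rule mult_left_mono)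
      ultimately have "D.q ?x + A.q ?x \<le> C * B.q ?x" by (simp add: C_def algebra_simps add_divide_distrib)
      also have "\<dots> \<le> C * (4 / real (Suc N))"
      proof (rule mult_left_mono)
        have "2 / real (Suc i) \<le> 2 / real (Suc N)" "2 / real (Suc j) \<le> 2 / real (Suc N)"
          using ij by (auto intro!: divide_left_mono)
        then show "B.q ?x \<le> 4 / real (Suc N)" using cau[of i j] by simp
      qed (use C in simp)
      also have "\<dots> < e"
      proof -
        have "4 * C / e < real (Suc N)" using N by simp
        then have "4 * C < real (Suc N) * e" using e by (simp only: pos_divide_less_eq)
        then show ?thesis by (simp add: pos_divide_less_eq mult.commute del: of_nat_Suc)
      qed
      finally show ?thesis .
    qed
    then show ?thesis by blast
  qed
  obtain l where l: "l \<in> D" and lD: "(\<lambda>n. D.q (D.diff (p n) l)) \<longlonglongrightarrow> 0"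
    and lA: "(\<lambda>n. A.q (A.diff (p n) l)) \<longlonglongrightarrow> 0"
    using complete[of p, OF pD(1) small] by blast
  have lK: "l \<in> K" using Kcl[OF pK l lD] .
  have "b E f l = ip f \<eta>" if f: "f \<in> K" for f
  proof (rule ccontr)
    define X where "X n = b E f (p n) - ip f \<eta>" for n
    define Y where "Y = b E f l - ip f \<eta>"
    \<comment> \<open>The minimising sequence is moved along - t Y f, with \<open>Y\<close> the
      defect of the equation at \<open>l\<close>. In the limit this gives 0 \<le> t |Y|^2 (t B.q f -
      2), which fails because this \<open>t\<close> has t B.q f < 1.\<close>
    define t where "t = 1 / (B.q f + 1)"
    assume "b E f l \<noteq> ip f \<eta>"
    then have Y: "cmod Y > 0" by (simp add: Y_def)
    have t: "t > 0" using B.pos[OF KD(1)[OF f]] by (simp add: t_def)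
    have "X \<longlonglongrightarrow> Y" unfolding X_def[abs_def] Y_def b_def
      by (intro tendsto_diff tendsto_mult tendsto_const A.tendsto_right[OF pD(1) l KD(1)[OF f] lA]
          D.tendsto_right[OF pD(1) l KD(1)[OF f] lD])
    have ge: "- (1 / real (Suc n)) \<le> 2 * Re (- of_real t * (cnj Y * X n)) + t\<^sup>2 * (cmod Y)\<^sup>2 * B.q f" for n
    proof -
      let ?y = "cb 1 (p n) (- of_real t * Y) f"
      have "m \<le> J ?y" using mle Kcb pK f by blast
      also have "J ?y = J (p n) + (2 * Re (- of_real t * (cnj Y * X n)) + t\<^sup>2 * (cmod Y)\<^sup>2 * B.q f)"
      proof -
        have "B.q ?y = B.q (p n) + t\<^sup>2 * (cmod Y)\<^sup>2 * B.q f + 2 * Re (cnj 1 * (- of_real t * Y) * b E (p n) f)"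
          using pD KD[OF f] by (subst B.q_cb) (auto simp: norm_mult power_mult_distrib)
        also have "b E (p n) f = cnj (b E f (p n))" using B.sym[OF KD(1)[OF f] pD(1)] .
        also have "Re (cnj 1 * (- of_real t * Y) * cnj (b E f (p n))) = Re (- of_real t * (cnj Y * b E f (p n)))"
          by (simp add: algebra_simps)
        finally have "B.q ?y = B.q (p n) + t\<^sup>2 * (cmod Y)\<^sup>2 * B.q f + 2 * Re (- of_real t * (cnj Y * b E f (p n)))" .
        moreover have "ip ?y \<eta> = ip (p n) \<eta> + - of_real t * (cnj Y * ip f \<eta>)"
          using pD KD[OF f] eta by (simp add: V.antilin)
        then have "Re (ip ?y \<eta>) = Re (ip (p n) \<eta>) + Re (- of_real t * (cnj Y * ip f \<eta>))" by simp
        moreover have "- of_real t * (cnj Y * X n) = - of_real t * (cnj Y * b E f (p n)) - (- of_real t * (cnj Y * ip f \<eta>))"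
          by (simp add: X_def algebra_simps)
        then have "Re (- of_real t * (cnj Y * X n)) = Re (- of_real t * (cnj Y * b E f (p n))) - Re (- of_real t * (cnj Y * ip f \<eta>))"
          by (simp only: minus_complex.sel)
        ultimately show ?thesis unfolding J_def by linarith
      qed
      finally show ?thesis using pJ[of n] by simp
    qed
    have L: "(\<lambda>n. - (1 / real (Suc n))) \<longlonglongrightarrow> - 0"
      using LIMSEQ_inverse_real_of_nat by (intro tendsto_minus) (simp add: inverse_eq_divide)
    have R: "(\<lambda>n. 2 * Re (- of_real t * (cnj Y * X n)) + t\<^sup>2 * (cmod Y)\<^sup>2 * B.q f)
        \<longlonglongrightarrow> 2 * Re (- of_real t * (cnj Y * Y)) + t\<^sup>2 * (cmod Y)\<^sup>2 * B.q f"
      by (intro tendsto_add tendsto_mult tendsto_Re tendsto_const \<open>X \<longlonglongrightarrow> Y\<close>)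
    have "- 0 \<le> 2 * Re (- of_real t * (cnj Y * Y)) + t\<^sup>2 * (cmod Y)\<^sup>2 * B.q f"
      by (rule LIMSEQ_le[OF L R]) (use ge in blast)
    also have "cnj Y * Y = of_real ((cmod Y)\<^sup>2)" by (metis complex_norm_square mult.commute)
    finally have "0 \<le> (cmod Y)\<^sup>2 * t * (t * B.q f - 2)" by (simp add: power2_eq_square algebra_simps)
    moreover have "(cmod Y)\<^sup>2 * t > 0" using Y t by simp
    ultimately have "0 \<le> t * B.q f - 2" by (rule pos_mult_nonneg)
    then have "t * B.q f \<ge> 2" by simp
    then show False using B.pos[OF KD(1)[OF f]] by (simp add: t_def field_simps)
  qed
  then show ?thesis using lK by blast
qed

end

text \<open>\<open>g\<close> is only required to lie in \<open>V\<close>: in the application it is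
  an indicator function. The bound allows at most one eigenvalue below \<open>\<Lambda>\<close>,
  counted with multiplicity, and \<open>w\<close> forces one.\<close>

locale gap_form = form_space cb V D ip a
  for cb :: "complex \<Rightarrow> 'v \<Rightarrow> complex \<Rightarrow> 'v \<Rightarrow> 'v" and V D :: "'v set" and ip a :: "'v \<Rightarrow> 'v \<Rightarrow> complex" +
  fixes g :: "'v" and \<Lambda> :: real and w :: "'v"
  assumes g: "g \<in> V"
    and hyperplane_bound: "\<And>f. f \<in> D \<Longrightarrow> ip g f = 0 \<Longrightarrow> \<Lambda> * Re (ip f f) \<le> Re (a f f)"
    and w: "w \<in> D" "Re (a w w) < \<Lambda> * Re (ip w w)"
begin

text \<open>Let \<open>E\<close> be the infimum of the Rayleigh quotient. On the hyperplane the
  shifted form \<open>b E\<close> dominates \<Lambda> - E times the squared norm, so normalised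
  minimisers keep their scalar product with \<open>g\<close> away from 0. Rescaled to scalar product
  1, they differ by vectors of the hyperplane, where smallness of \<open>b E\<close> makes them
  Cauchy. The limit is nonzero because its scalar product with \<open>g\<close> is 1, and
  \<open>b E\<close> vanishes on it.\<close>

lemma ground_state:
  "\<exists>E u. 0 \<le> E \<and> E < \<Lambda> \<and> eigen E u \<and> (\<forall>x\<in>D. E * D.q x \<le> A.q x)"
proof -
  define R where "R = {A.q x |x. x \<in> D \<and> D.q x = 1}"
  define E where "E = Inf R"
  have norm: "\<exists>y\<in>D. D.q y = 1 \<and> A.q y = A.q x / D.q x" if x: "x \<in> D" "D.q x > 0" for x
  proof -
    \<comment> \<open>A scalar multiple, written as a combination with second coefficient 0, since
      \<open>cb\<close> is the only operation at hand.\<close>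
    let ?y = "cb (of_real (1 / sqrt (D.q x))) x 0 x"
    have y: "?y \<in> D" using x by (intro D.cb_closed)
    have "D.q ?y = 1" "A.q ?y = A.q x / D.q x"
      using x by (simp_all add: D.q_cb A.q_cb norm_divide power_divide)
    then show ?thesis using y by blast
  qed
  have wp: "D.q w > 0"
  proof (rule ccontr)
    assume "\<not> D.q w > 0"
    then have "D.q w = 0" using D.pos[OF w(1)] by simp
    then show False using w A.pos[OF w(1)] by simp
  qed
  have wR: "A.q w / D.q w \<in> R" using norm[OF w(1) wp] unfolding R_def by (auto intro: sym)
  have bdd: "bdd_below R" unfolding R_def by (rule bdd_belowI[of _ 0]) (auto intro: A.pos)
  have E0: "0 \<le> E" unfolding E_def using wR by (intro cInf_greatest) (auto simp: R_def intro: A.pos)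
  have "E \<le> A.q w / D.q w" unfolding E_def using wR bdd by (rule cInf_lower)
  also have "\<dots> < \<Lambda>" using w(2) wp by (simp add: pos_divide_less_eq)
  finally have EL: "E < \<Lambda>" .
  have bE: "E * D.q x \<le> A.q x" if x: "x \<in> D" for x
  proof (cases "D.q x = 0")
    case True then show ?thesis using A.pos[OF x] by simp
  next
    case False
    then have p: "D.q x > 0" using D.pos[OF x] by simp
    have "A.q x / D.q x \<in> R" using norm[OF x p] unfolding R_def by (auto intro: sym)
    then have "E \<le> A.q x / D.q x" unfolding E_def using bdd by (rule cInf_lower)
    then show ?thesis using p by (simp add: pos_le_divide_eq)
  qed
  interpret B: hform cb D "b E" using bE by (rule b_hform)
  define \<delta> where "\<delta> = \<Lambda> - E"
  have \<delta>: "\<delta> > 0" using EL by (simp add: \<delta>_def)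
  have coer: "\<delta> * D.q x \<le> B.q x" if "x \<in> D" "ip g x = 0" for x
    using hyperplane_bound[OF that] that(1) by (simp add: Re_b \<delta>_def algebra_simps)
  have ipgw: "ip g w \<noteq> 0" using hyperplane_bound[OF w(1)] w(2) by auto
  \<comment> \<open>\<open>w\<close> lies off the hyperplane. Scaled to \<open>ip g w1 = 1\<close>,
    it projects a vector onto the hyperplane by subtraction of a multiple.\<close>
  define w1 where "w1 = cb (1 / ip g w) w 0 w"
  have w1: "w1 \<in> D" "ip g w1 = 1"
    using w ipgw g sub by (auto simp: w1_def D.cb_closed V.lin subsetD)
  have "\<exists>x\<in>D. D.q x = 1 \<and> A.q x < E + 1 / real (Suc n)" for n
  proof -
    have "Inf R < E + 1 / real (Suc n)" by (simp add: E_def)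
    then obtain r where "r \<in> R" "r < E + 1 / real (Suc n)" using cInf_lessD[of R] wR by blast
    then show ?thesis by (auto simp: R_def)
  qed
  then obtain f where fD: "\<And>n. f n \<in> D" and f1: "\<And>n. D.q (f n) = 1"
    and fA: "\<And>n. A.q (f n) < E + 1 / real (Suc n)" by metis
  have fB: "B.q (f n) < 1 / real (Suc n)" for n using fA[of n] f1[of n] fD[of n] by (simp add: Re_b)
  define c where "c n = ip g (f n)" for n
  define M where "M = sqrt (B.q w1) + sqrt \<delta> * sqrt (D.q w1)"
  have M0: "M \<ge> 0" unfolding M_def using w1 \<delta> by (simp add: B.pos D.pos)
  \<comment> \<open>Coercivity at the projection \<open>?h\<close> of \<open>f n\<close>, combined
    with the norm 1 of \<open>f n\<close>: if \<open>c n\<close> were small, \<open>f n\<close>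
    would almost lie on the hyperplane and \<open>B.q (f n)\<close> could not be small.\<close>
  have clow: "sqrt \<delta> \<le> sqrt (B.q (f n)) + cmod (c n) * M" for n
  proof -
    let ?h = "cb 1 (f n) (- c n) w1"
    have h: "?h \<in> D" "ip g ?h = 0"
      using fD w1 g sub by (auto simp: D.cb_closed V.lin subsetD c_def)
    have "sqrt \<delta> * sqrt (D.q ?h) \<le> sqrt (B.q ?h)"
      using coer[OF h] by (simp add: real_sqrt_mult[symmetric])
    also have "\<dots> \<le> sqrt (B.q (f n)) + cmod (c n) * sqrt (B.q w1)"
      using B.triangle[OF fD w1(1), of 1 n "- c n"] by simp
    finally have 1: "sqrt \<delta> * sqrt (D.q ?h) \<le> sqrt (B.q (f n)) + cmod (c n) * sqrt (B.q w1)" .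
    have "D.q (cb 1 ?h (c n) w1) = D.q (f n)"
      using fD w1(1) by (simp add: D.lin D.antilin D.cb_closed algebra_simps)
    then have "1 \<le> sqrt (D.q ?h) + cmod (c n) * sqrt (D.q w1)"
      using D.triangle[OF h(1) w1(1), of 1 "c n"] f1 by simp
    then have "sqrt \<delta> * 1 \<le> sqrt \<delta> * (sqrt (D.q ?h) + cmod (c n) * sqrt (D.q w1))"
      using \<delta> by (intro mult_left_mono) auto
    then show ?thesis using 1 by (simp add: M_def algebra_simps)
  qed
  have Mp: "M > 0"
  proof (rule ccontr)
    assume "\<not> M > 0"
    then have "M = 0" using M0 by simp
    have "sqrt \<delta> \<le> sqrt (1 / real (Suc n))" for n
      using clow[of n] fB[of n] \<open>M = 0\<close> by (simp add: less_imp_le order_trans)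
    then have "\<delta> \<le> 1 / real (Suc n)" for n by (simp add: real_sqrt_le_iff)
    moreover obtain n where "1 / real (Suc n) < \<delta>" using \<delta> nat_approx_posE by blast
    ultimately show False by (meson linorder_not_less)
  qed
  \<comment> \<open>For n \<ge> N0 the value \<open>B.q (f n)\<close> is at most \<delta> / 4, which
    leaves half of sqrt \<delta> in \<open>clow\<close> for the term with
    \<open>c n\<close>.\<close>
  obtain N0 where N0: "4 / \<delta> < real N0" using reals_Archimedean2 by blast
  define k where "k = sqrt \<delta> / (2 * M)"
  have k: "k > 0" using Mp \<delta> by (simp add: k_def)
  have ck: "k \<le> cmod (c n)" if n: "n \<ge> N0" for n
  proof -
    have "1 / real (Suc n) \<le> \<delta> / 4"
    proof -
      have "4 / \<delta> < real (Suc n)" using N0 n by simp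
      then show ?thesis using \<delta> by (simp add: field_simps)
    qed
    then have "B.q (f n) \<le> \<delta> / 4" using fB[of n] by simp
    then have "sqrt (B.q (f n)) \<le> sqrt (\<delta> / 4)" by (rule real_sqrt_le_mono)
    also have "sqrt (\<delta> / 4) = sqrt \<delta> / 2" by (simp add: real_sqrt_divide)
    finally have "sqrt \<delta> / 2 \<le> cmod (c n) * M" using clow[of n] by simp
    then show ?thesis using Mp by (simp add: k_def field_simps)
  qed
  define v where "v n = cb (1 / c (n + N0)) (f (n + N0)) 0 (f (n + N0))" for n
  have vD: "v n \<in> D" for n unfolding v_def using fD by (intro D.cb_closed)
  have c0: "c (n + N0) \<noteq> 0" for n using ck[of "n + N0"] k by auto
  have vg: "ip g (v n) = 1" for n
  proof -
    have "ip g (v n) = 1 / c (n + N0) * c (n + N0)"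
      unfolding v_def using fD g sub by (subst V.lin) (auto simp: c_def)
    then show ?thesis using c0 by simp
  qed
  have vB: "B.q (v n) \<le> (1 / k\<^sup>2) * (1 / real (Suc n))" for n
  proof -
    have "B.q (v n) = B.q (f (n + N0)) / (cmod (c (n + N0)))\<^sup>2"
      unfolding v_def using fD by (subst B.q_cb) (auto simp: norm_divide power_divide)
    also have "\<dots> \<le> (1 / real (Suc n)) / k\<^sup>2"
    proof (rule frac_le)
      have "B.q (f (n + N0)) \<le> 1 / real (Suc (n + N0))" using fB[of "n + N0"] by simp
      also have "\<dots> \<le> 1 / real (Suc n)" by (auto intro!: divide_left_mono)
      finally show "B.q (f (n + N0)) \<le> 1 / real (Suc n)" .
      show "k\<^sup>2 \<le> (cmod (c (n + N0)))\<^sup>2" using ck[of "n + N0"] k by (intro power_mono) auto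
    qed (use k in auto)
    finally show ?thesis by (simp add: field_simps)
  qed
  have vcau: "B.q (B.diff (v i) (v j)) \<le> (2 / k\<^sup>2) * (1 / real (Suc i) + 1 / real (Suc j))" for i j
    using B.q_cb_le[OF vD vD, of 1 i "-1" j] vB[of i] vB[of j] by (simp add: algebra_simps)
  have small: "\<exists>N. \<forall>m\<ge>N. \<forall>n\<ge>N. D.q (D.diff (v m) (v n)) + A.q (A.diff (v m) (v n)) < e"
    if e: "e > 0" for e
  proof -
    define C where "C = 1 + (1 + E) / \<delta>"
    have C: "C > 0" using \<delta> E0 by (simp add: C_def add_pos_nonneg)
    obtain N where N: "4 * C / (k\<^sup>2 * e) < real N" using reals_Archimedean2 by blast
    have "D.q (D.diff (v i) (v j)) + A.q (A.diff (v i) (v j)) < e" if ij: "i \<ge> N" "j \<ge> N" for i j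
    proof -
      let ?x = "cb 1 (v i) (- 1) (v j)"
      have xD: "?x \<in> D" using vD by (intro D.cb_closed)
      have xg: "ip g ?x = 0" using vD g sub vg by (subst V.lin) auto
      have "D.q ?x \<le> B.q ?x / \<delta>" using coer[OF xD xg] \<delta> by (simp add: field_simps)
      moreover have "A.q ?x = B.q ?x + E * D.q ?x" using xD by (simp add: Re_b)
      moreover have "E * D.q ?x \<le> E * (B.q ?x / \<delta>)" using calculation(1) E0 by (rule mult_left_mono)
      ultimately have "D.q ?x + A.q ?x \<le> C * B.q ?x" by (simp add: C_def algebra_simps add_divide_distrib)
      also have "\<dots> \<le> C * (4 / (k\<^sup>2 * real (Suc N)))"
      proof (rule mult_left_mono)
        have "1 / real (Suc i) \<le> 1 / real (Suc N)" "1 / real (Suc j) \<le> 1 / real (Suc N)"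
          using ij by (auto intro!: divide_left_mono)
        then have "1 / real (Suc i) + 1 / real (Suc j) \<le> 2 * (1 / real (Suc N))" by simp
        then have "(2 / k\<^sup>2) * (1 / real (Suc i) + 1 / real (Suc j)) \<le> (2 / k\<^sup>2) * (2 * (1 / real (Suc N)))"
          by (rule mult_left_mono) simp
        then show "B.q ?x \<le> 4 / (k\<^sup>2 * real (Suc N))" using vcau[of i j] by simp
      qed (use C in simp)
      also have "\<dots> < e"
      proof -
        have "4 * C / (k\<^sup>2 * e) < real (Suc N)" using N by simp
        then have "4 * C < real (Suc N) * (k\<^sup>2 * e)" using e k by (subst (asm) pos_divide_less_eq) auto
        then show ?thesis using k by (simp add: pos_divide_less_eq algebra_simps del: of_nat_Suc)
      qed
      finally show ?thesis .
    qed
    then show ?thesis by blast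
  qed
  obtain l where l: "l \<in> D" and lD: "(\<lambda>n. D.q (D.diff (v n) l)) \<longlonglongrightarrow> 0"
    and lA: "(\<lambda>n. A.q (A.diff (v n) l)) \<longlonglongrightarrow> 0"
    using complete[of v, OF vD small] by blast
  have "(\<lambda>n. ip g (v n)) \<longlonglongrightarrow> ip g l"
    using V.tendsto_right[OF _ _ g lD] vD l sub by blast
  then have lg: "ip g l = 1" using vg by (simp add: LIMSEQ_const_iff)
  have lpos: "D.q l > 0"
  proof (rule ccontr)
    assume "\<not> D.q l > 0"
    then have "D.q l = 0" using D.pos[OF l] by simp
    then show False using V.cauchy_schwarz[OF g subsetD[OF sub l]] lg by simp
  qed
  have "(\<lambda>n. A.q (v n) - E * D.q (v n)) \<longlonglongrightarrow> A.q l - E * D.q l"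
    by (intro tendsto_diff tendsto_mult tendsto_const A.tendsto_q[OF vD l lA] D.tendsto_q[OF vD l lD])
  then have lim1: "(\<lambda>n. B.q (v n)) \<longlonglongrightarrow> B.q l" using vD l by (simp add: Re_b)
  have lim2: "(\<lambda>n. (1 / k\<^sup>2) * (1 / real (Suc n))) \<longlonglongrightarrow> (1 / k\<^sup>2) * 0"
    using LIMSEQ_inverse_real_of_nat by (intro tendsto_mult tendsto_const) (simp add: inverse_eq_divide)
  have "B.q l \<le> (1 / k\<^sup>2) * 0" by (rule LIMSEQ_le[OF lim1 lim2]) (use vB in blast)
  then have l0: "B.q l = 0" using B.pos[OF l] by simp
  \<comment> \<open>\<open>B.q l = 0\<close> and Cauchy-Schwarz for the nonnegative form
    \<open>b E\<close>; this is the eigenvalue equation in weak form.\<close>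
  have bl: "b E x l = 0" if "x \<in> D" for x
    using B.cauchy_schwarz[OF that l] l0 by simp
  define u where "u = cb (of_real (1 / sqrt (D.q l))) l 0 l"
  have uD: "u \<in> D" unfolding u_def using l by (intro D.cb_closed)
  have "D.q u = 1" using l lpos by (simp add: u_def D.q_cb norm_divide power_divide)
  then have "ip u u = 1" using D.im0[OF uD] by simp
  moreover have "a x u = of_real E * ip x u" if x: "x \<in> D" for x
    using bl[OF x] x l unfolding u_def b_def by (simp add: A.lin D.lin)
  ultimately have "eigen E u" using uD by (simp add: eigen_def)
  then show ?thesis using E0 EL bE by blast
qed

section \<open>The resolvent near the ground state energy\<close>

definition E0 :: real where
  "E0 = (SOME E. \<exists>u. 0 \<le> E \<and> E < \<Lambda> \<and> eigen E u \<and> (\<forall>x\<in>D. E * D.q x \<le> A.q x))"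

definition u0 :: 'v where "u0 = (SOME u. eigen E0 u)"

lemma E0: "0 \<le> E0" "E0 < \<Lambda>" "x \<in> D \<Longrightarrow> E0 * D.q x \<le> A.q x"
  and u0: "u0 \<in> D" "ip u0 u0 = 1" "f \<in> D \<Longrightarrow> a f u0 = of_real E0 * ip f u0"
proof -
  have *: "\<exists>u. 0 \<le> E0 \<and> E0 < \<Lambda> \<and> eigen E0 u \<and> (\<forall>x\<in>D. E0 * D.q x \<le> A.q x)"
    unfolding E0_def using ground_state by (rule someI_ex)
  then show "0 \<le> E0" "E0 < \<Lambda>" "x \<in> D \<Longrightarrow> E0 * D.q x \<le> A.q x" by blast+
  have "eigen E0 u0" unfolding u0_def using * by (metis someI_ex)
  then show "u0 \<in> D" "ip u0 u0 = 1" "f \<in> D \<Longrightarrow> a f u0 = of_real E0 * ip f u0"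
    by (auto simp: eigen_def)
qed

lemma u0_left: "f \<in> D \<Longrightarrow> a u0 f = of_real E0 * ip u0 f"
  using u0(3)[of f] A.sym[of f u0] D.sym[of f u0] u0(1) by simp

text \<open>Any plane spanned by the ground state and a vector orthogonal to it meets the
  hyperplane orthogonal to \<open>g\<close>.\<close>

lemma form_bound_orthogonal:
  assumes f: "f \<in> D" "ip u0 f = 0"
  shows "\<Lambda> * D.q f \<le> A.q f"
proof -
  have af: "a u0 f = 0" using u0_left[OF f(1)] f(2) by simp
  have uu: "D.q u0 = 1" "A.q u0 = E0" using u0 by (simp_all add: u0(3)[OF u0(1)])
  have key: "(cmod \<alpha>)\<^sup>2 * (\<Lambda> - E0) \<le> (cmod \<beta>)\<^sup>2 * (A.q f - \<Lambda> * D.q f)"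
    if "\<alpha> * ip g u0 + \<beta> * ip g f = 0" for \<alpha> \<beta>
  proof -
    let ?v = "cb \<alpha> u0 \<beta> f"
    have "?v \<in> D" "ip g ?v = 0" using that f u0(1) g sub by (auto simp: D.cb_closed V.lin subsetD)
    from hyperplane_bound[OF this] show ?thesis
      using f u0(1) af uu by (simp add: D.q_cb A.q_cb algebra_simps)
  qed
  show ?thesis
  proof (cases "ip g u0 = 0")
    case True
    \<comment> \<open>If \<open>u0\<close> itself were on the hyperplane, \<open>key\<close> would
      give \<open>\<Lambda> \<le> E0\<close>.\<close>
    then show ?thesis using key[of 1 0] E0(2) by simp
  next
    case False
    have "0 \<le> (cmod (- ip g f / ip g u0))\<^sup>2 * (\<Lambda> - E0)" using E0(2) by simp
    also have "\<dots> \<le> (cmod 1)\<^sup>2 * (A.q f - \<Lambda> * D.q f)" by (rule key) (use False in simp)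
    finally show ?thesis by simp
  qed
qed

definition form_graph :: "('v \<times> 'v) set" where
  "form_graph = {(\<phi>, \<eta>). \<phi> \<in> D \<and> \<eta> \<in> V \<and> (\<forall>\<psi>\<in>D. a \<psi> \<phi> = ip \<psi> \<eta>)}"

text \<open>\<open>\<phi>\<close> is split into its component along \<open>u0\<close> and the rest.
  The pairing of the residual with \<open>u0\<close> is E0 - z times the coefficient
  \<open>c\<close>; on the rest the form is at least \<Lambda> times the squared norm, and \<Lambda>
  - Re z is at least half of the gap.\<close>

lemma lower_bound:
  assumes z: "cmod (z - of_real E0) < (\<Lambda> - E0) / 2" "z \<noteq> of_real E0"
  shows "\<exists>C. \<forall>(\<phi>, \<psi>)\<in>form_graph. sqrt (V.q \<phi>) \<le> C * sqrt (V.q (cb 1 \<psi> (- z) \<phi>))"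
proof (intro exI ballI, clarify)
  fix \<phi> \<psi> assume "(\<phi>, \<psi>) \<in> form_graph"
  then have h: "\<phi> \<in> D" "\<psi> \<in> V" "\<And>f. f \<in> D \<Longrightarrow> a f \<phi> = ip f \<psi>" by (auto simp: form_graph_def)
  have V1: "\<phi> \<in> V" "u0 \<in> V" using h u0 sub by auto
  let ?r = "cb 1 \<psi> (- z) \<phi>"
  define c where "c = ip u0 \<phi>"
  define \<delta> where "\<delta> = (\<Lambda> - E0) / 2"
  have \<delta>: "\<delta> > 0" using E0(2) by (simp add: \<delta>_def)
  have rV: "?r \<in> V" using h V1 by (simp add: V.cb_closed)
  have "ip u0 ?r = (of_real E0 - z) * c"
    using h V1 u0_left[OF h(1)] h(3)[OF u0(1)] by (simp add: V.lin c_def algebra_simps)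
  moreover have "cmod (ip u0 ?r) \<le> sqrt (V.q ?r)"
    using V.cauchy_schwarz[OF V1(2) rV] u0(2) by simp
  ultimately have "cmod (of_real E0 - z) * cmod c \<le> sqrt (V.q ?r)" by (simp add: norm_mult)
  then have c1: "cmod c \<le> sqrt (V.q ?r) / cmod (of_real E0 - z)" using z by (simp add: field_simps)
  let ?f = "cb 1 \<phi> (- c) u0"
  have fD: "?f \<in> D" using h u0 by (intro D.cb_closed)
  then have fV: "?f \<in> V" using sub by auto
  have fu: "ip u0 ?f = 0" using V1 u0 by (simp add: V.lin c_def)
  have fu': "ip ?f u0 = 0" using V.sym[OF V1(2) fV] fu by simp
  have e1: "a ?f ?f = ip ?f \<psi>"
    using h fD u0 by (simp add: A.lin[of ?f] u0(3)[OF fD] fu')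
  have e2: "ip ?f \<psi> = ip ?f ?r + z * ip ?f ?f"
    using h fV V1 u0 by (simp add: V.lin[of ?f] fu')
  have "A.q ?f = Re (ip ?f ?r) + Re z * D.q ?f"
    using e1 e2 D.im0[OF fD] by (simp add: complex_eq_iff)
  then have "\<Lambda> * D.q ?f \<le> Re (ip ?f ?r) + Re z * D.q ?f" using form_bound_orthogonal[OF fD fu] by simp
  also have "Re (ip ?f ?r) \<le> sqrt (V.q ?f) * sqrt (V.q ?r)"
    using V.cauchy_schwarz[OF fV rV] complex_Re_le_cmod order_trans by blast
  finally have "(\<Lambda> - Re z) * V.q ?f \<le> sqrt (V.q ?f) * sqrt (V.q ?r)" by (simp add: algebra_simps)
  moreover have "\<delta> \<le> \<Lambda> - Re z"
    using z(1) complex_Re_le_cmod[of "z - of_real E0"] by (simp add: \<delta>_def field_simps)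
  then have "\<delta> * V.q ?f \<le> (\<Lambda> - Re z) * V.q ?f" using V.pos[OF fV] by (rule mult_right_mono)
  ultimately have "\<delta> * (sqrt (V.q ?f))\<^sup>2 \<le> sqrt (V.q ?f) * sqrt (V.q ?r)" using V.pos[OF fV] by simp
  then have f2: "sqrt (V.q ?f) \<le> sqrt (V.q ?r) / \<delta>"
  proof (cases "sqrt (V.q ?f) = 0")
    case True then show ?thesis using \<delta> V.pos[OF rV] by simp
  next
    case False
    then have p: "sqrt (V.q ?f) > 0" using V.pos[OF fV] by (simp add: less_le)
    have "sqrt (V.q ?f) * (\<delta> * sqrt (V.q ?f)) \<le> sqrt (V.q ?f) * sqrt (V.q ?r)"
      using \<open>\<delta> * (sqrt (V.q ?f))\<^sup>2 \<le> _\<close> by (simp only: power2_eq_square mult.left_commute mult.commute)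
    then have "\<delta> * sqrt (V.q ?f) \<le> sqrt (V.q ?r)" using p by (simp only: mult_le_cancel_left_pos)
    then show ?thesis using \<delta> by (simp only: pos_le_divide_eq mult.commute)
  qed
  have "V.q (cb 1 ?f c u0) = V.q \<phi>"
    using V1 by (simp add: V.lin V.antilin V.cb_closed algebra_simps)
  then have "sqrt (V.q \<phi>) \<le> sqrt (V.q ?f) + cmod c"
    using V.triangle[OF fV V1(2), of 1 c] u0(2) by simp
  also have "\<dots> \<le> sqrt (V.q ?r) / \<delta> + sqrt (V.q ?r) / cmod (of_real E0 - z)"
    using f2 c1 by (rule add_mono)
  also have "\<dots> = (1 / \<delta> + 1 / cmod (of_real E0 - z)) * sqrt (V.q ?r)" by (simp add: algebra_simps)
  finally show "sqrt (V.q \<phi>) \<le> (1 / ((\<Lambda> - E0) / 2) + 1 / cmod (of_real E0 - z)) * sqrt (V.q (cb 1 \<psi> (- z) \<phi>))"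
    by (simp only: \<delta>_def)
qed

text \<open>A Neumann series on the orthogonal complement of the ground state, started from the solution
  operator of \<open>riesz\<close>.\<close>

lemma solvable:
  assumes z: "cmod (z - of_real E0) < (\<Lambda> - E0) / 2" "z \<noteq> of_real E0"
    and eta: "\<eta> \<in> V"
  shows "\<exists>\<phi>\<in>D. \<forall>f\<in>D. a f \<phi> = ip f (cb 1 \<eta> z \<phi>)"
proof -
  define K where "K = {f \<in> D. ip u0 f = 0}"
  define \<delta> where "\<delta> = \<Lambda> - E0"
  define \<zeta> where "\<zeta> = z - of_real E0"
  have \<delta>: "\<delta> > 0" using E0(2) by (simp add: \<delta>_def)
  have \<zeta>: "cmod \<zeta> < \<delta> / 2" using z by (simp add: \<zeta>_def \<delta>_def)
  have uV: "u0 \<in> V" using u0 sub by auto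
  interpret B: hform cb D "b E0" using E0(3) by (rule b_hform)
  have KD: "f \<in> D" "f \<in> V" "ip u0 f = 0" "ip f u0 = 0" if "f \<in> K" for f
    using that sub V.sym[OF uV, of f] by (auto simp: K_def)
  have Kcb: "cb c f d g \<in> K" if "f \<in> K" "g \<in> K" for c d f g
    using KD[OF that(1)] KD[OF that(2)] uV by (auto simp: K_def D.cb_closed V.lin)
  have coer: "\<delta> * D.q x \<le> B.q x" if "x \<in> K" for x
    using form_bound_orthogonal[OF KD(1,3)[OF that]] KD(1)[OF that] by (simp add: Re_b \<delta>_def algebra_simps)
  have Kcl: "l \<in> K" if "\<And>n. f n \<in> K" "l \<in> D" "(\<lambda>n. D.q (D.diff (f n) l)) \<longlonglongrightarrow> 0" for f l
  proof -
    have "(\<lambda>n. ip u0 (f n)) \<longlonglongrightarrow> ip u0 l"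
      using that KD by (intro D.tendsto_right u0(1)) auto
    then show ?thesis using KD(3)[OF that(1)] that(2) by (simp add: K_def LIMSEQ_const_iff)
  qed
  have k0: "cb 0 u0 0 u0 \<in> K" using uV u0 by (auto simp: K_def D.cb_closed V.lin)
  \<comment> \<open>\<open>b E0\<close> is coercive on \<open>K\<close>, the orthogonal complement
    of \<open>u0\<close> in \<open>D\<close>, so the equation with shift \<open>E0\<close> is
    solvable there; \<open>S\<close> is the solution operator.\<close>
  have R: "\<exists>\<phi>\<in>K. \<forall>f\<in>K. b E0 f \<phi> = ip f y" if "y \<in> V" for y
    using E0(3,1) KD(1) k0 Kcb Kcl \<delta> coer that by (intro riesz[where \<delta>=\<delta>]) blast+
  then obtain S where SK: "\<And>y. y \<in> V \<Longrightarrow> S y \<in> K"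
    and S: "\<And>y f. y \<in> V \<Longrightarrow> f \<in> K \<Longrightarrow> b E0 f (S y) = ip f y" by metis
  have solve_bound: "D.q p \<le> V.q r / \<delta>\<^sup>2" "B.q p \<le> V.q r / \<delta>"
    if p: "p \<in> K" and r: "r \<in> V" and e: "b E0 p p = ip p r" for p r
  proof -
    define s where "s = sqrt (D.q p)"
    define t where "t = sqrt (V.q r)"
    have st: "D.q p = s\<^sup>2" "V.q r = t\<^sup>2" "0 \<le> s" "0 \<le> t"
      using V.pos[OF KD(2)[OF p]] V.pos[OF r] by (auto simp: s_def t_def)
    have le: "B.q p \<le> s * t"
      using e V.cauchy_schwarz[OF KD(2)[OF p] r] complex_Re_le_cmod[of "ip p r"] by (simp add: s_def t_def)
    then have "\<delta> * s\<^sup>2 \<le> s * t" using coer[OF p] st by simp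
    then have "\<delta> * s \<le> t" using st(3,4) by (cases "s = 0") (auto simp: power2_eq_square)
    then have s: "s \<le> t / \<delta>" using \<delta> by (simp add: field_simps)
    show "D.q p \<le> V.q r / \<delta>\<^sup>2" unfolding st using power_mono[OF s st(3), of 2] by (simp add: power_divide)
    have "s * t \<le> t / \<delta> * t" using s st(4) by (rule mult_right_mono)
    then show "B.q p \<le> V.q r / \<delta>" unfolding st using le by (simp add: power2_eq_square)
  qed
  \<comment> \<open>Iteration towards a fixed point, which solves
    \<open>b E0 f l = ip f \<eta> + \<zeta> * ip f l\<close> on \<open>K\<close>. \<open>S\<close>
    has norm at most 1 / \<delta> and |\<zeta>| < \<delta> / 2, so squared increments shrink by a
    factor of 4.\<close>
  define p where "p = rec_nat (S \<eta>) (\<lambda>_ x. S (cb 1 \<eta> \<zeta> x))"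
  have p0: "p 0 = S \<eta>" and pS: "p (Suc n) = S (cb 1 \<eta> \<zeta> (p n))" for n by (simp_all add: p_def)
  have pK: "p n \<in> K" for n
    by (induction n) (simp_all add: p0 pS SK eta V.cb_closed KD(2))
  note pD = KD(1,2)[OF pK]
  have pb: "b E0 f (p (Suc n)) = ip f \<eta> + \<zeta> * ip f (p n)" if f: "f \<in> K" for f n
    using S[OF V.cb_closed[OF eta pD(2)[of n], of 1 \<zeta>] f] KD[OF f] eta pD by (simp add: pS V.lin)
  define Q where "Q n = D.q (D.diff (p (Suc n)) (p n))" for n
  have step_eq: "b E0 f (D.diff (p (Suc (Suc n))) (p (Suc n))) = ip f (cb \<zeta> (D.diff (p (Suc n)) (p n)) 0 (p n))"
    if f: "f \<in> K" for f n
    using KD[OF f] pD f by (simp add: B.lin pb V.lin D.cb_closed V.cb_closed algebra_simps)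
  have qz: "V.q (cb \<zeta> (D.diff (p (Suc n)) (p n)) 0 (p n)) = (cmod \<zeta>)\<^sup>2 * Q n" for n
    using pD by (subst V.q_cb) (auto simp: V.cb_closed Q_def)
  have zd: "(cmod \<zeta>)\<^sup>2 \<le> \<delta>\<^sup>2 / 4" using power_mono[OF less_imp_le[OF \<zeta>] norm_ge_zero, of 2] by (simp add: power_divide)
  have Qpos: "0 \<le> Q n" for n unfolding Q_def using pD by (intro D.pos D.cb_closed)
  have QS: "Q (Suc n) \<le> Q n / 4" "B.q (D.diff (p (Suc (Suc n))) (p (Suc n))) \<le> \<delta> / 4 * Q n" for n
  proof -
    have dK: "D.diff (p (Suc (Suc n))) (p (Suc n)) \<in> K" using pK by (intro Kcb)
    have rV: "cb \<zeta> (D.diff (p (Suc n)) (p n)) 0 (p n) \<in> V" using pD by (intro V.cb_closed)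
    note sb = solve_bound[OF dK rV step_eq[OF dK], unfolded qz]
    have z4: "(cmod \<zeta>)\<^sup>2 * Q n \<le> \<delta>\<^sup>2 / 4 * Q n" using zd Qpos by (rule mult_right_mono)
    have "(cmod \<zeta>)\<^sup>2 * Q n / \<delta>\<^sup>2 \<le> \<delta>\<^sup>2 / 4 * Q n / \<delta>\<^sup>2" using z4 by (rule divide_right_mono) simp
    also have "\<dots> = Q n / 4" using \<delta> by simp
    finally show "Q (Suc n) \<le> Q n / 4" using sb(1) unfolding Q_def[of "Suc n"] by linarith
    have "(cmod \<zeta>)\<^sup>2 * Q n / \<delta> \<le> \<delta>\<^sup>2 / 4 * Q n / \<delta>" using z4 \<delta> by (intro divide_right_mono) auto
    also have "\<dots> = \<delta> / 4 * Q n" using \<delta> by (simp add: power2_eq_square)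
    finally show "B.q (D.diff (p (Suc (Suc n))) (p (Suc n))) \<le> \<delta> / 4 * Q n"
      using sb(2) by linarith
  qed
  have Qn: "Q n \<le> Q 0 * (1/4)^n" for n
  proof (induction n)
    case (Suc n) then show ?case using QS(1)[of n] by simp
  qed simp
  define C where "C = sqrt (Q 0 * (1 + E0) + 4 * \<delta> * Q 0 + B.q (D.diff (p 1) (p 0)))"
  have C2: "0 \<le> Q 0 * (1 + E0) + 4 * \<delta> * Q 0 + B.q (D.diff (p 1) (p 0))"
    using Qpos[of 0] E0(1) \<delta> B.pos[OF D.cb_closed[OF pD(1) pD(1)]] by (intro add_nonneg_nonneg) auto
  have C0: "0 \<le> C" using C2 by (simp add: C_def)
  \<comment> \<open>The form norm, in which the increments are summed: the iteration must converge
    in \<open>D\<close> and not only in \<open>V\<close>.\<close>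
  define N where "N x y = ip x y + a x y" for x y
  interpret N: hform cb D N
  proof
    fix x y f g c d
    show "cb c f d g \<in> D" if "f \<in> D" "g \<in> D" using that by (rule A.cb_closed)
    show "N x (cb c f d g) = c * N x f + d * N x g" if "x \<in> D" "f \<in> D" "g \<in> D"
      using that by (simp add: N_def A.lin D.lin algebra_simps)
    show "N y x = cnj (N x y)" if "x \<in> D" "y \<in> D"
      using that by (simp add: N_def A.sym[of x y] D.sym[of x y])
    show "0 \<le> Re (N x x)" if "x \<in> D" using A.pos[OF that] D.pos[OF that] by (simp add: N_def)
  qed
  have Nq: "N.q (D.diff (p (Suc n)) (p n)) \<le> C\<^sup>2 * (1/4)^n" for n
  proof -
    have "D.diff (p (Suc n)) (p n) \<in> D" using pD by (intro D.cb_closed)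
    then have "N.q (D.diff (p (Suc n)) (p n)) = B.q (D.diff (p (Suc n)) (p n)) + (1 + E0) * Q n"
      by (simp add: N_def Re_b Q_def algebra_simps)
    also have "\<dots> \<le> (4 * \<delta> * Q 0 + B.q (D.diff (p 1) (p 0))) * (1/4)^n + (1 + E0) * (Q 0 * (1/4)^n)"
    proof (rule add_mono)
      show "B.q (D.diff (p (Suc n)) (p n)) \<le> (4 * \<delta> * Q 0 + B.q (D.diff (p 1) (p 0))) * (1/4)^n"
      proof (cases n)
        case 0 then show ?thesis using Qpos[of 0] \<delta> by simp
      next
        case (Suc k)
        have "B.q (D.diff (p (Suc n)) (p n)) \<le> \<delta> / 4 * Q k" using QS(2)[of k] Suc by simp
        also have "\<dots> \<le> \<delta> / 4 * (Q 0 * (1/4)^k)" using Qn[of k] \<delta> by (intro mult_left_mono) auto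
        also have "\<dots> \<le> 4 * \<delta> * Q 0 * (1/4)^n" using \<delta> Qpos[of 0] Suc by simp
        also have "\<dots> \<le> (4 * \<delta> * Q 0 + B.q (D.diff (p 1) (p 0))) * (1/4)^n"
          using B.pos[OF D.cb_closed[OF pD(1) pD(1)], of 1 1 "-1" 0] by (intro mult_right_mono) auto
        finally show ?thesis .
      qed
      show "(1 + E0) * Q n \<le> (1 + E0) * (Q 0 * (1/4)^n)" using Qn E0(1) by (intro mult_left_mono) auto
    qed
    also have "\<dots> = C\<^sup>2 * (1/4)^n" using C2 by (simp add: C_def algebra_simps)
    finally show ?thesis .
  qed
  have Ns: "sqrt (N.q (D.diff (p (Suc n)) (p n))) \<le> C * (1/2)^n" for n
  proof (rule real_le_lsqrt)
    have "(1/4::real)^n = ((1/2)^n)\<^sup>2" by (simp add: power_mult[symmetric] mult.commute[of n] power_mult power_divide)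
    then show "N.q (D.diff (p (Suc n)) (p n)) \<le> (C * (1/2)^n)\<^sup>2" using Nq[of n] by (simp add: power_mult_distrib)
  qed (use C0 in simp)
  have tail: "sqrt (N.q (D.diff (p (n + k)) (p n))) \<le> 2 * C * (1/2)^n * (1 - (1/2)^k)" for n k
  proof (induction k)
    case 0
    have "N.q (D.diff (p n) (p n)) = 0" using pD by (simp add: N.lin N.antilin N.cb_closed)
    then show ?case by simp
  next
    case (Suc k)
    have "sqrt (N.q (D.diff (p (n + Suc k)) (p n))) \<le>
       sqrt (N.q (D.diff (p (n + Suc k)) (p (n + k)))) + sqrt (N.q (D.diff (p (n + k)) (p n)))"
      using pD by (intro N.triangle_diff)
    also have "\<dots> \<le> C * (1/2)^(n + k) + 2 * C * (1/2)^n * (1 - (1/2)^k)"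
      using Ns[of "n + k"] Suc by simp
    also have "\<dots> = 2 * C * (1/2)^n * (1 - (1/2)^Suc k)" by (simp add: power_add algebra_simps)
    finally show ?case .
  qed
  have tail2: "N.q (D.diff (p (n + k)) (p n)) \<le> 4 * C\<^sup>2 * (1/4)^n" for n k
  proof -
    have "sqrt (N.q (D.diff (p (n + k)) (p n))) \<le> 2 * C * (1/2)^n * (1 - (1/2)^k)" by (rule tail)
    also have "\<dots> \<le> 2 * C * (1/2)^n * 1" using C0 by (intro mult_left_mono) auto
    finally have "(sqrt (N.q (D.diff (p (n + k)) (p n))))\<^sup>2 \<le> (2 * C * (1/2)^n)\<^sup>2"
      using pD by (intro power_mono) (auto intro!: N.pos N.cb_closed)
    moreover have "((1/2::real)^n)\<^sup>2 = (1/4)^n" by (simp add: power_mult[symmetric] mult.commute[of n] power_mult power_divide)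
    ultimately show ?thesis using N.pos[OF N.cb_closed[OF pD(1) pD(1)]] by (simp add: power_mult_distrib)
  qed
  have small: "\<exists>N. \<forall>m\<ge>N. \<forall>n\<ge>N. D.q (D.diff (p m) (p n)) + A.q (A.diff (p m) (p n)) < e"
    if e: "e > 0" for e
  proof -
    have "(\<lambda>n. 4 * C\<^sup>2 * (1/4::real)^n) \<longlonglongrightarrow> 4 * C\<^sup>2 * 0"
      by (intro tendsto_mult tendsto_const LIMSEQ_power_zero) simp
    then have "eventually (\<lambda>n. 4 * C\<^sup>2 * (1/4::real)^n < e) sequentially"
      using e by (intro order_tendstoD(2)) auto
    then obtain M where M: "\<And>n. n \<ge> M \<Longrightarrow> 4 * C\<^sup>2 * (1/4::real)^n < e" by (auto simp: eventually_sequentially)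
    have "N.q (N.diff (p m) (p n)) < e" if mn: "m \<ge> M" "n \<ge> M" for m n
    proof (cases "n \<le> m")
      case True
      then show ?thesis using tail2[of n "m - n"] M[OF mn(2)] by simp
    next
      case False
      then show ?thesis using tail2[of m "n - m"] M[OF mn(1)] N.diff_commute[OF pD(1) pD(1), of m n] by simp
    qed
    then show ?thesis by (auto simp: N_def)
  qed
  obtain l where l: "l \<in> D" and lD: "(\<lambda>n. D.q (D.diff (p n) l)) \<longlonglongrightarrow> 0"
    and lA: "(\<lambda>n. A.q (A.diff (p n) l)) \<longlonglongrightarrow> 0"
    using complete[of p, OF pD(1) small] by blast
  have lK: "l \<in> K" using Kcl[OF pK l lD] .
  have lV: "l \<in> V" using l sub by auto
  have leq: "b E0 f l = ip f \<eta> + \<zeta> * ip f l" if f: "f \<in> K" for f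
  proof (rule LIMSEQ_unique)
    have "(\<lambda>n. b E0 f (p n)) \<longlonglongrightarrow> b E0 f l" unfolding b_def
      by (intro tendsto_diff tendsto_mult tendsto_const A.tendsto_right[OF pD(1) l KD(1)[OF f] lA]
          D.tendsto_right[OF pD(1) l KD(1)[OF f] lD])
    then show "(\<lambda>n. b E0 f (p (Suc n))) \<longlonglongrightarrow> b E0 f l" by (rule LIMSEQ_Suc)
    show "(\<lambda>n. b E0 f (p (Suc n))) \<longlonglongrightarrow> ip f \<eta> + \<zeta> * ip f l" unfolding pb[OF f]
      by (intro tendsto_add tendsto_mult tendsto_const D.tendsto_right[OF pD(1) l KD(1)[OF f] lD])
  qed
  \<comment> \<open>The coefficient c along \<open>u0\<close> is determined by (E0 - z) c =
    \<open>ip u0 \<eta>\<close>; \<open>l\<close> supplies the part in \<open>K\<close>.\<close>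
  define \<phi> where "\<phi> = cb 1 l (ip u0 \<eta> / (of_real E0 - z)) u0"
  have \<phi>: "\<phi> \<in> D" "\<phi> \<in> V" unfolding \<phi>_def using l u0 sub by (auto simp: D.cb_closed V.cb_closed subsetD)
  have "a f \<phi> = ip f (cb 1 \<eta> z \<phi>)" if f: "f \<in> D" for f
  proof -
    define c where "c = ip u0 f"
    \<comment> \<open>The equation for \<open>l\<close> is known only against \<open>K\<close>, so a
      general \<open>f\<close> is tested through its projection.\<close>
    let ?h = "cb 1 f (- c) u0"
    have fV: "f \<in> V" using f sub by auto
    have h: "?h \<in> K" using f fV u0 uV by (simp add: K_def D.cb_closed V.lin c_def)
    have c': "ip f u0 = cnj c" using V.sym[OF uV fV] by (simp add: c_def)
    have lu: "a u0 l = 0" "ip u0 l = 0" using u0_left[OF l] KD(3)[OF lK] by simp_all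
    have "b E0 ?h l = a f l - of_real E0 * ip f l"
      using f l u0(1) lu by (simp add: b_def A.antilin D.antilin)
    moreover have "ip ?h \<eta> + \<zeta> * ip ?h l = ip f \<eta> - cnj c * ip u0 \<eta> + \<zeta> * ip f l"
      using fV lV uV eta lu by (simp add: V.antilin)
    ultimately have "a f l = z * ip f l + ip f \<eta> - cnj c * ip u0 \<eta>"
      using leq[OF h] by (simp add: \<zeta>_def algebra_simps)
    moreover have "a f \<phi> = a f l + ip u0 \<eta> / (of_real E0 - z) * (of_real E0 * cnj c)"
      unfolding \<phi>_def using f l u0 by (simp add: A.lin u0(3)[OF f] c')
    moreover have "ip f (cb 1 \<eta> z \<phi>) = ip f \<eta> + z * (ip f l + ip u0 \<eta> / (of_real E0 - z) * cnj c)"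
      using fV \<phi> eta lV uV by (simp add: V.lin \<phi>_def V.cb_closed c')
    moreover define k where "k = ip u0 \<eta> / (of_real E0 - z)"
    moreover have "k * (of_real E0 - z) = ip u0 \<eta>" using z by (simp add: k_def)
    ultimately show ?thesis by algebra
  qed
  then show ?thesis using \<phi>(1) by blast
qed

text \<open>On the projection of \<open>\<phi>\<close> off \<open>u0\<close> the form is \<mu> times
  the squared norm, so the bound on the complement of \<open>u0\<close> makes \<Lambda> - \<mu>
  times that squared norm at most 0. The first conclusion yields multiplicity one, the second
  excludes other eigenvalues below \<open>\<Lambda>\<close>.\<close>

lemma eigen_below:
  assumes "(\<phi>, \<psi>) \<in> form_graph" "\<And>f. f \<in> D \<Longrightarrow> ip f \<psi> = of_real \<mu> * ip f \<phi>" "\<mu> < \<Lambda>"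
  shows "V.q (cb 1 \<phi> (- ip u0 \<phi>) u0) = 0" "\<mu> = E0 \<or> V.q \<phi> = 0"
proof -
  have h: "\<phi> \<in> D" "\<And>f. f \<in> D \<Longrightarrow> a f \<phi> = of_real \<mu> * ip f \<phi>"
    using assms by (auto simp: form_graph_def)
  have V1: "\<phi> \<in> V" "u0 \<in> V" using h u0 sub by auto
  let ?f = "cb 1 \<phi> (- ip u0 \<phi>) u0"
  have fD: "?f \<in> D" using h u0 by (intro D.cb_closed)
  then have fV: "?f \<in> V" using sub by auto
  have fu: "ip u0 ?f = 0" using V1 u0 by (simp add: V.lin)
  have fu': "ip ?f u0 = 0" using V.sym[OF V1(2) fV] fu by simp
  have "a ?f ?f = of_real \<mu> * ip ?f ?f"
    using fD h u0 V1 fV by (simp add: A.lin[of ?f] V.lin[of ?f] u0(3)[OF fD] fu')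
  then have "A.q ?f = \<mu> * D.q ?f" using D.im0[OF fD] by (simp add: complex_eq_iff)
  then have "(\<Lambda> - \<mu>) * D.q ?f \<le> 0" using form_bound_orthogonal[OF fD fu] by (simp add: algebra_simps)
  then show q0: "V.q ?f = 0" using D.pos[OF fD] assms(3) by (smt (verit) mult_pos_pos)
  have "of_real \<mu> * ip u0 \<phi> = of_real E0 * ip u0 \<phi>" using h(2)[OF u0(1)] u0_left[OF h(1)] by (simp only:)
  then have "\<mu> = E0 \<or> ip u0 \<phi> = 0" by (metis mult_cancel_right of_real_eq_iff)
  then show "\<mu> = E0 \<or> V.q \<phi> = 0"
  proof
    assume "ip u0 \<phi> = 0"
    then show ?thesis using q0 V1 by (simp add: V.q_cb)
  qed simp
qed

end

section \<open>One-dimensional inequalities\<close>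

text \<open>Lets \<open>\<theta>\<close> rise to a critical frequency; the inequalities in question
  are available only strictly below it, where the tangent stays finite.\<close>

lemma le_of_square_less:
  assumes "0 < K" "\<And>\<theta>. 0 < \<theta> \<Longrightarrow> \<theta> < K \<Longrightarrow> \<theta>\<^sup>2 * X \<le> Y"
  shows "K\<^sup>2 * X \<le> (Y::real)"
proof (rule field_le_mult_one_interval)
  fix z :: real assume z: "0 < z" "z < 1"
  have "(K * sqrt z)\<^sup>2 * X \<le> Y"
    using z assms(1) by (intro assms(2)) (auto simp: mult_less_cancel_left1)
  then show "z * (K\<^sup>2 * X) \<le> Y" using z by (simp add: power_mult_distrib algebra_simps)
qed

text \<open>The ground state substitution: integrate \<open>|f' + \<theta> tan(\<theta>(t - c)) f|\<^sup>2 \<ge> 0\<close>.\<close>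

lemma slice_bound:
  fixes f :: "real \<Rightarrow> complex"
  assumes ab: "\<alpha> \<le> \<beta>"
    and f: "\<And>t. t \<in> {\<alpha>..\<beta>} \<Longrightarrow> (f has_vector_derivative f' t) (at t within {\<alpha>..\<beta>})"
    and f': "continuous_on {\<alpha>..\<beta>} f'"
    and \<theta>: "\<And>t. t \<in> {\<alpha>..\<beta>} \<Longrightarrow> \<bar>\<theta> * (t - c)\<bar> < pi / 2"
  shows "\<theta>\<^sup>2 * integral {\<alpha>..\<beta>} (\<lambda>t. (cmod (f t))\<^sup>2) \<le> integral {\<alpha>..\<beta>} (\<lambda>t. (cmod (f' t))\<^sup>2)
     + \<theta> * tan (\<theta> * (\<beta> - c)) * (cmod (f \<beta>))\<^sup>2 - \<theta> * tan (\<theta> * (\<alpha> - c)) * (cmod (f \<alpha>))\<^sup>2"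
proof -
  define T where "T t = tan (\<theta> * (t - c))" for t
  \<comment> \<open>\<open>T\<close> solves T' = \<theta> (1 + T^2). The quadratic term of
    \<open>h'\<close> is what completes the square, and the boundary terms of the claim are the
    values of \<open>h\<close> at the ends.\<close>
  define h where "h t = \<theta> * T t * (f t \<bullet> f t)" for t
  define h' where "h' t = \<theta> * T t * (f t \<bullet> f' t + f' t \<bullet> f t) + \<theta> * (\<theta> * (1 + (T t)\<^sup>2)) * (f t \<bullet> f t)" for t
  have fc: "continuous_on {\<alpha>..\<beta>} f"
    by (auto simp: continuous_on_eq_continuous_within intro!: has_vector_derivative_continuous f)
  have d: "(h has_vector_derivative h' t) (at t within {\<alpha>..\<beta>})" if t: "t \<in> {\<alpha>..\<beta>}" for t
  proof -
    have c: "cos (\<theta> * (t - c)) \<noteq> 0"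
    proof -
      have "- (pi / 2) < \<theta> * (t - c)" "\<theta> * (t - c) < pi / 2" using \<theta>[OF t] by linarith+
      from cos_gt_zero_pi[OF this] show ?thesis by simp
    qed
    have "(T has_real_derivative \<theta> * (1 + (T t)\<^sup>2)) (at t within {\<alpha>..\<beta>})"
    proof -
      have "(T has_real_derivative inverse ((cos (\<theta> * (t - c)))\<^sup>2) * \<theta>) (at t within {\<alpha>..\<beta>})"
        unfolding T_def using c by (auto intro!: derivative_eq_intros simp: field_simps)
      moreover have "inverse ((cos (\<theta> * (t - c)))\<^sup>2) = 1 + (T t)\<^sup>2"
        unfolding T_def using tan_sec[OF c] by (simp add: power_inverse)
      ultimately show ?thesis by (simp add: mult.commute)
    qed
    then have 1: "((\<lambda>t. \<theta> * T t) has_vector_derivative \<theta> * (\<theta> * (1 + (T t)\<^sup>2))) (at t within {\<alpha>..\<beta>})"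
      unfolding has_real_derivative_iff_has_vector_derivative[symmetric] by (rule DERIV_cmult)
    have 2: "((\<lambda>t. f t \<bullet> f t) has_vector_derivative f t \<bullet> f' t + f' t \<bullet> f t) (at t within {\<alpha>..\<beta>})"
      by (rule bounded_bilinear.has_vector_derivative[OF bounded_bilinear_inner f[OF t] f[OF t]])
    show ?thesis unfolding h_def h'_def
      using has_vector_derivative_mult[OF 1 2] by simp
  qed
  have int_h: "(h' has_integral (h \<beta> - h \<alpha>)) {\<alpha>..\<beta>}"
    by (rule fundamental_theorem_of_calculus[OF ab d])
  have i1: "((\<lambda>t. (cmod (f' t))\<^sup>2) has_integral integral {\<alpha>..\<beta>} (\<lambda>t. (cmod (f' t))\<^sup>2)) {\<alpha>..\<beta>}"
    by (intro integrable_integral integrable_continuous_interval continuous_intros f')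
  have i2: "((\<lambda>t. (cmod (f t))\<^sup>2) has_integral integral {\<alpha>..\<beta>} (\<lambda>t. (cmod (f t))\<^sup>2)) {\<alpha>..\<beta>}"
    by (intro integrable_integral integrable_continuous_interval continuous_intros fc)
  have "\<theta>\<^sup>2 * integral {\<alpha>..\<beta>} (\<lambda>t. (cmod (f t))\<^sup>2) \<le> integral {\<alpha>..\<beta>} (\<lambda>t. (cmod (f' t))\<^sup>2) + (h \<beta> - h \<alpha>)"
  proof (rule has_integral_le)
    show "((\<lambda>t. \<theta>\<^sup>2 * (cmod (f t))\<^sup>2) has_integral \<theta>\<^sup>2 * integral {\<alpha>..\<beta>} (\<lambda>t. (cmod (f t))\<^sup>2)) {\<alpha>..\<beta>}"
      by (rule has_integral_mult_right[OF i2])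
    show "((\<lambda>t. (cmod (f' t))\<^sup>2 + h' t) has_integral integral {\<alpha>..\<beta>} (\<lambda>t. (cmod (f' t))\<^sup>2) + (h \<beta> - h \<alpha>)) {\<alpha>..\<beta>}"
      by (rule has_integral_add[OF i1 int_h])
    fix t
    have "0 \<le> (f' t + (\<theta> * T t) *\<^sub>R f t) \<bullet> (f' t + (\<theta> * T t) *\<^sub>R f t)" by simp
    also have "\<dots> = (cmod (f' t))\<^sup>2 + h' t - \<theta>\<^sup>2 * (cmod (f t))\<^sup>2"
      unfolding h'_def power2_norm_eq_inner
      by (simp add: inner_simps inner_commute[of "f' t" "f t"] algebra_simps power2_eq_square[of \<theta>] power2_eq_square[of "T t"])
    finally show "\<theta>\<^sup>2 * (cmod (f t))\<^sup>2 \<le> (cmod (f' t))\<^sup>2 + h' t" by simp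
  qed
  then show ?thesis by (simp add: h_def T_def dot_square_norm algebra_simps)
qed

lemma integral_variance:
  fixes f :: "real \<Rightarrow> complex"
  assumes "a < b" "continuous_on {a..b} f"
  defines "m \<equiv> integral {a..b} f /\<^sub>R (b - a)"
  shows "integral {a..b} (\<lambda>t. (cmod (f t - m))\<^sup>2)
       = integral {a..b} (\<lambda>t. (cmod (f t))\<^sup>2) - (cmod (integral {a..b} f))\<^sup>2 / (b - a)"
proof -
  have i: "(f has_integral integral {a..b} f) {a..b}"
    by (intro integrable_integral integrable_continuous_interval assms)
  have "((\<lambda>t. f t \<bullet> m) has_integral integral {a..b} f \<bullet> m) {a..b}"
    using has_integral_linear[OF i bounded_linear_inner_left[of m]] by (simp add: o_def)
  then have im: "integral {a..b} (\<lambda>t. f t \<bullet> m) = integral {a..b} f \<bullet> m"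
    by (rule integral_unique)
  have hf: "((\<lambda>t. (cmod (f t))\<^sup>2) has_integral integral {a..b} (\<lambda>t. (cmod (f t))\<^sup>2)) {a..b}"
    by (intro integrable_integral integrable_continuous_interval continuous_intros assms)
  have hm: "((\<lambda>t. f t \<bullet> m) has_integral integral {a..b} f \<bullet> m) {a..b}" by fact
  have "integral {a..b} (\<lambda>t. (cmod (f t - m))\<^sup>2)
      = integral {a..b} (\<lambda>t. (cmod (f t))\<^sup>2 + (- 2) * (f t \<bullet> m) + (cmod m)\<^sup>2)"
    by (intro integral_cong) (simp add: power2_norm_eq_inner inner_simps inner_commute)
  also have "\<dots> = integral {a..b} (\<lambda>t. (cmod (f t))\<^sup>2) + (- 2) * (integral {a..b} f \<bullet> m) + (b - a) * (cmod m)\<^sup>2"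
    using has_integral_add[OF has_integral_add[OF hf has_integral_mult_right[OF hm, of "- 2"]]
        has_integral_const_real[of "(cmod m)\<^sup>2" a b]] assms(1)
    by (intro integral_unique) simp
  finally have e: "integral {a..b} (\<lambda>t. (cmod (f t - m))\<^sup>2)
      = integral {a..b} (\<lambda>t. (cmod (f t))\<^sup>2) + (- 2) * (integral {a..b} f \<bullet> m) + (b - a) * (cmod m)\<^sup>2" .
  define w where "w = cmod (integral {a..b} f)"
  have w1: "integral {a..b} f \<bullet> m = w\<^sup>2 / (b - a)"
    unfolding m_def w_def by (simp add: power2_norm_eq_inner divide_inverse)
  have "(cmod m)\<^sup>2 = w\<^sup>2 / (b - a)\<^sup>2"
    unfolding m_def w_def by (simp add: power_mult_distrib power_divide divide_inverse power_inverse)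
  then have "(b - a) * (cmod m)\<^sup>2 = w\<^sup>2 / (b - a)" using assms(1) by (simp add: power2_eq_square[of "b - a"])
  then show ?thesis unfolding e w1 by (simp add: w_def)
qed

lemma cauchy_schwarz_integral:
  fixes f :: "real \<Rightarrow> complex"
  assumes "a < b" "continuous_on {a..b} f"
  shows "(cmod (integral {a..b} f))\<^sup>2 \<le> (b - a) * integral {a..b} (\<lambda>t. (cmod (f t))\<^sup>2)"
proof -
  have "0 \<le> integral {a..b} (\<lambda>t. (cmod (f t - integral {a..b} f /\<^sub>R (b - a)))\<^sup>2)"
    using assms(2) by (intro integral_nonneg integrable_continuous_interval continuous_intros) auto
  then have "(cmod (integral {a..b} f))\<^sup>2 / (b - a) \<le> integral {a..b} (\<lambda>t. (cmod (f t))\<^sup>2)"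
    unfolding integral_variance[OF assms] by simp
  then show ?thesis using assms(1) by (simp add: pos_divide_le_eq mult.commute)
qed

text \<open>The Neumann case is reduced to the Dirichlet case, applied to the primitive \<open>U\<close> of
  \<open>f\<close> minus its mean.\<close>

lemma wirtinger_neumann:
  fixes f :: "real \<Rightarrow> complex"
  assumes ab: "a < b"
    and f: "\<And>t. t \<in> {a..b} \<Longrightarrow> (f has_vector_derivative f' t) (at t within {a..b})"
    and f': "continuous_on {a..b} f'"
  shows "(pi / (b - a))\<^sup>2 * (integral {a..b} (\<lambda>t. (cmod (f t))\<^sup>2) - (cmod (integral {a..b} f))\<^sup>2 / (b - a))
     \<le> integral {a..b} (\<lambda>t. (cmod (f' t))\<^sup>2)"
proof -
  have fc: "continuous_on {a..b} f"
    by (auto simp: continuous_on_eq_continuous_within intro!: has_vector_derivative_continuous f)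
  define m where "m = integral {a..b} f /\<^sub>R (b - a)"
  define g where "g t = f t - m" for t
  define U where "U t = integral {a..t} g" for t
  have gc: "continuous_on {a..b} g" unfolding g_def by (intro continuous_intros fc)
  have gd: "(g has_vector_derivative f' t) (at t within {a..b})" if "t \<in> {a..b}" for t
    unfolding g_def using has_vector_derivative_diff[OF f[OF that] has_vector_derivative_const] by simp
  have Ud: "(U has_vector_derivative g t) (at t within {a..b})" if "t \<in> {a..b}" for t
    unfolding U_def by (rule integral_has_vector_derivative[OF gc that])
  have Uc: "continuous_on {a..b} U"
    by (auto simp: continuous_on_eq_continuous_within intro!: has_vector_derivative_continuous Ud)
  have "integral {a..b} g = integral {a..b} f - (b - a) *\<^sub>R m"
    unfolding g_def using ab fc by (subst Henstock_Kurzweil_Integration.integral_diff)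
      (auto intro!: integrable_continuous_interval continuous_intros)
  \<comment> \<open>\<open>g\<close> has mean 0, so its primitive vanishes at both ends: the free
    ends of \<open>f\<close> become Dirichlet ends of \<open>U\<close>.\<close>
  then have U0: "U a = 0" "U b = 0" using ab by (auto simp: U_def m_def)
  define G where "G = integral {a..b} (\<lambda>t. (cmod (g t))\<^sup>2)"
  define F where "F = integral {a..b} (\<lambda>t. (cmod (f' t))\<^sup>2)"
  define W where "W = integral {a..b} (\<lambda>t. (cmod (U t))\<^sup>2)"
  have hG: "((\<lambda>t. (cmod (g t))\<^sup>2) has_integral G) {a..b}" unfolding G_def
    by (intro integrable_integral integrable_continuous_interval continuous_intros gc)
  have hF: "((\<lambda>t. (cmod (f' t))\<^sup>2) has_integral F) {a..b}" unfolding F_def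
    by (intro integrable_integral integrable_continuous_interval continuous_intros f')
  have hW: "((\<lambda>t. (cmod (U t))\<^sup>2) has_integral W) {a..b}" unfolding W_def
    by (intro integrable_integral integrable_continuous_interval continuous_intros Uc)
  have "((\<lambda>t. U t \<bullet> f' t + g t \<bullet> g t) has_integral (U b \<bullet> g b - U a \<bullet> g a)) {a..b}"
    using ab by (intro fundamental_theorem_of_calculus
        bounded_bilinear.has_vector_derivative[OF bounded_bilinear_inner] Ud gd) auto
  then have parts: "((\<lambda>t. U t \<bullet> f' t + g t \<bullet> g t) has_integral 0) {a..b}" by (simp add: U0)
  have "(pi / (b - a))\<^sup>2 * G \<le> F"
  proof (rule le_of_square_less)
    show "0 < pi / (b - a)" using ab by simp
    fix \<theta> :: real assume \<theta>: "0 < \<theta>" "\<theta> < pi / (b - a)"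
    have "\<theta>\<^sup>2 * W \<le> G"
    proof -
      have "\<bar>\<theta> * (t - (a + b) / 2)\<bar> < pi / 2" if "t \<in> {a..b}" for t
      proof -
        have "\<bar>t - (a + b) / 2\<bar> \<le> (b - a) / 2" using that by (auto simp: abs_if field_simps)
        then have "\<theta> * \<bar>t - (a + b) / 2\<bar> \<le> \<theta> * ((b - a) / 2)" using \<theta> by (intro mult_left_mono) auto
        also have "\<dots> < pi / 2" using \<theta> ab by (simp add: field_simps)
        finally show ?thesis using \<theta> by (simp add: abs_mult)
      qed
      then show ?thesis using slice_bound[OF less_imp_le[OF ab] Ud gc, where c="(a+b)/2" and \<theta>=\<theta>] U0
        by (simp add: W_def G_def)
    qed
    \<comment> \<open>By \<open>parts\<close> the integral of \<open>U \<bullet> f'\<close> is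
      \<open>- G\<close>. Young's inequality with weight \<open>\<theta>\<close> bounds 2 G by the
      right side, and \<theta>^2 W \<le> G then absorbs one \<open>G\<close>.\<close>
    have "2 * G \<le> \<theta>\<^sup>2 * W + (1 / \<theta>\<^sup>2) * F"
    proof (rule has_integral_le)
      show "((\<lambda>t. 2 * (cmod (g t))\<^sup>2 + (-2) * (U t \<bullet> f' t + g t \<bullet> g t)) has_integral 2 * G) {a..b}"
        using has_integral_add[OF has_integral_mult_right[OF hG, of 2] has_integral_mult_right[OF parts, of "-2"]] by simp
      show "((\<lambda>t. \<theta>\<^sup>2 * (cmod (U t))\<^sup>2 + (1 / \<theta>\<^sup>2) * (cmod (f' t))\<^sup>2) has_integral \<theta>\<^sup>2 * W + (1 / \<theta>\<^sup>2) * F) {a..b}"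
        by (intro has_integral_add has_integral_mult_right hW hF)
      fix t
      have "0 \<le> (\<theta> *\<^sub>R U t + (1 / \<theta>) *\<^sub>R f' t) \<bullet> (\<theta> *\<^sub>R U t + (1 / \<theta>) *\<^sub>R f' t)" by simp
      also have "\<dots> = \<theta>\<^sup>2 * (cmod (U t))\<^sup>2 + (1 / \<theta>\<^sup>2) * (cmod (f' t))\<^sup>2 + 2 * (U t \<bullet> f' t)"
        unfolding power2_norm_eq_inner
        using \<theta> by (simp add: inner_simps inner_commute[of "f' t" "U t"] power2_eq_square[of \<theta>] field_simps)
      finally show "2 * (cmod (g t))\<^sup>2 + (-2) * (U t \<bullet> f' t + g t \<bullet> g t)
          \<le> \<theta>\<^sup>2 * (cmod (U t))\<^sup>2 + (1 / \<theta>\<^sup>2) * (cmod (f' t))\<^sup>2"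
        by (simp add: power2_norm_eq_inner algebra_simps)
    qed
    then have "G \<le> (1 / \<theta>\<^sup>2) * F" using \<open>\<theta>\<^sup>2 * W \<le> G\<close> by simp
    then show "\<theta>\<^sup>2 * G \<le> F" using \<theta> by (simp add: field_simps)
  qed
  moreover have "G = integral {a..b} (\<lambda>t. (cmod (f t))\<^sup>2) - (cmod (integral {a..b} f))\<^sup>2 / (b - a)"
    unfolding G_def g_def m_def by (rule integral_variance[OF ab fc])
  ultimately show ?thesis by (simp add: F_def)
qed

text \<open>Each slice in \<open>t\<close> is compared with its integral \<open>M s\<close>, then
  \<open>M\<close> with its own mean; both steps are the one-dimensional inequality on an interval
  of length \<open>l\<close>. Cauchy-Schwarz bounds the derivative of \<open>M\<close> by the slice
  integrals of \<open>H1\<close>.\<close>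

lemma square_poincare:
  fixes H H1 H2 :: "real \<Rightarrow> real \<Rightarrow> complex"
  assumes l: "0 < l"
    and d1: "\<And>s t. ((\<lambda>s. H s t) has_vector_derivative H1 s t) (at s)"
    and d2: "\<And>s t. ((\<lambda>t. H s t) has_vector_derivative H2 s t) (at t)"
    and c: "continuous_on UNIV (\<lambda>(s, t). H s t)"
    and c1: "continuous_on UNIV (\<lambda>(s, t). H1 s t)" and c2: "continuous_on UNIV (\<lambda>(s, t). H2 s t)"
  shows "(pi / l)\<^sup>2 * (integral {a..a+l} (\<lambda>s. integral {b..b+l} (\<lambda>t. (cmod (H s t))\<^sup>2))
          - (cmod (integral {a..a+l} (\<lambda>s. integral {b..b+l} (H s))))\<^sup>2 / l\<^sup>2)
     \<le> integral {a..a+l} (\<lambda>s. integral {b..b+l} (\<lambda>t. (cmod (H1 s t))\<^sup>2))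
      + integral {a..a+l} (\<lambda>s. integral {b..b+l} (\<lambda>t. (cmod (H2 s t))\<^sup>2))"
proof -
  have par: "continuous_on {a..a+l} (\<lambda>s. integral {b..b+l} (K s))"
    if "continuous_on UNIV (\<lambda>(s, t). K s t)" for K :: "real \<Rightarrow> real \<Rightarrow> 'z::banach"
    using integral_continuous_on_param[of "{a..a+l}" b "b+l" K] continuous_on_subset[OF that]
    by (simp add: cbox_interval)
  have sl: "continuous_on S (K s)" if "continuous_on UNIV (\<lambda>(s, t). K s t)"
    for K :: "real \<Rightarrow> real \<Rightarrow> 'z::topological_space" and s S
    by (rule continuous_on_compose2[OF that, of S "\<lambda>t. (s, t)", simplified]) (intro continuous_intros)
  have sq: "continuous_on UNIV (\<lambda>(s, t). (cmod (K s t))\<^sup>2)" if "continuous_on UNIV (\<lambda>(s, t). K s t)" for K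
    using that unfolding case_prod_unfold by (intro continuous_intros)
  have iint: "(\<lambda>s. integral {b..b+l} (\<lambda>t. (cmod (K s t))\<^sup>2)) integrable_on {a..a+l}"
    if "continuous_on UNIV (\<lambda>(s, t). K s t)" for K
    by (intro integrable_continuous_interval par sq that)
  define M where "M s = integral {b..b+l} (H s)" for s
  define M' where "M' s = integral {b..b+l} (H1 s)" for s
  have Md: "(M has_vector_derivative M' s) (at s within {a..a+l})" if "s \<in> {a..a+l}" for s
  proof -
    have "((\<lambda>x. integral (cbox b (b+l)) (H x)) has_vector_derivative integral (cbox b (b+l)) (H1 s)) (at s within UNIV)"
      by (rule leibniz_rule_vector_derivative)
        (auto intro!: d1 continuous_on_subset[OF c1] integrable_continuous_interval sl[OF c])
    then show ?thesis unfolding M_def M'_def by (auto simp: cbox_interval intro: has_vector_derivative_at_within)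
  qed
  have Mc: "continuous_on {a..a+l} M'" unfolding M'_def by (rule par[OF c1])
  have Mcc: "continuous_on {a..a+l} M" unfolding M_def by (rule par[OF c])
  define A where "A = integral {a..a+l} (\<lambda>s. integral {b..b+l} (\<lambda>t. (cmod (H s t))\<^sup>2))"
  define B where "B = integral {a..a+l} (\<lambda>s. (cmod (M s))\<^sup>2)"
  define P1 where "P1 = integral {a..a+l} (\<lambda>s. integral {b..b+l} (\<lambda>t. (cmod (H1 s t))\<^sup>2))"
  define P2 where "P2 = integral {a..a+l} (\<lambda>s. integral {b..b+l} (\<lambda>t. (cmod (H2 s t))\<^sup>2))"
  have "(pi / l)\<^sup>2 * (A - B / l) = integral {a..a+l} (\<lambda>s. (pi / l)\<^sup>2 * (integral {b..b+l} (\<lambda>t. (cmod (H s t))\<^sup>2) - (cmod (M s))\<^sup>2 / l))"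
    unfolding A_def B_def
    by (subst Henstock_Kurzweil_Integration.integral_mult_right, subst Henstock_Kurzweil_Integration.integral_diff)
      (auto simp: divide_inverse integral_mult_left intro!: iint c integrable_continuous_interval continuous_intros Mcc par[OF sq[OF c]])
  also have "\<dots> \<le> P2" unfolding P2_def
  proof (rule integral_le)
    show "(\<lambda>s. (pi / l)\<^sup>2 * (integral {b..b+l} (\<lambda>t. (cmod (H s t))\<^sup>2) - (cmod (M s))\<^sup>2 / l)) integrable_on {a..a+l}"
      using l by (intro integrable_continuous_interval continuous_intros par sq c Mcc) auto
    show "(\<lambda>s. integral {b..b+l} (\<lambda>t. (cmod (H2 s t))\<^sup>2)) integrable_on {a..a+l}" by (rule iint[OF c2])
    fix s
    show "(pi / l)\<^sup>2 * (integral {b..b+l} (\<lambda>t. (cmod (H s t))\<^sup>2) - (cmod (M s))\<^sup>2 / l)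
         \<le> integral {b..b+l} (\<lambda>t. (cmod (H2 s t))\<^sup>2)"
      using wirtinger_neumann[of b "b+l" "H s" "H2 s"] l d2 sl[OF c2] unfolding M_def
      by (auto intro: has_vector_derivative_at_within)
  qed
  finally have 1: "(pi / l)\<^sup>2 * (A - B / l) \<le> P2" .
  have "(pi / l)\<^sup>2 * (B - (cmod (integral {a..a+l} M))\<^sup>2 / l) \<le> integral {a..a+l} (\<lambda>s. (cmod (M' s))\<^sup>2)"
    using wirtinger_neumann[of a "a+l" M M'] l Md Mc unfolding B_def by simp
  also have "\<dots> \<le> integral {a..a+l} (\<lambda>s. l * integral {b..b+l} (\<lambda>t. (cmod (H1 s t))\<^sup>2))"
  proof (rule integral_le)
    show "(\<lambda>s. (cmod (M' s))\<^sup>2) integrable_on {a..a+l}"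
      by (intro integrable_continuous_interval continuous_intros Mc)
    show "(\<lambda>s. l * integral {b..b+l} (\<lambda>t. (cmod (H1 s t))\<^sup>2)) integrable_on {a..a+l}"
      by (intro integrable_continuous_interval continuous_intros par sq c1)
    fix s show "(cmod (M' s))\<^sup>2 \<le> l * integral {b..b+l} (\<lambda>t. (cmod (H1 s t))\<^sup>2)"
      using cauchy_schwarz_integral[of b "b+l" "H1 s"] l sl[OF c1] unfolding M'_def by simp
  qed
  also have "\<dots> = l * P1" unfolding P1_def by (rule Henstock_Kurzweil_Integration.integral_mult_right)
  finally have 2: "(pi / l)\<^sup>2 * (B - (cmod (integral {a..a+l} M))\<^sup>2 / l) \<le> l * P1" .
  then have "(pi / l)\<^sup>2 * (B - (cmod (integral {a..a+l} M))\<^sup>2 / l) / l \<le> P1"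
    using l by (simp add: divide_le_eq mult.commute)
  \<comment> \<open>The variance on the square is the variance within the slices plus that of the
    slice means.\<close>
  moreover have "(pi / l)\<^sup>2 * (A - (cmod (integral {a..a+l} M))\<^sup>2 / l\<^sup>2)
     = (pi / l)\<^sup>2 * (A - B / l) + (pi / l)\<^sup>2 * (B - (cmod (integral {a..a+l} M))\<^sup>2 / l) / l"
    using l by (simp add: algebra_simps add_divide_distrib diff_divide_distrib power2_eq_square)
  ultimately show ?thesis using 1 unfolding A_def P1_def P2_def M_def[abs_def] by linarith
qed

section \<open>Smooth functions\<close>

definition smooth :: "('a::euclidean_space \<Rightarrow> complex) \<Rightarrow> bool" where
  "smooth f \<longleftrightarrow> (\<forall>k. times_cont_diff k f)"

abbreviation pd :: "'a::euclidean_space \<Rightarrow> ('a \<Rightarrow> complex) \<Rightarrow> 'a \<Rightarrow> complex" where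
  "pd v f \<equiv> (\<lambda>p. frechet_derivative f (at p) v)"

abbreviation vd :: "(real \<Rightarrow> complex) \<Rightarrow> real \<Rightarrow> complex" where
  "vd f \<equiv> (\<lambda>t. vector_derivative f (at t))"

lemma pdI: "(f has_derivative f') (at p) \<Longrightarrow> frechet_derivative f (at p) v = f' v"
  using frechet_derivative_at by metis

lemma tcd_mono: "times_cont_diff (Suc k) f \<Longrightarrow> times_cont_diff k f"
  by (induction k arbitrary: f) (auto intro: differentiable_imp_continuous_on)

lemma tcd_differentiable: "times_cont_diff (Suc k) f \<Longrightarrow> f differentiable (at p)"
  by (auto simp: differentiable_on_def)

lemma tcd_frechet: "times_cont_diff (Suc k) f \<Longrightarrow> (f has_derivative frechet_derivative f (at p)) (at p)"
  using tcd_differentiable frechet_derivative_works by blast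

lemma tcd_SucI:
  assumes "\<And>p. (f has_derivative f' p) (at p)" "\<And>v. v \<in> Basis \<Longrightarrow> times_cont_diff k (\<lambda>p. f' p v)"
  shows "times_cont_diff (Suc k) f"
proof -
  have "pd v f = (\<lambda>p. f' p v)" for v using pdI[OF assms(1)] by auto
  moreover have "f differentiable_on UNIV"
    using assms(1) by (auto simp: differentiable_on_def differentiable_def)
  ultimately show ?thesis using assms(2) by simp
qed

lemma tcd_const: "times_cont_diff k (\<lambda>_. c)"
proof (induction k arbitrary: c)
  case (Suc k)
  show ?case by (rule tcd_SucI[where f'="\<lambda>_ _. 0"]) (auto intro: Suc)
qed simp

lemma tcd_add: "times_cont_diff k f \<Longrightarrow> times_cont_diff k g \<Longrightarrow> times_cont_diff k (\<lambda>p. f p + g p)"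
proof (induction k arbitrary: f g)
  case 0 then show ?case by (auto intro: continuous_intros)
next
  case (Suc k)
  show ?case
    by (rule tcd_SucI, rule has_derivative_add[OF tcd_frechet[OF Suc.prems(1)] tcd_frechet[OF Suc.prems(2)]])
      (use Suc in auto)
qed

lemma tcd_mult: "times_cont_diff k f \<Longrightarrow> times_cont_diff k g \<Longrightarrow> times_cont_diff k (\<lambda>p. f p * g p)"
proof (induction k arbitrary: f g)
  case 0 then show ?case by (auto intro: continuous_intros)
next
  case (Suc k)
  show ?case
    by (rule tcd_SucI, rule has_derivative_mult[OF tcd_frechet[OF Suc.prems(1)] tcd_frechet[OF Suc.prems(2)]])
      (use Suc.prems in \<open>auto intro!: tcd_add Suc.IH tcd_mono[OF Suc.prems(1)] tcd_mono[OF Suc.prems(2)]\<close>)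
qed

lemma tcd_cnj: "times_cont_diff k f \<Longrightarrow> times_cont_diff k (\<lambda>p. cnj (f p))"
proof (induction k arbitrary: f)
  case 0 then show ?case by (auto intro: continuous_intros)
next
  case (Suc k)
  show ?case
    by (rule tcd_SucI, rule has_derivative_cnj[OF tcd_frechet[OF Suc.prems]])
      (use Suc in auto)
qed

lemma vector_frechet: "(f has_vector_derivative f') (at t) \<Longrightarrow> frechet_derivative f (at t) v = v *\<^sub>R f'"
  by (simp add: has_vector_derivative_def pdI)

lemma tcd_vd: "times_cont_diff (Suc k) f \<Longrightarrow> (f has_vector_derivative vd f t) (at t)"
  using tcd_differentiable vector_derivative_works by blast

lemma tcd_vd': "times_cont_diff (Suc k) f \<Longrightarrow> times_cont_diff k (vd f)"
proof -
  assume a: "times_cont_diff (Suc k) f"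
  have "pd 1 f = vd f" using vector_frechet[OF tcd_vd[OF a]] by auto
  then show ?thesis using a by auto
qed

lemma tcd_realI:
  assumes "\<And>t. (f has_vector_derivative f' t) (at t)" "times_cont_diff k f'"
  shows "times_cont_diff (Suc k) f"
  by (rule tcd_SucI[where f'="\<lambda>t v. v *\<^sub>R f' t"]) (use assms in \<open>auto simp: has_vector_derivative_def\<close>)

text \<open>Box bumps and product functions are products of one-variable profiles of affine
  functionals; this case of the chain rule gives their smoothness.\<close>

lemma tcd_compose_affine:
  fixes h :: "real \<Rightarrow> complex" and w :: "'a::euclidean_space"
  shows "times_cont_diff k h \<Longrightarrow> times_cont_diff k (\<lambda>p. h (p \<bullet> w + c))"
proof (induction k arbitrary: h)
  case 0
  then show ?case by (auto intro!: continuous_intros continuous_on_compose2[of UNIV h])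
next
  case (Suc k)
  have d: "((\<lambda>p. h (p \<bullet> w + c)) has_derivative (\<lambda>v. (v \<bullet> w) *\<^sub>R vd h (p \<bullet> w + c))) (at p)" for p
  proof -
    have "((\<lambda>p. p \<bullet> w + c) has_derivative (\<lambda>v. v \<bullet> w)) (at p)"
      by (auto intro!: derivative_eq_intros)
    from has_derivative_compose[OF this tcd_vd[OF Suc.prems, unfolded has_vector_derivative_def]]
    show ?thesis .
  qed
  show ?case
  proof (rule tcd_SucI[OF d])
    fix v :: 'a
    have "times_cont_diff k (\<lambda>p. of_real (v \<bullet> w) * vd h (p \<bullet> w + c))"
      by (intro tcd_mult tcd_const Suc.IH tcd_vd' Suc.prems)
    then show "times_cont_diff k (\<lambda>p. (v \<bullet> w) *\<^sub>R vd h (p \<bullet> w + c))" by (simp add: scaleR_conv_of_real)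
  qed
qed

lemma smooth_const: "smooth (\<lambda>_. c)"
  and smooth_add: "smooth f \<Longrightarrow> smooth g \<Longrightarrow> smooth (\<lambda>p. f p + g p)"
  and smooth_mult: "smooth f \<Longrightarrow> smooth g \<Longrightarrow> smooth (\<lambda>p. f p * g p)"
  and smooth_cnj: "smooth f \<Longrightarrow> smooth (\<lambda>p. cnj (f p))"
  by (auto simp: smooth_def intro: tcd_const tcd_add tcd_mult tcd_cnj)

lemma smooth_compose_affine:
  fixes h :: "real \<Rightarrow> complex" and w :: "'a::euclidean_space"
  shows "smooth h \<Longrightarrow> smooth (\<lambda>p. h (p \<bullet> w + c))"
  by (auto simp: smooth_def intro: tcd_compose_affine)

lemma smooth_affine:
  fixes h :: "real \<Rightarrow> complex"
  shows "smooth h \<Longrightarrow> smooth (\<lambda>t. h (a * t + c))"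
  using smooth_compose_affine[of h a c] by (simp add: mult.commute)

lemma smooth_has_derivative: "smooth f \<Longrightarrow> (f has_derivative frechet_derivative f (at p)) (at p)"
  using tcd_frechet unfolding smooth_def by blast

lemma smooth_pd: "smooth f \<Longrightarrow> v \<in> Basis \<Longrightarrow> smooth (pd v f)"
  unfolding smooth_def by (metis times_cont_diff.simps(2))

lemma smooth_continuous_on: "smooth f \<Longrightarrow> continuous_on S f"
  unfolding smooth_def by (metis times_cont_diff.simps(1) continuous_on_subset subset_UNIV)

lemma smooth_vd: "smooth f \<Longrightarrow> smooth (vd f)"
  unfolding smooth_def using tcd_vd' by blast

lemma smooth_vector_derivative: "smooth f \<Longrightarrow> (f has_vector_derivative vd f t) (at t)"
  unfolding smooth_def using tcd_vd by blast

lemma smooth_measurable: "smooth f \<Longrightarrow> f \<in> borel_measurable borel"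
  by (intro borel_measurable_continuous_onI smooth_continuous_on)

lemma smoothI_vd:
  assumes "\<And>t. (f has_vector_derivative f' t) (at t)" "smooth f'"
  shows "smooth f"
  unfolding smooth_def
proof
  fix k show "times_cont_diff k f"
    using tcd_realI[OF assms(1)] assms(2) tcd_mono unfolding smooth_def by blast
qed

lemma smooth_exp: "smooth (\<lambda>t::real. exp (c * of_real t))"
  unfolding smooth_def
proof
  fix k show "times_cont_diff k (\<lambda>t::real. exp (c * of_real t))"
  proof (induction k)
    case 0 show ?case by (auto intro!: continuous_intros)
  next
    case (Suc k)
    show ?case
    proof (rule tcd_realI)
      show "((\<lambda>t::real. exp (c * of_real t)) has_vector_derivative c * exp (c * of_real t)) (at t)" for t :: real
        by (auto intro!: derivative_eq_intros has_vector_derivative_real_field)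
      show "times_cont_diff k (\<lambda>t::real. c * exp (c * of_real t))" by (intro tcd_mult tcd_const Suc)
    qed
  qed
qed

lemma smooth_sin: "smooth (\<lambda>t::real. of_real (sin (c * t)))"
  and smooth_cos: "smooth (\<lambda>t::real. of_real (cos (c * t)))"
proof -
  have s: "(\<lambda>t::real. of_real (sin (c * t))) =
      (\<lambda>t. (- \<i> / 2) * (exp (\<i> * of_real c * of_real t) + (-1) * exp (- \<i> * of_real c * of_real t)))"
    by (rule ext) (simp add: sin_of_real[symmetric] sin_exp_eq field_simps)
  have c: "(\<lambda>t::real. of_real (cos (c * t))) =
      (\<lambda>t. (1 / 2) * (exp (\<i> * of_real c * of_real t) + exp (- \<i> * of_real c * of_real t)))"
    by (rule ext) (simp add: cos_of_real[symmetric] cos_exp_eq field_simps)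
  show "smooth (\<lambda>t::real. of_real (sin (c * t)))"
    unfolding s by (intro smooth_mult smooth_add smooth_const smooth_exp)
  show "smooth (\<lambda>t::real. of_real (cos (c * t)))"
    unfolding c by (intro smooth_mult smooth_add smooth_const smooth_exp)
qed

subsection \<open>Cutoff functions\<close>

text \<open>The powers of \<open>t\<close> in the denominator close the family under
  differentiation: the derivative of \<open>flat k\<close> is a combination of
  \<open>flat (k + 2)\<close> and \<open>flat (k + 1)\<close>. \<open>flat 0\<close> is the
  classical smooth function that is flat at 0.\<close>

definition flat :: "nat \<Rightarrow> real \<Rightarrow> real" where
  "flat k t = (if 0 < t then exp (- (1 / t)) / t ^ k else 0)"

lemma flat_tendsto_right: "(flat k \<longlongrightarrow> 0) (at_right 0)"
proof -
  have "((\<lambda>t. (inverse t) ^ k / exp (inverse t)) \<longlongrightarrow> 0) (at_right (0::real))"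
    by (rule filterlim_compose[OF tendsto_power_div_exp_0 filterlim_inverse_at_top_right])
  moreover have "\<forall>\<^sub>F t in at_right 0. (inverse t) ^ k / exp (inverse t) = flat k t"
    by (auto simp: eventually_at_right_field flat_def exp_minus field_simps intro!: exI[of _ 1])
  ultimately show ?thesis by (rule Lim_transform_eventually)
qed

lemma flat_derivative: "(flat k has_real_derivative (flat (k + 2) t - real k * flat (k + 1) t)) (at t)"
proof -
  consider "t > 0" | "t < 0" | "t = 0" by linarith
  then show ?thesis
  proof cases
    case 1
    have "((\<lambda>t. exp (- (1 / t)) / t ^ k) has_real_derivative (flat (k + 2) t - real k * flat (k + 1) t)) (at t)"
    proof -
      have e: "((\<lambda>t. exp (- (1 / t))) has_real_derivative exp (- (1 / t)) * (1 / t^2)) (at t)"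
        using 1 by (auto intro!: derivative_eq_intros simp: power2_eq_square)
      have p: "((\<lambda>t. 1 / t ^ k) has_real_derivative - real k / t ^ (k + 1)) (at t)"
      proof (cases k)
        case (Suc j)
        have "((\<lambda>t. inverse (t ^ k)) has_real_derivative - (real k * t ^ (k - Suc 0) * inverse ((t ^ k) ^ Suc (Suc 0)))) (at t)"
          using 1 by (intro DERIV_inverse_fun DERIV_pow) simp
        moreover have "- (real k * t ^ (k - Suc 0) * inverse ((t ^ k) ^ Suc (Suc 0))) = - real k / t ^ (k + 1)"
          using 1 Suc by (simp add: divide_simps)
        ultimately show ?thesis by (simp add: inverse_eq_divide)
      qed simp
      have "exp (- (1 / t)) * (1 / t^2) * (1 / t ^ k) + - real k / t ^ (k + 1) * exp (- (1 / t))
          = flat (k + 2) t - real k * flat (k + 1) t"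
        using 1 by (simp add: flat_def power2_eq_square)
      then show ?thesis using DERIV_mult[OF e p] by simp
    qed
    then show ?thesis
      by (rule has_field_derivative_transform_within_open[of _ _ _ "{0<..}"]) (use 1 in \<open>auto simp: flat_def\<close>)
  next
    case 2
    have "((\<lambda>t. 0) has_real_derivative (flat (k + 2) t - real k * flat (k + 1) t)) (at t)"
      using 2 by (simp add: flat_def)
    then show ?thesis
      by (rule has_field_derivative_transform_within_open[of _ _ _ "{..<0}"]) (use 2 in \<open>auto simp: flat_def\<close>)
  next
    case 3
    have "((\<lambda>h. (flat k (0 + h) - flat k 0) / h) \<longlongrightarrow> 0) (at 0)"
    proof (rule filterlim_split_at)
      show "((\<lambda>h. (flat k (0 + h) - flat k 0) / h) \<longlongrightarrow> 0) (at_left 0)"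
        by (rule Lim_transform_eventually[OF tendsto_const])
          (auto simp: eventually_at_left_field flat_def intro!: exI[of _ "-1"])
      \<comment> \<open>For h > 0 the difference quotient at 0 is
        \<open>flat (Suc k) h\<close>.\<close>
      show "((\<lambda>h. (flat k (0 + h) - flat k 0) / h) \<longlongrightarrow> 0) (at_right 0)"
        by (rule Lim_transform_eventually[OF flat_tendsto_right[of "Suc k"]])
          (auto simp: eventually_at_right_field flat_def intro!: exI[of _ 1])
    qed
    then show ?thesis using 3 by (simp add: DERIV_def flat_def)
  qed
qed

lemma smooth_flat: "smooth (\<lambda>t. of_real (flat k t))"
  unfolding smooth_def
proof
  fix n show "times_cont_diff n (\<lambda>t. of_real (flat k t))"
  proof (induction n arbitrary: k)
    case 0
    have "continuous_on UNIV (flat k)"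
      by (rule DERIV_continuous_on) (rule has_field_derivative_at_within[OF flat_derivative])
    then show ?case by (auto intro!: continuous_intros)
  next
    case (Suc n)
    show ?case
    proof (rule tcd_realI)
      show "((\<lambda>t. complex_of_real (flat k t)) has_vector_derivative
          of_real (flat (k + 2) t) + of_real (- real k) * of_real (flat (k + 1) t)) (at t)" for t
        using has_vector_derivative_of_real[OF flat_derivative[of k t]]
        by simp
      show "times_cont_diff n (\<lambda>t. complex_of_real (flat (k + 2) t) + of_real (- real k) * of_real (flat (k + 1) t))"
        by (intro tcd_add tcd_mult tcd_const Suc)
    qed
  qed
qed

lemma flat_bounds: "0 \<le> flat 0 t" "flat 0 t \<le> 1" "flat 0 t > 0 \<longleftrightarrow> t > 0"
  by (auto simp: flat_def)

definition bump :: "real \<Rightarrow> real" where "bump t = flat 0 t * flat 0 (1 - t)"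

lemma smooth_bump: "smooth (\<lambda>t. of_real (bump t))"
  unfolding bump_def of_real_mult
  using smooth_mult[OF smooth_flat[of 0] smooth_affine[OF smooth_flat[of 0], of "-1" 1]] by simp

lemma bump_nonneg: "0 \<le> bump t" and bump_pos: "bump t > 0 \<longleftrightarrow> 0 < t \<and> t < 1"
  and bump_zero: "t \<le> 0 \<or> 1 \<le> t \<Longrightarrow> bump t = 0"
  using flat_bounds(1)[of t] flat_bounds(1)[of "1-t"]
  by (auto simp: bump_def flat_def)

lemma continuous_on_bump: "continuous_on S bump"
proof -
  have "continuous_on S (\<lambda>t. Re (of_real (bump t)))"
    by (intro continuous_intros smooth_continuous_on smooth_bump)
  then show ?thesis by simp
qed

text \<open>The primitive starts at -1 and not at the left end 0 of the support of
  \<open>bump\<close>, so that every t \<ge> 0 is an interior point of an interval on which the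
  integral is differentiated.\<close>

definition ramp :: "real \<Rightarrow> real" where "ramp t = integral {-1..t} bump / integral {-1..1} bump"

lemma ramp_int_pos: "integral {-1..1} bump > 0"
proof -
  have "integral {-1..1} bump \<noteq> 0"
  proof
    assume 0: "integral {-1..1} bump = 0"
    have "(bump has_integral integral {-1..1} bump) {-1..1}"
      by (intro integrable_integral integrable_continuous_interval continuous_on_bump)
    then have h: "(bump has_integral 0) (cbox (-1) 1)" unfolding 0 cbox_interval .
    have "bump (1/2) = 0"
      by (rule has_integral_0_cbox_imp_0[OF continuous_on_bump bump_nonneg h]) auto
    then show False using bump_pos[of "1/2"] by simp
  qed
  moreover have "integral {-1..1} bump \<ge> 0" by (rule integral_nonneg) (auto simp: bump_nonneg integrable_continuous_interval continuous_on_bump)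
  ultimately show ?thesis by simp
qed

lemma integral_bump_low: "t \<le> 0 \<Longrightarrow> integral {-1..t} bump = 0"
proof -
  assume "t \<le> 0"
  then have "integral {-1..t} bump = integral {-1..t} (\<lambda>_. 0)" by (intro integral_cong) (auto simp: bump_zero)
  then show ?thesis by simp
qed

lemma integral_bump_high: "1 \<le> t \<Longrightarrow> integral {-1..t} bump = integral {-1..1} bump"
proof -
  assume t: "1 \<le> t"
  have "integral {-1..1} bump + integral {1..t} bump = integral {-1..t} bump"
    using t by (intro Henstock_Kurzweil_Integration.integral_combine integrable_continuous_interval continuous_on_bump) auto
  moreover have "integral {1..t} bump = integral {1..t} (\<lambda>_. 0)" by (intro integral_cong) (auto simp: bump_zero)
  ultimately show ?thesis by simp
qed

lemma ramp_low: "t \<le> 0 \<Longrightarrow> ramp t = 0" and ramp_high: "1 \<le> t \<Longrightarrow> ramp t = 1"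
  unfolding ramp_def using ramp_int_pos integral_bump_low[of t] integral_bump_high[of t] by simp_all

lemma ramp_derivative: "(ramp has_real_derivative (bump t / integral {-1..1} bump)) (at t)"
proof (cases "t < 0")
  case True
  have "((\<lambda>t. 0) has_real_derivative (bump t / integral {-1..1} bump)) (at t)"
    using True by (simp add: bump_zero)
  then show ?thesis
    by (rule has_field_derivative_transform_within_open[of _ _ _ "{..<0}"]) (use True in \<open>auto simp: ramp_low\<close>)
next
  case False
  have "((\<lambda>t. integral {-1..t} bump) has_real_derivative bump t) (at t within {-1..t+1})"
    by (rule integral_has_real_derivative) (use False in \<open>auto simp: continuous_on_bump\<close>)
  moreover have "at t within {-1..t+1} = at t"
    by (rule at_within_interior) (use False in \<open>auto simp: interior_atLeastAtMost_real\<close>)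
  ultimately have "((\<lambda>t. integral {-1..t} bump) has_real_derivative bump t) (at t)" by simp
  then show ?thesis unfolding ramp_def[abs_def] by (rule DERIV_cdivide)
qed

lemma smooth_ramp: "smooth (\<lambda>t. of_real (ramp t))"
proof (rule smoothI_vd)
  show "((\<lambda>t. complex_of_real (ramp t)) has_vector_derivative
     of_real (bump t / integral {-1..1} bump)) (at t)" for t
    by (rule has_vector_derivative_of_real[OF ramp_derivative])
  have "(\<lambda>t. complex_of_real (bump t / integral {-1..1} bump))
      = (\<lambda>t. of_real (1 / integral {-1..1} bump) * complex_of_real (bump t))"
    by auto
  then show "smooth (\<lambda>t. complex_of_real (bump t / integral {-1..1} bump))"
    using smooth_mult[OF smooth_const smooth_bump] by metis
qed

lemma ramp_bounds: "0 \<le> ramp t" "ramp t \<le> 1"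
proof -
  have mono: "ramp x \<le> ramp y" if "x \<le> y" for x y
    by (rule DERIV_nonneg_imp_nondecreasing[OF that])
      (use ramp_derivative ramp_int_pos bump_nonneg in \<open>meson divide_nonneg_pos\<close>)
  show "0 \<le> ramp t" using mono[of "min t 0" t] ramp_low[of "min t 0"] by simp
  show "ramp t \<le> 1" using mono[of t "max t 1"] ramp_high[of "max t 1"] by simp
qed

definition plateau :: "real \<Rightarrow> real \<Rightarrow> real" where
  "plateau R t = ramp (R + 1 + t) * ramp (R + 1 - t)"

lemma plateau_one: "\<bar>t\<bar> \<le> R \<Longrightarrow> plateau R t = 1"
  by (simp add: plateau_def ramp_high abs_le_iff)

lemma plateau_zero: "R + 1 \<le> \<bar>t\<bar> \<Longrightarrow> plateau R t = 0"
  by (auto simp: plateau_def abs_if ramp_low split: if_splits)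

lemma plateau_bounds: "0 \<le> plateau R t" "plateau R t \<le> 1"
  by (auto simp: plateau_def ramp_bounds intro!: mult_le_one)

lemma plateau_even: "plateau R (- t) = plateau R t"
  by (simp add: plateau_def mult.commute)

lemma smooth_plateau: "smooth (\<lambda>t. of_real (plateau R t))"
  unfolding plateau_def of_real_mult
  using smooth_mult[OF smooth_affine[OF smooth_ramp, of 1 "R+1"] smooth_affine[OF smooth_ramp, of "-1" "R+1"]]
  by (simp add: algebra_simps)

section \<open>Test functions\<close>

text \<open>The problem is posed with Lebesgue measure restricted to a set, whereas Fubini and
  substitution are applied to \<open>lborel\<close>. For Borel functions an indicator carries
  integrals over.\<close>

lemma integral_lebesgue_on_borel:
  fixes F :: "'a::euclidean_space \<Rightarrow> 'b::{banach, second_countable_topology}"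
  assumes "S \<in> sets borel" "F \<in> borel_measurable borel"
  shows "(LINT p|lebesgue_on S. F p) = (LINT p|lborel. indicator S p *\<^sub>R F p)"
    and "integrable (lebesgue_on S) F \<longleftrightarrow> integrable lborel (\<lambda>p. indicator S p *\<^sub>R F p)"
proof -
  have S: "S \<inter> space lebesgue \<in> sets lebesgue" using assms(1) by auto
  have m: "(\<lambda>p. indicator S p *\<^sub>R F p) \<in> borel_measurable lborel" using assms by measurable
  show "(LINT p|lebesgue_on S. F p) = (LINT p|lborel. indicator S p *\<^sub>R F p)"
    by (subst integral_restrict_space[OF S], rule integral_completion[OF m])
  show "integrable (lebesgue_on S) F \<longleftrightarrow> integrable lborel (\<lambda>p. indicator S p *\<^sub>R F p)"
    by (subst integrable_restrict_space[OF S], rule integrable_completion[OF m])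
qed

lemma measurable_lebesgue_on_borel:
  "F \<in> borel_measurable borel \<Longrightarrow> F \<in> borel_measurable (lebesgue_on S)"
  by (intro measurable_restrict_space1 measurable_completion) auto

lemma integrable_compact_support:
  fixes F :: "'a::euclidean_space \<Rightarrow> 'b::{banach, second_countable_topology}"
  assumes "continuous_on UNIV F" "\<And>p. R \<le> norm p \<Longrightarrow> F p = 0"
  shows "integrable lborel F"
proof -
  have "integrable lborel (\<lambda>p. indicator (cball 0 R) p *\<^sub>R F p)"
    by (intro borel_integrable_compact continuous_on_subset[OF assms(1)]) auto
  moreover have "(\<lambda>p. indicator (cball 0 R) p *\<^sub>R F p) = F"
    using assms(2) by (auto simp: indicator_def fun_eq_iff)
  ultimately show ?thesis by simp
qed

lemma test_functions_iff:
  "f \<in> test_functions U \<longleftrightarrow> smooth f \<and> compact (closure {p. f p \<noteq> 0}) \<and> closure {p. f p \<noteq> 0} \<subseteq> U"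
  by (auto simp: test_functions_def smooth_def)

lemma test_UNIV: "f \<in> test_functions U \<Longrightarrow> f \<in> test_functions UNIV"
  by (auto simp: test_functions_iff)

lemma test_smooth: "f \<in> test_functions U \<Longrightarrow> smooth f"
  by (auto simp: test_functions_iff)

lemma test_measurable: "f \<in> test_functions U \<Longrightarrow> f \<in> borel_measurable borel"
  by (intro smooth_measurable test_smooth)

lemma testI:
  assumes "smooth f" "\<And>p. f p \<noteq> 0 \<Longrightarrow> p \<in> K" "compact K" "K \<subseteq> U"
  shows "f \<in> test_functions U"
proof -
  have "closure {p. f p \<noteq> 0} \<subseteq> K"
    using assms by (intro closure_minimal compact_imp_closed) auto
  then show ?thesis using assms by (auto simp: test_functions_iff compact_eq_bounded_closed intro: bounded_subset)
qed

lemma test_support: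
  assumes "f \<in> test_functions U"
  obtains R where "R > 0" "\<And>p. R \<le> norm p \<Longrightarrow> f p = 0"
proof -
  have "bounded {p. f p \<noteq> 0}"
    using assms by (auto simp: test_functions_iff compact_eq_bounded_closed intro: bounded_subset[OF _ closure_subset])
  then obtain R where R: "\<And>p. f p \<noteq> 0 \<Longrightarrow> norm p \<le> R" by (auto simp: bounded_iff)
  show ?thesis
    by (rule that[of "\<bar>R\<bar> + 1"]) (use R in \<open>force simp: abs_if split: if_splits\<close>)+
qed

lemma test_zero: "f \<in> test_functions U \<Longrightarrow> p \<notin> U \<Longrightarrow> f p = 0"
  unfolding test_functions_iff using closure_subset[of "{p. f p \<noteq> 0}"] by blast

lemma test_pd:
  assumes "f \<in> test_functions U" "v \<in> Basis"
  shows "pd v f \<in> test_functions U"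
proof (rule testI[where K="closure {p. f p \<noteq> 0}"])
  show "smooth (pd v f)" using assms by (intro smooth_pd test_smooth)
  fix p assume "pd v f p \<noteq> 0"
  show "p \<in> closure {p. f p \<noteq> 0}"
  proof (rule ccontr)
    assume p: "p \<notin> closure {p. f p \<noteq> 0}"
    have "((\<lambda>_. 0) has_derivative (\<lambda>_. 0)) (at p)" by simp
    then have "(f has_derivative (\<lambda>_. 0)) (at p)"
      by (rule has_derivative_transform_within_open[where s="- closure {p. f p \<noteq> 0}"])
        (use p closure_subset[of "{p. f p \<noteq> 0}"] in auto)
    then show False using \<open>pd v f p \<noteq> 0\<close> pdI by metis
  qed
qed (use assms in \<open>auto simp: test_functions_iff\<close>)

lemma test_mult:
  assumes "smooth f" "g \<in> test_functions U"
  shows "(\<lambda>p. f p * g p) \<in> test_functions U"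
  by (rule testI[where K="closure {p. g p \<noteq> 0}"])
    (use assms closure_subset[of "{p. g p \<noteq> 0}"] in \<open>auto simp: test_functions_iff smooth_mult\<close>)

lemma test_cnj: "f \<in> test_functions U \<Longrightarrow> (\<lambda>p. cnj (f p)) \<in> test_functions U"
  by (simp add: test_functions_iff smooth_cnj)

lemma test_comb:
  assumes "f \<in> test_functions U" "g \<in> test_functions U"
  shows "fcomb c f d g \<in> test_functions U"
proof (rule testI[where K="closure {p. f p \<noteq> 0} \<union> closure {p. g p \<noteq> 0}"])
  fix p assume "fcomb c f d g p \<noteq> 0"
  then have "f p \<noteq> 0 \<or> g p \<noteq> 0" by auto
  then show "p \<in> closure {p. f p \<noteq> 0} \<union> closure {p. g p \<noteq> 0}"
    using subsetD[OF closure_subset, of p "{p. f p \<noteq> 0}"] subsetD[OF closure_subset, of p "{p. g p \<noteq> 0}"] by auto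
qed (use assms in \<open>auto simp: test_functions_iff intro!: smooth_add smooth_mult smooth_const\<close>)

lemma pd_comb:
  assumes "smooth f" "smooth g"
  shows "pd v (fcomb c f d g) p = c * pd v f p + d * pd v g p"
proof -
  have "(fcomb c f d g has_derivative (\<lambda>v. c * pd v f p + d * pd v g p)) (at p)"
    using smooth_has_derivative[OF assms(1), of p] smooth_has_derivative[OF assms(2), of p]
    by (intro has_derivative_add has_derivative_mult_right)
  then show ?thesis by (rule pdI)
qed

lemma pd_mult:
  assumes "smooth f" "smooth g"
  shows "pd v (\<lambda>p. f p * g p) p = f p * pd v g p + pd v f p * g p"
  using has_derivative_mult[OF smooth_has_derivative[OF assms(1), of p] smooth_has_derivative[OF assms(2), of p]]
  by (rule pdI)

lemma test_integrable:
  assumes "f \<in> test_functions U"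
  shows "integrable lborel f"
proof -
  obtain R where "\<And>p. R \<le> norm p \<Longrightarrow> f p = 0" using test_support[OF assms] by blast
  then show ?thesis by (intro integrable_compact_support smooth_continuous_on test_smooth[OF assms])
qed

lemma test_sq_integrable:
  assumes "f \<in> test_functions U"
  shows "integrable lborel (\<lambda>p. (cmod (f p))\<^sup>2)"
proof -
  obtain R where "\<And>p. R \<le> norm p \<Longrightarrow> f p = 0" using test_support[OF assms] by blast
  then show ?thesis by (intro integrable_compact_support[of _ R] continuous_intros smooth_continuous_on test_smooth[OF assms]) auto
qed

lemma test_L2:
  assumes "f \<in> test_functions U" "S \<in> sets borel"
  shows "f \<in> L2 (lebesgue_on S)"
proof -
  have m[measurable]: "f \<in> borel_measurable borel" by (rule test_measurable[OF assms(1)])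
  have "integrable lborel (\<lambda>p. indicator S p *\<^sub>R (cmod (f p))\<^sup>2)"
    by (rule integrable_mult_indicator) (use assms test_sq_integrable in auto)
  then have "integrable (lebesgue_on S) (\<lambda>p. (cmod (f p))\<^sup>2)"
    using assms(2) by (subst integral_lebesgue_on_borel(2)) auto
  then show ?thesis by (simp add: L2_def measurable_lebesgue_on_borel)
qed

section \<open>Uniqueness of weak derivatives\<close>

text \<open>The measures whose densities are the positive and the negative part of \<open>f\<close>
  agree on open boxes, an intersection-stable generator, hence everywhere; densities are unique
  almost everywhere.\<close>

lemma AE_zero_of_boxes:
  fixes f :: "'a::euclidean_space \<Rightarrow> real"
  assumes f: "integrable lborel f"
    and box: "\<And>a b. (LINT p|lborel. indicator (box a b) p * f p) = 0"
  shows "AE p in lborel. f p = 0"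
proof -
  have m[measurable]: "f \<in> borel_measurable borel" using f by auto
  define M1 where "M1 = density lborel (\<lambda>p. ennreal (max 0 (f p)))"
  define M2 where "M2 = density lborel (\<lambda>p. ennreal (max 0 (- f p)))"
  have i1: "integrable lborel (\<lambda>p. max 0 (f p))" and i2: "integrable lborel (\<lambda>p. max 0 (- f p))"
    using f by (auto intro!: integrable_max)
  have e1: "emeasure M1 A = ennreal (LINT p|lborel. indicator A p * max 0 (f p))" if "A \<in> sets borel" for A
  proof -
    have "integrable lborel (\<lambda>p. indicator A p * max 0 (f p))"
      using integrable_mult_indicator[OF _ i1, of A] that by simp
    then show ?thesis unfolding M1_def using that
      by (subst emeasure_density) (auto simp: nn_integral_eq_integral[symmetric] ennreal_mult'' ennreal_indicator mult.commute intro!: nn_integral_cong)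
  qed
  have e2: "emeasure M2 A = ennreal (LINT p|lborel. indicator A p * max 0 (- f p))" if "A \<in> sets borel" for A
  proof -
    have "integrable lborel (\<lambda>p. indicator A p * max 0 (- f p))"
      using integrable_mult_indicator[OF _ i2, of A] that by simp
    then show ?thesis unfolding M2_def using that
      by (subst emeasure_density) (auto simp: nn_integral_eq_integral[symmetric] ennreal_mult'' ennreal_indicator mult.commute intro!: nn_integral_cong)
  qed
  have "M1 = M2"
  proof (rule measure_eqI_generator_eq)
    let ?E = "range (\<lambda>(a, b). box a b::'a set)"
    let ?A = "\<lambda>n::nat. box (- (real n *\<^sub>R One)) (real n *\<^sub>R One) :: 'a set"
    show "Int_stable ?E" by (auto simp: Int_stable_def box_Int_box)
    show "?E \<subseteq> Pow UNIV" "sets M1 = sigma_sets UNIV ?E" "sets M2 = sigma_sets UNIV ?E"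
      by (simp_all add: borel_eq_box M1_def M2_def)
    show "range ?A \<subseteq> ?E" "(\<Union>i. ?A i) = UNIV" unfolding UN_box_eq_UNIV by auto
    show "emeasure M1 (?A i) \<noteq> \<infinity>" for i by (subst e1) auto
    fix X assume "X \<in> ?E"
    then obtain a b where X: "X = box a b" by auto
    have "(LINT p|lborel. indicator X p * max 0 (f p)) - (LINT p|lborel. indicator X p * max 0 (- f p))
       = (LINT p|lborel. indicator X p * max 0 (f p) - indicator X p * max 0 (- f p))"
      using integrable_mult_indicator[OF _ i1, of X] integrable_mult_indicator[OF _ i2, of X]
      by (intro Bochner_Integration.integral_diff[symmetric]) (auto simp: X)
    also have "\<dots> = (LINT p|lborel. indicator X p * f p)"
      by (intro Bochner_Integration.integral_cong) (auto simp: max_def)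
    also have "\<dots> = 0" unfolding X by (rule box)
    finally show "emeasure M1 X = emeasure M2 X" by (simp add: e1 e2 X)
  qed
  then have "AE p in lborel. ennreal (max 0 (f p)) = ennreal (max 0 (- f p))"
    unfolding M1_def M2_def by (subst (asm) sigma_finite_measure.density_unique_iff[OF sigma_finite_lborel]) auto
  then show ?thesis by eventually_elim (auto simp: max_def split: if_splits)
qed

text \<open>As \<open>flat 0 (n * u)\<close> tends to 1 for u > 0 and is 0 for u \<le> 0, these
  smooth functions tend to the indicator of the open box.\<close>

definition box_bump :: "nat \<Rightarrow> real \<times> real \<Rightarrow> real \<times> real \<Rightarrow> real \<times> real \<Rightarrow> real" where
  "box_bump n a b p = flat 0 (real n * (fst p - fst a)) * flat 0 (real n * (fst b - fst p))
     * (flat 0 (real n * (snd p - snd a)) * flat 0 (real n * (snd b - snd p)))"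

lemma mem_box_pair: "p \<in> box a b \<longleftrightarrow> fst a < fst p \<and> fst p < fst b \<and> snd a < snd p \<and> snd p < snd (b::real \<times> real)"
  and mem_cbox_pair: "p \<in> cbox a b \<longleftrightarrow> fst a \<le> fst p \<and> fst p \<le> fst b \<and> snd a \<le> snd p \<and> snd p \<le> snd b"
  by (auto simp: mem_box Basis_prod_def inner_prod_def)

lemma smooth_box_bump: "smooth (\<lambda>p. of_real (box_bump n a b p))"
proof -
  have s: "smooth (\<lambda>p::real \<times> real. complex_of_real (flat 0 (p \<bullet> w + c)))" for w c
    by (rule smooth_compose_affine[OF smooth_flat])
  have e: "real n * (fst p - fst a) = p \<bullet> (real n, 0) + (- real n * fst a)"
    "real n * (fst b - fst p) = p \<bullet> (- real n, 0) + real n * fst b"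
    "real n * (snd p - snd a) = p \<bullet> (0, real n) + (- real n * snd a)"
    "real n * (snd b - snd p) = p \<bullet> (0, - real n) + real n * snd b" for p
    by (auto simp: inner_prod_def algebra_simps)
  show ?thesis unfolding box_bump_def of_real_mult e by (intro smooth_mult s)
qed

lemma box_bump_bounds: "0 \<le> box_bump n a b p" "box_bump n a b p \<le> 1"
  unfolding box_bump_def using flat_bounds(1,2) by (auto intro!: mult_nonneg_nonneg mult_le_one)

lemma box_bump_support: "box_bump n a b p \<noteq> 0 \<Longrightarrow> p \<in> box a b"
  unfolding box_bump_def mem_box_pair
  by (auto simp: flat_def zero_less_mult_iff split: if_splits)

lemma flat_scaled_tendsto: "(\<lambda>n. flat 0 (real n * u)) \<longlonglongrightarrow> (if 0 < u then 1 else 0)"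
proof (cases "0 < u")
  case True
  have "(\<lambda>n. exp (- (inverse u * inverse (real (Suc n))))) \<longlonglongrightarrow> exp (- (inverse u * 0))"
    by (intro tendsto_intros LIMSEQ_inverse_real_of_nat)
  then have "(\<lambda>n. flat 0 (real (Suc n) * u)) \<longlonglongrightarrow> 1"
    using True by (simp add: flat_def zero_less_mult_iff divide_inverse mult.commute)
  then show ?thesis using True filterlim_sequentially_Suc[of "\<lambda>n. flat 0 (real n * u)" "nhds 1"] by simp
next
  case False
  then have "real n * u \<le> 0" for n by (simp add: mult_nonneg_nonpos)
  then show ?thesis using False by (simp add: flat_def not_less[symmetric] del: mult_le_0_iff)
qed

lemma box_bump_tendsto: "(\<lambda>n. box_bump n a b p) \<longlonglongrightarrow> indicator (box a b) p"
proof -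
  have "(\<lambda>n. box_bump n a b p) \<longlonglongrightarrow> (if 0 < fst p - fst a then 1 else 0) * (if 0 < fst b - fst p then 1 else 0)
     * ((if 0 < snd p - snd a then 1 else 0) * (if 0 < snd b - snd p then 1 else 0))"
    unfolding box_bump_def by (intro tendsto_mult flat_scaled_tendsto)
  moreover have "(if 0 < fst p - fst a then 1 else 0) * (if 0 < fst b - fst p then 1 else 0)
     * ((if 0 < snd p - snd a then 1 else 0) * (if 0 < snd b - snd p then 1 else 0)) = (indicator (box a b) p :: real)"
    by (simp add: indicator_def mem_box_pair)
  ultimately show ?thesis by simp
qed

text \<open>Dominated convergence replaces the bumps by indicators of boxes whose closure lies in
  \<open>U\<close>. On each such box a Borel representative of \<open>g\<close> has zero integral
  over every box, so it vanishes, and countably many boxes exhaust \<open>U\<close>.\<close>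

lemma fundamental_lemma_real:
  fixes U :: "(real \<times> real) set" and g :: "real \<times> real \<Rightarrow> real"
  assumes U: "open U" and g: "g \<in> borel_measurable (lebesgue_on U)" "integrable (lebesgue_on U) (\<lambda>p. (g p)\<^sup>2)"
    and z: "\<And>n a b. cbox a b \<subseteq> U \<Longrightarrow> (LINT p|lebesgue_on U. g p * box_bump n a b p) = 0"
  shows "AE p in lebesgue_on U. g p = 0"
proof -
  have Ub: "U \<in> sets borel" using U by simp
  have Ul: "U \<inter> space lebesgue \<in> sets lebesgue" using Ub by auto
  have gi: "integrable lebesgue (\<lambda>p. indicator (box a b) p * g p)" if ab: "cbox a b \<subseteq> U" for a b
  proof -
    have bU: "box a b \<subseteq> U" by (rule order_trans[OF box_subset_cbox ab])
    have b1: "integrable lebesgue (\<lambda>p. indicator (box a b) p + indicator U p * (g p)\<^sup>2)"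
    proof (rule Bochner_Integration.integrable_add)
      show "integrable lebesgue (indicator (box a b) :: _ \<Rightarrow> real)"
        by (rule integrable_real_indicator) (auto simp: emeasure_lborel_box_eq)
      show "integrable lebesgue (\<lambda>p. indicator U p * (g p)\<^sup>2)"
        using g(2) integrable_restrict_space[OF Ul, of "\<lambda>p. (g p)\<^sup>2"] by simp
    qed
    have gm: "(\<lambda>p. indicator U p * g p) \<in> borel_measurable lebesgue"
      using g(1) borel_measurable_restrict_space_iff[OF Ul, of g] by (simp add: mult.commute)
    show ?thesis
    proof (rule Bochner_Integration.integrable_bound[OF b1])
      have "(\<lambda>p. indicator (box a b) p * (indicator U p * g p)) \<in> borel_measurable lebesgue"
        by (rule borel_measurable_times[OF borel_measurable_indicator gm]) auto
      moreover have "(\<lambda>p. indicator (box a b) p * (indicator U p * g p)) = (\<lambda>p. indicator (box a b) p * g p)"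
        using bU by (auto simp: indicator_def fun_eq_iff)
      ultimately show "(\<lambda>p. indicator (box a b) p * g p) \<in> borel_measurable lebesgue" by simp
      have "\<bar>x\<bar> \<le> 1 + x\<^sup>2" for x :: real
        using sum_squares_bound[of "\<bar>x\<bar>" 1] by simp
      then show "AE p in lebesgue. norm (indicator (box a b) p * g p) \<le> norm (indicator (box a b) p + indicator U p * (g p)\<^sup>2)"
        using bU by (intro AE_I2) (auto simp: indicator_def)
    qed
  qed
  have box0: "(LINT p|lebesgue. indicator (box a b) p * g p) = 0" if ab: "cbox a b \<subseteq> U" for a b
  proof (rule LIMSEQ_unique)
    have bU: "box a b \<subseteq> U" by (rule order_trans[OF box_subset_cbox ab])
    have gm: "(\<lambda>p. indicator (box a b) p * g p) \<in> borel_measurable lebesgue" using gi[OF ab] by auto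
    have "(\<lambda>n. LINT p|lebesgue. (indicator (box a b) p * g p) * box_bump n a b p)
      \<longlonglongrightarrow> (LINT p|lebesgue. (indicator (box a b) p * g p) * indicator (box a b) p)"
    proof (rule integral_dominated_convergence)
      show "(\<lambda>p. (indicator (box a b) p * g p) * indicator (box a b) p) \<in> borel_measurable lebesgue"
        by (rule borel_measurable_times[OF gm borel_measurable_indicator]) auto
      have "box_bump n a b \<in> borel_measurable borel" for n
        using smooth_measurable[OF smooth_box_bump[of n a b]] by (simp add: borel_measurable_complex_iff)
      then show "(\<lambda>p. (indicator (box a b) p * g p) * box_bump n a b p) \<in> borel_measurable lebesgue" for n
        by (intro borel_measurable_times[OF gm] measurable_completion) auto
      show "integrable lebesgue (\<lambda>p. norm (indicator (box a b) p * g p))" using gi[OF ab] by (rule integrable_norm)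
      show "AE p in lebesgue. (\<lambda>n. (indicator (box a b) p * g p) * box_bump n a b p)
          \<longlonglongrightarrow> (indicator (box a b) p * g p) * indicator (box a b) p"
        by (intro AE_I2 tendsto_mult tendsto_const box_bump_tendsto)
      show "AE p in lebesgue. norm ((indicator (box a b) p * g p) * box_bump n a b p)
         \<le> norm (indicator (box a b) p * g p)" for n
        using box_bump_bounds[of n a b]
        by (intro AE_I2) (auto simp: abs_mult intro!: mult_right_le_one_le)
    qed
    moreover have "(LINT p|lebesgue. (indicator (box a b) p * g p) * box_bump n a b p) = 0" for n
    proof -
      have "(LINT p|lebesgue. (indicator (box a b) p * g p) * box_bump n a b p)
          = (LINT p|lebesgue. indicator U p *\<^sub>R (g p * box_bump n a b p))"
        using bU box_bump_support[of n a b]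
        by (intro Bochner_Integration.integral_cong) (auto simp: indicator_def)
      also have "\<dots> = 0" using z[OF ab] integral_restrict_space[OF Ul, of "\<lambda>p. g p * box_bump n a b p"] by simp
      finally show ?thesis .
    qed
    moreover have "(\<lambda>p. (indicator (box a b) p * g p) * indicator (box a b) p) = (\<lambda>p. indicator (box a b) p * g p)"
      by (auto simp: indicator_def fun_eq_iff)
    ultimately show "(\<lambda>n::nat. 0) \<longlonglongrightarrow> (LINT p|lebesgue. indicator (box a b) p * g p)" by simp
  qed simp
  have local_zero: "AE p in lebesgue. p \<in> cbox a b \<longrightarrow> g p = 0" if ab: "cbox a b \<subseteq> U" for a b
  proof -
    obtain h where h: "h \<in> borel_measurable lborel" "AE p in lborel. indicator (box a b) p * g p = h p"
      using completion_ex_borel_measurable_real[of "\<lambda>p. indicator (box a b) p * g p" lborel] gi[OF ab] by auto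
    have hl: "AE p in lebesgue. indicator (box a b) p * g p = h p" using h(2) by (rule AE_completion)
    have hi: "integrable lborel h"
      using integrable_cong_AE_imp[OF gi[OF ab] measurable_completion[OF h(1)]] hl h(1)
      by (auto simp: integrable_completion)
    have "AE p in lborel. h p = 0"
    proof (rule AE_zero_of_boxes[OF hi])
      fix l u
      have "(LINT p|lborel. indicator (box l u) p * h p) = (LINT p|lebesgue. indicator (box l u) p * h p)"
        using h(1) by (intro integral_completion[symmetric]) auto
      also have "\<dots> = (LINT p|lebesgue. indicator (box l u) p * (indicator (box a b) p * g p))"
      proof (rule integral_cong_AE)
        show "AE p in lebesgue. indicator (box l u) p * h p = indicator (box l u) p * (indicator (box a b) p * g p)"
          using hl by eventually_elim auto
        show "(\<lambda>p. indicator (box l u) p * h p) \<in> borel_measurable lebesgue"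
          using h(1) by (intro borel_measurable_times measurable_completion) auto
        show "(\<lambda>p. indicator (box l u) p * (indicator (box a b) p * g p)) \<in> borel_measurable lebesgue"
          by (rule borel_measurable_times[OF borel_measurable_indicator borel_measurable_integrable[OF gi[OF ab]]]) auto
      qed
      also have "\<dots> = 0"
      proof -
        \<comment> \<open>The intersection is again a box; if nonempty, its closure lies in
          \<open>cbox a b\<close> and hence in \<open>U\<close>.\<close>
        obtain a' b' where ab': "box l u \<inter> box a b = box a' b'" by (rule that[OF box_Int_box])
        show ?thesis
        proof (cases "box a' b' = {}")
          case True
          then have "(\<lambda>p. indicator (box l u) p * (indicator (box a b) p * g p)) = (\<lambda>p. 0)"
            using ab' by (auto simp: indicator_def fun_eq_iff)
          then show ?thesis by simp
        next
          case False
          have "cbox a' b' = closure (box a' b')" using False by (simp add: closure_box)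
          also have "\<dots> \<subseteq> closure (box a b)" using ab' by (intro closure_mono) auto
          also have "\<dots> \<subseteq> cbox a b" by (intro closure_minimal box_subset_cbox closed_cbox)
          finally have "(LINT p|lebesgue. indicator (box a' b') p * g p) = 0" using box0 ab by auto
          moreover have "(\<lambda>p. indicator (box l u) p * (indicator (box a b) p * g p)) = (\<lambda>p. indicator (box a' b') p * g p)"
            using ab' by (auto simp: indicator_def fun_eq_iff)
          ultimately show ?thesis by simp
        qed
      qed
      finally show "(LINT p|lborel. indicator (box l u) p * h p) = 0" .
    qed
    then have h0: "AE p in lebesgue. h p = 0" by (rule AE_completion)
    have "cbox a b - box a b \<in> null_sets lebesgue"
      using negligible_frontier_interval negligible_iff_null_sets by blast
    then have "AE p in lebesgue. p \<notin> cbox a b - box a b" by (rule AE_not_in)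
    with h0 hl show ?thesis by eventually_elim (auto simp: indicator_def)
  qed
  obtain \<D> where \<D>: "countable \<D>" "\<D> \<subseteq> Pow U" "\<And>X. X \<in> \<D> \<Longrightarrow> \<exists>a b. X = cbox a b" "\<Union>\<D> = U"
    using open_countable_Union_open_cbox[OF U] by metis
  have "AE p in lebesgue. \<forall>X\<in>\<D>. p \<in> X \<longrightarrow> g p = 0"
  proof (subst AE_ball_countable[OF \<D>(1)], rule ballI)
    fix X assume X: "X \<in> \<D>"
    then obtain a b where ab: "X = cbox a b" using \<D>(3) by blast
    then show "AE p in lebesgue. p \<in> X \<longrightarrow> g p = 0" using local_zero[of a b] X \<D>(2) by auto
  qed
  then have "AE p in lebesgue. p \<in> U \<longrightarrow> g p = 0"
    by eventually_elim (use \<D>(4) in blast)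
  then show ?thesis by (simp add: AE_restrict_space_iff[OF Ul])
qed

lemma fundamental_lemma:
  fixes U :: "(real \<times> real) set"
  assumes U: "open U" and g: "g \<in> L2 (lebesgue_on U)"
    and z: "\<And>\<phi>. \<phi> \<in> test_functions U \<Longrightarrow> (LINT p|lebesgue_on U. g p * \<phi> p) = 0"
  shows "AE p in lebesgue_on U. g p = 0"
proof -
  have m[measurable]: "g \<in> borel_measurable (lebesgue_on U)" by (rule L2_measurable[OF g])
  have t: "(\<lambda>p. complex_of_real (box_bump n a b p)) \<in> test_functions U" if "cbox a b \<subseteq> U" for n a b
  proof (rule testI[where K="cbox a b"])
    fix p assume "complex_of_real (box_bump n a b p) \<noteq> 0"
    then have "p \<in> box a b" by (intro box_bump_support) auto
    then show "p \<in> cbox a b" by (rule subsetD[OF box_subset_cbox])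
  qed (use that smooth_box_bump in auto)
  have i: "integrable (lebesgue_on U) (\<lambda>p. g p * of_real (box_bump n a b p))" if "cbox a b \<subseteq> U" for n a b
    by (rule L2_prod_integrable(1)[OF g test_L2[OF t[OF that]]]) (use U in auto)
  have bd: "(Re w)\<^sup>2 \<le> (cmod w)\<^sup>2" "(Im w)\<^sup>2 \<le> (cmod w)\<^sup>2" for w by (auto simp: cmod_power2)
  have "AE p in lebesgue_on U. Re (g p) = 0"
  proof (rule fundamental_lemma_real[OF U])
    show "integrable (lebesgue_on U) (\<lambda>p. (Re (g p))\<^sup>2)"
      by (rule Bochner_Integration.integrable_bound[OF L2_integrable_sq[OF g]]) (auto simp: bd)
    show "(LINT p|lebesgue_on U. Re (g p) * box_bump n a b p) = 0" if "cbox a b \<subseteq> U" for n a b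
    proof -
      have "Re (LINT p|lebesgue_on U. g p * of_real (box_bump n a b p)) = (LINT p|lebesgue_on U. Re (g p * of_real (box_bump n a b p)))"
        by (rule integral_Re[symmetric, OF i[OF that]])
      then show ?thesis using z[OF t[OF that]] by simp
    qed
  qed measurable
  moreover have "AE p in lebesgue_on U. Im (g p) = 0"
  proof (rule fundamental_lemma_real[OF U])
    show "integrable (lebesgue_on U) (\<lambda>p. (Im (g p))\<^sup>2)"
      by (rule Bochner_Integration.integrable_bound[OF L2_integrable_sq[OF g]]) (auto simp: bd)
    show "(LINT p|lebesgue_on U. Im (g p) * box_bump n a b p) = 0" if "cbox a b \<subseteq> U" for n a b
    proof -
      have "Im (LINT p|lebesgue_on U. g p * of_real (box_bump n a b p)) = (LINT p|lebesgue_on U. Im (g p * of_real (box_bump n a b p)))"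
        by (rule integral_Im[symmetric, OF i[OF that]])
      then show ?thesis using z[OF t[OF that]] by simp
    qed
  qed measurable
  ultimately show ?thesis by eventually_elim (simp add: complex_eq_iff)
qed

section \<open>Sobolev functions on open subsets of the plane\<close>

type_synonym plane = "real \<times> real"

lemma Basis_plane: "(Basis :: plane set) = {(1, 0), (0, 1)}"
  by (auto simp: Basis_prod_def)

lemma sum_Basis_plane: "(\<Sum>v\<in>(Basis :: plane set). h v) = h (1, 0) + h (0, 1)"
  by (simp add: Basis_plane)

lemma H1_weak_deriv:
  assumes "f \<in> H1 U" "v \<in> Basis"
  shows "weak_deriv U v f \<in> L2 (lebesgue_on U)" "is_weak_deriv U v f (weak_deriv U v f)"
proof -
  have "\<exists>g. g \<in> L2 (lebesgue_on U) \<and> is_weak_deriv U v f g" using assms by (auto simp: H1_def)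
  from someI_ex[OF this] show "weak_deriv U v f \<in> L2 (lebesgue_on U)" "is_weak_deriv U v f (weak_deriv U v f)"
    unfolding weak_deriv_def by blast+
qed

lemma H1_L2: "f \<in> H1 U \<Longrightarrow> f \<in> L2 (lebesgue_on U)"
  by (simp add: H1_def)

lemma open_sets_borel: "open U \<Longrightarrow> U \<in> sets borel" by simp

lemma is_weak_deriv_comb:
  assumes U: "open U" and v: "v \<in> Basis"
    and "f \<in> L2 (lebesgue_on U)" "f' \<in> L2 (lebesgue_on U)" "is_weak_deriv U v f f'"
    and "g \<in> L2 (lebesgue_on U)" "g' \<in> L2 (lebesgue_on U)" "is_weak_deriv U v g g'"
  shows "is_weak_deriv U v (fcomb c f d g) (fcomb c f' d g')"
  unfolding is_weak_deriv_def
proof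
  fix \<phi> assume \<phi>: "\<phi> \<in> test_functions U"
  have t: "\<phi> \<in> L2 (lebesgue_on U)" "pd v \<phi> \<in> L2 (lebesgue_on U)"
    using test_L2[OF \<phi> open_sets_borel[OF U]] test_L2[OF test_pd[OF \<phi> v] open_sets_borel[OF U]] by auto
  have lin: "(LINT p|lebesgue_on U. (c * x p + d * y p) * w p)
      = c * (LINT p|lebesgue_on U. x p * w p) + d * (LINT p|lebesgue_on U. y p * w p)"
    if "x \<in> L2 (lebesgue_on U)" "y \<in> L2 (lebesgue_on U)" "w \<in> L2 (lebesgue_on U)" for x y w
  proof -
    have "(LINT p|lebesgue_on U. (c * x p + d * y p) * w p) = (LINT p|lebesgue_on U. c * (x p * w p) + d * (y p * w p))"
      by (simp add: algebra_simps)
    also have "\<dots> = c * (LINT p|lebesgue_on U. x p * w p) + d * (LINT p|lebesgue_on U. y p * w p)"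
      by (subst Bochner_Integration.integral_add) (simp_all add: L2_prod_integrable that)
    finally show ?thesis .
  qed
  show "(LINT p|lebesgue_on U. (c * f p + d * g p) * pd v \<phi> p) = - (LINT p|lebesgue_on U. (c * f' p + d * g' p) * \<phi> p)"
    using assms \<phi> by (simp add: lin t is_weak_deriv_def)
qed

lemma is_weak_deriv_unique:
  fixes U :: "plane set"
  assumes U: "open U"
    and "g \<in> L2 (lebesgue_on U)" "g' \<in> L2 (lebesgue_on U)"
    and "is_weak_deriv U v f g" "is_weak_deriv U v f g'"
  shows "AE p in lebesgue_on U. g p = g' p"
proof -
  have "AE p in lebesgue_on U. 1 * g p + (- 1) * g' p = 0"
  proof (rule fundamental_lemma[OF U L2_fcomb])
    fix \<phi> assume \<phi>: "\<phi> \<in> test_functions U"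
    have t: "\<phi> \<in> L2 (lebesgue_on U)" using test_L2[OF \<phi> open_sets_borel[OF U]] .
    have "(LINT p|lebesgue_on U. (1 * g p + (- 1) * g' p) * \<phi> p)
       = (LINT p|lebesgue_on U. g p * \<phi> p - g' p * \<phi> p)" by (simp add: algebra_simps)
    also have "\<dots> = (LINT p|lebesgue_on U. g p * \<phi> p) - (LINT p|lebesgue_on U. g' p * \<phi> p)"
      by (intro Bochner_Integration.integral_diff L2_prod_integrable assms t)
    also have "\<dots> = 0" proof -
      have "- (LINT p|lebesgue_on U. g p * \<phi> p) = - (LINT p|lebesgue_on U. g' p * \<phi> p)"
        using bspec[OF assms(4)[unfolded is_weak_deriv_def] \<phi>] bspec[OF assms(5)[unfolded is_weak_deriv_def] \<phi>]
        by (simp only:)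
      then show ?thesis by simp
    qed
    finally show "(LINT p|lebesgue_on U. (1 * g p + (- 1) * g' p) * \<phi> p) = 0" .
  qed (use assms in auto)
  then show ?thesis by eventually_elim simp
qed

text \<open>\<open>weak_deriv\<close> is an arbitrary choice, so rules for it hold almost everywhere
  only; each is reduced to exhibiting one weak derivative.\<close>

lemma weak_deriv_AE:
  fixes U :: "plane set"
  assumes U: "open U" and "f \<in> H1 U" "v \<in> Basis" "g \<in> L2 (lebesgue_on U)" "is_weak_deriv U v f g"
  shows "AE p in lebesgue_on U. weak_deriv U v f p = g p"
  using assms H1_weak_deriv by (intro is_weak_deriv_unique[OF U, where f=f and v=v]) auto

lemma H1_comb:
  assumes U: "open U" and "f \<in> H1 U" "g \<in> H1 U"
  shows "fcomb c f d g \<in> H1 U"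
  unfolding H1_def
proof (safe)
  show "fcomb c f d g \<in> L2 (lebesgue_on U)" using assms by (intro L2_fcomb H1_L2)
  fix v :: 'a assume v: "v \<in> Basis"
  show "\<exists>h\<in>L2 (lebesgue_on U). is_weak_deriv U v (fcomb c f d g) h"
  proof (rule bexI)
    show "is_weak_deriv U v (fcomb c f d g) (fcomb c (weak_deriv U v f) d (weak_deriv U v g))"
      by (rule is_weak_deriv_comb[OF U v H1_L2[OF assms(2)] H1_weak_deriv(1,2)[OF assms(2) v]
            H1_L2[OF assms(3)] H1_weak_deriv(1,2)[OF assms(3) v]])
    show "fcomb c (weak_deriv U v f) d (weak_deriv U v g) \<in> L2 (lebesgue_on U)"
      by (rule L2_fcomb[OF H1_weak_deriv(1)[OF assms(2) v] H1_weak_deriv(1)[OF assms(3) v]])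
  qed
qed

lemma weak_deriv_comb:
  fixes U :: "plane set"
  assumes U: "open U" and "f \<in> H1 U" "g \<in> H1 U" "v \<in> Basis"
  shows "AE p in lebesgue_on U. weak_deriv U v (fcomb c f d g) p = c * weak_deriv U v f p + d * weak_deriv U v g p"
  by (rule weak_deriv_AE[OF U H1_comb[OF U assms(2,3)] assms(4)
        L2_fcomb[OF H1_weak_deriv(1)[OF assms(2,4)] H1_weak_deriv(1)[OF assms(3,4)]]
        is_weak_deriv_comb[OF U assms(4) H1_L2[OF assms(2)] H1_weak_deriv(1,2)[OF assms(2,4)]
            H1_L2[OF assms(3)] H1_weak_deriv(1,2)[OF assms(3,4)]]])

lemma dirichlet_form_inner:
  fixes U :: "plane set"
  assumes "f \<in> H1 U" "g \<in> H1 U"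
  shows "dirichlet_form U f g = (\<Sum>v\<in>Basis. l2_inner (lebesgue_on U) (weak_deriv U v f) (weak_deriv U v g))"
  unfolding dirichlet_form_def l2_inner_def
  using assms by (intro Bochner_Integration.integral_sum L2_prod_integrable H1_weak_deriv)

lemma weak_inner_comb:
  fixes U :: "plane set"
  assumes U: "open U" and "x \<in> L2 (lebesgue_on U)" "f \<in> H1 U" "g \<in> H1 U" "v \<in> Basis"
  shows "l2_inner (lebesgue_on U) x (weak_deriv U v (fcomb c f d g))
     = c * l2_inner (lebesgue_on U) x (weak_deriv U v f) + d * l2_inner (lebesgue_on U) x (weak_deriv U v g)"
proof -
  have "l2_inner (lebesgue_on U) x (weak_deriv U v (fcomb c f d g))
     = l2_inner (lebesgue_on U) x (fcomb c (weak_deriv U v f) d (weak_deriv U v g))"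
    by (rule l2_inner_cong[OF H1_weak_deriv(1)[OF H1_comb[OF U assms(3,4)] assms(5)]
          L2_fcomb[OF H1_weak_deriv(1)[OF assms(3,5)] H1_weak_deriv(1)[OF assms(4,5)]]
          assms(2) assms(2) weak_deriv_comb[OF U assms(3-5)]]) simp
  also have "\<dots> = c * l2_inner (lebesgue_on U) x (weak_deriv U v f) + d * l2_inner (lebesgue_on U) x (weak_deriv U v g)"
    by (rule L2.lin[OF assms(2) H1_weak_deriv(1)[OF assms(3,5)] H1_weak_deriv(1)[OF assms(4,5)]])
  finally show ?thesis .
qed

lemma hform_dirichlet:
  fixes U :: "plane set"
  assumes U: "open U"
  shows "hform fcomb (H1 U) (dirichlet_form U)"
proof
  fix x y f g :: "plane \<Rightarrow> complex" and c d :: complex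
  show "fcomb c f d g \<in> H1 U" if "f \<in> H1 U" "g \<in> H1 U" using that by (rule H1_comb[OF U])
  show "dirichlet_form U x (fcomb c f d g) = c * dirichlet_form U x f + d * dirichlet_form U x g"
    if "x \<in> H1 U" "f \<in> H1 U" "g \<in> H1 U"
    using that by (simp add: dirichlet_form_inner H1_comb[OF U] weak_inner_comb[OF U] H1_weak_deriv
        sum.distrib sum_distrib_left)
  show "dirichlet_form U y x = cnj (dirichlet_form U x y)" if "x \<in> H1 U" "y \<in> H1 U"
    unfolding dirichlet_form_inner[OF that] dirichlet_form_inner[OF that(2,1)]
    using that by (simp only: cnj_sum) (intro sum.cong refl L2.sym H1_weak_deriv)
  show "0 \<le> Re (dirichlet_form U x x)" if "x \<in> H1 U"
    unfolding dirichlet_form_inner[OF that that]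
    using that by (simp only: Re_sum) (intro sum_nonneg L2.pos H1_weak_deriv)
qed

lemma H1_norm_sq:
  fixes U :: "plane set"
  assumes "f \<in> H1 U"
  shows "(H1_norm U f)\<^sup>2 = Re (l2_inner (lebesgue_on U) f f) + Re (dirichlet_form U f f)"
proof -
  have "(H1_norm U f)\<^sup>2 = (l2_norm (lebesgue_on U) f)\<^sup>2 + (\<Sum>v\<in>Basis. (l2_norm (lebesgue_on U) (weak_deriv U v f))\<^sup>2)"
    unfolding H1_norm_def by (rule real_sqrt_pow2) (auto intro!: add_nonneg_nonneg sum_nonneg)
  then show ?thesis unfolding dirichlet_form_inner[OF assms assms] by (simp add: l2_norm_sq l2_inner_self)
qed

text \<open>Functions and weak derivatives converge separately in L2, and the identity against a
  test function passes to the limit, so the limit of the derivatives is a weak derivative of the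
  limit.\<close>

lemma H1_complete:
  fixes U :: "plane set"
  assumes U: "open U" and f: "\<And>n. f n \<in> H1 U"
    and cau: "\<And>e. e > 0 \<Longrightarrow> \<exists>N::nat. \<forall>m\<ge>N. \<forall>n\<ge>N.
       Re (l2_inner (lebesgue_on U) (fcomb 1 (f m) (- 1) (f n)) (fcomb 1 (f m) (- 1) (f n)))
     + Re (dirichlet_form U (fcomb 1 (f m) (- 1) (f n)) (fcomb 1 (f m) (- 1) (f n))) < e"
  shows "\<exists>l\<in>H1 U. (\<lambda>n. Re (l2_inner (lebesgue_on U) (fcomb 1 (f n) (- 1) l) (fcomb 1 (f n) (- 1) l))) \<longlonglongrightarrow> 0
      \<and> (\<lambda>n. Re (dirichlet_form U (fcomb 1 (f n) (- 1) l) (fcomb 1 (f n) (- 1) l))) \<longlonglongrightarrow> 0"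
proof -
  let ?M = "lebesgue_on U"
  let ?W = "weak_deriv U"
  interpret A: hform fcomb "H1 U" "dirichlet_form U" by (rule hform_dirichlet[OF U])
  have dH: "fcomb 1 x (- 1) y \<in> H1 U" if "x \<in> H1 U" "y \<in> H1 U" for x y using that by (rule H1_comb[OF U])
  have wq: "Re (l2_inner ?M (\<lambda>p. ?W v x p - ?W v y p) (\<lambda>p. ?W v x p - ?W v y p))
      = Re (l2_inner ?M (?W v (fcomb 1 x (- 1) y)) (?W v (fcomb 1 x (- 1) y)))"
    if "x \<in> H1 U" "y \<in> H1 U" "v \<in> Basis" for x y v
  proof -
    have "l2_inner ?M (fcomb 1 (?W v x) (- 1) (?W v y)) (fcomb 1 (?W v x) (- 1) (?W v y))
      = l2_inner ?M (?W v (fcomb 1 x (- 1) y)) (?W v (fcomb 1 x (- 1) y))"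
    proof -
      note L = H1_weak_deriv(1)[OF dH[OF that(1,2)] that(3)]
        L2_fcomb[OF H1_weak_deriv(1)[OF that(1,3)] H1_weak_deriv(1)[OF that(2,3)], of 1 "-1"]
      note ae = weak_deriv_comb[OF U that, of 1 "-1"]
      show ?thesis by (rule l2_inner_cong[OF L L ae ae, symmetric])
    qed
    then show ?thesis by simp
  qed
  have wle: "Re (l2_inner ?M (?W v x) (?W v x)) \<le> Re (dirichlet_form U x x)" if "x \<in> H1 U" "v \<in> Basis" for x v
    unfolding dirichlet_form_inner[OF that(1,1)] Re_sum
    using that by (intro member_le_sum L2.pos H1_weak_deriv) auto
  have "\<exists>l\<in>L2 ?M. (\<lambda>n. Re (l2_inner ?M (\<lambda>p. f n p - l p) (\<lambda>p. f n p - l p))) \<longlonglongrightarrow> 0"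
  proof (rule L2_complete)
    fix e :: real assume "e > 0"
    then obtain N where N: "\<And>m n. m \<ge> N \<Longrightarrow> n \<ge> N \<Longrightarrow>
       Re (l2_inner ?M (fcomb 1 (f m) (- 1) (f n)) (fcomb 1 (f m) (- 1) (f n)))
     + Re (dirichlet_form U (fcomb 1 (f m) (- 1) (f n)) (fcomb 1 (f m) (- 1) (f n))) < e" using cau by meson
    have "Re (l2_inner ?M (\<lambda>p. f m p - f n p) (\<lambda>p. f m p - f n p)) < e" if "m \<ge> N" "n \<ge> N" for m n
      using N[OF that] A.pos[OF dH[OF f f], of m n] by simp
    then show "\<exists>N. \<forall>m\<ge>N. \<forall>n\<ge>N. Re (l2_inner ?M (\<lambda>p. f m p - f n p) (\<lambda>p. f m p - f n p)) < e" by blast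
  qed (rule H1_L2[OF f])
  then obtain l where l: "l \<in> L2 ?M" "(\<lambda>n. Re (l2_inner ?M (\<lambda>p. f n p - l p) (\<lambda>p. f n p - l p))) \<longlonglongrightarrow> 0" by blast
  have "\<exists>g\<in>L2 ?M. (\<lambda>n. Re (l2_inner ?M (\<lambda>p. ?W v (f n) p - g p) (\<lambda>p. ?W v (f n) p - g p))) \<longlonglongrightarrow> 0"
    if v: "v \<in> Basis" for v
  proof (rule L2_complete)
    fix e :: real assume "e > 0"
    then obtain N where N: "\<And>m n. m \<ge> N \<Longrightarrow> n \<ge> N \<Longrightarrow>
       Re (l2_inner ?M (fcomb 1 (f m) (- 1) (f n)) (fcomb 1 (f m) (- 1) (f n)))
     + Re (dirichlet_form U (fcomb 1 (f m) (- 1) (f n)) (fcomb 1 (f m) (- 1) (f n))) < e" using cau by meson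
    have "Re (l2_inner ?M (\<lambda>p. ?W v (f m) p - ?W v (f n) p) (\<lambda>p. ?W v (f m) p - ?W v (f n) p)) < e"
      if "m \<ge> N" "n \<ge> N" for m n
      unfolding wq[OF f f v]
      using N[OF that] wle[OF dH[OF f f] v, of m n] L2.pos[OF H1_L2[OF dH[OF f f]], of m n] by linarith
    then show "\<exists>N. \<forall>m\<ge>N. \<forall>n\<ge>N. Re (l2_inner ?M (\<lambda>p. ?W v (f m) p - ?W v (f n) p) (\<lambda>p. ?W v (f m) p - ?W v (f n) p)) < e" by blast
  qed (rule H1_weak_deriv(1)[OF f v])
  then have "\<forall>v\<in>Basis. \<exists>g. g \<in> L2 ?M \<and> (\<lambda>n. Re (l2_inner ?M (\<lambda>p. ?W v (f n) p - g p) (\<lambda>p. ?W v (f n) p - g p))) \<longlonglongrightarrow> 0"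
    by (simp only: Bex_def) blast
  from bchoice[OF this] obtain g where gg: "\<forall>v\<in>Basis. g v \<in> L2 ?M \<and> (\<lambda>n. Re (l2_inner ?M (\<lambda>p. ?W v (f n) p - g v p) (\<lambda>p. ?W v (f n) p - g v p))) \<longlonglongrightarrow> 0"
    by (elim exE)
  then have g: "\<And>v. v \<in> Basis \<Longrightarrow> g v \<in> L2 ?M"
    and gl: "\<And>v. v \<in> Basis \<Longrightarrow> (\<lambda>n. Re (l2_inner ?M (\<lambda>p. ?W v (f n) p - g v p) (\<lambda>p. ?W v (f n) p - g v p))) \<longlonglongrightarrow> 0"
    by (simp_all only: Ball_def)
  have wd: "is_weak_deriv U v l (g v)" if v: "v \<in> Basis" for v
    unfolding is_weak_deriv_def
  proof
    fix \<phi> assume \<phi>: "\<phi> \<in> test_functions U"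
    have t: "(\<lambda>p. cnj (\<phi> p)) \<in> L2 ?M" "(\<lambda>p. cnj (pd v \<phi> p)) \<in> L2 ?M"
      using test_L2[OF test_cnj[OF \<phi>] open_sets_borel[OF U]]
        test_L2[OF test_cnj[OF test_pd[OF \<phi> v]] open_sets_borel[OF U]] by auto
    have ie: "l2_inner ?M (\<lambda>p. cnj (y p)) x = (LINT p|?M. x p * y p)" for x y
      by (simp add: l2_inner_def mult.commute)
    have a: "(\<lambda>n. l2_inner ?M (\<lambda>p. cnj (pd v \<phi> p)) (f n)) \<longlonglongrightarrow> l2_inner ?M (\<lambda>p. cnj (pd v \<phi> p)) l"
      by (rule L2.tendsto_right[OF H1_L2[OF f] l(1) t(2)]) (use l(2) in simp)
    have b: "(\<lambda>n. l2_inner ?M (\<lambda>p. cnj (\<phi> p)) (?W v (f n))) \<longlonglongrightarrow> l2_inner ?M (\<lambda>p. cnj (\<phi> p)) (g v)"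
      by (rule L2.tendsto_right[OF H1_weak_deriv(1)[OF f v] g[OF v] t(1)]) (use gl[OF v] in simp)
    have "l2_inner ?M (\<lambda>p. cnj (pd v \<phi> p)) (f n) = - l2_inner ?M (\<lambda>p. cnj (\<phi> p)) (?W v (f n))" for n
      unfolding ie using H1_weak_deriv(2)[OF f v, of n] \<phi> by (auto simp: is_weak_deriv_def)
    then have "(\<lambda>n. l2_inner ?M (\<lambda>p. cnj (pd v \<phi> p)) (f n)) \<longlonglongrightarrow> - l2_inner ?M (\<lambda>p. cnj (\<phi> p)) (g v)"
      using tendsto_minus[OF b] by simp
    from LIMSEQ_unique[OF a this]
    show "(LINT p|?M. l p * pd v \<phi> p) = - (LINT p|?M. g v p * \<phi> p)" unfolding ie .
  qed
  have lH: "l \<in> H1 U" unfolding H1_def using l(1) g wd by blast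
  have "(\<lambda>n. Re (dirichlet_form U (fcomb 1 (f n) (- 1) l) (fcomb 1 (f n) (- 1) l))) \<longlonglongrightarrow> 0"
  proof -
    have "Re (dirichlet_form U (fcomb 1 (f n) (- 1) l) (fcomb 1 (f n) (- 1) l))
       = (\<Sum>v\<in>Basis. Re (l2_inner ?M (\<lambda>p. ?W v (f n) p - g v p) (\<lambda>p. ?W v (f n) p - g v p)))" for n
    proof -
      have "l2_inner ?M (?W v (fcomb 1 (f n) (- 1) l)) (?W v (fcomb 1 (f n) (- 1) l))
         = l2_inner ?M (fcomb 1 (?W v (f n)) (- 1) (g v)) (fcomb 1 (?W v (f n)) (- 1) (g v))" if v: "v \<in> Basis" for v
      proof -
        have ae: "AE p in ?M. ?W v (fcomb 1 (f n) (- 1) l) p = 1 * ?W v (f n) p + - 1 * g v p"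
          using weak_deriv_comb[OF U f lH v, of 1 n "-1"] weak_deriv_AE[OF U lH v g[OF v] wd[OF v]]
          by eventually_elim simp
        show ?thesis
          by (rule l2_inner_cong[OF H1_weak_deriv(1)[OF dH[OF f lH] v] L2_fcomb[OF H1_weak_deriv(1)[OF f v] g[OF v]]
              H1_weak_deriv(1)[OF dH[OF f lH] v] L2_fcomb[OF H1_weak_deriv(1)[OF f v] g[OF v]] ae ae])
      qed
      then show ?thesis unfolding dirichlet_form_inner[OF dH[OF f lH] dH[OF f lH]] Re_sum
        by (intro sum.cong) simp_all
    qed
    moreover have "(\<lambda>n. \<Sum>v\<in>Basis. Re (l2_inner ?M (\<lambda>p. ?W v (f n) p - g v p) (\<lambda>p. ?W v (f n) p - g v p))) \<longlonglongrightarrow> (\<Sum>v\<in>(Basis::plane set). 0)"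
      by (intro tendsto_sum gl)
    ultimately show ?thesis by simp
  qed
  then show ?thesis using lH l(2) by (intro bexI[of _ l]) auto
qed

section \<open>Iterated integrals\<close>

lemma plane_Fubini:
  fixes F :: "plane \<Rightarrow> 'b::{banach, second_countable_topology}"
  assumes "integrable lborel F"
  shows "(LINT p|lborel. F p) = (LINT x|lborel. LINT y|lborel. F (x, y))"
    and "(LINT p|lborel. F p) = (LINT y|lborel. LINT x|lborel. F (x, y))"
    and "integrable lborel (\<lambda>x. LINT y|lborel. F (x, y))"
proof -
  have i: "integrable (lborel \<Otimes>\<^sub>M lborel) F" using assms by (simp add: lborel_prod)
  then have i': "integrable (lborel \<Otimes>\<^sub>M lborel) (case_prod (\<lambda>x y. F (x, y)))" by simp
  show "(LINT p|lborel. F p) = (LINT x|lborel. LINT y|lborel. F (x, y))"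
    using lborel_pair.integral_fst'[OF i] by (simp add: lborel_prod)
  show "(LINT p|lborel. F p) = (LINT y|lborel. LINT x|lborel. F (x, y))"
    using lborel_pair.integral_snd[OF i'] by (simp add: lborel_prod)
  show "integrable lborel (\<lambda>x. LINT y|lborel. F (x, y))"
    by (rule lborel_pair.integrable_fst'[OF i])
qed

text \<open>\<open>I\<close> may contain both ends, one or none: the regions of the partitions below
  are half-open in different ways.\<close>

lemma interval_integral:
  fixes g :: "real \<Rightarrow> 'b::euclidean_space"
  assumes "continuous_on UNIV g" "{a<..<b} \<subseteq> I" "I \<subseteq> {a..b}"
  shows "(LINT t|lborel. indicator I t *\<^sub>R g t) = integral {a..b} g"
proof -
  have "I = {a<..<b} \<union> (I \<inter> {a, b})" using assms(2,3) by force
  moreover have "finite (I \<inter> {a, b})" by simp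
  ultimately have Ib: "I \<in> sets borel" by (metis borel_open finite_imp_closed borel_closed open_greaterThanLessThan sets.Un)
  have "(LINT t|lborel. indicator I t *\<^sub>R g t) = (LINT t|lborel. indicator {a..b} t *\<^sub>R g t)"
  proof (rule integral_cong_AE)
    have "AE t in lborel. t \<noteq> a \<and> t \<noteq> b" using AE_lborel_singleton by (auto intro: eventually_conj)
    then show "AE t in lborel. indicator I t *\<^sub>R g t = indicator {a..b} t *\<^sub>R g t"
    proof eventually_elim
      case (elim t)
      then show ?case using assms(2,3) by (cases "t \<in> I") (force simp: indicator_def)+
    qed
  qed (use Ib borel_measurable_continuous_onI[OF assms(1)] in \<open>auto intro!: borel_measurable_scaleR borel_measurable_indicator\<close>)
  also have "\<dots> = integral {a..b} g"
    using set_borel_integral_eq_integral(2)[OF borel_integrable_atLeastAtMost'[OF continuous_on_subset[OF assms(1)]], of a b]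
    by (simp add: set_lebesgue_integral_def)
  finally show ?thesis .
qed

lemma integral_derivative_zero:
  fixes f :: "real \<Rightarrow> complex"
  assumes d: "\<And>t. (f has_vector_derivative f' t) (at t)" and c: "continuous_on UNIV f'"
    and z: "\<And>t. R \<le> \<bar>t\<bar> \<Longrightarrow> f t = 0" and R: "0 < R"
  shows "(LINT t|lborel. f' t) = 0"
proof -
  have f0: "f' t = 0" if "t \<notin> {-R..R}" for t
  proof -
    have "((\<lambda>_. 0) has_vector_derivative f' t) (at t)"
      by (rule has_vector_derivative_transform_within_open[OF d, where S="- {-R..R}"])
        (use that z in \<open>auto simp: abs_if not_le\<close>)
    then show ?thesis using vector_derivative_unique_at[of "\<lambda>_. 0" "f' t" t 0] by auto
  qed
  have "(LINT t|lborel. f' t) = (LINT t|lborel. indicator {-R..R} t *\<^sub>R f' t)"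
    using f0 by (intro Bochner_Integration.integral_cong) (auto simp: indicator_def)
  also have "\<dots> = integral {-R..R} f'" by (rule interval_integral[OF c]) auto
  also have "\<dots> = f R - f (- R)"
    using R d by (intro integral_unique fundamental_theorem_of_calculus) (auto intro: has_vector_derivative_at_within)
  also have "\<dots> = 0" using z[of R] z[of "-R"] R by simp
  finally show ?thesis .
qed

lemma smooth_partial:
  assumes "smooth (F :: plane \<Rightarrow> complex)"
  shows "((\<lambda>x. F (x, y)) has_vector_derivative pd (1, 0) F (x, y)) (at x)"
    and "((\<lambda>y. F (x, y)) has_vector_derivative pd (0, 1) F (x, y)) (at y)"
proof -
  have "((\<lambda>x. (x, y)) has_derivative (\<lambda>v. (v, 0))) (at x)" "((\<lambda>y. (x, y)) has_derivative (\<lambda>v. (0, v))) (at y)"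
    by (auto intro!: derivative_eq_intros)
  from has_derivative_compose[OF this(1) smooth_has_derivative[OF assms]]
    has_derivative_compose[OF this(2) smooth_has_derivative[OF assms]]
  have 1: "((\<lambda>x. F (x, y)) has_derivative (\<lambda>v. frechet_derivative F (at (x, y)) (v, 0))) (at x)"
    and 2: "((\<lambda>y. F (x, y)) has_derivative (\<lambda>v. frechet_derivative F (at (x, y)) (0, v))) (at y)" .
  interpret L: bounded_linear "frechet_derivative F (at (x, y))"
    using smooth_has_derivative[OF assms] has_derivative_bounded_linear by blast
  have e1: "(\<lambda>v. frechet_derivative F (at (x, y)) (v, 0)) = (\<lambda>v. v *\<^sub>R pd (1, 0) F (x, y))"
  proof
    fix v show "frechet_derivative F (at (x, y)) (v, 0) = v *\<^sub>R pd (1, 0) F (x, y)"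
      using L.scaleR[of v "(1, 0)"] by (simp only: scaleR_Pair real_scaleR_def mult_1_right mult_zero_right)
  qed
  have e2: "(\<lambda>v. frechet_derivative F (at (x, y)) (0, v)) = (\<lambda>v. v *\<^sub>R pd (0, 1) F (x, y))"
  proof
    fix v show "frechet_derivative F (at (x, y)) (0, v) = v *\<^sub>R pd (0, 1) F (x, y)"
      using L.scaleR[of v "(0, 1)"] by (simp only: scaleR_Pair real_scaleR_def mult_1_right mult_zero_right)
  qed
  show "((\<lambda>x. F (x, y)) has_vector_derivative pd (1, 0) F (x, y)) (at x)"
    using 1 unfolding e1 has_vector_derivative_def .
  show "((\<lambda>y. F (x, y)) has_vector_derivative pd (0, 1) F (x, y)) (at y)"
    using 2 unfolding e2 has_vector_derivative_def .
qed

lemma integral_pd_zero: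
  fixes K :: "plane \<Rightarrow> complex"
  assumes K: "K \<in> test_functions UNIV" and v: "v \<in> Basis"
  shows "(LINT p|lborel. pd v K p) = 0"
proof -
  have i: "integrable lborel (pd v K)" by (rule test_integrable[OF test_pd[OF K v]])
  have s: "smooth K" "smooth (pd v K)" using K v by (auto intro: smooth_pd test_smooth)
  obtain R where R: "R > 0" "\<And>p. R \<le> norm p \<Longrightarrow> K p = 0" using test_support[OF K] by blast
  have c: "continuous_on UNIV (\<lambda>x. pd v K (x, y))" "continuous_on UNIV (\<lambda>y. pd v K (x, y))" for x y
    by (auto intro!: continuous_intros continuous_on_compose2[OF smooth_continuous_on[OF s(2), of UNIV]])
  have nn: "\<bar>x\<bar> \<le> norm (x, y)" "\<bar>y\<bar> \<le> norm (x, y)" for x y :: real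
    using norm_fst_le[of x y] norm_snd_le[of y x] by (auto simp: norm_Pair)
  consider "v = (1, 0)" | "v = (0, 1)" using v by (auto simp: Basis_plane)
  then show ?thesis
  proof cases
    case 1
    have "(LINT x|lborel. pd v K (x, y)) = 0" for y
      by (rule integral_derivative_zero[where R=R, OF smooth_partial(1)[OF s(1), folded 1] c(1) _ R(1)])
        (use R(2) nn(1) order_trans in blast)
    then show ?thesis by (subst plane_Fubini(2)[OF i]) simp
  next
    case 2
    have "(LINT y|lborel. pd v K (x, y)) = 0" for x
      by (rule integral_derivative_zero[where R=R, OF smooth_partial(2)[OF s(1), folded 2] c(2) _ R(1)])
        (use R(2) nn(2) order_trans in blast)
    then show ?thesis by (subst plane_Fubini(1)[OF i]) simp
  qed
qed

text \<open>\<open>f\<close> may be nonzero on the boundary of \<open>U\<close>, but its product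
  with \<open>\<phi>\<close> has compact support in \<open>U\<close>, so the integral of a partial
  derivative of the product is 0.\<close>

lemma is_weak_deriv_smooth:
  fixes U :: "plane set"
  assumes U: "open U" and f: "f \<in> test_functions UNIV" and v: "v \<in> Basis"
  shows "is_weak_deriv U v f (pd v f)"
  unfolding is_weak_deriv_def
proof
  fix \<phi> assume \<phi>: "\<phi> \<in> test_functions U"
  let ?M = "lebesgue_on U"
  have Ub: "U \<in> sets borel" using U by simp
  have sm: "smooth f" "smooth \<phi>" using f \<phi> test_smooth by auto
  have K: "(\<lambda>p. f p * \<phi> p) \<in> test_functions U" by (rule test_mult[OF sm(1) \<phi>])
  have i: "integrable ?M (\<lambda>p. f p * pd v \<phi> p)" "integrable ?M (\<lambda>p. pd v f p * \<phi> p)"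
    using f \<phi> v by (auto intro!: L2_prod_integrable test_L2[OF _ Ub] test_pd)
  have "(LINT p|?M. f p * pd v \<phi> p) + (LINT p|?M. pd v f p * \<phi> p) = (LINT p|?M. pd v (\<lambda>p. f p * \<phi> p) p)"
    unfolding pd_mult[OF sm] by (rule Bochner_Integration.integral_add[OF i, symmetric])
  also have "\<dots> = (LINT p|lborel. indicator U p *\<^sub>R pd v (\<lambda>p. f p * \<phi> p) p)"
    by (rule integral_lebesgue_on_borel(1)[OF Ub test_measurable[OF test_pd[OF K v]]])
  also have "\<dots> = (LINT p|lborel. pd v (\<lambda>p. f p * \<phi> p) p)"
    using test_zero[OF test_pd[OF K v]] by (intro Bochner_Integration.integral_cong) (auto simp: indicator_def)
  also have "\<dots> = 0" by (rule integral_pd_zero[OF test_UNIV[OF K] v])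
  finally show "(LINT p|?M. f p * pd v \<phi> p) = - (LINT p|?M. pd v f p * \<phi> p)" by (simp add: eq_neg_iff_add_eq_0)
qed

lemma test_H1:
  fixes U :: "plane set"
  assumes U: "open U" and f: "f \<in> test_functions UNIV"
  shows "f \<in> H1 U"
  using f is_weak_deriv_smooth[OF U f] test_pd[OF f] test_L2[OF _ open_sets_borel[OF U]]
  unfolding H1_def by blast

lemma weak_deriv_test:
  fixes U :: "plane set"
  assumes U: "open U" and f: "f \<in> test_functions UNIV" and v: "v \<in> Basis"
  shows "AE p in lebesgue_on U. weak_deriv U v f p = pd v f p"
  by (rule weak_deriv_AE[OF U test_H1[OF U f] v test_L2[OF test_pd[OF f v] open_sets_borel[OF U]] is_weak_deriv_smooth[OF U f v]])

lemma dirichlet_form_test: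
  fixes U :: "plane set"
  assumes U: "open U" and f: "f \<in> test_functions UNIV" and g: "g \<in> test_functions UNIV"
  shows "dirichlet_form U f g = (LINT p|lebesgue_on U. cnj (pd (1,0) f p) * pd (1,0) g p + cnj (pd (0,1) f p) * pd (0,1) g p)"
proof -
  have b: "(1, 0) \<in> (Basis :: plane set)" "(0, 1) \<in> (Basis :: plane set)" by (auto simp: Basis_plane)
  have tL: "pd v h \<in> L2 (lebesgue_on U)" if "h \<in> test_functions UNIV" "v \<in> Basis" for h v
    by (rule test_L2[OF test_pd[OF that] open_sets_borel[OF U]])
  have "dirichlet_form U f g = (\<Sum>v\<in>Basis. l2_inner (lebesgue_on U) (pd v f) (pd v g))"
    unfolding dirichlet_form_inner[OF test_H1[OF U f] test_H1[OF U g]]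
  proof (rule sum.cong[OF refl])
    fix v :: plane assume v: "v \<in> Basis"
    show "l2_inner (lebesgue_on U) (weak_deriv U v f) (weak_deriv U v g) = l2_inner (lebesgue_on U) (pd v f) (pd v g)"
      by (rule l2_inner_cong[OF H1_weak_deriv(1)[OF test_H1[OF U g] v] tL[OF g v]
            H1_weak_deriv(1)[OF test_H1[OF U f] v] tL[OF f v] weak_deriv_test[OF U g v] weak_deriv_test[OF U f v]])
  qed
  also have "\<dots> = (LINT p|lebesgue_on U. cnj (pd (1,0) f p) * pd (1,0) g p + cnj (pd (0,1) f p) * pd (0,1) g p)"
    unfolding sum_Basis_plane l2_inner_def
    by (rule Bochner_Integration.integral_add[symmetric, OF L2_prod_integrable(2)[OF tL[OF f b(1)] tL[OF g b(1)]]
        L2_prod_integrable(2)[OF tL[OF f b(2)] tL[OF g b(2)]]])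
  finally show ?thesis .
qed

section \<open>Rotated coordinates\<close>

text \<open>The argument is (s, t), the value is the point with x + y = s and x - y = t; the area
  factor is 1/2.\<close>

definition rot :: "plane \<Rightarrow> plane" where "rot = (\<lambda>(s, t). ((s + t) / 2, (s - t) / 2))"

lemma rot_measurable [measurable]: "rot \<in> borel_measurable borel"
  unfolding rot_def by (intro borel_measurable_continuous_onI) (auto simp: case_prod_unfold intro!: continuous_intros)

text \<open>\<open>rot\<close> halves areas, so the image measure has density 2. The substitution is
  done one variable at a time: x = y + t at fixed y, then y = (s - t) / 2 at fixed t.\<close>

lemma distr_rot: "distr lborel borel rot = density lborel (\<lambda>_. ennreal 2)"
proof (rule measure_eqI)
  show "sets (distr lborel borel rot) = sets (density lborel (\<lambda>_. ennreal 2))" by simp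
  fix A assume "A \<in> sets (distr lborel borel rot)"
  then have A[measurable]: "A \<in> sets borel" by simp
  have A2[measurable]: "A \<in> sets (borel \<Otimes>\<^sub>M borel)" unfolding borel_prod by (rule A)
  have "emeasure lborel A = (\<integral>\<^sup>+p. indicator A p \<partial>(lborel \<Otimes>\<^sub>M lborel))" by (simp add: lborel_prod)
  also have "\<dots> = (\<integral>\<^sup>+y. \<integral>\<^sup>+x. indicator A (x, y) \<partial>lborel \<partial>lborel)"
    by (rule lborel_pair.nn_integral_snd[symmetric]) measurable
  also have "\<dots> = (\<integral>\<^sup>+y. \<integral>\<^sup>+t. indicator A (y + t, y) \<partial>lborel \<partial>lborel)"
  proof (rule nn_integral_cong)
    fix y :: real
    show "(\<integral>\<^sup>+x. indicator A (x, y) \<partial>lborel) = (\<integral>\<^sup>+t. indicator A (y + t, y) \<partial>lborel)"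
      by (subst nn_integral_real_affine[where c=1 and t=y]) auto
  qed
  also have "\<dots> = (\<integral>\<^sup>+t. \<integral>\<^sup>+y. indicator A (y + t, y) \<partial>lborel \<partial>lborel)"
    by (rule lborel_pair.Fubini'[where f="\<lambda>t y. indicator A (y + t, y)"]) measurable
  also have "\<dots> = (\<integral>\<^sup>+t. ennreal (1/2) * (\<integral>\<^sup>+s. indicator A ((s + t) / 2, (s - t) / 2) \<partial>lborel) \<partial>lborel)"
  proof (intro nn_integral_cong)
    fix t :: real
    have "(\<integral>\<^sup>+y. indicator A (y + t, y) \<partial>lborel) = ennreal \<bar>1/2\<bar> * (\<integral>\<^sup>+s. indicator A ((- t / 2 + 1/2 * s) + t, - t / 2 + 1/2 * s) \<partial>lborel)"
      by (subst nn_integral_real_affine[where c="1/2" and t="- t / 2"]) auto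
    also have "(\<lambda>s. indicator A ((- t / 2 + 1/2 * s) + t, - t / 2 + 1/2 * s) :: ennreal) = (\<lambda>s. indicator A ((s + t) / 2, (s - t) / 2))"
      by (auto simp: field_simps)
    finally show "(\<integral>\<^sup>+y. indicator A (y + t, y) \<partial>lborel) = ennreal (1/2) * (\<integral>\<^sup>+s. indicator A ((s + t) / 2, (s - t) / 2) \<partial>lborel)"
      by simp
  qed
  also have "\<dots> = ennreal (1/2) * (\<integral>\<^sup>+t. \<integral>\<^sup>+s. indicator A (rot (s, t)) \<partial>lborel \<partial>lborel)"
    by (subst nn_integral_cmult) (auto simp: rot_def)
  also have "(\<integral>\<^sup>+t. \<integral>\<^sup>+s. indicator A (rot (s, t)) \<partial>lborel \<partial>lborel) = (\<integral>\<^sup>+p. indicator A (rot p) \<partial>(lborel \<Otimes>\<^sub>M lborel))"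
    by (rule lborel_pair.nn_integral_snd) (simp add: lborel_prod)
  also have "\<dots> = emeasure (distr lborel borel rot) A"
  proof -
    have "emeasure (distr lborel borel rot) A = (\<integral>\<^sup>+p. indicator A p \<partial>(distr lborel borel rot))" by simp
    also have "\<dots> = (\<integral>\<^sup>+p. indicator A (rot p) \<partial>lborel)" by (rule nn_integral_distr) auto
    finally show ?thesis by (simp add: lborel_prod)
  qed
  finally have "emeasure lborel A = ennreal (1/2) * emeasure (distr lborel borel rot) A" .
  then have "ennreal 2 * emeasure lborel A = (ennreal 2 * ennreal (1/2)) * emeasure (distr lborel borel rot) A"
    by (simp add: mult.assoc)
  also have "ennreal 2 * ennreal (1/2) = 1" by (subst ennreal_mult[symmetric]) auto
  finally show "emeasure (distr lborel borel rot) A = emeasure (density lborel (\<lambda>_. ennreal 2)) A"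
    by (subst emeasure_density) (auto simp: nn_integral_cmult)
qed

lemma rot_integral:
  fixes F :: "plane \<Rightarrow> 'b::{banach, second_countable_topology}"
  assumes "F \<in> borel_measurable borel"
  shows "integrable lborel (\<lambda>p. F (rot p)) \<longleftrightarrow> integrable lborel F"
    and "(LINT p|lborel. F p) = (1/2) *\<^sub>R (LINT p|lborel. F (rot p))"
proof -
  have "integrable lborel (\<lambda>p. F (rot p)) \<longleftrightarrow> integrable (density lborel (\<lambda>_. ennreal 2)) F"
    unfolding distr_rot[symmetric] using assms by (subst integrable_distr_eq) auto
  also have "\<dots> \<longleftrightarrow> integrable lborel (\<lambda>x. (2::real) *\<^sub>R F x)"
    using assms by (subst integrable_density) auto
  also have "\<dots> \<longleftrightarrow> integrable lborel F"
  proof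
    assume "integrable lborel (\<lambda>x. (2::real) *\<^sub>R F x)"
    then have "integrable lborel (\<lambda>x. (1/2::real) *\<^sub>R ((2::real) *\<^sub>R F x))" by (rule integrable_scaleR_right)
    then show "integrable lborel F" by simp
  qed (rule integrable_scaleR_right)
  finally show "integrable lborel (\<lambda>p. F (rot p)) \<longleftrightarrow> integrable lborel F" .
  have "(LINT p|lborel. F (rot p)) = integral\<^sup>L (density lborel (\<lambda>_. ennreal 2)) F"
    unfolding distr_rot[symmetric] using assms by (subst integral_distr) auto
  also have "\<dots> = (LINT x|lborel. (2::real) *\<^sub>R F x)"
    using assms by (subst integral_density) auto
  also have "\<dots> = 2 *\<^sub>R (LINT p|lborel. F p)" by simp
  finally show "(LINT p|lborel. F p) = (1/2) *\<^sub>R (LINT p|lborel. F (rot p))" by simp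
qed

section \<open>Inequalities for test functions on the half-strip\<close>

definition grad2 :: "(plane \<Rightarrow> complex) \<Rightarrow> plane \<Rightarrow> real" where
  "grad2 F p = (cmod (pd (1, 0) F p))\<^sup>2 + (cmod (pd (0, 1) F p))\<^sup>2"

lemma frechet_plane:
  assumes "smooth (F :: plane \<Rightarrow> complex)"
  shows "frechet_derivative F (at p) (u, w) = u *\<^sub>R pd (1, 0) F p + w *\<^sub>R pd (0, 1) F p"
proof -
  interpret L: bounded_linear "frechet_derivative F (at p)"
    using smooth_has_derivative[OF assms] has_derivative_bounded_linear by blast
  have "(u, w) = u *\<^sub>R (1, 0) + w *\<^sub>R (0, 1 :: real)" by simp
  then have "frechet_derivative F (at p) (u, w) = frechet_derivative F (at p) (u *\<^sub>R (1, 0) + w *\<^sub>R (0, 1))" by (simp only:)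
  then show ?thesis by (simp only: L.add L.scaleR)
qed

lemma smooth_line:
  assumes "smooth (F :: plane \<Rightarrow> complex)"
  shows "((\<lambda>t. F (a + t * u, b + t * w)) has_vector_derivative
     u *\<^sub>R pd (1, 0) F (a + t * u, b + t * w) + w *\<^sub>R pd (0, 1) F (a + t * u, b + t * w)) (at t)"
proof -
  have "((\<lambda>t. (a + t * u, b + t * w)) has_derivative (\<lambda>v. (v * u, v * w))) (at t)"
    by (auto intro!: derivative_eq_intros)
  from has_derivative_compose[OF this smooth_has_derivative[OF assms]]
  have "((\<lambda>t. F (a + t * u, b + t * w)) has_derivative
      (\<lambda>v. frechet_derivative F (at (a + t * u, b + t * w)) (v * u, v * w))) (at t)" .
  moreover have "frechet_derivative F (at p) (v * u, v * w) = v *\<^sub>R (u *\<^sub>R pd (1, 0) F p + w *\<^sub>R pd (0, 1) F p)" for v p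
    by (subst frechet_plane[OF assms, of p "v * u" "v * w"]) (simp add: scaleR_add_right)
  ultimately show ?thesis unfolding has_vector_derivative_def by (simp only:)
qed

text \<open>The derivative of \<open>F (rot (s, t))\<close> with respect to \<open>t\<close>, as a
  function of the image point.\<close>

definition rot_t :: "(plane \<Rightarrow> complex) \<Rightarrow> plane \<Rightarrow> complex" where
  "rot_t F p = (1/2) *\<^sub>R pd (1, 0) F p + (- 1/2) *\<^sub>R pd (0, 1) F p"

lemma rot_line: "rot (s, t) = (s / 2 + t * (1/2), s / 2 + t * (- 1/2))"
  by (simp add: rot_def field_simps)

lemma rot_derivative:
  assumes "smooth F"
  shows "((\<lambda>t. F (rot (s, t))) has_vector_derivative rot_t F (rot (s, t))) (at t)"
  unfolding rot_line rot_t_def by (rule smooth_line[OF assms])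

text \<open>The squared gradient is twice the sum of the squared derivatives in \<open>s\<close> and
  \<open>t\<close>, and the one in \<open>s\<close> is dropped.\<close>

lemma rot_t_sq: "2 * (cmod (rot_t F p))\<^sup>2 \<le> grad2 F p"
proof -
  have "2 * (cmod ((1/2) *\<^sub>R a + (- 1/2) *\<^sub>R b))\<^sup>2 \<le> (cmod a)\<^sup>2 + (cmod b)\<^sup>2" for a b :: complex
  proof -
    have "0 \<le> (a + b) \<bullet> (a + b)" by simp
    then show ?thesis unfolding power2_norm_eq_inner by (simp add: inner_simps inner_commute algebra_simps)
  qed
  then show ?thesis by (simp add: rot_t_def grad2_def)
qed

lemma continuous_rot: "continuous_on S rot"
  unfolding rot_def case_prod_unfold by (auto intro!: continuous_intros)

lemma norm_rot: "\<bar>s\<bar> \<le> 2 * norm (rot (s, t))"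
proof -
  have e: "(s + t) / 2 + (s - t) / 2 = s" by (simp add: field_simps)
  have "\<bar>(s + t) / 2\<bar> \<le> norm (rot (s, t))" "\<bar>(s - t) / 2\<bar> \<le> norm (rot (s, t))"
    using norm_fst_le[of "(s + t) / 2" "(s - t) / 2"] norm_snd_le[of "(s - t) / 2" "(s + t) / 2"]
    by (simp_all only: rot_def prod.case real_norm_def)
  then show ?thesis using abs_triangle_ineq[of "(s + t) / 2" "(s - t) / 2"] unfolding e by linarith
qed

lemma pd_continuous:
  assumes "smooth (F :: plane \<Rightarrow> complex)"
  shows "continuous_on S (pd (1, 0) F)" "continuous_on S (pd (0, 1) F)"
  by (auto intro!: smooth_continuous_on smooth_pd assms simp: Basis_plane)

lemma rot_t_continuous: "smooth F \<Longrightarrow> continuous_on S (rot_t F)"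
  unfolding rot_t_def[abs_def] by (intro continuous_intros pd_continuous)

lemma grad2_continuous: "smooth F \<Longrightarrow> continuous_on S (grad2 F)"
  unfolding grad2_def[abs_def] by (intro continuous_intros pd_continuous)

lemma test_grad_zero:
  assumes "F \<in> test_functions UNIV"
  obtains R where "R > 0" "\<And>p. R \<le> norm p \<Longrightarrow> F p = 0" "\<And>p. R \<le> norm p \<Longrightarrow> grad2 F p = 0"
    "\<And>p. R \<le> norm p \<Longrightarrow> rot_t F p = 0"
proof -
  have b: "(1, 0) \<in> (Basis :: plane set)" "(0, 1) \<in> (Basis :: plane set)" by (auto simp: Basis_plane)
  obtain R0 where R0: "R0 > 0" "\<And>p. R0 \<le> norm p \<Longrightarrow> F p = 0" using test_support[OF assms] by blast
  obtain R1 where R1: "R1 > 0" "\<And>p. R1 \<le> norm p \<Longrightarrow> pd (1, 0) F p = 0" using test_support[OF test_pd[OF assms b(1)]] by blast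
  obtain R2 where R2: "R2 > 0" "\<And>p. R2 \<le> norm p \<Longrightarrow> pd (0, 1) F p = 0" using test_support[OF test_pd[OF assms b(2)]] by blast
  show ?thesis
    by (rule that[of "max R0 (max R1 R2)"]) (use R0 R1 R2 in \<open>auto simp: grad2_def rot_t_def\<close>)
qed

section \<open>Integration of one-dimensional bounds over regions\<close>

lemma integrable_indicator_test:
  fixes h :: "plane \<Rightarrow> 'b::{banach, second_countable_topology}"
  assumes "A \<in> sets borel" "continuous_on UNIV h" "\<And>p. R \<le> norm p \<Longrightarrow> h p = 0"
  shows "integrable lborel (\<lambda>p. indicator A p *\<^sub>R h p)"
  using assms by (intro integrable_mult_indicator integrable_compact_support) auto

lemma test_integrable_sets:
  assumes F: "F \<in> test_functions UNIV" and A: "A \<in> sets borel"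
  shows "integrable lborel (\<lambda>p. indicator A p * (cmod (F p))\<^sup>2)"
    and "integrable lborel (\<lambda>p. indicator A p * grad2 F p)"
    and "integrable lborel (\<lambda>p. indicator A p * (cmod (rot_t F p))\<^sup>2)"
    and "integrable lborel (\<lambda>p. indicator A p *\<^sub>R F p)"
proof -
  have s: "smooth F" by (rule test_smooth[OF F])
  obtain R where R: "R > 0" "\<And>p. R \<le> norm p \<Longrightarrow> F p = 0" "\<And>p. R \<le> norm p \<Longrightarrow> grad2 F p = 0"
    "\<And>p. R \<le> norm p \<Longrightarrow> rot_t F p = 0" using test_grad_zero[OF F] by blast
  have "integrable lborel (\<lambda>p. indicator A p *\<^sub>R (cmod (F p))\<^sup>2)"
    using R by (intro integrable_indicator_test[OF A, of _ R] continuous_intros smooth_continuous_on s) auto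
  then show "integrable lborel (\<lambda>p. indicator A p * (cmod (F p))\<^sup>2)" by simp
  have "integrable lborel (\<lambda>p. indicator A p *\<^sub>R grad2 F p)"
    using R by (intro integrable_indicator_test[OF A, of _ R] grad2_continuous s) auto
  then show "integrable lborel (\<lambda>p. indicator A p * grad2 F p)" by simp
  have "integrable lborel (\<lambda>p. indicator A p *\<^sub>R (cmod (rot_t F p))\<^sup>2)"
    using R by (intro integrable_indicator_test[OF A, of _ R] continuous_intros rot_t_continuous s) auto
  then show "integrable lborel (\<lambda>p. indicator A p * (cmod (rot_t F p))\<^sup>2)" by simp
  show "integrable lborel (\<lambda>p. indicator A p *\<^sub>R F p)"
    using R by (intro integrable_indicator_test[OF A, of _ R] smooth_continuous_on s) auto
qed

text \<open>The area factor 1/2 is common to both integrals over \<open>A\<close>. The factor 2 in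
  front of \<open>\<theta>\<close> comes from \<open>rot_t_sq\<close>, and after multiplication by
  it the error term is left with coefficient 1.\<close>

lemma region_bound:
  assumes F: "F \<in> test_functions UNIV" and A: "A \<in> sets borel" and err: "integrable lborel err"
    and slice: "\<And>s. \<theta>\<^sup>2 * (LINT t|lborel. indicator A (rot (s, t)) * (cmod (F (rot (s, t))))\<^sup>2)
       \<le> (LINT t|lborel. indicator A (rot (s, t)) * (cmod (rot_t F (rot (s, t))))\<^sup>2) + err s"
  shows "2 * \<theta>\<^sup>2 * (LINT p|lborel. indicator A p * (cmod (F p))\<^sup>2)
     \<le> (LINT p|lborel. indicator A p * grad2 F p) + (LINT s|lborel. err s)"
proof -
  let ?N = "\<lambda>p. indicator A p * (cmod (F p))\<^sup>2"
  let ?D = "\<lambda>p. indicator A p * (cmod (rot_t F p))\<^sup>2"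
  note I = test_integrable_sets[OF F A]
  have m: "?N \<in> borel_measurable borel" "?D \<in> borel_measurable borel" using I(1,3) by auto
  have I': "integrable lborel (\<lambda>p. ?N (rot p))" "integrable lborel (\<lambda>p. ?D (rot p))"
    using I(1,3) rot_integral(1)[OF m(1)] rot_integral(1)[OF m(2)] by auto
  have "2 * \<theta>\<^sup>2 * (LINT p|lborel. ?N p) = \<theta>\<^sup>2 * (LINT p|lborel. ?N (rot p))"
    unfolding rot_integral(2)[OF m(1)] by simp
  also have "\<dots> = (LINT s|lborel. \<theta>\<^sup>2 * (LINT t|lborel. ?N (rot (s, t))))"
    unfolding plane_Fubini(1)[OF I'(1)] by simp
  also have "\<dots> \<le> (LINT s|lborel. (LINT t|lborel. ?D (rot (s, t))) + err s)"
    by (rule integral_mono[OF integrable_mult_right[OF plane_Fubini(3)[OF I'(1)]]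
          Bochner_Integration.integrable_add[OF plane_Fubini(3)[OF I'(2)] err] slice])
  also have "\<dots> = (LINT p|lborel. ?D (rot p)) + (LINT s|lborel. err s)"
    unfolding plane_Fubini(1)[OF I'(2)]
    by (rule Bochner_Integration.integral_add[OF plane_Fubini(3)[OF I'(2)] err])
  also have "(LINT p|lborel. ?D (rot p)) = (LINT p|lborel. 2 * ?D p)"
    using rot_integral(2)[OF m(2)] by simp
  also have "\<dots> \<le> (LINT p|lborel. indicator A p * grad2 F p)"
    by (rule integral_mono) (use I in \<open>auto simp: rot_t_sq indicator_def\<close>)
  finally show ?thesis by simp
qed

lemma slice_interval:
  assumes F: "F \<in> test_functions UNIV" and ab: "\<alpha> \<le> \<beta>"
    and A: "\<And>t. \<alpha> < t \<Longrightarrow> t < \<beta> \<Longrightarrow> rot (s, t) \<in> A" "\<And>t. rot (s, t) \<in> A \<Longrightarrow> \<alpha> \<le> t \<and> t \<le> \<beta>"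
    and \<theta>: "\<And>t. \<alpha> \<le> t \<Longrightarrow> t \<le> \<beta> \<Longrightarrow> \<bar>\<theta> * (t - c)\<bar> < pi / 2"
  shows "\<theta>\<^sup>2 * (LINT t|lborel. indicator A (rot (s, t)) * (cmod (F (rot (s, t))))\<^sup>2)
       \<le> (LINT t|lborel. indicator A (rot (s, t)) * (cmod (rot_t F (rot (s, t))))\<^sup>2)
      + \<theta> * tan (\<theta> * (\<beta> - c)) * (cmod (F (rot (s, \<beta>))))\<^sup>2 - \<theta> * tan (\<theta> * (\<alpha> - c)) * (cmod (F (rot (s, \<alpha>))))\<^sup>2"
proof -
  have s: "smooth F" by (rule test_smooth[OF F])
  have c: "continuous_on UNIV (\<lambda>t. F (rot (s, t)))" "continuous_on UNIV (\<lambda>t. rot_t F (rot (s, t)))"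
    by (auto intro!: continuous_on_compose2[OF smooth_continuous_on[OF s, of UNIV]]
        continuous_on_compose2[OF rot_t_continuous[OF s, of UNIV]]
        continuous_on_compose2[OF continuous_rot[of UNIV]] continuous_intros)
  have ii: "(LINT t|lborel. indicator A (rot (s, t)) * h t) = integral {\<alpha>..\<beta>} h"
    if "continuous_on UNIV h" for h :: "real \<Rightarrow> real"
  proof -
    have "(LINT t|lborel. indicator A (rot (s, t)) * h t) = (LINT t|lborel. indicator {t. rot (s, t) \<in> A} t *\<^sub>R h t)"
      by (simp add: indicator_def)
    also have "\<dots> = integral {\<alpha>..\<beta>} h" using A by (intro interval_integral[OF that]) auto
    finally show ?thesis .
  qed
  have e1: "(LINT t|lborel. indicator A (rot (s, t)) * (cmod (F (rot (s, t))))\<^sup>2) = integral {\<alpha>..\<beta>} (\<lambda>t. (cmod (F (rot (s, t))))\<^sup>2)"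
    by (intro ii continuous_intros c)
  have e2: "(LINT t|lborel. indicator A (rot (s, t)) * (cmod (rot_t F (rot (s, t))))\<^sup>2) = integral {\<alpha>..\<beta>} (\<lambda>t. (cmod (rot_t F (rot (s, t))))\<^sup>2)"
    by (intro ii continuous_intros c)
  show ?thesis unfolding e1 e2
    by (rule slice_bound[OF ab has_vector_derivative_at_within[OF rot_derivative[OF s]]
        continuous_on_subset[OF c(2) subset_UNIV] \<theta>]) auto
qed

lemma slice_empty:
  assumes "\<And>t. rot (s, t) \<notin> A" "0 \<le> e"
  shows "\<theta>\<^sup>2 * (LINT t|lborel. indicator A (rot (s, t)) * (cmod (F (rot (s, t))))\<^sup>2)
       \<le> (LINT t|lborel. indicator A (rot (s, t)) * (cmod (rot_t F (rot (s, t))))\<^sup>2) + e"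
  using assms by simp

text \<open>The squared norm on the Dirichlet part of the boundary, up to a constant.\<close>

definition bdry :: "real \<Rightarrow> (plane \<Rightarrow> complex) \<Rightarrow> real \<Rightarrow> real" where
  "bdry d F s = indicator {d<..} s * ((cmod (F (rot (s, d))))\<^sup>2 + (cmod (F (rot (s, - d))))\<^sup>2)"

lemma bdry_nonneg: "0 \<le> bdry d F s" by (simp add: bdry_def)

lemma rot_section_integrable:
  fixes h :: "plane \<Rightarrow> 'b::{banach, second_countable_topology}"
  assumes "continuous_on UNIV h" "\<And>p. R \<le> norm p \<Longrightarrow> h p = 0" "I \<in> sets borel"
  shows "integrable lborel (\<lambda>s. indicator I s *\<^sub>R h (rot (s, t)))"
proof (rule integrable_mult_indicator)
  show "integrable lborel (\<lambda>s. h (rot (s, t)))"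
  proof (rule integrable_compact_support[where R="2 * R"])
    show "continuous_on UNIV (\<lambda>s. h (rot (s, t)))"
      by (auto intro!: continuous_on_compose2[OF assms(1)] continuous_on_compose2[OF continuous_rot[of UNIV]] continuous_intros)
    show "h (rot (s, t)) = 0" if "2 * R \<le> norm s" for s
      using that norm_rot[of s t] by (intro assms(2)) simp
  qed
qed (use assms in auto)

lemma bdry_integrable:
  assumes F: "F \<in> test_functions UNIV"
  shows "integrable lborel (bdry d F)"
proof -
  obtain R where R: "R > 0" "\<And>p. R \<le> norm p \<Longrightarrow> F p = 0" using test_support[OF F] by blast
  have "integrable lborel (\<lambda>s. indicator {d<..} s *\<^sub>R (cmod (F (rot (s, t))))\<^sup>2)" for t
    by (rule rot_section_integrable[where R=R and h="\<lambda>p. (cmod (F p))\<^sup>2"])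
      (use R in \<open>auto intro!: continuous_intros smooth_continuous_on test_smooth[OF F]\<close>)
  from Bochner_Integration.integrable_add[OF this[of d] this[of "-d"]]
  show ?thesis unfolding bdry_def[abs_def] by (simp add: distrib_left)
qed

lemma fst_snd_measurable [measurable]: "(fst :: plane \<Rightarrow> real) \<in> borel_measurable borel" "(snd :: plane \<Rightarrow> real) \<in> borel_measurable borel"
  by (auto intro!: borel_measurable_continuous_onI continuous_intros)

subsection \<open>No symmetry\<close>

lemma rect_integral:
  fixes h :: "plane \<Rightarrow> 'b::euclidean_space"
  assumes h: "continuous_on UNIV h"
  shows "(LINT p|lborel. indicator (box (a, b) (a', b')) p *\<^sub>R h p) = integral {a..a'} (\<lambda>x. integral {b..b'} (\<lambda>y. h (x, y)))"
proof -
  have "integrable lborel (\<lambda>p. indicator (box (a, b) (a', b')) p *\<^sub>R (indicator (cbox (a, b) (a', b')) p *\<^sub>R h p))"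
    by (intro integrable_mult_indicator borel_integrable_compact continuous_on_subset[OF h]) auto
  moreover have "(\<lambda>p. indicator (box (a, b) (a', b')) p *\<^sub>R (indicator (cbox (a, b) (a', b')) p *\<^sub>R h p)) = (\<lambda>p. indicator (box (a, b) (a', b')) p *\<^sub>R h p)"
    using subsetD[OF box_subset_cbox] by (fastforce simp: indicator_def)
  ultimately have i: "integrable lborel (\<lambda>p. indicator (box (a, b) (a', b')) p *\<^sub>R h p)" by simp
  have hy: "continuous_on UNIV (\<lambda>y. h (x, y))" for x
    by (auto intro!: continuous_on_compose2[OF h] continuous_intros)
  have hx: "continuous_on UNIV (\<lambda>x. integral {b..b'} (\<lambda>y. h (x, y)))"
    using integral_continuous_on_param[of UNIV b b' "\<lambda>x y. h (x, y)"] continuous_on_subset[OF h] by (simp add: cbox_interval)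
  have "(LINT p|lborel. indicator (box (a, b) (a', b')) p *\<^sub>R h p)
     = (LINT x|lborel. LINT y|lborel. indicator {a<..<a'} x *\<^sub>R (indicator {b<..<b'} y *\<^sub>R h (x, y)))"
    unfolding plane_Fubini(1)[OF i]
    by (intro Bochner_Integration.integral_cong refl) (auto simp: indicator_def mem_box_pair)
  also have "\<dots> = (LINT x|lborel. indicator {a<..<a'} x *\<^sub>R integral {b..b'} (\<lambda>y. h (x, y)))"
  proof (rule Bochner_Integration.integral_cong[OF refl])
    fix x
    have "(LINT y|lborel. indicator {b<..<b'} y *\<^sub>R h (x, y)) = integral {b..b'} (\<lambda>y. h (x, y))"
      by (rule interval_integral[OF hy]) auto
    then show "(LINT y|lborel. indicator {a<..<a'} x *\<^sub>R (indicator {b<..<b'} y *\<^sub>R h (x, y)))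
        = indicator {a<..<a'} x *\<^sub>R integral {b..b'} (\<lambda>y. h (x, y))"
      by (simp only: integral_scaleR_right)
  qed
  also have "\<dots> = integral {a..a'} (\<lambda>x. integral {b..b'} (\<lambda>y. h (x, y)))"
    by (rule interval_integral[OF hx]) auto
  finally show ?thesis .
qed

lemma square_bound:
  assumes F: "F \<in> test_functions UNIV" and d: "0 < d"
  defines "Q \<equiv> box (0, 0) (d, d) :: plane set"
  shows "(pi / d)\<^sup>2 * (LINT p|lborel. indicator Q p * (cmod (F p))\<^sup>2)
     \<le> (LINT p|lborel. indicator Q p * grad2 F p) + (pi / d)\<^sup>2 / d\<^sup>2 * (cmod (LINT p|lborel. indicator Q p *\<^sub>R F p))\<^sup>2"
proof -
  have s: "smooth F" by (rule test_smooth[OF F])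
  note c = smooth_continuous_on[OF s, of UNIV] pd_continuous[OF s, of UNIV]
  have e1: "(LINT p|lborel. indicator Q p * (cmod (F p))\<^sup>2) = integral {0..d} (\<lambda>x. integral {0..d} (\<lambda>y. (cmod (F (x, y)))\<^sup>2))"
    using rect_integral[of "\<lambda>p. (cmod (F p))\<^sup>2" 0 0 d d] c by (simp add: Q_def continuous_intros)
  have e2: "(LINT p|lborel. indicator Q p *\<^sub>R F p) = integral {0..d} (\<lambda>x. integral {0..d} (\<lambda>y. F (x, y)))"
    using rect_integral[of F 0 0 d d] c by (simp add: Q_def)
  have e3: "(LINT p|lborel. indicator Q p * (cmod (pd v F p))\<^sup>2) = integral {0..d} (\<lambda>x. integral {0..d} (\<lambda>y. (cmod (pd v F (x, y)))\<^sup>2))"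
    if "v \<in> Basis" for v
    using rect_integral[of "\<lambda>p. (cmod (pd v F p))\<^sup>2" 0 0 d d] smooth_continuous_on[OF smooth_pd[OF s that]]
    by (simp add: Q_def continuous_intros)
  have b: "(1, 0) \<in> (Basis :: plane set)" "(0, 1) \<in> (Basis :: plane set)" by (auto simp: Basis_plane)
  have Qb: "Q \<in> sets borel" by (simp add: Q_def)
  have e4: "(LINT p|lborel. indicator Q p * grad2 F p)
     = (LINT p|lborel. indicator Q p * (cmod (pd (1,0) F p))\<^sup>2) + (LINT p|lborel. indicator Q p * (cmod (pd (0,1) F p))\<^sup>2)"
    unfolding grad2_def distrib_left
    by (rule Bochner_Integration.integral_add[OF test_integrable_sets(1)[OF test_pd[OF F b(1)] Qb] test_integrable_sets(1)[OF test_pd[OF F b(2)] Qb]])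
  have "(pi / d)\<^sup>2 * (integral {0..0+d} (\<lambda>x. integral {0..0+d} (\<lambda>y. (cmod (F (x, y)))\<^sup>2))
          - (cmod (integral {0..0+d} (\<lambda>x. integral {0..0+d} (\<lambda>y. F (x, y)))))\<^sup>2 / d\<^sup>2)
     \<le> integral {0..0+d} (\<lambda>x. integral {0..0+d} (\<lambda>y. (cmod (pd (1,0) F (x, y)))\<^sup>2))
      + integral {0..0+d} (\<lambda>x. integral {0..0+d} (\<lambda>y. (cmod (pd (0,1) F (x, y)))\<^sup>2))"
    by (rule square_poincare[OF d smooth_partial(1)[OF s] smooth_partial(2)[OF s]]) (use c in \<open>simp_all\<close>)
  then show ?thesis unfolding e4 e3[OF b(1)] e3[OF b(2)] e1 e2 by (simp add: algebra_simps)
qed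

lemma tan_nonneg: "0 \<le> x \<Longrightarrow> x < pi / 2 \<Longrightarrow> 0 \<le> tan x"
  using tan_gt_zero[of x] by (cases "x = 0") auto

lemma bdry_scaled: "integrable lborel (bdry d F) \<Longrightarrow> integrable lborel (\<lambda>s. k * bdry d F s)"
  by (rule integrable_mult_right)

text \<open>Besides the square there are three regions: \<open>A1\<close>, where x + y \<ge> 2 d and
  the sections are all of -d < t < d, and the triangles \<open>A2\<close> and \<open>A3\<close>
  beside the square, whose sections run from an edge of the square to the Dirichlet boundary. With
  the tangent centered at 0 the inner end of such a section contributes a term of favourable sign.
  Each region is charged one copy of the boundary term, hence the factor 3.\<close>

lemma test_bound_0:
  assumes F: "F \<in> test_functions UNIV" and d: "0 < d" and \<theta>: "0 < \<theta>" "\<theta> < pi / (2 * d)"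
  defines "Q \<equiv> box (0, 0) (d, d) :: plane set"
  shows "2 * \<theta>\<^sup>2 * (LINT p|lborel. indicator (Omega d) p * (cmod (F p))\<^sup>2)
     \<le> (LINT p|lborel. indicator (Omega d) p * grad2 F p)
      + (pi / d)\<^sup>2 / d\<^sup>2 * (cmod (LINT p|lborel. indicator Q p *\<^sub>R F p))\<^sup>2
      + 3 * (\<theta> * tan (\<theta> * d)) * (LINT s|lborel. bdry d F s)"
proof -
  define A1 where "A1 = {p :: plane. 2 * d \<le> fst p + snd p \<and> \<bar>fst p - snd p\<bar> < d}"
  define A2 where "A2 = {p :: plane. fst p + snd p < 2 * d \<and> d \<le> fst p \<and> fst p - snd p < d}"
  define A3 where "A3 = {p :: plane. fst p + snd p < 2 * d \<and> d \<le> snd p \<and> snd p - fst p < d}"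
  have "Measurable.pred borel (\<lambda>p::plane. 2 * d \<le> fst p + snd p \<and> \<bar>fst p - snd p\<bar> < d)"
    "Measurable.pred borel (\<lambda>p::plane. fst p + snd p < 2 * d \<and> d \<le> fst p \<and> fst p - snd p < d)"
    "Measurable.pred borel (\<lambda>p::plane. fst p + snd p < 2 * d \<and> d \<le> snd p \<and> snd p - fst p < d)" by measurable
  then have A: "A1 \<in> sets borel" "A2 \<in> sets borel" "A3 \<in> sets borel" "Q \<in> sets borel"
    by (auto simp: A1_def A2_def A3_def Q_def pred_def)
  have part: "indicator (Omega d) p = (indicator Q p + indicator A1 p + indicator A2 p + indicator A3 p :: real)" for p
    using d by (auto simp: indicator_def Omega_def Q_def A1_def A2_def A3_def mem_box_pair split: if_splits)
  define k where "k = \<theta> * tan (\<theta> * d)"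
  have \<theta>d: "\<theta> * d < pi / 2" using \<theta> d by (simp add: field_simps)
  have k0: "0 \<le> k" unfolding k_def using \<theta> d \<theta>d by (intro mult_nonneg_nonneg tan_nonneg) auto
  have small: "\<bar>\<theta> * (t - 0)\<bar> < pi / 2" if "- d \<le> t" "t \<le> d" for t
  proof -
    have "\<theta> * \<bar>t\<bar> \<le> \<theta> * d" using that \<theta> by (intro mult_left_mono) auto
    moreover have "\<bar>\<theta> * (t - 0)\<bar> = \<theta> * \<bar>t\<bar>" using \<theta> by (simp add: abs_mult)
    ultimately show ?thesis using \<theta>d by linarith
  qed
  note err = bdry_scaled[OF bdry_integrable[OF F, of d], of k]
  have r: "fst (rot (s, t)) = (s + t) / 2" "snd (rot (s, t)) = (s - t) / 2" for s t by (simp_all add: rot_def)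
  have rr: "(s + t) / 2 + (s - t) / 2 = s" "(s + t) / 2 - (s - t) / 2 = t" for s t :: real by (auto simp: field_simps)
  have mA1: "rot (s, t) \<in> A1 \<longleftrightarrow> 2 * d \<le> s \<and> - d < t \<and> t < d" for s t
    unfolding A1_def mem_Collect_eq r rr by auto
  have mA2: "rot (s, t) \<in> A2 \<longleftrightarrow> s < 2 * d \<and> 2 * d - s \<le> t \<and> t < d" for s t
    unfolding A2_def mem_Collect_eq r rr by auto
  have mA3: "rot (s, t) \<in> A3 \<longleftrightarrow> s < 2 * d \<and> t \<le> s - 2 * d \<and> - d < t" for s t
  proof -
    have "(s - t) / 2 - (s + t) / 2 = - t" by (simp add: field_simps)
    then show ?thesis unfolding A3_def mem_Collect_eq r rr by auto
  qed
  have b1: "2 * \<theta>\<^sup>2 * (LINT p|lborel. indicator A1 p * (cmod (F p))\<^sup>2)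
     \<le> (LINT p|lborel. indicator A1 p * grad2 F p) + (LINT s|lborel. k * bdry d F s)"
  proof (rule region_bound[OF F A(1) err])
    fix s
    show "\<theta>\<^sup>2 * (LINT t|lborel. indicator A1 (rot (s, t)) * (cmod (F (rot (s, t))))\<^sup>2)
       \<le> (LINT t|lborel. indicator A1 (rot (s, t)) * (cmod (rot_t F (rot (s, t))))\<^sup>2) + k * bdry d F s"
    proof (cases "2 * d \<le> s")
      case True
      have si: "\<theta>\<^sup>2 * (LINT t|lborel. indicator A1 (rot (s, t)) * (cmod (F (rot (s, t))))\<^sup>2)
         \<le> (LINT t|lborel. indicator A1 (rot (s, t)) * (cmod (rot_t F (rot (s, t))))\<^sup>2)
        + \<theta> * tan (\<theta> * (d - 0)) * (cmod (F (rot (s, d))))\<^sup>2 - \<theta> * tan (\<theta> * (- d - 0)) * (cmod (F (rot (s, - d))))\<^sup>2"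
        by (rule slice_interval[OF F]) (use small d True mA1 in auto)
      moreover have "k * bdry d F s = \<theta> * tan (\<theta> * (d - 0)) * (cmod (F (rot (s, d))))\<^sup>2 - \<theta> * tan (\<theta> * (- d - 0)) * (cmod (F (rot (s, - d))))\<^sup>2"
        using True d by (simp add: k_def bdry_def algebra_simps)
      ultimately show ?thesis by linarith
    qed (intro slice_empty mult_nonneg_nonneg k0 bdry_nonneg, auto simp: mA1)
  qed
  have b2: "2 * \<theta>\<^sup>2 * (LINT p|lborel. indicator A2 p * (cmod (F p))\<^sup>2)
     \<le> (LINT p|lborel. indicator A2 p * grad2 F p) + (LINT s|lborel. k * bdry d F s)"
  proof (rule region_bound[OF F A(2) err])
    fix s
    show "\<theta>\<^sup>2 * (LINT t|lborel. indicator A2 (rot (s, t)) * (cmod (F (rot (s, t))))\<^sup>2)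
       \<le> (LINT t|lborel. indicator A2 (rot (s, t)) * (cmod (rot_t F (rot (s, t))))\<^sup>2) + k * bdry d F s"
    proof (cases "d < s \<and> s < 2 * d")
      case True
      have "0 \<le> tan (\<theta> * (2 * d - s))"
      proof (rule tan_nonneg)
        have "\<theta> * (2 * d - s) \<le> \<theta> * d" using True \<theta> by (intro mult_left_mono) auto
        then show "\<theta> * (2 * d - s) < pi / 2" using \<theta>d by simp
      qed (use True \<theta> in simp)
      then have t0: "0 \<le> \<theta> * tan (\<theta> * ((2 * d - s) - 0)) * (cmod (F (rot (s, 2 * d - s))))\<^sup>2" using \<theta> by simp
      have "\<theta> * tan (\<theta> * (d - 0)) * (cmod (F (rot (s, d))))\<^sup>2 \<le> k * bdry d F s"
        using True k0 by (auto simp: k_def bdry_def intro!: mult_left_mono)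
      moreover have "\<theta>\<^sup>2 * (LINT t|lborel. indicator A2 (rot (s, t)) * (cmod (F (rot (s, t))))\<^sup>2)
         \<le> (LINT t|lborel. indicator A2 (rot (s, t)) * (cmod (rot_t F (rot (s, t))))\<^sup>2)
        + \<theta> * tan (\<theta> * (d - 0)) * (cmod (F (rot (s, d))))\<^sup>2 - \<theta> * tan (\<theta> * ((2 * d - s) - 0)) * (cmod (F (rot (s, 2 * d - s))))\<^sup>2"
        by (rule slice_interval[OF F]) (use small d True mA2 in auto)
      ultimately show ?thesis using t0 by linarith
    qed (intro slice_empty mult_nonneg_nonneg k0 bdry_nonneg, auto simp: mA2)
  qed
  have b3: "2 * \<theta>\<^sup>2 * (LINT p|lborel. indicator A3 p * (cmod (F p))\<^sup>2)
     \<le> (LINT p|lborel. indicator A3 p * grad2 F p) + (LINT s|lborel. k * bdry d F s)"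
  proof (rule region_bound[OF F A(3) err])
    fix s
    show "\<theta>\<^sup>2 * (LINT t|lborel. indicator A3 (rot (s, t)) * (cmod (F (rot (s, t))))\<^sup>2)
       \<le> (LINT t|lborel. indicator A3 (rot (s, t)) * (cmod (rot_t F (rot (s, t))))\<^sup>2) + k * bdry d F s"
    proof (cases "d < s \<and> s < 2 * d")
      case True
      have "0 \<le> tan (\<theta> * (2 * d - s))"
      proof (rule tan_nonneg)
        have "\<theta> * (2 * d - s) \<le> \<theta> * d" using True \<theta> by (intro mult_left_mono) auto
        then show "\<theta> * (2 * d - s) < pi / 2" using \<theta>d by simp
      qed (use True \<theta> in simp)
      moreover have "tan (\<theta> * ((s - 2 * d) - 0)) = - tan (\<theta> * (2 * d - s))"
        using tan_minus[of "\<theta> * (2 * d - s)"] by (simp only: minus_mult_right minus_diff_eq diff_0_right)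
      ultimately have t0: "\<theta> * tan (\<theta> * ((s - 2 * d) - 0)) * (cmod (F (rot (s, s - 2 * d))))\<^sup>2 \<le> 0"
        using \<theta> by (simp add: mult_nonneg_nonneg)
      moreover have "- (\<theta> * tan (\<theta> * (- d - 0)) * (cmod (F (rot (s, - d))))\<^sup>2) \<le> k * bdry d F s"
        using True k0 by (auto simp: k_def bdry_def intro!: mult_left_mono)
      moreover have "\<theta>\<^sup>2 * (LINT t|lborel. indicator A3 (rot (s, t)) * (cmod (F (rot (s, t))))\<^sup>2)
         \<le> (LINT t|lborel. indicator A3 (rot (s, t)) * (cmod (rot_t F (rot (s, t))))\<^sup>2)
        + \<theta> * tan (\<theta> * ((s - 2 * d) - 0)) * (cmod (F (rot (s, s - 2 * d))))\<^sup>2 - \<theta> * tan (\<theta> * (- d - 0)) * (cmod (F (rot (s, - d))))\<^sup>2"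
        by (rule slice_interval[OF F]) (use small d True mA3 in auto)
      ultimately show ?thesis using t0 by linarith
    qed (intro slice_empty mult_nonneg_nonneg k0 bdry_nonneg, auto simp: mA3)
  qed
  \<comment> \<open>The Neumann constant (pi / d)^2 of the square is twice the threshold 2 (pi / (2
    d))^2, so the square leaves a margin.\<close>
  have sq: "2 * \<theta>\<^sup>2 \<le> (pi / d)\<^sup>2"
  proof -
    have "\<theta>\<^sup>2 \<le> (pi / (2 * d))\<^sup>2" using \<theta> by (intro power_mono) auto
    also have "\<dots> = (pi / d)\<^sup>2 / 4" by (simp add: power_divide power_mult_distrib)
    finally show ?thesis using zero_le_power2[of "pi / d"] by linarith
  qed
  have "2 * \<theta>\<^sup>2 * (LINT p|lborel. indicator Q p * (cmod (F p))\<^sup>2) \<le> (pi / d)\<^sup>2 * (LINT p|lborel. indicator Q p * (cmod (F p))\<^sup>2)"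
    by (rule mult_right_mono[OF sq]) (simp add: integral_nonneg_AE)
  also have "\<dots> \<le> (LINT p|lborel. indicator Q p * grad2 F p) + (pi / d)\<^sup>2 / d\<^sup>2 * (cmod (LINT p|lborel. indicator Q p *\<^sub>R F p))\<^sup>2"
    unfolding Q_def by (rule square_bound[OF F d])
  finally have b0: "2 * \<theta>\<^sup>2 * (LINT p|lborel. indicator Q p * (cmod (F p))\<^sup>2) \<le> \<dots>" .
  have sum: "(LINT p|lborel. indicator (Omega d) p * h p) = (LINT p|lborel. indicator Q p * h p)
      + (LINT p|lborel. indicator A1 p * h p) + (LINT p|lborel. indicator A2 p * h p) + (LINT p|lborel. indicator A3 p * h p)"
    if "\<And>S. S \<in> sets borel \<Longrightarrow> integrable lborel (\<lambda>p. indicator S p * h p)" for h :: "plane \<Rightarrow> real"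
    unfolding part distrib_right using that A by simp
  have sN: "(LINT p|lborel. indicator (Omega d) p * (cmod (F p))\<^sup>2) = (LINT p|lborel. indicator Q p * (cmod (F p))\<^sup>2)
      + (LINT p|lborel. indicator A1 p * (cmod (F p))\<^sup>2) + (LINT p|lborel. indicator A2 p * (cmod (F p))\<^sup>2)
      + (LINT p|lborel. indicator A3 p * (cmod (F p))\<^sup>2)"
    by (rule sum) (rule test_integrable_sets(1)[OF F])
  have sG: "(LINT p|lborel. indicator (Omega d) p * grad2 F p) = (LINT p|lborel. indicator Q p * grad2 F p)
      + (LINT p|lborel. indicator A1 p * grad2 F p) + (LINT p|lborel. indicator A2 p * grad2 F p)
      + (LINT p|lborel. indicator A3 p * grad2 F p)"
    by (rule sum) (rule test_integrable_sets(2)[OF F])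
  have "(LINT s|lborel. k * bdry d F s) = k * (LINT s|lborel. bdry d F s)" by simp
  then show ?thesis
    unfolding sN sG k_def[symmetric] distrib_left
    using b0 b1 b2 b3 by linarith
qed

subsection \<open>Antisymmetric functions\<close>

text \<open>A shear is added to the rotation: at fixed s = x + y the second coordinate is d / 2 - 2
  y, in which \<open>P\<close> becomes a square with side d / 2 up to edges. The shear preserves
  area, so the factor 1/2 remains that of \<open>rot\<close>.\<close>

lemma para_integral:
  fixes h :: "plane \<Rightarrow> 'b::euclidean_space" and d :: real
  assumes h: "continuous_on UNIV h" "\<And>p. R \<le> norm p \<Longrightarrow> h p = 0"
  defines "P \<equiv> {p :: plane. d / 2 < fst p + snd p \<and> fst p + snd p \<le> d \<and> 0 < snd p \<and> snd p \<le> d / 4}"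
  shows "(LINT p|lborel. indicator P p *\<^sub>R h p)
     = (1/2) *\<^sub>R integral {d/2..d} (\<lambda>s. integral {0..d/2} (\<lambda>t. h (s - d/4 + t/2, d/4 - t/2)))"
proof -
  have "Measurable.pred borel (\<lambda>p :: plane. d / 2 < fst p + snd p \<and> fst p + snd p \<le> d \<and> 0 < snd p \<and> snd p \<le> d / 4)"
    by measurable
  then have P: "P \<in> sets borel" by (simp add: P_def pred_def)
  let ?h = "\<lambda>p. indicator P p *\<^sub>R h p"
  let ?c = "\<lambda>s t. (s - d/4 + t/2, d/4 - t/2)"
  have i: "integrable lborel ?h" by (rule integrable_indicator_test[OF P h])
  have m: "?h \<in> borel_measurable borel" using i by auto
  have i': "integrable lborel (\<lambda>p. ?h (rot p))" using i rot_integral(1)[OF m] by simp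
  have e: "rot (s, (s - d/2) + 1 * t) = ?c s t" for s t by (simp add: rot_def field_simps)
  have ct: "continuous_on UNIV (\<lambda>t. h (?c s t))" for s
    by (auto intro!: continuous_on_compose2[OF h(1)] continuous_intros)
  have "continuous_on (UNIV \<times> cbox 0 (d/2)) (\<lambda>(s, t). h (?c s t))"
    unfolding case_prod_unfold by (auto intro!: continuous_on_compose2[OF h(1)] continuous_intros)
  from integral_continuous_on_param[OF this]
  have smooth_compact: "continuous_on UNIV (\<lambda>s. integral {0..d/2} (\<lambda>t. h (?c s t)))" by (simp add: cbox_interval)
  have inner: "(LINT t|lborel. ?h (rot (s, t))) = indicator {d/2<..d} s *\<^sub>R integral {0..d/2} (\<lambda>t. h (?c s t))" for s
  proof -
    have "(LINT t|lborel. ?h (rot (s, t))) = \<bar>1\<bar> *\<^sub>R (LINT t|lborel. ?h (rot (s, (s - d/2) + 1 * t)))"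
      by (rule lborel_integral_real_affine) simp
    also have "\<dots> = (LINT t|lborel. ?h (?c s t))" unfolding e by simp
    also have "\<dots> = (LINT t|lborel. indicator {d/2<..d} s *\<^sub>R (indicator {0..<d/2} t *\<^sub>R h (?c s t)))"
      by (intro Bochner_Integration.integral_cong refl) (auto simp: indicator_def P_def)
    also have "\<dots> = indicator {d/2<..d} s *\<^sub>R (LINT t|lborel. indicator {0..<d/2} t *\<^sub>R h (?c s t))"
      by (rule integral_scaleR_right)
    also have "(LINT t|lborel. indicator {0..<d/2} t *\<^sub>R h (?c s t)) = integral {0..d/2} (\<lambda>t. h (?c s t))"
      by (rule interval_integral[OF ct]) auto
    finally show ?thesis .
  qed
  have "(LINT p|lborel. ?h p) = (1/2) *\<^sub>R (LINT s|lborel. LINT t|lborel. ?h (rot (s, t)))"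
    unfolding rot_integral(2)[OF m] plane_Fubini(1)[OF i'] ..
  also have "(LINT s|lborel. LINT t|lborel. ?h (rot (s, t))) = integral {d/2..d} (\<lambda>s. integral {0..d/2} (\<lambda>t. h (?c s t)))"
    unfolding inner by (rule interval_integral[OF smooth_compact]) auto
  finally show ?thesis .
qed

text \<open>The Poincare constant of a square with side d / 2 is 4 (pi / d)^2, and in the sheared
  coordinates the sum of the squared derivatives is at most twice the squared gradient. The quotient
  2 (pi / d)^2 is exactly the threshold of the antisymmetric sector.\<close>

lemma parallelogram_bound:
  assumes F: "F \<in> test_functions UNIV" and d: "0 < d"
  defines "P \<equiv> {p :: plane. d / 2 < fst p + snd p \<and> fst p + snd p \<le> d \<and> 0 < snd p \<and> snd p \<le> d / 4}"
  shows "2 * (pi / d)\<^sup>2 * (LINT p|lborel. indicator P p * (cmod (F p))\<^sup>2)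
     \<le> (LINT p|lborel. indicator P p * grad2 F p) + 16 * (pi / d)\<^sup>2 / d\<^sup>2 * (cmod (LINT p|lborel. indicator P p *\<^sub>R F p))\<^sup>2"
proof -
  have sF: "smooth F" by (rule test_smooth[OF F])
  obtain R where R: "R > 0" "\<And>p. R \<le> norm p \<Longrightarrow> F p = 0" "\<And>p. R \<le> norm p \<Longrightarrow> grad2 F p = 0"
    "\<And>p. R \<le> norm p \<Longrightarrow> rot_t F p = 0" using test_grad_zero[OF F] by blast
  let ?c = "\<lambda>s t. (s - d/4 + t/2, d/4 - t/2)"
  define H where "H s t = F (?c s t)" for s t
  define H1 where "H1 s t = pd (1, 0) F (?c s t)" for s t
  define H2 where "H2 s t = (1/2) *\<^sub>R pd (1, 0) F (?c s t) + (- 1/2) *\<^sub>R pd (0, 1) F (?c s t)" for s t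
  have cc: "continuous_on UNIV (\<lambda>(s, t). h (?c s t))" if "continuous_on UNIV h" for h :: "plane \<Rightarrow> 'z::topological_space"
    unfolding case_prod_unfold by (auto intro!: continuous_on_compose2[OF that] continuous_intros)
  have d1: "((\<lambda>s. H s t) has_vector_derivative H1 s t) (at s)" for s t
    using smooth_line[OF sF, of "- d/4 + t/2" 1 "d/4 - t/2" 0 s] by (simp add: H_def H1_def algebra_simps)
  have d2: "((\<lambda>t. H s t) has_vector_derivative H2 s t) (at t)" for s t
    using smooth_line[OF sF, of "s - d/4" "1/2" "d/4" "- 1/2" t] by (simp add: H_def H2_def algebra_simps)
  have c0: "continuous_on UNIV (\<lambda>(s, t). H s t)" unfolding H_def by (rule cc[OF smooth_continuous_on[OF sF]])
  have c1: "continuous_on UNIV (\<lambda>(s, t). H1 s t)" unfolding H1_def by (rule cc[OF pd_continuous(1)[OF sF]])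
  have c2: "continuous_on UNIV (\<lambda>(s, t). H2 s t)" unfolding H2_def
    by (rule cc[of "\<lambda>p. (1/2) *\<^sub>R pd (1, 0) F p + (- 1/2) *\<^sub>R pd (0, 1) F p"]) (intro continuous_intros pd_continuous[OF sF])
  define I where "I h = integral {d/2..d} (\<lambda>s. integral {0..d/2} (\<lambda>t. h s t))" for h :: "real \<Rightarrow> real \<Rightarrow> real"
  define J where "J = integral {d/2..d} (\<lambda>s. integral {0..d/2} (\<lambda>t. H s t))"
  have sq: "(pi / (d/2))\<^sup>2 * (I (\<lambda>s t. (cmod (H s t))\<^sup>2) - (cmod J)\<^sup>2 / (d/2)\<^sup>2)
     \<le> I (\<lambda>s t. (cmod (H1 s t))\<^sup>2) + I (\<lambda>s t. (cmod (H2 s t))\<^sup>2)"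
    using square_poincare[OF _ d1 d2 c0 c1 c2, of "d/2" "d/2" 0] d unfolding I_def J_def by simp
  have par: "(\<lambda>s. integral {0..d/2} (\<lambda>t. h s t)) integrable_on {d/2..d}"
    and par': "h s integrable_on {0..d/2}"
    if "continuous_on UNIV (\<lambda>(s, t). h s t)" for h :: "real \<Rightarrow> real \<Rightarrow> real" and s
  proof -
    have "continuous_on {d/2..d} (\<lambda>s. integral (cbox 0 (d/2)) (h s))"
      by (rule integral_continuous_on_param) (rule continuous_on_subset[OF that], simp)
    then show "(\<lambda>s. integral {0..d/2} (\<lambda>t. h s t)) integrable_on {d/2..d}"
      by (intro integrable_continuous_interval) (simp add: cbox_interval)
    have "continuous_on {0..d/2} (\<lambda>t. (\<lambda>(s, t). h s t) (s, t))"
      by (rule continuous_on_compose2[OF that]) (auto intro!: continuous_intros)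
    then show "h s integrable_on {0..d/2}" by (intro integrable_continuous_interval) simp
  qed
  have csq: "continuous_on UNIV (\<lambda>(s, t). (cmod (K s t))\<^sup>2)" if "continuous_on UNIV (\<lambda>(s, t). K s t)" for K
    using that unfolding case_prod_unfold by (intro continuous_intros)
  have Iadd: "I (\<lambda>s t. h s t + k s t) = I h + I k"
    if "continuous_on UNIV (\<lambda>(s, t). h s t)" "continuous_on UNIV (\<lambda>(s, t). k s t)" for h k
    unfolding I_def using par[OF that(1)] par[OF that(2)] par'[OF that(1)] par'[OF that(2)]
    by (simp add: Henstock_Kurzweil_Integration.integral_add)
  have Imono: "I h \<le> I k"
    if "continuous_on UNIV (\<lambda>(s, t). h s t)" "continuous_on UNIV (\<lambda>(s, t). k s t)" "\<And>s t. h s t \<le> k s t" for h k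
    unfolding I_def by (intro integral_le par par' that)
  have Icm: "I (\<lambda>s t. c * h s t) = c * I h" for c h unfolding I_def by simp
  have cg: "continuous_on UNIV (\<lambda>(s, t). grad2 F (?c s t))" by (rule cc[OF grad2_continuous[OF sF]])
  have pw: "(cmod (H1 s t))\<^sup>2 + (cmod (H2 s t))\<^sup>2 \<le> 2 * grad2 F (?c s t)" for s t
  proof -
    have "(cmod a)\<^sup>2 + (cmod ((1/2) *\<^sub>R a + (- 1/2) *\<^sub>R b))\<^sup>2 \<le> 2 * ((cmod a)\<^sup>2 + (cmod b)\<^sup>2)" for a b :: complex
    proof -
      \<comment> \<open>Four times the difference of the two sides, written as a sum of
        squares.\<close>
      have "0 \<le> (a + b) \<bullet> (a + b) + (2 * (a \<bullet> a) + 6 * (b \<bullet> b))" by (intro add_nonneg_nonneg) auto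
      then show ?thesis unfolding power2_norm_eq_inner by (simp add: inner_simps inner_commute algebra_simps)
    qed
    then show ?thesis unfolding H1_def H2_def grad2_def .
  qed
  have "I (\<lambda>s t. (cmod (H1 s t))\<^sup>2) + I (\<lambda>s t. (cmod (H2 s t))\<^sup>2) = I (\<lambda>s t. (cmod (H1 s t))\<^sup>2 + (cmod (H2 s t))\<^sup>2)"
    by (rule Iadd[symmetric, OF csq[OF c1] csq[OF c2]])
  also have "\<dots> \<le> I (\<lambda>s t. 2 * grad2 F (?c s t))"
  proof (rule Imono)
    show "continuous_on UNIV (\<lambda>(s, t). (cmod (H1 s t))\<^sup>2 + (cmod (H2 s t))\<^sup>2)"
      using continuous_on_add[OF csq[OF c1] csq[OF c2]] unfolding case_prod_unfold .
    show "continuous_on UNIV (\<lambda>(s, t). 2 * grad2 F (?c s t))"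
      using cg unfolding case_prod_unfold by (intro continuous_intros)
  qed (rule pw)
  also have "\<dots> = 2 * I (\<lambda>s t. grad2 F (?c s t))" by (rule Icm)
  finally have up: "I (\<lambda>s t. (cmod (H1 s t))\<^sup>2) + I (\<lambda>s t. (cmod (H2 s t))\<^sup>2) \<le> 2 * I (\<lambda>s t. grad2 F (?c s t))" .
  have e1: "(LINT p|lborel. indicator P p * (cmod (F p))\<^sup>2) = I (\<lambda>s t. (cmod (H s t))\<^sup>2) / 2"
    using para_integral[of "\<lambda>p. (cmod (F p))\<^sup>2" R d] R smooth_continuous_on[OF sF, of UNIV]
    by (simp add: P_def I_def H_def continuous_intros)
  have e2: "(LINT p|lborel. indicator P p * grad2 F p) = I (\<lambda>s t. grad2 F (?c s t)) / 2"
    using para_integral[of "grad2 F" R d] R grad2_continuous[OF sF, of UNIV]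
    by (simp add: P_def I_def)
  have e3: "(LINT p|lborel. indicator P p *\<^sub>R F p) = (1/2) *\<^sub>R J"
    using para_integral[of F R d] R smooth_continuous_on[OF sF, of UNIV]
    by (simp add: P_def J_def H_def)
  have n3: "(cmod (LINT p|lborel. indicator P p *\<^sub>R F p))\<^sup>2 = (cmod J)\<^sup>2 / 4"
    unfolding e3 by (simp add: power_divide)
  define X where "X = I (\<lambda>s t. (cmod (H s t))\<^sup>2)"
  define Y where "Y = I (\<lambda>s t. grad2 F (?c s t))"
  define Z where "Z = (cmod J)\<^sup>2"
  have "(pi / (d/2))\<^sup>2 * (X - Z / (d/2)\<^sup>2) \<le> 2 * Y" using sq up unfolding X_def Y_def Z_def by linarith
  moreover have "(pi / (d/2))\<^sup>2 * (X - Z / (d/2)\<^sup>2) = 4 * (pi / d)\<^sup>2 * X - 16 * (pi / d)\<^sup>2 / d\<^sup>2 * Z"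
  proof -
    have 1: "(pi / (d/2))\<^sup>2 = 4 * (pi / d)\<^sup>2" "Z / (d/2)\<^sup>2 = 4 * (Z / d\<^sup>2)" by (simp_all add: power_divide)
    have "4 * A * (X - 4 * (Z / d\<^sup>2)) = 4 * A * X - 16 * A / d\<^sup>2 * Z" for A
      by (simp add: right_diff_distrib)
    then show ?thesis unfolding 1 .
  qed
  ultimately have le: "4 * (pi / d)\<^sup>2 * X \<le> 2 * Y + 16 * (pi / d)\<^sup>2 / d\<^sup>2 * Z" by simp
  have "2 * (pi / d)\<^sup>2 * (X / 2) = (4 * (pi / d)\<^sup>2 * X) / 4" by simp
  also have "\<dots> \<le> (2 * Y + 16 * (pi / d)\<^sup>2 / d\<^sup>2 * Z) / 4" using le by (rule divide_right_mono) simp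
  also have "\<dots> = Y / 2 + 16 * (pi / d)\<^sup>2 / d\<^sup>2 * (Z / 4)" by (simp add: add_divide_distrib)
  finally show ?thesis unfolding e1 e2 n3 X_def[symmetric] Y_def[symmetric] Z_def[symmetric] .
qed

definition Omega_half :: "real \<Rightarrow> plane set" where
  "Omega_half d = {p \<in> Omega d. snd p < fst p}"

text \<open>\<open>F\<close> vanishes on the diagonal t = 0. In \<open>A1\<close> and
  \<open>A2\<close> a section runs from the diagonal to a free end at distance at most d / 2; in
  \<open>A3\<close> it runs from the diagonal to the Dirichlet boundary at distance d, and the
  tangent is centered at d / 2. The remainder \<open>P\<close> is treated by the Neumann inequality,
  at the price of the mean value.\<close>

lemma test_bound_a:
  assumes F: "F \<in> test_functions UNIV" and anti: "\<And>x y. F (y, x) = - F (x, y)"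
    and d: "0 < d" and \<theta>: "0 < \<theta>" "\<theta> < pi / d"
  defines "P \<equiv> {p :: plane. d / 2 < fst p + snd p \<and> fst p + snd p \<le> d \<and> 0 < snd p \<and> snd p \<le> d / 4}"
  shows "2 * \<theta>\<^sup>2 * (LINT p|lborel. indicator (Omega_half d) p * (cmod (F p))\<^sup>2)
     \<le> (LINT p|lborel. indicator (Omega_half d) p * grad2 F p)
      + 16 * (pi / d)\<^sup>2 / d\<^sup>2 * (cmod (LINT p|lborel. indicator P p *\<^sub>R F p))\<^sup>2
      + \<theta> * tan (\<theta> * (d / 2)) * (LINT s|lborel. bdry d F s)"
proof -
  define A1 where "A1 = {p :: plane. 0 < snd p \<and> snd p < fst p \<and> fst p + snd p \<le> d / 2}"
  define A2 where "A2 = {p :: plane. d / 2 < fst p + snd p \<and> fst p + snd p \<le> d \<and> snd p < fst p \<and> d / 4 < snd p}"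
  define A3 where "A3 = {p :: plane. d < fst p + snd p \<and> snd p < fst p \<and> fst p - snd p < d}"
  have "Measurable.pred borel (\<lambda>p::plane. 0 < snd p \<and> snd p < fst p \<and> fst p + snd p \<le> d / 2)"
    "Measurable.pred borel (\<lambda>p::plane. d / 2 < fst p + snd p \<and> fst p + snd p \<le> d \<and> snd p < fst p \<and> d / 4 < snd p)"
    "Measurable.pred borel (\<lambda>p::plane. d < fst p + snd p \<and> snd p < fst p \<and> fst p - snd p < d)"
    "Measurable.pred borel (\<lambda>p :: plane. d / 2 < fst p + snd p \<and> fst p + snd p \<le> d \<and> 0 < snd p \<and> snd p \<le> d / 4)" by measurable
  then have A: "A1 \<in> sets borel" "A2 \<in> sets borel" "A3 \<in> sets borel" "P \<in> sets borel"
    by (auto simp: A1_def A2_def A3_def P_def pred_def)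
  have part: "indicator (Omega_half d) p = (indicator P p + indicator A1 p + indicator A2 p + indicator A3 p :: real)" for p
    using d by (auto simp: indicator_def Omega_half_def Omega_def P_def A1_def A2_def A3_def split: if_splits)
  have diag: "F (rot (s, 0)) = 0" for s
    using anti[of "s/2" "s/2"] by (simp add: rot_def eq_neg_iff_add_eq_0)
  have r: "fst (rot (s, t)) = (s + t) / 2" "snd (rot (s, t)) = (s - t) / 2" for s t by (simp_all add: rot_def)
  have rr: "(s + t) / 2 + (s - t) / 2 = s" "(s + t) / 2 - (s - t) / 2 = t" for s t :: real by (auto simp: field_simps)
  have mA1: "rot (s, t) \<in> A1 \<longleftrightarrow> s \<le> d / 2 \<and> 0 < t \<and> t < s" for s t
    unfolding A1_def mem_Collect_eq r rr by (auto simp: field_simps)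
  have mA2: "rot (s, t) \<in> A2 \<longleftrightarrow> d / 2 < s \<and> s \<le> d \<and> 0 < t \<and> t < s - d / 2" for s t
    unfolding A2_def mem_Collect_eq r rr by (auto simp: field_simps)
  have mA3: "rot (s, t) \<in> A3 \<longleftrightarrow> d < s \<and> 0 < t \<and> t < d" for s t
    unfolding A3_def mem_Collect_eq r rr by (auto simp: field_simps)
  define k where "k = \<theta> * tan (\<theta> * (d / 2))"
  have \<theta>d: "\<theta> * (d / 2) < pi / 2" using \<theta> d by (simp add: field_simps)
  have k0: "0 \<le> k" unfolding k_def using \<theta> d \<theta>d by (intro mult_nonneg_nonneg tan_nonneg) auto
  have small: "\<bar>\<theta> * x\<bar> < pi / 2" if "\<bar>x\<bar> \<le> d / 2" for x
  proof -
    have "\<theta> * \<bar>x\<bar> \<le> \<theta> * (d / 2)" using that \<theta> by (intro mult_left_mono) auto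
    moreover have "\<bar>\<theta> * x\<bar> = \<theta> * \<bar>x\<bar>" using \<theta> by (simp add: abs_mult)
    ultimately show ?thesis using \<theta>d by linarith
  qed
  \<comment> \<open>The tangent is centered at the free end \<open>\<beta>\<close>, where its term
    vanishes; the other end term vanishes because \<open>F\<close> is 0 on the diagonal.\<close>
  have sl: "\<theta>\<^sup>2 * (LINT t|lborel. indicator B (rot (s, t)) * (cmod (F (rot (s, t))))\<^sup>2)
       \<le> (LINT t|lborel. indicator B (rot (s, t)) * (cmod (rot_t F (rot (s, t))))\<^sup>2) + 0"
    if B: "\<And>t. rot (s, t) \<in> B \<longleftrightarrow> 0 < t \<and> t < \<beta>" and b: "0 \<le> \<beta>" "\<beta> \<le> d / 2" for B s \<beta>
  proof -
    have "\<theta>\<^sup>2 * (LINT t|lborel. indicator B (rot (s, t)) * (cmod (F (rot (s, t))))\<^sup>2)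
       \<le> (LINT t|lborel. indicator B (rot (s, t)) * (cmod (rot_t F (rot (s, t))))\<^sup>2)
        + \<theta> * tan (\<theta> * (\<beta> - \<beta>)) * (cmod (F (rot (s, \<beta>))))\<^sup>2 - \<theta> * tan (\<theta> * (0 - \<beta>)) * (cmod (F (rot (s, 0))))\<^sup>2"
      by (rule slice_interval[OF F]) (use B b small in auto)
    then show ?thesis by (simp add: diag)
  qed
  have b1: "2 * \<theta>\<^sup>2 * (LINT p|lborel. indicator A1 p * (cmod (F p))\<^sup>2)
     \<le> (LINT p|lborel. indicator A1 p * grad2 F p) + (LINT s|lborel. (\<lambda>_. 0) (s::real))"
  proof (rule region_bound[OF F A(1)])
    fix s
    show "\<theta>\<^sup>2 * (LINT t|lborel. indicator A1 (rot (s, t)) * (cmod (F (rot (s, t))))\<^sup>2)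
       \<le> (LINT t|lborel. indicator A1 (rot (s, t)) * (cmod (rot_t F (rot (s, t))))\<^sup>2) + 0"
    proof (cases "0 \<le> s \<and> s \<le> d / 2")
      case True
      show ?thesis by (rule sl[where \<beta>=s]) (use True mA1 in auto)
    qed (rule slice_empty, auto simp: mA1)
  qed simp
  have b2: "2 * \<theta>\<^sup>2 * (LINT p|lborel. indicator A2 p * (cmod (F p))\<^sup>2)
     \<le> (LINT p|lborel. indicator A2 p * grad2 F p) + (LINT s|lborel. (\<lambda>_. 0) (s::real))"
  proof (rule region_bound[OF F A(2)])
    fix s
    show "\<theta>\<^sup>2 * (LINT t|lborel. indicator A2 (rot (s, t)) * (cmod (F (rot (s, t))))\<^sup>2)
       \<le> (LINT t|lborel. indicator A2 (rot (s, t)) * (cmod (rot_t F (rot (s, t))))\<^sup>2) + 0"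
    proof (cases "d / 2 < s \<and> s \<le> d")
      case True
      show ?thesis by (rule sl[where \<beta>="s - d / 2"]) (use True mA2 in auto)
    qed (rule slice_empty, auto simp: mA2)
  qed simp
  have b3: "2 * \<theta>\<^sup>2 * (LINT p|lborel. indicator A3 p * (cmod (F p))\<^sup>2)
     \<le> (LINT p|lborel. indicator A3 p * grad2 F p) + (LINT s|lborel. k * bdry d F s)"
  proof (rule region_bound[OF F A(3) bdry_scaled[OF bdry_integrable[OF F]]])
    fix s
    show "\<theta>\<^sup>2 * (LINT t|lborel. indicator A3 (rot (s, t)) * (cmod (F (rot (s, t))))\<^sup>2)
       \<le> (LINT t|lborel. indicator A3 (rot (s, t)) * (cmod (rot_t F (rot (s, t))))\<^sup>2) + k * bdry d F s"
    proof (cases "d < s")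
      case True
      have "\<theta>\<^sup>2 * (LINT t|lborel. indicator A3 (rot (s, t)) * (cmod (F (rot (s, t))))\<^sup>2)
         \<le> (LINT t|lborel. indicator A3 (rot (s, t)) * (cmod (rot_t F (rot (s, t))))\<^sup>2)
        + \<theta> * tan (\<theta> * (d - d / 2)) * (cmod (F (rot (s, d))))\<^sup>2 - \<theta> * tan (\<theta> * (0 - d / 2)) * (cmod (F (rot (s, 0))))\<^sup>2"
      proof (rule slice_interval[OF F])
        fix t assume "0 \<le> t" "t \<le> d"
        then have "t - d / 2 \<le> d / 2" "- (t - d / 2) \<le> d / 2" by (auto simp: field_simps)
        then show "\<bar>\<theta> * (t - d / 2)\<bar> < pi / 2" by (intro small abs_leI)
      qed (use d True mA3 in auto)
      moreover have "d - d / 2 = d / 2" by simp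
      ultimately have "\<theta>\<^sup>2 * (LINT t|lborel. indicator A3 (rot (s, t)) * (cmod (F (rot (s, t))))\<^sup>2)
         \<le> (LINT t|lborel. indicator A3 (rot (s, t)) * (cmod (rot_t F (rot (s, t))))\<^sup>2) + k * (cmod (F (rot (s, d))))\<^sup>2"
        by (simp only: diag k_def) simp
      moreover have "k * (cmod (F (rot (s, d))))\<^sup>2 \<le> k * bdry d F s"
        using True k0 by (auto simp: bdry_def intro!: mult_left_mono)
      ultimately show ?thesis by linarith
    qed (intro slice_empty mult_nonneg_nonneg k0 bdry_nonneg, auto simp: mA3)
  qed
  have sq: "2 * \<theta>\<^sup>2 \<le> 2 * (pi / d)\<^sup>2" using \<theta> by (auto intro!: power_mono)
  have "2 * \<theta>\<^sup>2 * (LINT p|lborel. indicator P p * (cmod (F p))\<^sup>2) \<le> 2 * (pi / d)\<^sup>2 * (LINT p|lborel. indicator P p * (cmod (F p))\<^sup>2)"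
    by (rule mult_right_mono[OF sq]) (simp add: integral_nonneg_AE)
  also have "\<dots> \<le> (LINT p|lborel. indicator P p * grad2 F p) + 16 * (pi / d)\<^sup>2 / d\<^sup>2 * (cmod (LINT p|lborel. indicator P p *\<^sub>R F p))\<^sup>2"
    unfolding P_def by (rule parallelogram_bound[OF F d])
  finally have b0: "2 * \<theta>\<^sup>2 * (LINT p|lborel. indicator P p * (cmod (F p))\<^sup>2) \<le> \<dots>" .
  have sum: "(LINT p|lborel. indicator (Omega_half d) p * h p) = (LINT p|lborel. indicator P p * h p)
      + (LINT p|lborel. indicator A1 p * h p) + (LINT p|lborel. indicator A2 p * h p) + (LINT p|lborel. indicator A3 p * h p)"
    if "\<And>S. S \<in> sets borel \<Longrightarrow> integrable lborel (\<lambda>p. indicator S p * h p)" for h :: "plane \<Rightarrow> real"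
    unfolding part distrib_right using that A by simp
  have sN: "(LINT p|lborel. indicator (Omega_half d) p * (cmod (F p))\<^sup>2) = (LINT p|lborel. indicator P p * (cmod (F p))\<^sup>2)
      + (LINT p|lborel. indicator A1 p * (cmod (F p))\<^sup>2) + (LINT p|lborel. indicator A2 p * (cmod (F p))\<^sup>2)
      + (LINT p|lborel. indicator A3 p * (cmod (F p))\<^sup>2)"
    by (rule sum) (rule test_integrable_sets(1)[OF F])
  have sG: "(LINT p|lborel. indicator (Omega_half d) p * grad2 F p) = (LINT p|lborel. indicator P p * grad2 F p)
      + (LINT p|lborel. indicator A1 p * grad2 F p) + (LINT p|lborel. indicator A2 p * grad2 F p)
      + (LINT p|lborel. indicator A3 p * grad2 F p)"
    by (rule sum) (rule test_integrable_sets(2)[OF F])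
  have "(LINT s|lborel. k * bdry d F s) = k * (LINT s|lborel. bdry d F s)" "(LINT s|lborel. (\<lambda>_. 0 :: real) (s::real)) = 0" by simp_all
  then show ?thesis
    unfolding sN sG k_def[symmetric] distrib_left
    using b0 b1 b2 b3 by linarith
qed

section \<open>The form domain\<close>

lemma Omega_alt: "Omega d = {p. 0 < fst p \<and> 0 < snd p \<and> \<bar>fst p - snd p\<bar> < d}"
  by (auto simp: Omega_def)

lemma open_Omega: "open (Omega d)"
  unfolding Omega_alt by (intro open_Collect_conj open_Collect_less continuous_intros)

lemma Omega_borel [measurable]: "Omega d \<in> sets borel"
  by (rule open_sets_borel[OF open_Omega])

section \<open>Arc length on the Dirichlet boundary and zero trace\<close>

lemma scale_measure_density: "scale_measure r M = density M (\<lambda>_. r)"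
  by (rule measure_eqI) (auto simp: emeasure_density nn_integral_cmult_indicator)

lemma boundary_param_measurable [measurable]: "boundary_param d \<in> borel_measurable borel"
  unfolding boundary_param_def by (intro measurable_If borel_measurable_Pair) auto

lemma boundary_integral:
  fixes h :: "plane \<Rightarrow> real"
  assumes h[measurable]: "h \<in> borel_measurable borel"
  shows "integrable (boundary_measure d) h \<longleftrightarrow> integrable lborel (\<lambda>t. h (boundary_param d t))"
    and "(LINT p|boundary_measure d. h p) = sqrt 2 * (LINT t|lborel. h (boundary_param d t))"
proof -
  have bm: "boundary_measure d = density (distr lborel borel (boundary_param d)) (\<lambda>_. ennreal (sqrt 2))"
    unfolding boundary_measure_def scale_measure_density ..
  have "integrable (boundary_measure d) h \<longleftrightarrow> integrable (distr lborel borel (boundary_param d)) (\<lambda>x. sqrt 2 *\<^sub>R h x)"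
    unfolding bm by (rule integrable_density) auto
  also have "\<dots> \<longleftrightarrow> integrable lborel (\<lambda>t. sqrt 2 *\<^sub>R h (boundary_param d t))"
    by (rule integrable_distr_eq) auto
  finally show "integrable (boundary_measure d) h \<longleftrightarrow> integrable lborel (\<lambda>t. h (boundary_param d t))" by simp
  have "(LINT p|boundary_measure d. h p) = (LINT p|distr lborel borel (boundary_param d). sqrt 2 *\<^sub>R h p)"
    unfolding bm by (rule integral_density) auto
  also have "\<dots> = (LINT t|lborel. sqrt 2 *\<^sub>R h (boundary_param d t))"
    by (rule integral_distr) auto
  finally show "(LINT p|boundary_measure d. h p) = sqrt 2 * (LINT t|lborel. h (boundary_param d t))" by simp
qed

text \<open>On either ray s = d + 2 |t| for the parameter t of \<open>boundary_param\<close>, so the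
  line element sqrt 2 dt becomes (sqrt 2 / 2) ds.\<close>

lemma boundary_norm_test:
  assumes F: "F \<in> test_functions UNIV"
  shows "(l2_norm (boundary_measure d) F)\<^sup>2 = sqrt 2 / 2 * (LINT s|lborel. bdry d F s)"
proof -
  have m[measurable]: "F \<in> borel_measurable borel" by (rule test_measurable[OF F])
  obtain R where R: "R > 0" "\<And>p. R \<le> norm p \<Longrightarrow> F p = 0" using test_support[OF F] by blast
  define h where "h t s = indicator {d<..} s *\<^sub>R (cmod (F (rot (s, t))))\<^sup>2" for t s
  have hi: "integrable lborel (h t)" for t
    unfolding h_def
    by (rule rot_section_integrable[where R=R and h="\<lambda>p. (cmod (F p))\<^sup>2"])
      (use R in \<open>auto intro!: continuous_intros smooth_continuous_on test_smooth[OF F]\<close>)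
  have i1: "integrable lborel (\<lambda>t. h (- d) (d + 2 * t))" "integrable lborel (\<lambda>t. h d (d + (- 2) * t))"
    using lborel_integrable_real_affine[OF hi[of "- d"], of 2 d] lborel_integrable_real_affine[OF hi[of d], of "- 2" d] by simp_all
  have "(l2_norm (boundary_measure d) F)\<^sup>2 = sqrt 2 * (LINT t|lborel. (cmod (F (boundary_param d t)))\<^sup>2)"
    unfolding l2_norm_sq by (rule boundary_integral(2)) measurable
  also have "(LINT t|lborel. (cmod (F (boundary_param d t)))\<^sup>2) = (LINT t|lborel. h (- d) (d + 2 * t) + h d (d + (- 2) * t))"
  proof (rule integral_cong_AE)
    show "AE t in lborel. (cmod (F (boundary_param d t)))\<^sup>2 = h (- d) (d + 2 * t) + h d (d + (- 2) * t)"
      using AE_lborel_singleton[of 0]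
    proof eventually_elim
      case (elim t)
      have "rot (d + 2 * t, - d) = (t, t + d)" "rot (d + (- 2) * t, d) = (d - t, - t)"
        by (auto simp: rot_def field_simps)
      then show ?case using elim by (auto simp: h_def boundary_param_def indicator_def)
    qed
    show "(\<lambda>t. h (- d) (d + 2 * t) + h d (d + (- 2) * t)) \<in> borel_measurable lborel"
      using Bochner_Integration.integrable_add[OF i1] by auto
  qed measurable
  also have "\<dots> = (LINT t|lborel. h (- d) (d + 2 * t)) + (LINT t|lborel. h d (d + (- 2) * t))"
    by (rule Bochner_Integration.integral_add[OF i1])
  also have "\<dots> = (LINT s|lborel. h (- d) s) / 2 + (LINT s|lborel. h d s) / 2"
    using lborel_integral_real_affine[of 2 "h (- d)" d] lborel_integral_real_affine[of "- 2" "h d" d] by simp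
  also have "\<dots> = (LINT s|lborel. h d s + h (- d) s) / 2"
    by (subst Bochner_Integration.integral_add[OF hi hi]) simp
  also have "(LINT s|lborel. h d s + h (- d) s) = (LINT s|lborel. bdry d F s)"
    by (intro Bochner_Integration.integral_cong refl) (simp add: h_def bdry_def distrib_left)
  finally show ?thesis by simp
qed

text \<open>Zero trace, with the boundary norm expressed through \<open>bdry\<close>. The test
  functions need not vanish on the boundary; only their boundary norms tend to 0.\<close>

definition approximates :: "real \<Rightarrow> (plane \<Rightarrow> complex) \<Rightarrow> (nat \<Rightarrow> plane \<Rightarrow> complex) \<Rightarrow> bool" where
  "approximates d f F \<longleftrightarrow> (\<forall>n. F n \<in> test_functions UNIV) \<and>
     (\<lambda>n. H1_norm (Omega d) (\<lambda>p. F n p - f p)) \<longlonglongrightarrow> 0 \<and> (\<lambda>n. LINT s|lborel. bdry d (F n) s) \<longlonglongrightarrow> 0"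

lemma has_trace_zero_iff:
  assumes "f \<in> H1 (Omega d)"
  shows "has_trace d f (\<lambda>_. 0) \<longleftrightarrow> (\<exists>F. approximates d f F)"
proof -
  have z: "(\<lambda>_. 0) \<in> L2 (boundary_measure d)" by (simp add: L2_def)
  have eq: "(\<lambda>n. l2_norm (boundary_measure d) (\<lambda>p. F n p - 0)) \<longlonglongrightarrow> 0 \<longleftrightarrow> (\<lambda>n. LINT s|lborel. bdry d (F n) s) \<longlonglongrightarrow> 0"
    if F: "\<And>n. F n \<in> test_functions UNIV" for F
  proof
    assume "(\<lambda>n. l2_norm (boundary_measure d) (\<lambda>p. F n p - 0)) \<longlonglongrightarrow> 0"
    then have "(\<lambda>n. (l2_norm (boundary_measure d) (F n))\<^sup>2) \<longlonglongrightarrow> 0\<^sup>2" by (intro tendsto_power) simp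
    then have "(\<lambda>n. sqrt 2 / 2 * (LINT s|lborel. bdry d (F n) s)) \<longlonglongrightarrow> 0" by (simp add: boundary_norm_test[OF F])
    from tendsto_mult_left[OF this, of "sqrt 2"] show "(\<lambda>n. LINT s|lborel. bdry d (F n) s) \<longlonglongrightarrow> 0" by simp
  next
    assume "(\<lambda>n. LINT s|lborel. bdry d (F n) s) \<longlonglongrightarrow> 0"
    then have "(\<lambda>n. sqrt (sqrt 2 / 2 * (LINT s|lborel. bdry d (F n) s))) \<longlonglongrightarrow> sqrt (sqrt 2 / 2 * 0)"
      by (intro tendsto_real_sqrt tendsto_mult_left)
    moreover have "sqrt (sqrt 2 / 2 * (LINT s|lborel. bdry d (F n) s)) = l2_norm (boundary_measure d) (F n)" for n
      unfolding boundary_norm_test[OF F, symmetric] by (simp add: l2_norm_def)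
    ultimately show "(\<lambda>n. l2_norm (boundary_measure d) (\<lambda>p. F n p - 0)) \<longlonglongrightarrow> 0" by simp
  qed
  show ?thesis
    unfolding has_trace_def approximates_def using assms z eq by (auto simp del: diff_0_right)
qed

text \<open>The inner product of H1; as an \<open>hform\<close> it gives \<open>H1_norm\<close> its
  triangle inequality.\<close>

definition energy :: "real \<Rightarrow> (plane \<Rightarrow> complex) \<Rightarrow> (plane \<Rightarrow> complex) \<Rightarrow> complex" where
  "energy d f g = l2_inner (lebesgue_on (Omega d)) f g + dirichlet_form (Omega d) f g"

lemma hform_energy: "hform fcomb (H1 (Omega d)) (energy d)"
proof -
  interpret A: hform fcomb "H1 (Omega d)" "dirichlet_form (Omega d)" by (rule hform_dirichlet[OF open_Omega])
  show ?thesis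
  proof
    fix x y f g :: "plane \<Rightarrow> complex" and a b :: complex
    show "fcomb a f b g \<in> H1 (Omega d)" if "f \<in> H1 (Omega d)" "g \<in> H1 (Omega d)" using that by (rule A.cb_closed)
    show "energy d x (fcomb a f b g) = a * energy d x f + b * energy d x g"
      if "x \<in> H1 (Omega d)" "f \<in> H1 (Omega d)" "g \<in> H1 (Omega d)"
      unfolding energy_def L2.lin[OF that[THEN H1_L2]] A.lin[OF that] by (simp add: algebra_simps)
    show "energy d y x = cnj (energy d x y)" if "x \<in> H1 (Omega d)" "y \<in> H1 (Omega d)"
      unfolding energy_def using L2.sym[OF that[THEN H1_L2]] A.sym[OF that] by simp
    show "0 \<le> Re (energy d x x)" if "x \<in> H1 (Omega d)"
      unfolding energy_def using L2.pos[OF H1_L2[OF that]] A.pos[OF that] by simp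
  qed
qed

interpretation E: hform fcomb "H1 (Omega d)" "energy d" for d by (rule hform_energy)
interpretation A: hform fcomb "H1 (Omega d)" "dirichlet_form (Omega d)" for d by (rule hform_dirichlet[OF open_Omega])

lemma H1_norm_energy:
  assumes "f \<in> H1 (Omega d)" shows "H1_norm (Omega d) f = sqrt (Re (energy d f f))"
proof -
  have "H1_norm (Omega d) f \<ge> 0" by (auto simp: H1_norm_def intro!: add_nonneg_nonneg sum_nonneg)
  moreover have "(H1_norm (Omega d) f)\<^sup>2 = Re (energy d f f)" unfolding H1_norm_sq[OF assms] energy_def by simp
  ultimately show ?thesis by (metis real_sqrt_unique)
qed

lemma H1_diff: "f \<in> H1 (Omega d) \<Longrightarrow> g \<in> H1 (Omega d) \<Longrightarrow> (\<lambda>p. f p - g p) \<in> H1 (Omega d)"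
  using H1_comb[OF open_Omega, of f d g 1 "-1"] by simp

lemma test_in_H1: "F \<in> test_functions UNIV \<Longrightarrow> F \<in> H1 (Omega d)"
  by (rule test_H1[OF open_Omega])

lemma H1_norm_le_comb:
  assumes "f \<in> H1 (Omega d)" "g \<in> H1 (Omega d)"
  shows "H1_norm (Omega d) (fcomb a f b g) \<le> cmod a * H1_norm (Omega d) f + cmod b * H1_norm (Omega d) g"
  using E.triangle[OF assms, of a b] by (simp add: H1_norm_energy assms H1_comb[OF open_Omega])

lemma bdry_comb: "bdry d (fcomb a F b G) s \<le> 2 * (cmod a)\<^sup>2 * bdry d F s + 2 * (cmod b)\<^sup>2 * bdry d G s"
proof -
  have le: "(cmod (a * x + b * y))\<^sup>2 \<le> 2 * (cmod a)\<^sup>2 * (cmod x)\<^sup>2 + 2 * (cmod b)\<^sup>2 * (cmod y)\<^sup>2" for x y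
  proof -
    have "(cmod (a * x + b * y))\<^sup>2 \<le> (cmod (a * x) + cmod (b * y))\<^sup>2" by (intro power_mono norm_triangle_ineq) auto
    also have "\<dots> \<le> 2 * (cmod (a * x))\<^sup>2 + 2 * (cmod (b * y))\<^sup>2"
      using sum_squares_bound[of "cmod (a * x)" "cmod (b * y)"] by (simp add: power2_sum)
    finally show ?thesis by (simp add: norm_mult power_mult_distrib)
  qed
  show ?thesis
    using add_mono[OF le[of "F (rot (s, d))" "G (rot (s, d))"] le[of "F (rot (s, - d))" "G (rot (s, - d))"]]
    by (simp add: bdry_def indicator_def algebra_simps)
qed

lemma approximates_comb:
  assumes f: "f \<in> H1 (Omega d)" "approximates d f F" and g: "g \<in> H1 (Omega d)" "approximates d g G"
  shows "approximates d (fcomb a f b g) (\<lambda>n. fcomb a (F n) b (G n))"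
proof -
  have T: "F n \<in> test_functions UNIV" "G n \<in> test_functions UNIV" for n using f g by (auto simp: approximates_def)
  note H = test_in_H1[OF T(1), of _ d] test_in_H1[OF T(2), of _ d]
  have "(\<lambda>n. H1_norm (Omega d) (\<lambda>p. (a * F n p + b * G n p) - (a * f p + b * g p))) \<longlonglongrightarrow> 0"
  proof (rule tendsto_sandwich)
    show "\<forall>\<^sub>F n in sequentially. 0 \<le> H1_norm (Omega d) (\<lambda>p. (a * F n p + b * G n p) - (a * f p + b * g p))"
      by (auto simp: H1_norm_def intro!: always_eventually add_nonneg_nonneg sum_nonneg)
    show "\<forall>\<^sub>F n in sequentially. H1_norm (Omega d) (\<lambda>p. (a * F n p + b * G n p) - (a * f p + b * g p))
       \<le> cmod a * H1_norm (Omega d) (\<lambda>p. F n p - f p) + cmod b * H1_norm (Omega d) (\<lambda>p. G n p - g p)"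
    proof (rule always_eventually, rule allI)
      fix n
      have e: "(\<lambda>p. (a * F n p + b * G n p) - (a * f p + b * g p)) = fcomb a (\<lambda>p. F n p - f p) b (\<lambda>p. G n p - g p)"
        by (simp add: algebra_simps)
      show "H1_norm (Omega d) (\<lambda>p. (a * F n p + b * G n p) - (a * f p + b * g p))
       \<le> cmod a * H1_norm (Omega d) (\<lambda>p. F n p - f p) + cmod b * H1_norm (Omega d) (\<lambda>p. G n p - g p)"
        unfolding e by (rule H1_norm_le_comb[OF H1_diff[OF H(1) f(1)] H1_diff[OF H(2) g(1)]])
    qed
    have "(\<lambda>n. cmod a * H1_norm (Omega d) (\<lambda>p. F n p - f p) + cmod b * H1_norm (Omega d) (\<lambda>p. G n p - g p))
       \<longlonglongrightarrow> cmod a * 0 + cmod b * 0"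
      using f g unfolding approximates_def by (intro tendsto_add tendsto_mult tendsto_const) auto
    then show "(\<lambda>n. cmod a * H1_norm (Omega d) (\<lambda>p. F n p - f p) + cmod b * H1_norm (Omega d) (\<lambda>p. G n p - g p))
       \<longlonglongrightarrow> 0" by simp
  qed simp
  moreover have "(\<lambda>n. LINT s|lborel. bdry d (fcomb a (F n) b (G n)) s) \<longlonglongrightarrow> 0"
  proof (rule tendsto_sandwich)
    show "\<forall>\<^sub>F n in sequentially. 0 \<le> (LINT s|lborel. bdry d (fcomb a (F n) b (G n)) s)"
      by (intro always_eventually allI integral_nonneg_AE AE_I2 bdry_nonneg)
    show "\<forall>\<^sub>F n in sequentially. (LINT s|lborel. bdry d (fcomb a (F n) b (G n)) s)
       \<le> 2 * (cmod a)\<^sup>2 * (LINT s|lborel. bdry d (F n) s) + 2 * (cmod b)\<^sup>2 * (LINT s|lborel. bdry d (G n) s)"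
    proof (rule always_eventually, rule allI)
      fix n
      have i: "integrable lborel (\<lambda>s. 2 * (cmod a)\<^sup>2 * bdry d (F n) s)" "integrable lborel (\<lambda>s. 2 * (cmod b)\<^sup>2 * bdry d (G n) s)"
        by (intro integrable_mult_right bdry_integrable T)+
      have "(LINT s|lborel. bdry d (fcomb a (F n) b (G n)) s) \<le> (LINT s|lborel. 2 * (cmod a)\<^sup>2 * bdry d (F n) s + 2 * (cmod b)\<^sup>2 * bdry d (G n) s)"
        by (rule integral_mono[OF bdry_integrable[OF test_comb[OF T]] Bochner_Integration.integrable_add[OF i] bdry_comb])
      also have "\<dots> = 2 * (cmod a)\<^sup>2 * (LINT s|lborel. bdry d (F n) s) + 2 * (cmod b)\<^sup>2 * (LINT s|lborel. bdry d (G n) s)"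
        by (subst Bochner_Integration.integral_add[OF i]) simp
      finally show "(LINT s|lborel. bdry d (fcomb a (F n) b (G n)) s)
       \<le> 2 * (cmod a)\<^sup>2 * (LINT s|lborel. bdry d (F n) s) + 2 * (cmod b)\<^sup>2 * (LINT s|lborel. bdry d (G n) s)" .
    qed
    have "(\<lambda>n. 2 * (cmod a)\<^sup>2 * (LINT s|lborel. bdry d (F n) s) + 2 * (cmod b)\<^sup>2 * (LINT s|lborel. bdry d (G n) s))
       \<longlonglongrightarrow> 2 * (cmod a)\<^sup>2 * 0 + 2 * (cmod b)\<^sup>2 * 0"
      using f g unfolding approximates_def by (intro tendsto_add tendsto_mult tendsto_const) auto
    then show "(\<lambda>n. 2 * (cmod a)\<^sup>2 * (LINT s|lborel. bdry d (F n) s) + 2 * (cmod b)\<^sup>2 * (LINT s|lborel. bdry d (G n) s))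
       \<longlonglongrightarrow> 0" by simp
  qed simp
  ultimately show ?thesis unfolding approximates_def using test_comb[OF T] by blast
qed

text \<open>A diagonal choice: among the approximants of \<open>f k\<close> one is taken whose
  distance to \<open>f k\<close> and whose boundary integral are below 1 / (k + 1).\<close>

lemma approximates_limit:
  assumes f: "\<And>k. f k \<in> H1 (Omega d)" "\<And>k. \<exists>F. approximates d (f k) F" and l: "l \<in> H1 (Omega d)"
    and lim: "(\<lambda>k. Re (energy d (fcomb 1 (f k) (- 1) l) (fcomb 1 (f k) (- 1) l))) \<longlonglongrightarrow> 0"
  shows "\<exists>F. approximates d l F"
proof -
  have "\<exists>G. G \<in> test_functions UNIV \<and> H1_norm (Omega d) (\<lambda>p. G p - f k p) < inverse (real (Suc k))
      \<and> (LINT s|lborel. bdry d G s) < inverse (real (Suc k))" for k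
  proof -
    obtain F where F: "approximates d (f k) F" using f(2) by blast
    have e: "0 < inverse (real (Suc k))" by simp
    have "eventually (\<lambda>n. H1_norm (Omega d) (\<lambda>p. F n p - f k p) < inverse (real (Suc k))) sequentially"
      "eventually (\<lambda>n. (LINT s|lborel. bdry d (F n) s) < inverse (real (Suc k))) sequentially"
      using F e unfolding approximates_def by (auto intro: order_tendstoD(2))
    from eventually_conj[OF this] obtain n where "H1_norm (Omega d) (\<lambda>p. F n p - f k p) < inverse (real (Suc k))"
      "(LINT s|lborel. bdry d (F n) s) < inverse (real (Suc k))" by (auto simp: eventually_sequentially)
    then show ?thesis using F unfolding approximates_def by blast
  qed
  then obtain G where G: "\<And>k. G k \<in> test_functions UNIV" "\<And>k. H1_norm (Omega d) (\<lambda>p. G k p - f k p) < inverse (real (Suc k))"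
      "\<And>k. (LINT s|lborel. bdry d (G k) s) < inverse (real (Suc k))" by metis
  have "(\<lambda>n. H1_norm (Omega d) (\<lambda>p. G n p - l p)) \<longlonglongrightarrow> 0"
  proof (rule tendsto_sandwich)
    show "\<forall>\<^sub>F n in sequentially. 0 \<le> H1_norm (Omega d) (\<lambda>p. G n p - l p)"
      by (auto simp: H1_norm_def intro!: always_eventually add_nonneg_nonneg sum_nonneg)
    show "\<forall>\<^sub>F n in sequentially. H1_norm (Omega d) (\<lambda>p. G n p - l p) \<le> inverse (real (Suc n)) + sqrt (Re (energy d (fcomb 1 (f n) (- 1) l) (fcomb 1 (f n) (- 1) l)))"
    proof (rule always_eventually, rule allI)
      fix n
      have e: "(\<lambda>p. G n p - l p) = fcomb 1 (\<lambda>p. G n p - f n p) 1 (\<lambda>p. f n p - l p)" by simp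
      have "H1_norm (Omega d) (\<lambda>p. G n p - l p) \<le> cmod 1 * H1_norm (Omega d) (\<lambda>p. G n p - f n p) + cmod 1 * H1_norm (Omega d) (\<lambda>p. f n p - l p)"
        unfolding e by (rule H1_norm_le_comb[OF H1_diff[OF test_in_H1[OF G(1)] f(1)] H1_diff[OF f(1) l]])
      moreover have "H1_norm (Omega d) (\<lambda>p. f n p - l p) = sqrt (Re (energy d (fcomb 1 (f n) (- 1) l) (fcomb 1 (f n) (- 1) l)))"
        using H1_norm_energy[OF H1_diff[OF f(1) l], of n] by simp
      ultimately show "H1_norm (Omega d) (\<lambda>p. G n p - l p) \<le> inverse (real (Suc n)) + sqrt (Re (energy d (fcomb 1 (f n) (- 1) l) (fcomb 1 (f n) (- 1) l)))"
        using G(2)[of n] by simp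
    qed
    have "(\<lambda>n. inverse (real (Suc n)) + sqrt (Re (energy d (fcomb 1 (f n) (- 1) l) (fcomb 1 (f n) (- 1) l)))) \<longlonglongrightarrow> 0 + sqrt 0"
      by (intro tendsto_add LIMSEQ_inverse_real_of_nat tendsto_real_sqrt lim)
    then show "(\<lambda>n. inverse (real (Suc n)) + sqrt (Re (energy d (fcomb 1 (f n) (- 1) l) (fcomb 1 (f n) (- 1) l)))) \<longlonglongrightarrow> 0" by (simp only: real_sqrt_zero add_0_left)
  qed simp
  moreover have "(\<lambda>n. LINT s|lborel. bdry d (G n) s) \<longlonglongrightarrow> 0"
  proof (rule tendsto_sandwich[OF _ _ tendsto_const LIMSEQ_inverse_real_of_nat])
    show "\<forall>\<^sub>F n in sequentially. 0 \<le> (LINT s|lborel. bdry d (G n) s)"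
      by (intro always_eventually allI integral_nonneg_AE AE_I2 bdry_nonneg)
    show "\<forall>\<^sub>F n in sequentially. (LINT s|lborel. bdry d (G n) s) \<le> inverse (real (Suc n))"
      by (intro always_eventually allI less_imp_le G(3))
  qed
  ultimately show ?thesis unfolding approximates_def using G(1) by blast
qed

subsection \<open>Exchange of the coordinates\<close>

definition flip :: "plane \<Rightarrow> plane" where "flip p = (snd p, fst p)"

lemma flip_flip [simp]: "flip (flip p) = p" by (simp add: flip_def)

lemma flip_measurable [measurable]: "flip \<in> borel_measurable borel"
  unfolding flip_def[abs_def] by (intro borel_measurable_continuous_onI continuous_intros)

lemma distr_flip: "distr lborel lborel flip = lborel"
proof -
  have "distr (lborel \<Otimes>\<^sub>M lborel) (lborel \<Otimes>\<^sub>M lborel) (\<lambda>(x, y). (y, x)) = (lborel \<Otimes>\<^sub>M lborel :: plane measure)"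
    by (rule lborel_pair.distr_pair_swap[symmetric])
  moreover have "(\<lambda>(x, y). (y, x)) = flip" by (auto simp: flip_def)
  ultimately show ?thesis by (simp only: lborel_prod)
qed

lemma flip_lborel: "flip \<in> lborel \<rightarrow>\<^sub>M lborel" using flip_measurable by simp

lemma AE_flip: "AE p in lborel. P p \<Longrightarrow> AE p in lborel. P (flip p)"
  using AE_distrD[OF flip_lborel, of P] unfolding distr_flip .

lemma integral_flip:
  fixes h :: "plane \<Rightarrow> 'b::{banach, second_countable_topology}"
  assumes "h \<in> borel_measurable borel"
  shows "(LINT p|lborel. h (flip p)) = (LINT p|lborel. h p)"
    and "integrable lborel (\<lambda>p. h (flip p)) \<longleftrightarrow> integrable lborel h"
  using integral_distr[OF flip_lborel, of h] integrable_distr_eq[OF flip_lborel, of h] assms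
  by (simp_all add: distr_flip)

lemma AE_Omega_iff: "(AE p in lebesgue_on (Omega d). P p) \<longleftrightarrow> (AE p in lborel. p \<in> Omega d \<longrightarrow> P p)"
  by (subst AE_restrict_space_iff) (auto simp: AE_completion_iff)

lemma Omega_flip: "flip p \<in> Omega d \<longleftrightarrow> p \<in> Omega d"
  by (auto simp: flip_def Omega_alt)

lemma AE_Omega_flip: "AE p in lebesgue_on (Omega d). P p \<Longrightarrow> AE p in lebesgue_on (Omega d). P (flip p)"
  unfolding AE_Omega_iff using AE_flip[of "\<lambda>p. p \<in> Omega d \<longrightarrow> P p"] by (simp add: Omega_flip)

text \<open>Members of L2 are only Lebesgue measurable; a Borel version can be composed with
  \<open>flip\<close> and integrated by substitution.\<close>

lemma borel_representative:
  assumes "f \<in> borel_measurable (lebesgue_on (Omega d))"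
  obtains g :: "plane \<Rightarrow> complex" where "g \<in> borel_measurable borel" "AE p in lebesgue_on (Omega d). f p = g p"
proof -
  have S: "Omega d \<inter> space lebesgue \<in> sets lebesgue" by auto
  have ex: "\<exists>r\<in>borel_measurable lborel. AE p in lborel. indicator (Omega d) p * h p = r p"
    if h: "h \<in> borel_measurable (lebesgue_on (Omega d))" for h :: "plane \<Rightarrow> real"
  proof -
    have "(\<lambda>p. indicator (Omega d) p * h p) \<in> borel_measurable lebesgue"
      using h borel_measurable_restrict_space_iff[OF S, of h] by (simp add: mult.commute)
    then show ?thesis by (rule completion_ex_borel_measurable_real)
  qed
  have "(\<lambda>p. Re (f p)) \<in> borel_measurable (lebesgue_on (Omega d))" "(\<lambda>p. Im (f p)) \<in> borel_measurable (lebesgue_on (Omega d))"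
    using assms by measurable
  from ex[OF this(1)] ex[OF this(2)]
  obtain r i where ri: "r \<in> borel_measurable lborel" "AE p in lborel. indicator (Omega d) p * Re (f p) = r p"
    "i \<in> borel_measurable lborel" "AE p in lborel. indicator (Omega d) p * Im (f p) = i p"
    by (elim bexE)
  show ?thesis
  proof (rule that[of "\<lambda>p. Complex (r p) (i p)"])
    show "(\<lambda>p. Complex (r p) (i p)) \<in> borel_measurable borel"
      using ri by (subst borel_measurable_complex_iff) simp
    show "AE p in lebesgue_on (Omega d). f p = Complex (r p) (i p)"
      unfolding AE_Omega_iff using ri(2,4) by eventually_elim (auto simp: complex_eq_iff)
  qed
qed

lemma L2_flip:
  assumes b: "f \<in> borel_measurable borel" and f: "f \<in> L2 (lebesgue_on (Omega d))"
  shows "(\<lambda>p. f (flip p)) \<in> L2 (lebesgue_on (Omega d))"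
    and "Re (l2_inner (lebesgue_on (Omega d)) (\<lambda>p. f (flip p)) (\<lambda>p. f (flip p))) = Re (l2_inner (lebesgue_on (Omega d)) f f)"
proof -
  note b[measurable]
  let ?h = "\<lambda>p. indicator (Omega d) p *\<^sub>R (cmod (f p))\<^sup>2"
  have e: "(\<lambda>p. indicator (Omega d) p *\<^sub>R (cmod (f (flip p)))\<^sup>2) = (\<lambda>p. ?h (flip p))"
    by (auto simp: indicator_def Omega_flip)
  have m: "?h \<in> borel_measurable borel" by measurable
  have m1: "(\<lambda>p. (cmod (f p))\<^sup>2) \<in> borel_measurable borel" "(\<lambda>p. (cmod (f (flip p)))\<^sup>2) \<in> borel_measurable borel"
    by measurable
  have "integrable lborel ?h"
    using L2_integrable_sq[OF f] integral_lebesgue_on_borel(2)[OF Omega_borel m1(1)] by simp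
  then have i: "integrable (lebesgue_on (Omega d)) (\<lambda>p. (cmod (f (flip p)))\<^sup>2)"
    unfolding integral_lebesgue_on_borel(2)[OF Omega_borel m1(2)] e using integral_flip(2)[OF m] by simp
  have "(\<lambda>p. f (flip p)) \<in> borel_measurable borel" by measurable
  then show "(\<lambda>p. f (flip p)) \<in> L2 (lebesgue_on (Omega d))"
    using i by (simp add: L2_def measurable_lebesgue_on_borel)
  show "Re (l2_inner (lebesgue_on (Omega d)) (\<lambda>p. f (flip p)) (\<lambda>p. f (flip p))) = Re (l2_inner (lebesgue_on (Omega d)) f f)"
    unfolding l2_inner_self integral_lebesgue_on_borel(1)[OF Omega_borel m1(1)] integral_lebesgue_on_borel(1)[OF Omega_borel m1(2)] e
    by (rule integral_flip(1)[OF m])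
qed

text \<open>The value 0 at \<open>Sector_0\<close> is a mere default: that sector imposes no
  symmetry and is split off wherever the sign occurs.\<close>

fun sector_sign :: "sector \<Rightarrow> complex" where
  "sector_sign Sector_0 = 0" | "sector_sign Sector_s = 1" | "sector_sign Sector_a = - 1"

lemma sector_symmetry_iff:
  "has_sector_symmetry d j f \<longleftrightarrow> j = Sector_0 \<or> (AE p in lebesgue_on (Omega d). f p = sector_sign j * f (flip p))"
  unfolding Omega_measure_def[symmetric] by (cases j) (simp_all add: flip_def case_prod_unfold)

lemma sector_symmetry_comb:
  assumes "has_sector_symmetry d j f" "has_sector_symmetry d j g"
  shows "has_sector_symmetry d j (fcomb a f b g)"
proof (cases "j = Sector_0")
  case False
  then have "AE p in lebesgue_on (Omega d). f p = sector_sign j * f (flip p)"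
    "AE p in lebesgue_on (Omega d). g p = sector_sign j * g (flip p)" using assms by (auto simp: sector_symmetry_iff)
  then have "AE p in lebesgue_on (Omega d). fcomb a f b g p = sector_sign j * fcomb a f b g (flip p)"
    by eventually_elim (simp add: algebra_simps)
  then show ?thesis by (simp add: sector_symmetry_iff)
qed simp

text \<open>The defect of symmetry of \<open>l\<close> is, up to sign, that of
  \<open>f n - l\<close>, since \<open>f n\<close> has none. Its squared norm is at most 4 times the
  squared distance of \<open>f n\<close> and \<open>l\<close>, for every n.\<close>

lemma sector_symmetry_limit:
  assumes f: "\<And>n. f n \<in> L2 (lebesgue_on (Omega d))" "\<And>n. has_sector_symmetry d j (f n)" and l: "l \<in> L2 (lebesgue_on (Omega d))"
    and lim: "(\<lambda>n. Re (l2_inner (lebesgue_on (Omega d)) (fcomb 1 (f n) (- 1) l) (fcomb 1 (f n) (- 1) l))) \<longlonglongrightarrow> 0"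
  shows "has_sector_symmetry d j l"
proof (cases "j = Sector_0")
  case False
  let ?M = "lebesgue_on (Omega d)"
  define c where "c = sector_sign j"
  have c: "cmod c = 1" using False by (cases j) (auto simp: c_def)
  obtain l' where l': "l' \<in> borel_measurable borel" "AE p in ?M. l p = l' p"
    using borel_representative[OF L2_measurable[OF l]] by blast
  have l'L: "l' \<in> L2 ?M" by (rule L2_congAE[OF l measurable_lebesgue_on_borel[OF l'(1)] l'(2)])
  define w where "w = fcomb 1 l' (- c) (\<lambda>p. l' (flip p))"
  have wL: "w \<in> L2 ?M" unfolding w_def by (intro L2_fcomb l'L L2_flip(1)[OF l'(1)])
  have bound: "Re (l2_inner ?M w w) \<le> 4 * Re (l2_inner ?M (fcomb 1 (f n) (- 1) l) (fcomb 1 (f n) (- 1) l))" for n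
  proof -
    obtain g where g: "g \<in> borel_measurable borel" "AE p in ?M. f n p = g p"
      using borel_representative[OF L2_measurable[OF f(1)[of n]]] by blast
    have gL: "g \<in> L2 ?M" by (rule L2_congAE[OF f(1) measurable_lebesgue_on_borel[OF g(1)] g(2)])
    define x where "x = fcomb 1 g (- 1) l'"
    have xL: "x \<in> L2 ?M" unfolding x_def by (intro L2_fcomb gL l'L)
    have xb: "x \<in> borel_measurable borel" unfolding x_def using g(1) l'(1) by measurable
    have "AE p in ?M. f n p = c * f n (flip p)" using f(2)[of n] False by (simp add: sector_symmetry_iff c_def)
    then have "AE p in ?M. w p = fcomb (- 1) x c (\<lambda>p. x (flip p)) p"
      using g(2) AE_Omega_flip[OF g(2)] by eventually_elim (simp add: w_def x_def algebra_simps)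
    then have "l2_inner ?M w w = l2_inner ?M (fcomb (- 1) x c (\<lambda>p. x (flip p))) (fcomb (- 1) x c (\<lambda>p. x (flip p)))"
      by (intro l2_inner_cong wL L2_fcomb xL L2_flip(1)[OF xb])
    then have "Re (l2_inner ?M w w) \<le> 2 * (cmod (- 1))\<^sup>2 * Re (l2_inner ?M x x) + 2 * (cmod c)\<^sup>2 * Re (l2_inner ?M (\<lambda>p. x (flip p)) (\<lambda>p. x (flip p)))"
      using L2.q_cb_le[OF xL L2_flip(1)[OF xb xL], of "- 1" c] by simp
    then have "Re (l2_inner ?M w w) \<le> 4 * Re (l2_inner ?M x x)" by (simp add: c L2_flip(2)[OF xb xL])
    also have "l2_inner ?M x x = l2_inner ?M (fcomb 1 (f n) (- 1) l) (fcomb 1 (f n) (- 1) l)"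
    proof -
      have ae: "AE p in ?M. x p = fcomb 1 (f n) (- 1) l p"
        using g(2) l'(2) by eventually_elim (simp add: x_def)
      show ?thesis by (rule l2_inner_cong[OF xL L2_fcomb[OF f(1) l] xL L2_fcomb[OF f(1) l] ae ae])
    qed
    finally show ?thesis .
  qed
  have "(\<lambda>n. 4 * Re (l2_inner ?M (fcomb 1 (f n) (- 1) l) (fcomb 1 (f n) (- 1) l))) \<longlonglongrightarrow> 4 * 0"
    by (intro tendsto_mult tendsto_const lim)
  then have "Re (l2_inner ?M w w) \<le> 4 * 0" by (rule LIMSEQ_le_const) (use bound in blast)
  then have "l2_norm ?M w = 0" using L2.pos[OF wL] by (simp add: l2_norm_inner)
  then have "AE p in ?M. w p = 0" by (simp add: l2_norm_zero_iff[OF wL])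
  then have "AE p in ?M. l p = c * l (flip p)"
    using l'(2) AE_Omega_flip[OF l'(2)] by eventually_elim (simp add: w_def)
  then show ?thesis by (simp add: sector_symmetry_iff c_def)
qed simp

section \<open>The closed form on each sector\<close>

lemma form_domain_iff:
  "f \<in> form_domain d j \<longleftrightarrow> f \<in> H1 (Omega d) \<and> has_sector_symmetry d j f \<and> (\<exists>F. approximates d f F)"
  unfolding form_domain_def L2_sector_def Omega_measure_def using has_trace_zero_iff H1_L2 by blast

text \<open>The ambient space is all of L2 and not the sector, so the abstract results yield images
  in L2; the sector is recovered at the end, because it is closed under linear combinations.\<close>

lemma form_space_sector:
  "form_space fcomb (L2 (lebesgue_on (Omega d))) (form_domain d j) (l2_inner (lebesgue_on (Omega d))) (dirichlet_form (Omega d))"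
proof (rule form_space.intro)
  let ?M = "lebesgue_on (Omega d)"
  have DH: "f \<in> H1 (Omega d)" if "f \<in> form_domain d j" for f using that by (simp add: form_domain_iff)
  have cb: "fcomb a f b g \<in> form_domain d j" if "f \<in> form_domain d j" "g \<in> form_domain d j" for f g a b
    using that sector_symmetry_comb approximates_comb H1_comb[OF open_Omega] unfolding form_domain_iff by blast
  show "hform fcomb (L2 ?M) (l2_inner ?M)" by (rule hform_L2)
  show "hform fcomb (form_domain d j) (dirichlet_form (Omega d))"
  proof
    fix x y f g :: "plane \<Rightarrow> complex" and a b :: complex
    show "fcomb a f b g \<in> form_domain d j" if "f \<in> form_domain d j" "g \<in> form_domain d j" using that by (rule cb)
    show "dirichlet_form (Omega d) x (fcomb a f b g) = a * dirichlet_form (Omega d) x f + b * dirichlet_form (Omega d) x g"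
      if "x \<in> form_domain d j" "f \<in> form_domain d j" "g \<in> form_domain d j" by (rule A.lin[OF that[THEN DH]])
    show "dirichlet_form (Omega d) y x = cnj (dirichlet_form (Omega d) x y)"
      if "x \<in> form_domain d j" "y \<in> form_domain d j" by (rule A.sym[OF that[THEN DH]])
    show "0 \<le> Re (dirichlet_form (Omega d) x x)" if "x \<in> form_domain d j" by (rule A.pos[OF DH[OF that]])
  qed
  show "form_domain d j \<subseteq> L2 ?M" using DH H1_L2 by blast
  fix f :: "nat \<Rightarrow> plane \<Rightarrow> complex"
  assume f: "\<And>n. f n \<in> form_domain d j"
    and cau: "\<And>e. e > 0 \<Longrightarrow> \<exists>N::nat. \<forall>m\<ge>N. \<forall>n\<ge>N.
       Re (l2_inner ?M (fcomb 1 (f m) (- 1) (f n)) (fcomb 1 (f m) (- 1) (f n)))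
     + Re (dirichlet_form (Omega d) (fcomb 1 (f m) (- 1) (f n)) (fcomb 1 (f m) (- 1) (f n))) < e"
  obtain l where l: "l \<in> H1 (Omega d)" and l1: "(\<lambda>n. Re (l2_inner ?M (fcomb 1 (f n) (- 1) l) (fcomb 1 (f n) (- 1) l))) \<longlonglongrightarrow> 0"
    and l2: "(\<lambda>n. Re (dirichlet_form (Omega d) (fcomb 1 (f n) (- 1) l) (fcomb 1 (f n) (- 1) l))) \<longlonglongrightarrow> 0"
    using H1_complete[OF open_Omega DH[OF f] cau] by blast
  have lim: "(\<lambda>n. Re (energy d (fcomb 1 (f n) (- 1) l) (fcomb 1 (f n) (- 1) l))) \<longlonglongrightarrow> 0"
    using tendsto_add[OF l1 l2] unfolding energy_def by simp
  have fa: "\<exists>F. approximates d (f n) F" "has_sector_symmetry d j (f n)" for n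
    using f[of n] by (simp_all add: form_domain_iff)
  have "\<exists>F. approximates d l F" by (rule approximates_limit[OF DH[OF f] fa(1) l lim])
  moreover have "has_sector_symmetry d j l" by (rule sector_symmetry_limit[OF H1_L2[OF DH[OF f]] fa(2) H1_L2[OF l] l1])
  ultimately have "l \<in> form_domain d j" using l by (simp add: form_domain_iff)
  then show "\<exists>l\<in>form_domain d j. (\<lambda>n. Re (l2_inner ?M (fcomb 1 (f n) (- 1) l) (fcomb 1 (f n) (- 1) l))) \<longlonglongrightarrow> 0
     \<and> (\<lambda>n. Re (dirichlet_form (Omega d) (fcomb 1 (f n) (- 1) l) (fcomb 1 (f n) (- 1) l))) \<longlonglongrightarrow> 0"
    using l1 l2 by blast
qed

section \<open>The form is bounded below on a hyperplane\<close>

lemma approximates_tendsto: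
  assumes f: "f \<in> H1 (Omega d)" and F: "approximates d f F"
  shows "x \<in> L2 (lebesgue_on (Omega d)) \<Longrightarrow> (\<lambda>n. l2_inner (lebesgue_on (Omega d)) x (F n)) \<longlonglongrightarrow> l2_inner (lebesgue_on (Omega d)) x f"
    and "(\<lambda>n. Re (l2_inner (lebesgue_on (Omega d)) (fcomb 1 (F n) (- 1) f) (fcomb 1 (F n) (- 1) f))) \<longlonglongrightarrow> 0"
    and "(\<lambda>n. Re (l2_inner (lebesgue_on (Omega d)) (F n) (F n))) \<longlonglongrightarrow> Re (l2_inner (lebesgue_on (Omega d)) f f)"
    and "(\<lambda>n. Re (dirichlet_form (Omega d) (fcomb 1 (F n) (- 1) f) (fcomb 1 (F n) (- 1) f))) \<longlonglongrightarrow> 0"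
    and "(\<lambda>n. Re (dirichlet_form (Omega d) (F n) (F n))) \<longlonglongrightarrow> Re (dirichlet_form (Omega d) f f)"
proof -
  let ?M = "lebesgue_on (Omega d)"
  have T: "F n \<in> test_functions UNIV" for n using F by (simp add: approximates_def)
  have H: "F n \<in> H1 (Omega d)" for n by (rule test_in_H1[OF T])
  have fH: "fcomb 1 (F n) (- 1) f \<in> H1 (Omega d)" for n by (rule H1_comb[OF open_Omega H f])
  have "(\<lambda>n. (H1_norm (Omega d) (\<lambda>p. F n p - f p))\<^sup>2) \<longlonglongrightarrow> 0\<^sup>2"
    using F unfolding approximates_def by (intro tendsto_power) blast
  moreover have "(H1_norm (Omega d) (\<lambda>p. F n p - f p))\<^sup>2 = Re (l2_inner ?M (fcomb 1 (F n) (- 1) f) (fcomb 1 (F n) (- 1) f))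
      + Re (dirichlet_form (Omega d) (fcomb 1 (F n) (- 1) f) (fcomb 1 (F n) (- 1) f))" for n
    using H1_norm_sq[OF fH[of n]] by simp
  ultimately have lim: "(\<lambda>n. Re (l2_inner ?M (fcomb 1 (F n) (- 1) f) (fcomb 1 (F n) (- 1) f))
      + Re (dirichlet_form (Omega d) (fcomb 1 (F n) (- 1) f) (fcomb 1 (F n) (- 1) f))) \<longlonglongrightarrow> 0"
    by (simp only: power_zero_numeral)
  show l1: "(\<lambda>n. Re (l2_inner ?M (fcomb 1 (F n) (- 1) f) (fcomb 1 (F n) (- 1) f))) \<longlonglongrightarrow> 0"
    by (rule tendsto_sandwich[OF always_eventually always_eventually tendsto_const lim])
      (simp_all only: L2.pos[OF H1_L2[OF fH]] A.pos[OF fH] le_add_same_cancel1 simp_thms)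
  show l2: "(\<lambda>n. Re (dirichlet_form (Omega d) (fcomb 1 (F n) (- 1) f) (fcomb 1 (F n) (- 1) f))) \<longlonglongrightarrow> 0"
    by (rule tendsto_sandwich[OF always_eventually always_eventually tendsto_const lim])
      (simp_all only: L2.pos[OF H1_L2[OF fH]] A.pos[OF fH] le_add_same_cancel2 simp_thms)
  show "(\<lambda>n. l2_inner ?M x (F n)) \<longlonglongrightarrow> l2_inner ?M x f" if "x \<in> L2 ?M"
    by (rule L2.tendsto_right[OF H1_L2[OF H] H1_L2[OF f] that l1])
  show "(\<lambda>n. Re (l2_inner ?M (F n) (F n))) \<longlonglongrightarrow> Re (l2_inner ?M f f)"
    by (rule L2.tendsto_q[OF H1_L2[OF H] H1_L2[OF f] l1])
  show "(\<lambda>n. Re (dirichlet_form (Omega d) (F n) (F n))) \<longlonglongrightarrow> Re (dirichlet_form (Omega d) f f)"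
    by (rule A.tendsto_q[OF H f l2])
qed

section \<open>From test functions to the form domain\<close>

lemma test_norm:
  assumes F: "F \<in> test_functions UNIV"
  shows "Re (l2_inner (lebesgue_on (Omega d)) F F) = (LINT p|lborel. indicator (Omega d) p * (cmod (F p))\<^sup>2)"
proof -
  have [measurable]: "F \<in> borel_measurable borel" by (rule test_measurable[OF F])
  show ?thesis unfolding l2_inner_self by (subst integral_lebesgue_on_borel(1)) auto
qed

lemma test_energy:
  assumes F: "F \<in> test_functions UNIV"
  shows "Re (dirichlet_form (Omega d) F F) = (LINT p|lborel. indicator (Omega d) p * grad2 F p)"
proof -
  have z: "cnj z * z = of_real ((cmod z)\<^sup>2)" for z
    by (metis complex_norm_square mult.commute)
  have m: "grad2 F \<in> borel_measurable borel"
    by (intro borel_measurable_continuous_onI grad2_continuous test_smooth[OF F])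
  have "dirichlet_form (Omega d) F F = (LINT p|lebesgue_on (Omega d). complex_of_real (grad2 F p))"
    unfolding dirichlet_form_test[OF open_Omega F F] grad2_def z of_real_add ..
  also have "\<dots> = of_real (LINT p|lebesgue_on (Omega d). grad2 F p)" by simp
  finally show ?thesis by (simp add: integral_lebesgue_on_borel(1)[OF Omega_borel m])
qed

definition indicator_fun :: "plane set \<Rightarrow> plane \<Rightarrow> complex" where "indicator_fun Q p = of_real (indicator Q p)"

lemma indicator_fun_L2:
  assumes "Q \<in> sets borel" "bounded Q"
  shows "indicator_fun Q \<in> L2 (lebesgue_on (Omega d))"
proof -
  have m: "(\<lambda>p. (cmod (indicator_fun Q p))\<^sup>2) = indicator Q" by (auto simp: indicator_fun_def indicator_def)
  have mm[measurable]: "indicator_fun Q \<in> borel_measurable borel" unfolding indicator_fun_def using assms(1) by measurable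
  have "integrable lborel (indicator Q :: plane \<Rightarrow> real)"
    using assms by (intro integrable_real_indicator) (auto simp flip: infinity_ennreal_def intro: emeasure_bounded_finite)
  then have "integrable lborel (\<lambda>p. indicator (Omega d) p *\<^sub>R (indicator Q p :: real))"
    by (intro integrable_mult_indicator) auto
  then have "integrable (lebesgue_on (Omega d)) (indicator Q :: plane \<Rightarrow> real)"
    using assms by (subst integral_lebesgue_on_borel(2)) auto
  then show ?thesis unfolding L2_def using m by (simp add: measurable_lebesgue_on_borel[OF mm])
qed

lemma indicator_fun_inner:
  assumes F: "F \<in> test_functions UNIV" and Q: "Q \<in> sets borel" "Q \<subseteq> Omega d"
  shows "l2_inner (lebesgue_on (Omega d)) (indicator_fun Q) F = (LINT p|lborel. indicator Q p *\<^sub>R F p)"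
proof -
  have [measurable]: "F \<in> borel_measurable borel" "Q \<in> sets borel" using test_measurable[OF F] Q by auto
  have "l2_inner (lebesgue_on (Omega d)) (indicator_fun Q) F = (LINT p|lebesgue_on (Omega d). indicator Q p *\<^sub>R F p)"
    unfolding l2_inner_def indicator_fun_def by (intro Bochner_Integration.integral_cong refl) (auto simp: indicator_def)
  also have "\<dots> = (LINT p|lborel. indicator (Omega d) p *\<^sub>R (indicator Q p *\<^sub>R F p))"
    by (subst integral_lebesgue_on_borel(1)) auto
  also have "\<dots> = (LINT p|lborel. indicator Q p *\<^sub>R F p)"
    using Q(2) by (intro Bochner_Integration.integral_cong refl) (auto simp: indicator_def)
  finally show ?thesis .
qed

text \<open>At fixed \<open>\<theta>\<close> the integrals of the approximants over the square tend
  to the scalar product that vanishes by \<open>orth\<close>, and the boundary terms tend to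
  0.\<close>

lemma hyperplane_bound_square:
  assumes d: "0 < d" and f: "f \<in> form_domain d j"
    and orth: "l2_inner (lebesgue_on (Omega d)) (indicator_fun (box (0, 0) (d, d))) f = 0"
  shows "2 * (pi / (2 * d))\<^sup>2 * Re (l2_inner (lebesgue_on (Omega d)) f f) \<le> Re (dirichlet_form (Omega d) f f)"
proof -
  let ?M = "lebesgue_on (Omega d)"
  let ?Q = "box (0, 0) (d, d) :: plane set"
  obtain F where fH: "f \<in> H1 (Omega d)" and F: "approximates d f F" using f by (auto simp: form_domain_iff)
  have T: "F n \<in> test_functions UNIV" for n using F by (simp add: approximates_def)
  have QO: "?Q \<subseteq> Omega d" by (auto simp: Omega_alt mem_box_pair)
  note lim = approximates_tendsto[OF fH F]
  have "(pi / (2 * d))\<^sup>2 * (2 * Re (l2_inner ?M f f)) \<le> Re (dirichlet_form (Omega d) f f)"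
  proof (rule le_of_square_less)
    show "0 < pi / (2 * d)" using d by simp
    fix \<theta> :: real assume \<theta>: "0 < \<theta>" "\<theta> < pi / (2 * d)"
    let ?K = "(pi / d)\<^sup>2 / d\<^sup>2" and ?L = "3 * (\<theta> * tan (\<theta> * d))"
    have "\<theta>\<^sup>2 * (2 * Re (l2_inner ?M f f)) \<le> Re (dirichlet_form (Omega d) f f) + ?K * (cmod 0)\<^sup>2 + ?L * 0"
    proof (rule LIMSEQ_le)
      show "(\<lambda>n. \<theta>\<^sup>2 * (2 * Re (l2_inner ?M (F n) (F n)))) \<longlonglongrightarrow> \<theta>\<^sup>2 * (2 * Re (l2_inner ?M f f))"
        by (intro tendsto_mult tendsto_const lim(3))
      have "(\<lambda>n. l2_inner ?M (indicator_fun ?Q) (F n)) \<longlonglongrightarrow> 0"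
        using lim(1)[OF indicator_fun_L2[of ?Q]] orth by (simp add: bounded_box)
      then show "(\<lambda>n. Re (dirichlet_form (Omega d) (F n) (F n)) + ?K * (cmod (l2_inner ?M (indicator_fun ?Q) (F n)))\<^sup>2
          + ?L * (LINT s|lborel. bdry d (F n) s)) \<longlonglongrightarrow> Re (dirichlet_form (Omega d) f f) + ?K * (cmod 0)\<^sup>2 + ?L * 0"
        using F unfolding approximates_def
        by (intro tendsto_add tendsto_mult tendsto_const lim(5) tendsto_power tendsto_norm) auto
      show "\<exists>N. \<forall>n\<ge>N. \<theta>\<^sup>2 * (2 * Re (l2_inner ?M (F n) (F n)))
         \<le> Re (dirichlet_form (Omega d) (F n) (F n)) + ?K * (cmod (l2_inner ?M (indicator_fun ?Q) (F n)))\<^sup>2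
          + ?L * (LINT s|lborel. bdry d (F n) s)"
      proof (intro exI allI impI)
        fix n
        show "\<theta>\<^sup>2 * (2 * Re (l2_inner ?M (F n) (F n)))
         \<le> Re (dirichlet_form (Omega d) (F n) (F n)) + ?K * (cmod (l2_inner ?M (indicator_fun ?Q) (F n)))\<^sup>2
          + ?L * (LINT s|lborel. bdry d (F n) s)"
          unfolding test_norm[OF T] test_energy[OF T] indicator_fun_inner[OF T _ QO, simplified]
          using test_bound_0[OF T d \<theta>, of n] by (simp only: mult.assoc mult.left_commute)
      qed
    qed
    then show "\<theta>\<^sup>2 * (2 * Re (l2_inner ?M f f)) \<le> Re (dirichlet_form (Omega d) f f)" by simp
  qed
  then show ?thesis by (simp only: mult.assoc mult.left_commute)
qed

subsection \<open>Antisymmetrisation\<close>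

lemma flip_derivative: "(flip has_derivative flip) (at p)"
  unfolding flip_def[abs_def] by (auto intro!: derivative_eq_intros)

lemma flip_Basis: "v \<in> (Basis :: plane set) \<Longrightarrow> flip v \<in> Basis"
  by (auto simp: Basis_plane flip_def)

lemma tcd_flip: "times_cont_diff k F \<Longrightarrow> times_cont_diff k (\<lambda>p. F (flip p))"
proof (induction k arbitrary: F)
  case 0
  have "continuous_on UNIV flip" unfolding flip_def[abs_def] by (intro continuous_intros)
  then show ?case using 0 by (auto intro: continuous_on_compose2[of UNIV F])
next
  case (Suc k)
  show ?case
    by (rule tcd_SucI[OF has_derivative_compose[OF flip_derivative tcd_frechet[OF Suc.prems]]])
      (rule Suc.IH, use Suc.prems flip_Basis in simp)
qed

lemma pd_flip: "smooth F \<Longrightarrow> pd v (\<lambda>p. F (flip p)) p = pd (flip v) F (flip p)"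
  using has_derivative_compose[OF flip_derivative smooth_has_derivative, of F p] by (rule pdI)

lemma smooth_flip: "smooth F \<Longrightarrow> smooth (\<lambda>p. F (flip p))"
  by (simp add: smooth_def tcd_flip)

lemma test_flip:
  assumes "F \<in> test_functions UNIV"
  shows "(\<lambda>p. F (flip p)) \<in> test_functions UNIV"
proof -
  obtain R where R: "R > 0" "\<And>p. R \<le> norm p \<Longrightarrow> F p = 0" using test_support[OF assms] by blast
  have n: "norm (flip p) = norm p" for p by (simp add: flip_def norm_prod_def add.commute)
  show ?thesis
    by (rule testI[where K="cball 0 R"])
      (use smooth_flip[OF test_smooth[OF assms]] R n in \<open>auto simp: dist_norm not_le intro: less_imp_le\<close>,
        metis R(2) n linorder_not_less less_imp_le)
qed

text \<open>Approximants of an antisymmetric function need not be antisymmetric themselves, whereas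
  the inequality on the half of the strip relies on their vanishing on the diagonal.\<close>

definition antisymmetrise :: "(plane \<Rightarrow> complex) \<Rightarrow> plane \<Rightarrow> complex" where
  "antisymmetrise F = fcomb (1/2) F (- 1/2) (\<lambda>p. F (flip p))"

lemma test_antisymmetrise: "F \<in> test_functions UNIV \<Longrightarrow> antisymmetrise F \<in> test_functions UNIV"
  unfolding antisymmetrise_def by (intro test_comb test_flip)

lemma half_sq: "2 * (cmod ((1/2) * a + (- 1/2) * b))\<^sup>2 \<le> (cmod a)\<^sup>2 + (cmod b)\<^sup>2" for a b :: complex
proof -
  have "0 \<le> (a + b) \<bullet> (a + b)" by simp
  then have "(cmod (a - b))\<^sup>2 \<le> 2 * (cmod a)\<^sup>2 + 2 * (cmod b)\<^sup>2"
    unfolding power2_norm_eq_inner by (simp add: inner_simps inner_commute algebra_simps)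
  moreover have "(1/2) * a + (- 1/2) * b = (1/2) * (a - b)" by (simp add: algebra_simps)
  then have "(cmod ((1/2) * a + (- 1/2) * b))\<^sup>2 = (cmod (a - b))\<^sup>2 / 4"
    by (simp only: norm_mult power_mult_distrib) (simp add: power_divide)
  ultimately show ?thesis by simp
qed

lemma grad2_antisym:
  assumes F: "F \<in> test_functions UNIV"
  shows "2 * grad2 (antisymmetrise F) p \<le> grad2 F p + grad2 F (flip p)"
proof -
  have s: "smooth F" "smooth (\<lambda>p. F (flip p))" using F test_smooth smooth_flip by blast+
  have e: "pd v (antisymmetrise F) p = (1/2) * pd v F p + (- 1/2) * pd (flip v) F (flip p)" for v
    unfolding antisymmetrise_def pd_comb[OF s] pd_flip[OF s(1)] ..
  show ?thesis
    using half_sq[of "pd (1,0) F p" "pd (0,1) F (flip p)"] half_sq[of "pd (0,1) F p" "pd (1,0) F (flip p)"]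
    unfolding grad2_def e by (simp add: flip_def)
qed

text \<open>\<open>flip\<close> exchanges the two boundary rays, and \<open>bdry\<close> counts
  both.\<close>

lemma bdry_antisym: "bdry d (antisymmetrise F) s \<le> bdry d F s"
proof -
  have f: "flip (rot (s, t)) = rot (s, - t)" for t by (simp add: flip_def rot_def)
  show ?thesis
    using half_sq[of "F (rot (s, d))" "F (rot (s, - d))"] half_sq[of "F (rot (s, - d))" "F (rot (s, d))"]
    by (simp add: bdry_def antisymmetrise_def f indicator_def)
qed

lemma Omega_half_borel [measurable]: "Omega_half d \<in> sets borel"
proof -
  have "Measurable.pred borel (\<lambda>p::plane. 0 < fst p \<and> 0 < snd p \<and> \<bar>fst p - snd p\<bar> < d \<and> snd p < fst p)" by measurable
  then show ?thesis by (simp add: Omega_half_def Omega_alt pred_def)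
qed

lemma AE_off_diagonal: "AE p in (lborel :: plane measure). fst p \<noteq> snd p"
proof -
  have "negligible {p :: plane. (1, - 1) \<bullet> p = 0}"
    by (rule negligible_hyperplane) (simp add: zero_prod_def)
  then have "AE p in lebesgue. p \<notin> {p :: plane. (1, - 1) \<bullet> p = 0}"
    by (intro AE_not_in) (simp add: negligible_iff_null_sets)
  then have "AE p in (lborel :: plane measure). p \<notin> {p :: plane. (1, - 1) \<bullet> p = 0}"
    by (simp only: AE_completion_iff)
  then show ?thesis by eventually_elim (simp add: inner_prod_def)
qed

lemma Omega_halves:
  fixes h :: "plane \<Rightarrow> real"
  assumes h: "integrable lborel (\<lambda>p. indicator (Omega d) p * h p)"
    and hb: "h \<in> borel_measurable borel"
  shows "(LINT p|lborel. indicator (Omega d) p * h p) = (LINT p|lborel. indicator (Omega_half d) p * (h p + h (flip p)))"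
proof -
  let ?H = "\<lambda>p. indicator (Omega_half d) p * h p"
  note hb[measurable]
  have "integrable lborel (\<lambda>p. indicator (Omega_half d) p *\<^sub>R (indicator (Omega d) p * h p))"
    by (rule integrable_mult_indicator[OF _ h]) auto
  moreover have "(\<lambda>p. indicator (Omega_half d) p *\<^sub>R (indicator (Omega d) p * h p)) = ?H"
    by (auto simp: indicator_def Omega_half_def)
  ultimately have i: "integrable lborel ?H" by simp
  have "integrable lborel (\<lambda>p. indicator (Omega_half d) p *\<^sub>R (indicator (Omega d) (flip p) * h (flip p)))"
    using h integral_flip(2)[of "\<lambda>p. indicator (Omega d) p * h p"] by (intro integrable_mult_indicator) auto
  moreover have "(\<lambda>p. indicator (Omega_half d) p *\<^sub>R (indicator (Omega d) (flip p) * h (flip p))) = (\<lambda>p. indicator (Omega_half d) p * h (flip p))"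
    by (auto simp: indicator_def Omega_half_def Omega_flip)
  ultimately have i2: "integrable lborel (\<lambda>p. indicator (Omega_half d) p * h (flip p))" by simp
  let ?K = "\<lambda>p. indicator (Omega_half d) (flip p) * h p"
  have Km: "?K \<in> borel_measurable borel" by measurable
  have Ke: "(\<lambda>p. ?K (flip p)) = (\<lambda>p. indicator (Omega_half d) p * h (flip p))" by simp
  have i3: "integrable lborel ?K" using i2 integral_flip(2)[OF Km] unfolding Ke by simp
  have "(LINT p|lborel. indicator (Omega d) p * h p) = (LINT p|lborel. ?H p + ?K p)"
  proof (rule integral_cong_AE)
    show "AE p in lborel. indicator (Omega d) p * h p = ?H p + ?K p"
      using AE_off_diagonal
      by eventually_elim (auto simp: indicator_def Omega_half_def Omega_flip flip_def, auto simp: Omega_alt)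
  qed (use h i i3 in auto)
  also have "\<dots> = (LINT p|lborel. ?H p) + (LINT p|lborel. ?K p)"
    by (rule Bochner_Integration.integral_add[OF i i3])
  also have "(LINT p|lborel. ?K p) = (LINT p|lborel. indicator (Omega_half d) p * h (flip p))"
    using integral_flip(1)[OF Km] unfolding Ke by simp
  also have "(LINT p|lborel. ?H p) + \<dots> = (LINT p|lborel. ?H p + indicator (Omega_half d) p * h (flip p))"
    by (rule Bochner_Integration.integral_add[OF i i2, symmetric])
  finally show ?thesis by (simp add: distrib_left)
qed

text \<open>The energy on the right is that of \<open>F\<close> and not of its antisymmetric part,
  because convergence of energies is known for the approximants themselves. Passage from the half to
  the whole doubles the two error terms.\<close>

lemma test_bound_antisym:
  assumes F: "F \<in> test_functions UNIV" and d: "0 < d" and \<theta>: "0 < \<theta>" "\<theta> < pi / d"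
  defines "P \<equiv> {p :: plane. d / 2 < fst p + snd p \<and> fst p + snd p \<le> d \<and> 0 < snd p \<and> snd p \<le> d / 4}"
  shows "2 * \<theta>\<^sup>2 * (LINT p|lborel. indicator (Omega d) p * (cmod (antisymmetrise F p))\<^sup>2)
     \<le> (LINT p|lborel. indicator (Omega d) p * grad2 F p)
      + 2 * (16 * (pi / d)\<^sup>2 / d\<^sup>2) * (cmod (LINT p|lborel. indicator P p *\<^sub>R antisymmetrise F p))\<^sup>2
      + 2 * (\<theta> * tan (\<theta> * (d / 2))) * (LINT s|lborel. bdry d F s)"
proof -
  let ?G = "antisymmetrise F"
  have G: "?G \<in> test_functions UNIV" by (rule test_antisymmetrise[OF F])
  have anti: "?G (y, x) = - ?G (x, y)" for x y by (simp add: antisymmetrise_def flip_def algebra_simps)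
  have anti': "?G (flip p) = - ?G p" for p by (simp add: antisymmetrise_def algebra_simps)
  have mG: "(\<lambda>p. (cmod (?G p))\<^sup>2) \<in> borel_measurable borel" using test_measurable[OF G] by measurable
  have mF: "grad2 F \<in> borel_measurable borel"
    by (intro borel_measurable_continuous_onI grad2_continuous test_smooth[OF F])
  have e1: "(LINT p|lborel. indicator (Omega d) p * (cmod (?G p))\<^sup>2) = 2 * (LINT p|lborel. indicator (Omega_half d) p * (cmod (?G p))\<^sup>2)"
  proof -
    have "(LINT p|lborel. indicator (Omega d) p * (cmod (?G p))\<^sup>2) = (LINT p|lborel. indicator (Omega_half d) p * ((cmod (?G p))\<^sup>2 + (cmod (?G (flip p)))\<^sup>2))"
      by (rule Omega_halves[OF test_integrable_sets(1)[OF G Omega_borel] mG])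
    also have "\<dots> = (LINT p|lborel. 2 * (indicator (Omega_half d) p * (cmod (?G p))\<^sup>2))"
      by (simp add: anti' algebra_simps)
    finally show ?thesis by simp
  qed
  have "2 * (LINT p|lborel. indicator (Omega_half d) p * grad2 ?G p) = (LINT p|lborel. 2 * (indicator (Omega_half d) p * grad2 ?G p))"
    by simp
  also have "\<dots> \<le> (LINT p|lborel. indicator (Omega_half d) p * (grad2 F p + grad2 F (flip p)))"
  proof (rule integral_mono)
    show "integrable lborel (\<lambda>p. 2 * (indicator (Omega_half d) p * grad2 ?G p))"
      by (rule integrable_mult_right[OF test_integrable_sets(2)[OF G Omega_half_borel]])
    have "integrable lborel (\<lambda>p. grad2 F p)"
      using test_integrable_sets(2)[OF F, of UNIV] by simp
    then have "integrable lborel (\<lambda>p. grad2 F p + grad2 F (flip p))"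
      using integral_flip(2)[OF mF] by simp
    from integrable_mult_indicator[OF _ this, of "Omega_half d"]
    show "integrable lborel (\<lambda>p. indicator (Omega_half d) p * (grad2 F p + grad2 F (flip p)))" by simp
    show "2 * (indicator (Omega_half d) p * grad2 ?G p) \<le> indicator (Omega_half d) p * (grad2 F p + grad2 F (flip p))" for p
      using grad2_antisym[OF F, of p] by (simp add: indicator_def)
  qed
  also have "\<dots> = (LINT p|lborel. indicator (Omega d) p * grad2 F p)"
    by (rule Omega_halves[OF test_integrable_sets(2)[OF F Omega_borel] mF, symmetric])
  finally have e2: "2 * (LINT p|lborel. indicator (Omega_half d) p * grad2 ?G p) \<le> (LINT p|lborel. indicator (Omega d) p * grad2 F p)" .
  have e3: "(LINT s|lborel. bdry d ?G s) \<le> (LINT s|lborel. bdry d F s)"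
    by (rule integral_mono[OF bdry_integrable[OF G] bdry_integrable[OF F] bdry_antisym])
  have "\<theta> * (d / 2) < pi / 2" using \<theta> d by (simp add: field_simps)
  then have k: "0 \<le> \<theta> * tan (\<theta> * (d / 2))" using \<theta> d by (intro mult_nonneg_nonneg tan_nonneg) auto
  note b = test_bound_a[OF G anti d \<theta>, folded P_def]
  have k2: "\<theta> * tan (\<theta> * (d / 2)) * (LINT s|lborel. bdry d ?G s) \<le> \<theta> * tan (\<theta> * (d / 2)) * (LINT s|lborel. bdry d F s)"
    using e3 k by (rule mult_left_mono)
  define N where "N = 2 * \<theta>\<^sup>2 * (LINT p|lborel. indicator (Omega_half d) p * (cmod (?G p))\<^sup>2)"
  define B where "B = 16 * (pi / d)\<^sup>2 / d\<^sup>2 * (cmod (LINT p|lborel. indicator P p *\<^sub>R ?G p))\<^sup>2"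
  define K where "K = \<theta> * tan (\<theta> * (d / 2)) * (LINT s|lborel. bdry d F s)"
  have "N \<le> (LINT p|lborel. indicator (Omega_half d) p * grad2 ?G p) + B + K"
    using b k2 unfolding N_def B_def K_def by linarith
  then have "2 * N \<le> (LINT p|lborel. indicator (Omega d) p * grad2 F p) + 2 * B + 2 * K" using e2 by linarith
  then show ?thesis unfolding e1 N_def B_def K_def by (simp only: mult.assoc mult.left_commute)
qed

text \<open>At x + y = s with d / 2 < s \<le> d, the condition y \<le> d / 4 keeps the last d / 2 of
  the section 0 < t < s, next to the coordinate axis.\<close>

definition slanted_box :: "real \<Rightarrow> plane set" where
  "slanted_box d = {p. d / 2 < fst p + snd p \<and> fst p + snd p \<le> d \<and> 0 < snd p \<and> snd p \<le> d / 4}"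

lemma slanted_box_borel: "slanted_box d \<in> sets borel"
proof -
  have "Measurable.pred borel (\<lambda>p :: plane. d / 2 < fst p + snd p \<and> fst p + snd p \<le> d \<and> 0 < snd p \<and> snd p \<le> d / 4)"
    by measurable
  then show ?thesis by (simp add: slanted_box_def pred_def)
qed

lemma slanted_box_bounded: "0 < d \<Longrightarrow> bounded (slanted_box d)"
proof -
  assume "0 < d"
  then have "slanted_box d \<subseteq> cbox (0, 0) (d, d)" by (auto simp: slanted_box_def mem_cbox_pair)
  then show ?thesis using bounded_cbox bounded_subset by blast
qed

lemma hyperplane_bound_antisymmetric:
  fixes d :: real
  defines "P \<equiv> slanted_box d"
  assumes d: "0 < d" and f: "f \<in> form_domain d Sector_a"
    and orth: "l2_inner (lebesgue_on (Omega d)) (indicator_fun P) f = 0"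
  shows "2 * (pi / d)\<^sup>2 * Re (l2_inner (lebesgue_on (Omega d)) f f) \<le> Re (dirichlet_form (Omega d) f f)"
proof -
  let ?M = "lebesgue_on (Omega d)"
  have Pb: "P \<in> sets borel" unfolding P_def by (rule slanted_box_borel)
  have Pbd: "bounded P" unfolding P_def by (rule slanted_box_bounded[OF d])
  note P_def = P_def[unfolded slanted_box_def]
  have PO: "P \<subseteq> Omega d" using d by (auto simp: P_def Omega_alt)
  obtain F where fH: "f \<in> H1 (Omega d)" and F: "approximates d f F" and sy: "has_sector_symmetry d Sector_a f"
    using f by (auto simp: form_domain_iff)
  have T: "F n \<in> test_functions UNIV" for n using F by (simp add: approximates_def)
  have TL: "F n \<in> L2 ?M" for n by (rule H1_L2[OF test_in_H1[OF T]])
  have GL: "antisymmetrise (F n) \<in> L2 ?M" for n by (rule H1_L2[OF test_in_H1[OF test_antisymmetrise[OF T]]])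
  have fL: "f \<in> L2 ?M" by (rule H1_L2[OF fH])
  note lim = approximates_tendsto[OF fH F]
  obtain g where g: "g \<in> borel_measurable borel" "AE p in ?M. f p = g p"
    using borel_representative[OF L2_measurable[OF fL]] by blast
  have gL: "g \<in> L2 ?M" by (rule L2_congAE[OF fL measurable_lebesgue_on_borel[OF g(1)] g(2)])
  have fs: "AE p in ?M. f p = - f (flip p)" using sy by (subst (asm) sector_symmetry_iff) simp
  \<comment> \<open>Antisymmetrisation is a contraction that leaves \<open>f\<close> unchanged, so
    the antisymmetric parts converge to \<open>f\<close> at least as fast as the
    \<open>F n\<close>.\<close>
  have close: "Re (l2_inner ?M (fcomb 1 (antisymmetrise (F n)) (- 1) f) (fcomb 1 (antisymmetrise (F n)) (- 1) f))
      \<le> Re (l2_inner ?M (fcomb 1 (F n) (- 1) f) (fcomb 1 (F n) (- 1) f))" for n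
  proof -
    define x where "x = fcomb 1 (F n) (- 1) g"
    have xL: "x \<in> L2 ?M" unfolding x_def by (rule L2_fcomb[OF TL gL])
    have xb: "x \<in> borel_measurable borel" unfolding x_def using g(1) test_measurable[OF T] by measurable
    have ae: "AE p in ?M. fcomb 1 (antisymmetrise (F n)) (- 1) f p = fcomb (1/2) x (- 1/2) (\<lambda>p. x (flip p)) p"
      using g(2) AE_Omega_flip[OF g(2)] fs
    proof eventually_elim
      case (elim p)
      have "f p = (1/2) * f p + (- 1/2) * f (flip p)" using elim(3) by simp
      then have "f p = (1/2) * g p + (- 1/2) * g (flip p)" using elim(1,2) by simp
      then show ?case unfolding x_def antisymmetrise_def by (simp add: algebra_simps)
    qed
    have ae2: "AE p in ?M. x p = fcomb 1 (F n) (- 1) f p"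
      using g(2) by eventually_elim (simp add: x_def)
    have "l2_inner ?M (fcomb 1 (antisymmetrise (F n)) (- 1) f) (fcomb 1 (antisymmetrise (F n)) (- 1) f)
       = l2_inner ?M (fcomb (1/2) x (- 1/2) (\<lambda>p. x (flip p))) (fcomb (1/2) x (- 1/2) (\<lambda>p. x (flip p)))"
      by (rule l2_inner_cong[OF L2_fcomb[OF GL fL] L2_fcomb[OF xL L2_flip(1)[OF xb xL]] L2_fcomb[OF GL fL] L2_fcomb[OF xL L2_flip(1)[OF xb xL]] ae ae])
    then have "Re (l2_inner ?M (fcomb 1 (antisymmetrise (F n)) (- 1) f) (fcomb 1 (antisymmetrise (F n)) (- 1) f))
      \<le> 2 * (cmod (1/2))\<^sup>2 * Re (l2_inner ?M x x) + 2 * (cmod (- 1/2))\<^sup>2 * Re (l2_inner ?M (\<lambda>p. x (flip p)) (\<lambda>p. x (flip p)))"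
      using L2.q_cb_le[OF xL L2_flip(1)[OF xb xL], of "1/2" "- 1/2"] by (simp only:)
    also have "\<dots> = Re (l2_inner ?M x x)" unfolding L2_flip(2)[OF xb xL] by (simp add: power2_eq_square)
    also have "l2_inner ?M x x = l2_inner ?M (fcomb 1 (F n) (- 1) f) (fcomb 1 (F n) (- 1) f)"
      by (rule l2_inner_cong[OF xL L2_fcomb[OF TL fL] xL L2_fcomb[OF TL fL] ae2 ae2])
    finally show ?thesis .
  qed
  have limG: "(\<lambda>n. Re (l2_inner ?M (fcomb 1 (antisymmetrise (F n)) (- 1) f) (fcomb 1 (antisymmetrise (F n)) (- 1) f))) \<longlonglongrightarrow> 0"
    by (rule tendsto_sandwich[OF always_eventually[OF allI[OF L2.pos[OF L2_fcomb[OF GL fL]]]] always_eventually[OF allI[OF close]] tendsto_const lim(2)])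
  have "(pi / d)\<^sup>2 * (2 * Re (l2_inner ?M f f)) \<le> Re (dirichlet_form (Omega d) f f)"
  proof (rule le_of_square_less)
    show "0 < pi / d" using d by simp
    fix \<theta> :: real assume \<theta>: "0 < \<theta>" "\<theta> < pi / d"
    let ?K = "2 * (16 * (pi / d)\<^sup>2 / d\<^sup>2)" and ?L = "2 * (\<theta> * tan (\<theta> * (d / 2)))"
    have "\<theta>\<^sup>2 * (2 * Re (l2_inner ?M f f)) \<le> Re (dirichlet_form (Omega d) f f) + ?K * (cmod 0)\<^sup>2 + ?L * 0"
    proof (rule LIMSEQ_le)
      show "(\<lambda>n. \<theta>\<^sup>2 * (2 * Re (l2_inner ?M (antisymmetrise (F n)) (antisymmetrise (F n))))) \<longlonglongrightarrow> \<theta>\<^sup>2 * (2 * Re (l2_inner ?M f f))"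
        by (intro tendsto_mult tendsto_const L2.tendsto_q[OF GL fL limG])
      have "(\<lambda>n. l2_inner ?M (indicator_fun P) (antisymmetrise (F n))) \<longlonglongrightarrow> 0"
        using L2.tendsto_right[OF GL fL indicator_fun_L2[OF Pb Pbd] limG] orth by simp
      then show "(\<lambda>n. Re (dirichlet_form (Omega d) (F n) (F n)) + ?K * (cmod (l2_inner ?M (indicator_fun P) (antisymmetrise (F n))))\<^sup>2
          + ?L * (LINT s|lborel. bdry d (F n) s)) \<longlonglongrightarrow> Re (dirichlet_form (Omega d) f f) + ?K * (cmod 0)\<^sup>2 + ?L * 0"
        using F unfolding approximates_def
        by (intro tendsto_add tendsto_mult tendsto_const lim(5) tendsto_power tendsto_norm) auto
      show "\<exists>N. \<forall>n\<ge>N. \<theta>\<^sup>2 * (2 * Re (l2_inner ?M (antisymmetrise (F n)) (antisymmetrise (F n))))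
         \<le> Re (dirichlet_form (Omega d) (F n) (F n)) + ?K * (cmod (l2_inner ?M (indicator_fun P) (antisymmetrise (F n))))\<^sup>2
          + ?L * (LINT s|lborel. bdry d (F n) s)"
      proof (intro exI allI impI)
        fix n
        show "\<theta>\<^sup>2 * (2 * Re (l2_inner ?M (antisymmetrise (F n)) (antisymmetrise (F n))))
         \<le> Re (dirichlet_form (Omega d) (F n) (F n)) + ?K * (cmod (l2_inner ?M (indicator_fun P) (antisymmetrise (F n))))\<^sup>2
          + ?L * (LINT s|lborel. bdry d (F n) s)"
          unfolding test_norm[OF test_antisymmetrise[OF T]] test_energy[OF T] indicator_fun_inner[OF test_antisymmetrise[OF T] Pb PO]
          using test_bound_antisym[OF T d \<theta>, of n, folded P_def] by (simp only: mult.assoc mult.left_commute)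
      qed
    qed
    then show "\<theta>\<^sup>2 * (2 * Re (l2_inner ?M f f)) \<le> Re (dirichlet_form (Omega d) f f)" by simp
  qed
  then show "2 * (pi / d)\<^sup>2 * Re (l2_inner ?M f f) \<le> Re (dirichlet_form (Omega d) f f)"
    by (simp only: mult.assoc mult.left_commute)
qed

section \<open>Functions in product form\<close>

definition prodf :: "(real \<Rightarrow> complex) \<Rightarrow> (real \<Rightarrow> complex) \<Rightarrow> plane \<Rightarrow> complex" where
  "prodf X Y p = X (fst p + snd p) * Y (fst p - snd p)"

definition smooth_compact :: "(real \<Rightarrow> complex) \<Rightarrow> bool" where
  "smooth_compact X \<longleftrightarrow> smooth X \<and> (\<exists>R. \<forall>t. R \<le> \<bar>t\<bar> \<longrightarrow> X t = 0)"

lemma smooth_compactI: "smooth X \<Longrightarrow> (\<And>t. R \<le> \<bar>t\<bar> \<Longrightarrow> X t = 0) \<Longrightarrow> smooth_compact X"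
  by (auto simp: smooth_compact_def)

lemma smooth_compact_smooth: "smooth_compact X \<Longrightarrow> smooth X" by (simp add: smooth_compact_def)

lemma vd_zero:
  assumes X: "smooth X" and S: "open S" "t \<in> S" and c: "\<And>u. u \<in> S \<Longrightarrow> X u = c"
  shows "vd X t = 0"
proof -
  have "((\<lambda>_. c) has_vector_derivative vd X t) (at t)"
    by (rule has_vector_derivative_transform_within_open[OF smooth_vector_derivative[OF X] S c])
  then show ?thesis using vector_derivative_unique_at[of "\<lambda>_. c" "vd X t" t 0] by auto
qed

lemma smooth_compact_vd: "smooth_compact X \<Longrightarrow> smooth_compact (vd X)"
proof -
  assume X: "smooth_compact X"
  then obtain R where R: "\<And>t. R \<le> \<bar>t\<bar> \<Longrightarrow> X t = 0" by (auto simp: smooth_compact_def)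
  show ?thesis
  proof (rule smooth_compactI[where R="R + 1"])
    fix t :: real assume t: "R + 1 \<le> \<bar>t\<bar>"
    have "open {u :: real. R < \<bar>u\<bar>}" by (intro open_Collect_less continuous_intros)
    then show "vd X t = 0" by (rule vd_zero[OF smooth_compact_smooth[OF X]]) (use t R in auto)
  qed (rule smooth_vd[OF smooth_compact_smooth[OF X]])
qed

lemma smooth_compact_mult: "smooth X \<Longrightarrow> smooth_compact Y \<Longrightarrow> smooth_compact (\<lambda>t. X t * Y t)"
  by (auto simp: smooth_compact_def smooth_mult)

lemma smooth_compact_add: "smooth_compact X \<Longrightarrow> smooth_compact Y \<Longrightarrow> smooth_compact (\<lambda>t. X t + Y t)"
proof -
  assume X: "smooth_compact X" and Y: "smooth_compact Y"
  then obtain R R' where "\<And>t. R \<le> \<bar>t\<bar> \<Longrightarrow> X t = 0" "\<And>t. R' \<le> \<bar>t\<bar> \<Longrightarrow> Y t = 0" by (auto simp: smooth_compact_def)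
  then show ?thesis using X Y by (intro smooth_compactI[where R="max R R'"] smooth_add) (auto simp: smooth_compact_smooth)
qed

lemma smooth_prodf:
  assumes "smooth X" "smooth Y" shows "smooth (prodf X Y)"
proof -
  have "smooth (\<lambda>p::plane. X (p \<bullet> (1, 1) + 0) * Y (p \<bullet> (1, - 1) + 0))"
    by (intro smooth_mult smooth_compose_affine assms)
  moreover have "(\<lambda>p::plane. X (p \<bullet> (1, 1) + 0) * Y (p \<bullet> (1, - 1) + 0)) = prodf X Y"
    by (auto simp: prodf_def inner_prod_def)
  ultimately show ?thesis by simp
qed

lemma test_prodf:
  assumes "smooth_compact X" "smooth_compact Y" shows "prodf X Y \<in> test_functions UNIV"
proof -
  obtain R where R: "\<And>t. R \<le> \<bar>t\<bar> \<Longrightarrow> X t = 0" using assms(1) by (auto simp: smooth_compact_def)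
  obtain R' where R': "\<And>t. R' \<le> \<bar>t\<bar> \<Longrightarrow> Y t = 0" using assms(2) by (auto simp: smooth_compact_def)
  define B where "B = max R R'"
  show ?thesis
  proof (rule testI[where K="cbox (- B, - B) (B, B)"])
    fix p :: plane assume "prodf X Y p \<noteq> 0"
    then have "X (fst p + snd p) \<noteq> 0" "Y (fst p - snd p) \<noteq> 0" by (auto simp: prodf_def)
    then have "\<bar>fst p + snd p\<bar> < B" "\<bar>fst p - snd p\<bar> < B"
      using R[of "fst p + snd p"] R'[of "fst p - snd p"] unfolding B_def by linarith+
    then show "p \<in> cbox (- B, - B) (B, B)" by (auto simp: mem_cbox_pair)
  qed (auto intro: smooth_prodf smooth_compact_smooth assms)
qed

lemma prodf_rot: "prodf X Y (rot (s, t)) = X s * Y t"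
proof -
  have "(s + t) / 2 + (s - t) / 2 = s" "(s + t) / 2 - (s - t) / 2 = t" by (auto simp: field_simps)
  then show ?thesis by (simp add: prodf_def rot_def)
qed

lemma pd_prodf:
  assumes "smooth X" "smooth Y"
  shows "pd (1, 0) (prodf X Y) p = prodf (vd X) Y p + prodf X (vd Y) p"
    and "pd (0, 1) (prodf X Y) p = prodf (vd X) Y p - prodf X (vd Y) p"
proof -
  have s: "((\<lambda>p::plane. fst p + snd p) has_derivative (\<lambda>v. fst v + snd v)) (at p)"
    "((\<lambda>p::plane. fst p - snd p) has_derivative (\<lambda>v. fst v - snd v)) (at p)"
    by (auto intro!: derivative_eq_intros)
  have "(prodf X Y has_derivative (\<lambda>v. X (fst p + snd p) * ((fst v - snd v) *\<^sub>R vd Y (fst p - snd p))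
      + ((fst v + snd v) *\<^sub>R vd X (fst p + snd p)) * Y (fst p - snd p))) (at p)"
    unfolding prodf_def[abs_def]
    by (rule has_derivative_mult[OF
          has_derivative_compose[OF s(1) smooth_vector_derivative[OF assms(1), unfolded has_vector_derivative_def]]
          has_derivative_compose[OF s(2) smooth_vector_derivative[OF assms(2), unfolded has_vector_derivative_def]]])
  note D = pdI[OF this]
  show "pd (1, 0) (prodf X Y) p = prodf (vd X) Y p + prodf X (vd Y) p"
    "pd (0, 1) (prodf X Y) p = prodf (vd X) Y p - prodf X (vd Y) p"
    unfolding D by (simp_all add: prodf_def)
qed

text \<open>The parallelogram law removes the mixed terms, so the energy separates in
  \<open>s\<close> and \<open>t\<close>.\<close>

lemma grad2_prodf_rot:
  assumes "smooth X" "smooth Y"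
  shows "grad2 (prodf X Y) (rot (s, t)) = 2 * ((cmod (vd X s))\<^sup>2 * (cmod (Y t))\<^sup>2 + (cmod (X s))\<^sup>2 * (cmod (vd Y t))\<^sup>2)"
proof -
  have "(cmod (a + b))\<^sup>2 + (cmod (a - b))\<^sup>2 = 2 * ((cmod a)\<^sup>2 + (cmod b)\<^sup>2)" for a b
    unfolding power2_norm_eq_inner by (simp add: inner_simps inner_commute)
  from this[of "vd X s * Y t" "X s * vd Y t"] show ?thesis
    by (simp add: grad2_def pd_prodf[OF assms] prodf_rot norm_mult power_mult_distrib)
qed

lemma rot_mem_Omega: "rot (s, t) \<in> Omega d \<longleftrightarrow> \<bar>t\<bar> < s \<and> \<bar>t\<bar> < d"
proof -
  have "(s + t) / 2 - (s - t) / 2 = t" by (auto simp: field_simps)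
  then show ?thesis by (auto simp: rot_def Omega_alt abs_less_iff)
qed

lemma flip_prodf: "prodf X Y (flip p) = X (fst p + snd p) * Y (- (fst p - snd p))"
  by (simp add: prodf_def flip_def add.commute)

text \<open>The function is itself a test function that vanishes on the Dirichlet boundary, so the
  constant sequence approximates it.\<close>

lemma prodf_form_domain:
  assumes X: "smooth_compact X" and Y: "smooth_compact Y" "Y d = 0" "Y (- d) = 0"
    and sy: "j = Sector_0 \<or> (\<forall>t. Y t = sector_sign j * Y (- t))"
  shows "prodf X Y \<in> form_domain d j"
proof -
  have T: "prodf X Y \<in> test_functions UNIV" by (rule test_prodf[OF X Y(1)])
  have H: "prodf X Y \<in> H1 (Omega d)" by (rule test_in_H1[OF T])
  have "H1_norm (Omega d) (fcomb 1 (prodf X Y) (- 1) (prodf X Y)) = sqrt (Re (energy d (fcomb 1 (prodf X Y) (- 1) (prodf X Y)) (fcomb 1 (prodf X Y) (- 1) (prodf X Y))))"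
    by (rule H1_norm_energy[OF H1_comb[OF open_Omega H H]])
  also have "\<dots> = 0" unfolding E.q_diff[OF H H] by simp
  finally have n: "H1_norm (Omega d) (\<lambda>p. prodf X Y p - prodf X Y p) = 0" by simp
  have b: "bdry d (prodf X Y) s = 0" for s by (simp add: bdry_def prodf_rot Y)
  have "approximates d (prodf X Y) (\<lambda>_. prodf X Y)" using T n b by (simp add: approximates_def)
  moreover have "has_sector_symmetry d j (prodf X Y)"
  proof (cases "j = Sector_0")
    case False
    then have "prodf X Y p = sector_sign j * prodf X Y (flip p)" for p
    proof -
      have y: "Y (fst p - snd p) = sector_sign j * Y (- (fst p - snd p))" using sy False by blast
      show ?thesis unfolding flip_prodf unfolding prodf_def y by (simp only: mult.left_commute)
    qed
    then show ?thesis unfolding sector_symmetry_iff by (intro disjI2 AE_I2)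
  qed (simp add: sector_symmetry_iff)
  ultimately show ?thesis using H unfolding form_domain_iff by blast
qed

section \<open>Trial functions\<close>

text \<open>Separation of variables. The factor of |X|^2 is the energy deficit of \<open>Y\<close>
  on a section; for a mode it vanishes once s \<ge> d, so only the corner s < d can make the
  integral negative.\<close>

lemma trial_energy:
  assumes X: "smooth_compact X" and Y: "smooth_compact Y" and d: "0 < d"
  defines "F \<equiv> prodf X Y"
  shows "Re (dirichlet_form (Omega d) F F) - 2 * \<omega>\<^sup>2 * Re (l2_inner (lebesgue_on (Omega d)) F F)
     = (LINT s|lborel. indicator {0<..} s * ((cmod (vd X s))\<^sup>2 * integral {- min s d..min s d} (\<lambda>t. (cmod (Y t))\<^sup>2)
        + (cmod (X s))\<^sup>2 * integral {- min s d..min s d} (\<lambda>t. (cmod (vd Y t))\<^sup>2 - \<omega>\<^sup>2 * (cmod (Y t))\<^sup>2)))"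
    and "integrable lborel (\<lambda>s. indicator {0<..} s * ((cmod (vd X s))\<^sup>2 * integral {- min s d..min s d} (\<lambda>t. (cmod (Y t))\<^sup>2)
        + (cmod (X s))\<^sup>2 * integral {- min s d..min s d} (\<lambda>t. (cmod (vd Y t))\<^sup>2 - \<omega>\<^sup>2 * (cmod (Y t))\<^sup>2)))"
proof -
  have T: "F \<in> test_functions UNIV" unfolding F_def by (rule test_prodf[OF X Y])
  have sX: "smooth X" and sY: "smooth Y" using X Y by (simp_all add: smooth_compact_smooth)
  let ?I = "\<lambda>s. indicator {0<..} s * ((cmod (vd X s))\<^sup>2 * integral {- min s d..min s d} (\<lambda>t. (cmod (Y t))\<^sup>2)
        + (cmod (X s))\<^sup>2 * integral {- min s d..min s d} (\<lambda>t. (cmod (vd Y t))\<^sup>2 - \<omega>\<^sup>2 * (cmod (Y t))\<^sup>2))"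
  let ?h = "\<lambda>p. indicator (Omega d) p * grad2 F p - 2 * \<omega>\<^sup>2 * (indicator (Omega d) p * (cmod (F p))\<^sup>2)"
  note I1 = test_integrable_sets(2)[OF T Omega_borel, of d]
  note I2 = integrable_mult_right[OF test_integrable_sets(1)[OF T Omega_borel], of "2 * \<omega>\<^sup>2" d]
  have ih: "integrable lborel ?h" by (rule Bochner_Integration.integrable_diff[OF I1 I2])
  have mh: "?h \<in> borel_measurable borel" using ih by auto
  have ih': "integrable lborel (\<lambda>p. ?h (rot p))" using ih rot_integral(1)[OF mh] by simp
  have inner: "(LINT t|lborel. ?h (rot (s, t))) = 2 * ?I s" for s
  proof (cases "0 < s")
    case True
    let ?g = "\<lambda>t. 2 * ((cmod (vd X s))\<^sup>2 * (cmod (Y t))\<^sup>2 + (cmod (X s))\<^sup>2 * ((cmod (vd Y t))\<^sup>2 - \<omega>\<^sup>2 * (cmod (Y t))\<^sup>2))"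
    have gc: "continuous_on UNIV ?g"
      by (intro continuous_intros smooth_continuous_on sY smooth_vd)
    have "?h (rot (s, t)) = indicator {t. rot (s, t) \<in> Omega d} t *\<^sub>R ?g t" for t
      unfolding F_def grad2_prodf_rot[OF sX sY] prodf_rot
      by (simp add: indicator_def norm_mult power_mult_distrib algebra_simps)
    then have "(LINT t|lborel. ?h (rot (s, t))) = (LINT t|lborel. indicator {t. rot (s, t) \<in> Omega d} t *\<^sub>R ?g t)" by simp
    also have "\<dots> = integral {- min s d..min s d} ?g"
      by (rule interval_integral[OF gc]) (auto simp: rot_mem_Omega)
    also have "\<dots> = 2 * ((cmod (vd X s))\<^sup>2 * integral {- min s d..min s d} (\<lambda>t. (cmod (Y t))\<^sup>2)
        + (cmod (X s))\<^sup>2 * integral {- min s d..min s d} (\<lambda>t. (cmod (vd Y t))\<^sup>2 - \<omega>\<^sup>2 * (cmod (Y t))\<^sup>2))"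
    proof -
      have a: "(\<lambda>t. (cmod (vd X s))\<^sup>2 * (cmod (Y t))\<^sup>2) integrable_on {- min s d..min s d}"
        "(\<lambda>t. (cmod (X s))\<^sup>2 * ((cmod (vd Y t))\<^sup>2 - \<omega>\<^sup>2 * (cmod (Y t))\<^sup>2)) integrable_on {- min s d..min s d}"
        by (intro integrable_continuous_interval continuous_intros smooth_continuous_on sY smooth_vd)+
      show ?thesis
        unfolding Henstock_Kurzweil_Integration.integral_mult_right Henstock_Kurzweil_Integration.integral_add[OF a] ..
    qed
    finally show ?thesis using True by simp
  next
    case False
    then have "rot (s, t) \<notin> Omega d" for t by (auto simp: rot_mem_Omega)
    then show ?thesis using False by simp
  qed
  have "integrable lborel (\<lambda>s. 2 * ?I s)" using plane_Fubini(3)[OF ih'] unfolding inner .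
  from integrable_mult_right[OF this, of "1/2"] show "integrable lborel ?I" by simp
  have "Re (dirichlet_form (Omega d) F F) - 2 * \<omega>\<^sup>2 * Re (l2_inner (lebesgue_on (Omega d)) F F) = (LINT p|lborel. ?h p)"
    unfolding test_energy[OF T] test_norm[OF T]
    by (subst Bochner_Integration.integral_diff[OF I1 I2]) simp
  also have "\<dots> = (1/2) * (LINT s|lborel. 2 * ?I s)"
    unfolding rot_integral(2)[OF mh] plane_Fubini(1)[OF ih'] inner by simp
  also have "\<dots> = (LINT s|lborel. ?I s)" by simp
  finally show "Re (dirichlet_form (Omega d) F F) - 2 * \<omega>\<^sup>2 * Re (l2_inner (lebesgue_on (Omega d)) F F) = (LINT s|lborel. ?I s)" .
qed

text \<open>In the antisymmetric sector the mode has zero total deficit, so that only the first order of a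
  perturbation supported where the deficit is negative takes the energy below the threshold.\<close>

definition side_bump :: "real \<Rightarrow> real \<Rightarrow> complex" where
  "side_bump d s = of_real (bump (2 / d * s + (- 1)))"

lemma side_bump:
  assumes "0 < d"
  shows "smooth (side_bump d)" "s \<le> d / 2 \<or> d \<le> s \<Longrightarrow> side_bump d s = 0"
proof -
  show "smooth (side_bump d)" unfolding side_bump_def by (rule smooth_affine[OF smooth_bump])
  assume "s \<le> d / 2 \<or> d \<le> s"
  then have "2 / d * s + (- 1) \<le> 0 \<or> 1 \<le> 2 / d * s + (- 1)" using assms by (auto simp: field_simps)
  then show "side_bump d s = 0" by (simp add: side_bump_def bump_zero)
qed

lemma smooth_compact_bounded:
  assumes "smooth_compact X" obtains C where "0 \<le> C" "\<And>t. cmod (X t) \<le> C"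
proof -
  obtain R where R: "\<And>t. R \<le> \<bar>t\<bar> \<Longrightarrow> X t = 0" using assms by (auto simp: smooth_compact_def)
  have "compact (X ` {- R..R})" by (intro compact_continuous_image smooth_continuous_on smooth_compact_smooth assms) auto
  then obtain C where "\<forall>x\<in>X ` {- R..R}. norm x \<le> C" using compact_imp_bounded bounded_iff by metis
  then have C: "cmod (X t) \<le> C" if "- R \<le> t" "t \<le> R" for t using that by simp
  show ?thesis
  proof (rule that[of "max C 0"])
    fix t show "cmod (X t) \<le> max C 0"
    proof (cases "\<bar>t\<bar> < R")
      case True
      then have "- R \<le> t" "t \<le> R" by auto
      then show ?thesis using C[of t] by simp
    qed (use R[of t] in simp)
  qed simp
qed

text \<open>Far out the trial function is a slowly varying multiple of \<open>Y\<close>; its cost is of order \<open>1 / L\<close>.\<close>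

lemma trial_function:
  fixes \<epsilon> :: real
  assumes Y: "smooth_compact Y" and d: "0 < d" and Y1: "\<And>t. \<bar>t\<bar> \<le> d \<Longrightarrow> cmod (Y t) \<le> 1"
    and V: "continuous_on {0..d} V" "V d = 0" "\<And>s. 0 \<le> s \<Longrightarrow> s \<le> d \<Longrightarrow> V s = integral {- s..s} (\<lambda>t. (cmod (vd Y t))\<^sup>2 - \<omega>\<^sup>2 * (cmod (Y t))\<^sup>2)"
    and neg: "integral {0..d} (\<lambda>s. 2 * d * \<epsilon>\<^sup>2 * (cmod (vd (side_bump d) s))\<^sup>2 + (cmod (1 + of_real \<epsilon> * side_bump d s))\<^sup>2 * V s) < 0"
  shows "\<exists>X. smooth_compact X \<and> Re (dirichlet_form (Omega d) (prodf X Y) (prodf X Y)) < 2 * \<omega>\<^sup>2 * Re (l2_inner (lebesgue_on (Omega d)) (prodf X Y) (prodf X Y))"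
proof -
  define P where "P t = complex_of_real (plateau 1 t)" for t
  define N where "N s = 2 * d * \<epsilon>\<^sup>2 * (cmod (vd (side_bump d) s))\<^sup>2 + (cmod (1 + of_real \<epsilon> * side_bump d s))\<^sup>2 * V s" for s
  have P: "smooth_compact P" unfolding P_def by (rule smooth_compactI[where R=2]) (auto simp: smooth_plateau plateau_zero)
  obtain C where C: "0 \<le> C" "\<And>t. cmod (vd P t) \<le> C" using smooth_compact_bounded[OF smooth_compact_vd[OF P]] by blast
  define n where "n = integral {0..d} N"
  have n: "n < 0" unfolding n_def N_def[abs_def] by (rule neg)
  \<comment> \<open>The cutoff costs at most \<open>4 * d * C\<^sup>2 / L\<close>. This
    \<open>L\<close> brings the cost below \<open>- n\<close>, and L > d keeps the cutoff away from
    the corner.\<close>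
  define L where "L = d + 1 + 4 * d * C\<^sup>2 / (- n)"
  have L: "d < L" "4 * d * C\<^sup>2 / L < - n"
  proof -
    have x: "0 \<le> 4 * d * C\<^sup>2 / (- n)" using d n by (intro divide_nonneg_pos) auto
    then show "d < L" by (simp add: L_def)
    have "4 * d * C\<^sup>2 / (- n) < L" using d by (simp add: L_def)
    then have "4 * d * C\<^sup>2 < L * (- n)" using n by (subst (asm) pos_divide_less_eq) auto
    then show "4 * d * C\<^sup>2 / L < - n" using \<open>d < L\<close> d by (subst pos_divide_less_eq) (auto simp: mult.commute)
  qed
  have Lp: "0 < L" using L d by simp
  define \<xi> where "\<xi> = side_bump d"
  have s\<xi>: "smooth \<xi>" unfolding \<xi>_def by (rule side_bump(1)[OF d])
  have \<xi>0: "\<xi> s = 0" if "d \<le> s \<or> s \<le> d / 2" for s using side_bump(2)[OF d] that by (auto simp: \<xi>_def)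
  \<comment> \<open>The plateau is stretched by \<open>L\<close>, so on the corner 0 < s \<le> d the
    function is 1 plus the perturbation.\<close>
  define X where "X s = P (1 / L * s + 0) + of_real \<epsilon> * \<xi> s" for s
  have sPL: "smooth (\<lambda>s. P (1 / L * s + 0))" by (rule smooth_affine[OF smooth_compact_smooth[OF P]])
  have sX: "smooth X" unfolding X_def by (intro smooth_add smooth_mult smooth_const sPL s\<xi>)
  have Ps: "P (1 / L * s + 0) = 1" if "\<bar>s\<bar> \<le> L" for s
    using that Lp by (simp add: P_def plateau_one divide_le_eq)
  have Pz: "P (1 / L * s + 0) = 0" if "2 * L \<le> \<bar>s\<bar>" for s
    using that Lp by (simp add: P_def plateau_zero le_divide_eq)
  have cX: "smooth_compact X"
    by (rule smooth_compactI[OF sX, where R="2 * L + d"]) (use Pz \<xi>0 Lp d in \<open>auto simp: X_def abs_if split: if_splits\<close>)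
  have dX: "vd X s = (1 / L) *\<^sub>R vd P (1 / L * s + 0) + of_real \<epsilon> * vd \<xi> s" for s
  proof -
    have "((\<lambda>s. P (1 / L * s + 0)) has_vector_derivative (1 / L) *\<^sub>R vd P (1 / L * s + 0)) (at s)"
    proof -
      have "((\<lambda>s. 1 / L * s + 0) has_real_derivative 1 / L) (at s)" using Lp by (auto intro!: derivative_eq_intros)
      from vector_diff_chain_at[OF this[unfolded has_real_derivative_iff_has_vector_derivative] smooth_vector_derivative[OF smooth_compact_smooth[OF P]]]
      show ?thesis by (simp only: o_def)
    qed
    moreover have "((\<lambda>s. of_real \<epsilon> * \<xi> s) has_vector_derivative of_real \<epsilon> * vd \<xi> s) (at s)"
      by (rule has_vector_derivative_mult_right[OF smooth_vector_derivative[OF s\<xi>]])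
    ultimately show ?thesis unfolding X_def[abs_def]
      by (intro vector_derivative_at has_vector_derivative_add)
  qed
  have vP0: "vd P u = 0" if "\<bar>u\<bar> < 1" for u
    by (rule vd_zero[OF smooth_compact_smooth[OF P], where S="{-1<..<1}" and c=1]) (use that in \<open>auto simp: P_def plateau_one abs_less_iff\<close>)
  have vP2: "vd P u = 0" if "2 < u" for u
    by (rule vd_zero[OF smooth_compact_smooth[OF P], where S="{2<..}" and c=0]) (use that in \<open>auto simp: P_def plateau_zero\<close>)
  have v\<xi>: "vd \<xi> u = 0" if "d < u" for u
    by (rule vd_zero[OF s\<xi>, where S="{d<..}" and c=0]) (use that \<xi>0 in auto)
  let ?W = "\<lambda>s. integral {- min s d..min s d} (\<lambda>t. (cmod (Y t))\<^sup>2)"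
  let ?V = "\<lambda>s. integral {- min s d..min s d} (\<lambda>t. (cmod (vd Y t))\<^sup>2 - \<omega>\<^sup>2 * (cmod (Y t))\<^sup>2)"
  let ?I = "\<lambda>s. indicator {0<..} s * ((cmod (vd X s))\<^sup>2 * ?W s + (cmod (X s))\<^sup>2 * ?V s)"
  \<comment> \<open>A majorant of the integrand \<open>?I\<close>: \<open>N\<close> on the corner,
    plus the cost of the cutoff, whose derivative is at most C / L and vanishes for s > 2 L.\<close>
  define B where "B s = indicator {0..d} s * N s + indicator {0..2 * L} s * (2 * d * (C / L)\<^sup>2)" for s :: real
  have W: "?W s \<le> 2 * d" "0 \<le> ?W s" if "0 < s" for s
  proof -
    have "(cmod (Y t))\<^sup>2 \<le> 1" if "t \<in> {- min s d..min s d}" for t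
      using Y1[of t] that by (intro power_le_one) auto
    then have "?W s \<le> integral {- min s d..min s d} (\<lambda>t. 1)"
      by (intro integral_le integrable_continuous_interval continuous_intros smooth_continuous_on smooth_compact_smooth[OF Y]) auto
    also have "\<dots> = 2 * min s d"
    proof -
      have "integral {- m..m} (\<lambda>t. 1 :: real) = 2 * m" if "0 < m" for m :: real using that by simp
      then show ?thesis using that d by (metis min_less_iff_conj)
    qed
    finally show "?W s \<le> 2 * d" by simp
    show "0 \<le> ?W s"
      by (intro integral_nonneg integrable_continuous_interval continuous_intros smooth_continuous_on smooth_compact_smooth[OF Y]) auto
  qed
  have le: "?I s \<le> B s" for s
  proof -
    have cc: "0 \<le> indicator {0..2 * L} s * (2 * d * (C / L)\<^sup>2)" using d by simp
    consider "s < 0" | "s = 0" | "0 < s" "s \<le> d" | "d < s" by linarith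
    then show ?thesis
    proof cases
      case 1 then show ?thesis by (simp add: B_def)
    next
      case 2
      have "V 0 = 0" using V(3)[of 0] d by simp
      then have "0 \<le> N 0" using d by (simp add: N_def)
      then show ?thesis using cc 2 d by (simp add: B_def)
    next
      case 3
      have "\<bar>1 / L * s + 0\<bar> < 1" using 3 L Lp by (simp add: abs_less_iff divide_less_eq)
      then have "vd X s = of_real \<epsilon> * vd \<xi> s" by (simp add: dX vP0)
      then have e1: "(cmod (vd X s))\<^sup>2 = \<epsilon>\<^sup>2 * (cmod (vd \<xi> s))\<^sup>2" by (simp add: norm_mult power_mult_distrib)
      have e2: "X s = 1 + of_real \<epsilon> * \<xi> s" using Ps[of s] 3 L by (simp add: X_def)
      have m: "min s d = s" using 3 by simp
      have e3: "?V s = V s" unfolding m using V(3)[of s] 3 by simp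
      have i1: "indicator {0<..} s = (1::real)" using 3 by simp
      have Is: "?I s = \<epsilon>\<^sup>2 * (cmod (vd \<xi> s))\<^sup>2 * ?W s + (cmod (1 + of_real \<epsilon> * \<xi> s))\<^sup>2 * V s"
        unfolding i1 e1 e3 unfolding e2 by simp
      have Ns: "N s = \<epsilon>\<^sup>2 * (cmod (vd \<xi> s))\<^sup>2 * (2 * d) + (cmod (1 + of_real \<epsilon> * \<xi> s))\<^sup>2 * V s"
        unfolding N_def \<xi>_def[symmetric] by simp
      have "\<epsilon>\<^sup>2 * (cmod (vd \<xi> s))\<^sup>2 * ?W s \<le> \<epsilon>\<^sup>2 * (cmod (vd \<xi> s))\<^sup>2 * (2 * d)"
        using W(1)[OF 3(1)] by (intro mult_left_mono) auto
      then have "?I s \<le> N s" unfolding Is Ns by (rule add_right_mono)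
      moreover have "B s = N s + indicator {0..2 * L} s * (2 * d * (C / L)\<^sup>2)" using 3 by (simp add: B_def)
      ultimately show ?thesis using cc by linarith
    next
      case 4
      have m: "min s d = d" using 4 by simp
      have e3: "?V s = 0" using V(2) V(3)[of d] d by (simp add: m)
      have s0: "0 < s" using 4 d by simp
      show ?thesis
      proof (cases "s \<le> 2 * L")
        case True
        have "cmod (vd X s) \<le> C / L"
          using C(2)[of "1 / L * s + 0"] Lp 4 by (simp add: dX v\<xi> norm_mult divide_right_mono)
        then have "(cmod (vd X s))\<^sup>2 \<le> (C / L)\<^sup>2" by (intro power_mono) auto
        then have "(cmod (vd X s))\<^sup>2 * ?W s \<le> (C / L)\<^sup>2 * (2 * d)"
          using W[OF s0] by (intro mult_mono) auto
        then show ?thesis using 4 s0 True e3 by (simp add: B_def mult.commute)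
      next
        case False
        have "2 < 1 / L * s + 0" using False Lp by (simp add: less_divide_eq)
        then have "vd X s = 0" using 4 by (simp add: dX vP2 v\<xi>)
        then show ?thesis using e3 4 False by (simp add: B_def)
      qed
    qed
  qed
  have Nc: "continuous_on {0..d} N" unfolding N_def \<xi>_def[symmetric]
    by (intro continuous_intros smooth_continuous_on smooth_vd s\<xi> V(1))
  have iN: "integrable lborel (\<lambda>s. indicator {0..d} s * N s)"
    using borel_integrable_atLeastAtMost'[OF Nc] by (simp add: set_integrable_def)
  have iC: "integrable lborel (\<lambda>s. indicator {0..2 * L} s * (2 * d * (C / L)\<^sup>2))"
    using borel_integrable_atLeastAtMost'[of 0 "2 * L" "\<lambda>_. 2 * d * (C / L)\<^sup>2"] by (simp add: set_integrable_def)
  have "(LINT s|lborel. B s) = (LINT s|lborel. indicator {0..d} s * N s) + (LINT s|lborel. indicator {0..2 * L} s * (2 * d * (C / L)\<^sup>2))"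
    unfolding B_def by (rule Bochner_Integration.integral_add[OF iN iC])
  also have "(LINT s|lborel. indicator {0..d} s * N s) = n"
    using set_borel_integral_eq_integral(2)[OF borel_integrable_atLeastAtMost'[OF Nc]] by (simp add: set_lebesgue_integral_def n_def)
  also have "(LINT s|lborel. indicator {0..2 * L} s * (2 * d * (C / L)\<^sup>2)) = 2 * L * (2 * d * (C / L)\<^sup>2)"
    using Lp by simp
  also have "\<dots> = 4 * d * C\<^sup>2 / L" using Lp by (simp add: power2_eq_square field_simps)
  finally have B: "(LINT s|lborel. B s) < 0" using L(2) by simp
  have "Re (dirichlet_form (Omega d) (prodf X Y) (prodf X Y)) - 2 * \<omega>\<^sup>2 * Re (l2_inner (lebesgue_on (Omega d)) (prodf X Y) (prodf X Y)) = (LINT s|lborel. ?I s)"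
    by (rule trial_energy(1)[OF cX Y d])
  also have "\<dots> \<le> (LINT s|lborel. B s)"
  proof (rule integral_mono[OF trial_energy(2)[OF cX Y d] _ le])
    show "integrable lborel B" unfolding B_def by (rule Bochner_Integration.integrable_add[OF iN iC])
  qed
  finally show ?thesis using B cX by (intro exI[of _ X]) simp
qed

section \<open>The ground state of the cross section\<close>

definition freq :: "real \<Rightarrow> sector \<Rightarrow> real" where
  "freq d j = (if j = Sector_a then pi / d else pi / (2 * d))"

definition trig :: "real \<Rightarrow> sector \<Rightarrow> real \<Rightarrow> real" where
  "trig d j t = (if j = Sector_a then sin (freq d j * t) else cos (freq d j * t))"

definition trig' :: "real \<Rightarrow> sector \<Rightarrow> real \<Rightarrow> real" where
  "trig' d j t = (if j = Sector_a then freq d j * cos (freq d j * t) else - freq d j * sin (freq d j * t))"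

text \<open>The cutoff has no effect on the strip, where \<open>|t| < d\<close>.\<close>

definition mode :: "real \<Rightarrow> sector \<Rightarrow> real \<Rightarrow> complex" where
  "mode d j t = of_real (plateau (d + 1) t) * of_real (trig d j t)"

lemma smooth_compact_mode: "smooth_compact (mode d j)"
proof (rule smooth_compactI[where R="d + 2"])
  have "smooth (\<lambda>t. of_real (trig d j t))"
    using smooth_sin[of "freq d j"] smooth_cos[of "freq d j"] by (cases "j = Sector_a") (simp_all add: trig_def)
  then show "smooth (mode d j)" unfolding mode_def[abs_def] by (intro smooth_mult smooth_plateau)
  show "mode d j t = 0" if "d + 2 \<le> \<bar>t\<bar>" for t using that by (simp add: mode_def plateau_zero)
qed

lemma mode_le_1: "cmod (mode d j t) \<le> 1"
proof -
  have "\<bar>plateau (d + 1) t\<bar> * \<bar>trig d j t\<bar> \<le> 1"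
    using plateau_bounds[of "d + 1" t] by (intro mult_le_one) (auto simp: trig_def)
  then show ?thesis by (simp add: mode_def norm_mult)
qed

lemma mode_boundary: assumes "0 < d" shows "mode d j d = 0" "mode d j (- d) = 0"
proof -
  have "trig d j d = 0 \<and> trig d j (- d) = 0"
    using assms by (cases "j = Sector_a") (simp_all add: trig_def freq_def)
  then show "mode d j d = 0" "mode d j (- d) = 0" by (simp_all add: mode_def)
qed

lemma mode_parity: "j = Sector_0 \<or> (\<forall>t. mode d j t = sector_sign j * mode d j (- t))"
  by (cases j) (simp_all add: mode_def trig_def plateau_even)

lemma local_vd:
  assumes Y: "smooth Y" and S: "open S" "t \<in> S" "\<And>u. u \<in> S \<Longrightarrow> Y u = of_real (f u)"
    and f: "(f has_real_derivative f') (at t)"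
  shows "vd Y t = of_real f'"
proof -
  have "((\<lambda>u. complex_of_real (f u)) has_vector_derivative vd Y t) (at t)"
    by (rule has_vector_derivative_transform_within_open[OF smooth_vector_derivative[OF Y] S])
  moreover have "((\<lambda>u. complex_of_real (f u)) has_vector_derivative of_real f') (at t)"
    by (rule has_vector_derivative_of_real) (use f in \<open>simp add: has_real_derivative_iff_has_vector_derivative\<close>)
  ultimately show ?thesis by (rule vector_derivative_unique_at)
qed

lemma mode_derivatives:
  assumes t: "\<bar>t\<bar> < d + 1"
  shows "vd (mode d j) t = of_real (trig' d j t)" "vd (vd (mode d j)) t = - of_real ((freq d j)\<^sup>2) * mode d j t"
proof -
  have o: "open {- (d + 1)<..<d + 1}" by simp
  have 1: "vd (mode d j) t = of_real (trig' d j t)" if "t \<in> {- (d + 1)<..<d + 1}" for t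
  proof (rule local_vd[OF smooth_compact_smooth[OF smooth_compact_mode] o that])
    show "mode d j u = of_real (trig d j u)" if "u \<in> {- (d + 1)<..<d + 1}" for u
      using that by (simp add: mode_def plateau_one abs_le_iff)
    show "(trig d j has_real_derivative trig' d j t) (at t)"
      unfolding trig_def[abs_def] trig'_def by (cases "j = Sector_a") (auto intro!: derivative_eq_intros)
  qed
  have m: "t \<in> {- (d + 1)<..<d + 1}" using t by (auto simp: abs_less_iff)
  show "vd (mode d j) t = of_real (trig' d j t)" by (rule 1[OF m])
  have "vd (vd (mode d j)) t = of_real (- (freq d j)\<^sup>2 * trig d j t)"
  proof (rule local_vd[OF smooth_vd[OF smooth_compact_smooth[OF smooth_compact_mode]] o m 1])
    show "(trig' d j has_real_derivative - (freq d j)\<^sup>2 * trig d j t) (at t)"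
      unfolding trig_def trig'_def[abs_def] by (cases "j = Sector_a") (auto intro!: derivative_eq_intros simp: power2_eq_square)
  qed
  moreover have "mode d j t = of_real (trig d j t)" using t by (simp add: mode_def plateau_one)
  ultimately show "vd (vd (mode d j)) t = - of_real ((freq d j)\<^sup>2) * mode d j t" by simp
qed

text \<open>The closed form of the integral of |Y'|^2 - \<omega>^2 |Y|^2 over -s < t < s, with
  \<open>Y\<close> the mode; the integrand is plus or minus \<omega>^2 cos (2 \<omega> t).\<close>

definition deficit :: "real \<Rightarrow> sector \<Rightarrow> real \<Rightarrow> real" where
  "deficit d j s = (if j = Sector_a then 1 else - 1) * freq d j * sin (2 * freq d j * s)"

lemma mode_deficit:
  assumes d: "0 < d" and s: "0 \<le> s" "s \<le> d"
  shows "deficit d j s = integral {- s..s} (\<lambda>t. (cmod (vd (mode d j) t))\<^sup>2 - (freq d j)\<^sup>2 * (cmod (mode d j t))\<^sup>2)"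
proof -
  let ?w = "freq d j"
  define c :: real where "c = (if j = Sector_a then 1 else - 1)"
  have e: "(cmod (vd (mode d j) t))\<^sup>2 - ?w\<^sup>2 * (cmod (mode d j t))\<^sup>2 = c * ?w\<^sup>2 * cos (2 * ?w * t)" if "t \<in> {- s..s}" for t
  proof -
    have t: "\<bar>t\<bar> < d + 1" using that s by (auto simp: abs_less_iff)
    then have m: "mode d j t = of_real (trig d j t)" by (simp add: mode_def plateau_one)
    have c2: "cos (2 * ?w * t) = (cos (?w * t))\<^sup>2 - (sin (?w * t))\<^sup>2"
      using cos_double[of "?w * t"] by (simp add: mult.assoc)
    show ?thesis unfolding mode_derivatives(1)[OF t] m c2
      by (simp add: trig_def trig'_def c_def power_mult_distrib algebra_simps)
  qed
  have w: "0 < ?w" using d by (simp add: freq_def)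
  have "((\<lambda>t. c * ?w\<^sup>2 * cos (2 * ?w * t)) has_integral c * ?w / 2 * sin (2 * ?w * s) - c * ?w / 2 * sin (2 * ?w * (- s))) {- s..s}"
    using s by (intro fundamental_theorem_of_calculus)
      (auto intro!: derivative_eq_intros simp: has_real_derivative_iff_has_vector_derivative[symmetric] power2_eq_square)
  from integral_unique[OF this]
  have "integral {- s..s} (\<lambda>t. c * ?w\<^sup>2 * cos (2 * ?w * t)) = c * ?w * sin (2 * ?w * s)"
    by (simp only: mult_minus_right sin_minus) (simp add: field_simps)
  also have "\<dots> = deficit d j s" by (simp add: deficit_def c_def)
  finally have "integral {- s..s} (\<lambda>t. c * ?w\<^sup>2 * cos (2 * ?w * t)) = deficit d j s" .
  moreover have "integral {- s..s} (\<lambda>t. (cmod (vd (mode d j) t))\<^sup>2 - ?w\<^sup>2 * (cmod (mode d j t))\<^sup>2) = integral {- s..s} (\<lambda>t. c * ?w\<^sup>2 * cos (2 * ?w * t))"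
    by (rule integral_cong[OF e])
  ultimately show ?thesis by (simp only:)
qed

text \<open>2 \<omega> d is pi, or 2 pi in the antisymmetric sector: half a period of the sine has a
  nonzero integral, a full period has integral 0. This is why the antisymmetric trial function is
  perturbed.\<close>

lemma deficit_integral:
  assumes d: "0 < d"
  shows "j \<noteq> Sector_a \<Longrightarrow> integral {0..d} (deficit d j) = - 1" "integral {0..d} (deficit d Sector_a) = 0"
proof -
  have I: "integral {0..d} (deficit d j) = (if j = Sector_a then 0 else - 1)" for j
  proof -
    define w where "w = freq d j"
    define c :: real where "c = (if j = Sector_a then 1 else - 1)"
    have I: "((\<lambda>s. c * w * sin (2 * w * s)) has_integral - c / 2 * cos (2 * w * d) - (- c / 2 * cos (2 * w * 0))) {0..d}"
      using d by (intro fundamental_theorem_of_calculus)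
        (auto intro!: derivative_eq_intros simp: has_real_derivative_iff_has_vector_derivative[symmetric])
    have V: "deficit d j = (\<lambda>s. c * w * sin (2 * w * s))" by (simp add: deficit_def[abs_def] c_def w_def)
    have wd: "2 * w * d = (if j = Sector_a then 2 * pi else pi)" using d by (simp add: w_def freq_def)
    show ?thesis unfolding V integral_unique[OF I] wd by (simp add: c_def)
  qed
  show "j \<noteq> Sector_a \<Longrightarrow> integral {0..d} (deficit d j) = - 1" "integral {0..d} (deficit d Sector_a) = 0"
    by (simp_all add: I)
qed

lemma deficit_continuous: "continuous_on S (deficit d j)"
  unfolding deficit_def by (intro continuous_intros)

lemma deficit_end: "0 < d \<Longrightarrow> deficit d j d = 0"
proof -
  assume "0 < d"
  then have "2 * freq d j * d = (if j = Sector_a then 2 * pi else pi)" by (simp add: freq_def)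
  then show ?thesis by (simp add: deficit_def)
qed

lemma side_bump_deficit:
  assumes d: "0 < d"
  shows "integral {0..d} (\<lambda>s. Re (side_bump d s) * deficit d Sector_a s) < 0"
proof -
  let ?f = "\<lambda>s. - (Re (side_bump d s) * deficit d Sector_a s)"
  have w: "2 * freq d Sector_a * s = 2 * pi * (s / d)" for s by (simp add: freq_def)
  have c: "continuous_on {0..d} ?f" 
    by (intro continuous_intros deficit_continuous smooth_continuous_on side_bump(1) d)
  have nn: "0 \<le> ?f s" if s: "s \<in> {0..d}" for s
  proof (cases "s \<le> d / 2")
    case True then show ?thesis using side_bump(2)[OF d, of s] by simp
  next
    case False
    \<comment> \<open>The bump is supported in the second half of the period, where the sine is at
      most 0.\<close>
    have "1 / 2 < s / d" "s / d \<le> 1" using False s d by (auto simp: field_simps)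
    then have "pi \<le> 2 * pi * (s / d)" "2 * pi * (s / d) \<le> 2 * pi"
      using pi_gt_zero mult_left_mono[of "1/2" "s / d" "2 * pi"] mult_left_mono[of "s / d" 1 "2 * pi"] by auto
    then have "sin (2 * pi * (s / d)) \<le> 0"
      using sin_ge_zero[of "2 * pi * (s / d) - pi"] by (auto simp: sin_diff)
    moreover have "0 \<le> freq d Sector_a" using d by (simp add: freq_def)
    ultimately have "deficit d Sector_a s \<le> 0" unfolding deficit_def w by (simp add: mult_nonneg_nonpos)
    moreover have "0 \<le> Re (side_bump d s)" by (simp add: side_bump_def bump_nonneg)
    ultimately show ?thesis by (simp add: mult_nonneg_nonpos)
  qed
  have "integral {0..d} ?f \<noteq> 0"
  proof
    assume "integral {0..d} ?f = 0"
    then have "(?f has_integral 0) (cbox 0 d)"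
      using integrable_integral[OF integrable_continuous_interval[OF c]] by (simp add: cbox_interval)
    \<comment> \<open>At 3 d / 4 the sine is -1 and the bump is at the middle of its support, so the
      integrand is nonzero there.\<close>
    then have "?f (3 / 4 * d) = 0"
      using c nn d by (intro has_integral_0_cbox_imp_0[of 0 d ?f]) (auto simp: cbox_interval)
    moreover have "sin (2 * pi * (3 / 4 * d / d)) = - 1"
      using d sin_periodic_pi[of "pi / 2"] by (simp add: field_simps)
    then have "deficit d Sector_a (3 / 4 * d) \<noteq> 0" using d unfolding deficit_def w by (simp add: freq_def)
    moreover have "2 / d * (3 / 4 * d) + (- 1) = 1 / 2" using d by simp
    then have "side_bump d (3 / 4 * d) \<noteq> 0" using bump_pos[of "1/2"] unfolding side_bump_def by simp
    then have "Re (side_bump d (3 / 4 * d)) \<noteq> 0" by (simp add: side_bump_def)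
    ultimately show False by simp
  qed
  moreover have "0 \<le> integral {0..d} ?f"
    by (rule integral_nonneg[OF integrable_continuous_interval[OF c] nn])
  ultimately show ?thesis by simp
qed

lemma energy_below_threshold:
  assumes d: "0 < d"
  shows "\<exists>w\<in>form_domain d j. Re (dirichlet_form (Omega d) w w) < 2 * (freq d j)\<^sup>2 * Re (l2_inner (lebesgue_on (Omega d)) w w)"
proof -
  let ?V = "deficit d j"
  let ?\<xi> = "side_bump d"
  have s\<xi>: "smooth ?\<xi>" by (rule side_bump(1)[OF d])
  have "\<exists>\<epsilon>. integral {0..d} (\<lambda>s. 2 * d * \<epsilon>\<^sup>2 * (cmod (vd ?\<xi> s))\<^sup>2 + (cmod (1 + of_real \<epsilon> * ?\<xi> s))\<^sup>2 * ?V s) < 0"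
  proof (cases "j = Sector_a")
    case False
    \<comment> \<open>For \<epsilon> = 0 the integral is that of the deficit alone, namely
      -1.\<close>
    then show ?thesis using deficit_integral(1)[OF d False] by (intro exI[of _ 0]) simp
  next
    case True
    define I1 where "I1 = integral {0..d} (\<lambda>s. Re (?\<xi> s) * ?V s)"
    define I2 where "I2 = integral {0..d} (\<lambda>s. 2 * d * (cmod (vd ?\<xi> s))\<^sup>2 + (Re (?\<xi> s))\<^sup>2 * ?V s)"
    \<comment> \<open>The integral becomes \<epsilon> (2 I1 + \<epsilon> I2) with I1 < 0, and this
      choice gives \<epsilon> I2 \<le> - I1.\<close>
    define \<epsilon> where "\<epsilon> = - I1 / (\<bar>I2\<bar> + 1)"
    have I1: "I1 < 0" using side_bump_deficit[OF d] by (simp add: I1_def True)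
    have e: "0 < \<epsilon>" using I1 unfolding \<epsilon>_def by (intro divide_pos_pos) auto
    have ic: "?V integrable_on {0..d}" "(\<lambda>s. Re (?\<xi> s) * ?V s) integrable_on {0..d}"
      "(\<lambda>s. 2 * d * (cmod (vd ?\<xi> s))\<^sup>2 + (Re (?\<xi> s))\<^sup>2 * ?V s) integrable_on {0..d}"
      by (intro integrable_continuous_interval continuous_intros deficit_continuous smooth_continuous_on s\<xi> smooth_vd)+
    have "(cmod (1 + of_real \<epsilon> * ?\<xi> s))\<^sup>2 = 1 + 2 * \<epsilon> * Re (?\<xi> s) + \<epsilon>\<^sup>2 * (Re (?\<xi> s))\<^sup>2" for s
    proof -
      have "1 + of_real \<epsilon> * ?\<xi> s = of_real (1 + \<epsilon> * Re (?\<xi> s))" by (simp add: side_bump_def)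
      then have "(cmod (1 + of_real \<epsilon> * ?\<xi> s))\<^sup>2 = (1 + \<epsilon> * Re (?\<xi> s))\<^sup>2" by (simp only: norm_of_real power2_abs)
      then show ?thesis by (simp add: power2_eq_square algebra_simps)
    qed
    then have p: "2 * d * \<epsilon>\<^sup>2 * (cmod (vd ?\<xi> s))\<^sup>2 + (cmod (1 + of_real \<epsilon> * ?\<xi> s))\<^sup>2 * ?V s =
        ?V s + (2 * \<epsilon>) * (Re (?\<xi> s) * ?V s) + \<epsilon>\<^sup>2 * (2 * d * (cmod (vd ?\<xi> s))\<^sup>2 + (Re (?\<xi> s))\<^sup>2 * ?V s)" for s
      by (simp add: algebra_simps)
    have "integral {0..d} (\<lambda>s. 2 * d * \<epsilon>\<^sup>2 * (cmod (vd ?\<xi> s))\<^sup>2 + (cmod (1 + of_real \<epsilon> * ?\<xi> s))\<^sup>2 * ?V s)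
        = integral {0..d} ?V + 2 * \<epsilon> * I1 + \<epsilon>\<^sup>2 * I2"
      unfolding p I1_def I2_def
        Henstock_Kurzweil_Integration.integral_add[OF integrable_add[OF ic(1) integrable_on_mult_right[OF ic(2)]] integrable_on_mult_right[OF ic(3)]]
        Henstock_Kurzweil_Integration.integral_add[OF ic(1) integrable_on_mult_right[OF ic(2)]]
        Henstock_Kurzweil_Integration.integral_mult_right ..
    also have "\<dots> = \<epsilon> * (2 * I1 + \<epsilon> * I2)"
      using deficit_integral(2)[OF d] by (simp add: True power2_eq_square algebra_simps)
    also have "\<dots> < 0"
    proof -
      have "\<epsilon> * I2 \<le> \<epsilon> * (\<bar>I2\<bar> + 1)" using e by (intro mult_left_mono) auto
      also have "\<dots> = - I1" by (simp add: \<epsilon>_def)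
      finally have "2 * I1 + \<epsilon> * I2 < 0" using I1 by linarith
      then show ?thesis using e by (simp add: mult_pos_neg)
    qed
    finally show ?thesis by blast
  qed
  then obtain \<epsilon> where neg: "integral {0..d} (\<lambda>s. 2 * d * \<epsilon>\<^sup>2 * (cmod (vd ?\<xi> s))\<^sup>2 + (cmod (1 + of_real \<epsilon> * ?\<xi> s))\<^sup>2 * ?V s) < 0" by blast
  have "\<exists>X. smooth_compact X \<and> Re (dirichlet_form (Omega d) (prodf X (mode d j)) (prodf X (mode d j)))
      < 2 * (freq d j)\<^sup>2 * Re (l2_inner (lebesgue_on (Omega d)) (prodf X (mode d j)) (prodf X (mode d j)))"
    by (rule trial_function[OF smooth_compact_mode d mode_le_1 deficit_continuous deficit_end[OF d] _ neg])
      (rule mode_deficit[OF d])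
  then obtain X where X: "smooth_compact X" and lt: "Re (dirichlet_form (Omega d) (prodf X (mode d j)) (prodf X (mode d j)))
      < 2 * (freq d j)\<^sup>2 * Re (l2_inner (lebesgue_on (Omega d)) (prodf X (mode d j)) (prodf X (mode d j)))"
    by (elim exE conjE) (rule that)
  show ?thesis
  proof (rule bexI)
    show "prodf X (mode d j) \<in> form_domain d j"
      by (rule prodf_form_domain[OF X smooth_compact_mode mode_boundary[OF d] mode_parity])
  qed (rule lt)
qed

section \<open>Product functions in the operator domain\<close>

definition rot_s :: "(plane \<Rightarrow> complex) \<Rightarrow> plane \<Rightarrow> complex" where
  "rot_s F p = (1/2) *\<^sub>R pd (1, 0) F p + (1/2) *\<^sub>R pd (0, 1) F p"

lemma rot_s_derivative:
  assumes "smooth F"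
  shows "((\<lambda>s. F (rot (s, t))) has_vector_derivative rot_s F (rot (s, t))) (at s)"
proof -
  have l: "rot (s, t) = (t / 2 + s * (1/2), - t / 2 + s * (1/2))" for s by (simp add: rot_def field_simps)
  show ?thesis unfolding l rot_s_def by (rule smooth_line[OF assms])
qed

lemma rot_s_continuous: "smooth F \<Longrightarrow> continuous_on S (rot_s F)"
  unfolding rot_s_def[abs_def] by (intro continuous_intros pd_continuous)

lemma continuous_rot_section:
  assumes "continuous_on UNIV h"
  shows "continuous_on S (\<lambda>s. h (rot (s, t)))" "continuous_on S (\<lambda>t. h (rot (s, t)))"
  by (auto intro!: continuous_on_compose2[OF assms] continuous_on_compose2[OF continuous_rot[of UNIV]] continuous_intros)

text \<open>In the coordinates s = x + y and t = x - y the Laplacian is twice the sum of the second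
  derivatives.\<close>

definition minus_laplace :: "(real \<Rightarrow> complex) \<Rightarrow> (real \<Rightarrow> complex) \<Rightarrow> plane \<Rightarrow> complex" where
  "minus_laplace X Y = fcomb (- 2) (prodf (vd (vd X)) Y) (- 2) (prodf X (vd (vd Y)))"

text \<open>At fixed t with |t| < d the integral over \<open>s\<close> is that of a derivative.
  \<open>X\<close> vanishes for s \<le> 2 d, so the point s = |t| where the line enters the
  half-strip leaves no boundary term.\<close>

lemma green_s:
  fixes d :: real
  assumes d: "0 < d" and X: "smooth_compact X" "\<forall>s\<le>2 * d. X s = 0" and Y: "smooth_compact Y" and K: "K \<in> test_functions UNIV"
  defines "h \<equiv> \<lambda>p. prodf (vd X) Y p * cnj (rot_s K p) + prodf (vd (vd X)) Y p * cnj (K p)"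
  shows "integrable lborel (\<lambda>p. indicator (Omega d) p *\<^sub>R h p)" "(LINT p|lborel. indicator (Omega d) p *\<^sub>R h p) = 0"
proof -
  have sK: "smooth K" by (rule test_smooth[OF K])
  have sX: "smooth X" "smooth (vd X)" "smooth (vd (vd X))" "smooth Y"
    using X(1) Y by (auto intro: smooth_vd smooth_compact_smooth)
  obtain R where R: "R > 0" "\<And>p. R \<le> norm p \<Longrightarrow> K p = 0" "\<And>p. R \<le> norm p \<Longrightarrow> grad2 K p = 0"
    using test_grad_zero[OF K] by metis
  have R3: "rot_s K p = 0" if "R \<le> norm p" for p
    using R(3)[OF that] by (simp add: grad2_def rot_s_def add_nonneg_eq_0_iff)
  have "continuous_on UNIV h" unfolding h_def
    by (intro continuous_intros smooth_continuous_on smooth_prodf rot_s_continuous sX sK)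
  then show I: "integrable lborel (\<lambda>p. indicator (Omega d) p *\<^sub>R h p)"
    by (rule integrable_indicator_test[OF Omega_borel, where R=R]) (use R R3 in \<open>simp add: h_def\<close>)
  have m: "(\<lambda>p. indicator (Omega d) p *\<^sub>R h p) \<in> borel_measurable borel" using I by auto
  have I': "integrable lborel (\<lambda>p. indicator (Omega d) (rot p) *\<^sub>R h (rot p))" using I rot_integral(1)[OF m] by simp
  have X1: "vd X s = 0" "vd (vd X) s = 0" if "s < 2 * d" for s
  proof -
    have z: "vd X s = 0" if "s \<in> {..<2 * d}" for s
      by (rule vd_zero[OF sX(1), where S="{..<2 * d}" and c=0]) (use that X(2) in auto)
    then show "vd X s = 0" using that by simp
    show "vd (vd X) s = 0"
      by (rule vd_zero[OF sX(2), where S="{..<2 * d}" and c=0]) (use that z in auto)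
  qed
  have inner: "(LINT s|lborel. indicator (Omega d) (rot (s, t)) *\<^sub>R h (rot (s, t))) = 0" for t
  proof (cases "\<bar>t\<bar> < d")
    case False
    then have "rot (s, t) \<notin> Omega d" for s by (simp add: rot_mem_Omega)
    then show ?thesis by simp
  next
    case True
    let ?f = "\<lambda>s. vd X s * cnj (K (rot (s, t)))"
    let ?f' = "\<lambda>s. vd X s * cnj (rot_s K (rot (s, t))) + vd (vd X) s * cnj (K (rot (s, t)))"
    have "indicator (Omega d) (rot (s, t)) *\<^sub>R h (rot (s, t)) = Y t * ?f' s" for s
    proof (cases "s < 2 * d")
      case True then show ?thesis by (simp add: h_def prodf_rot X1)
    next
      case False
      then have "rot (s, t) \<in> Omega d" using True by (simp add: rot_mem_Omega)
      then show ?thesis by (simp add: h_def prodf_rot algebra_simps)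
    qed
    then have "(LINT s|lborel. indicator (Omega d) (rot (s, t)) *\<^sub>R h (rot (s, t))) = Y t * (LINT s|lborel. ?f' s)" by simp
    also have "(LINT s|lborel. ?f' s) = 0"
    proof (rule integral_derivative_zero[where f="?f" and R="2 * R"])
      show "(?f has_vector_derivative ?f' s) (at s)" for s
        by (intro has_vector_derivative_mult has_vector_derivative_cnj rot_s_derivative sK smooth_vector_derivative sX)
      show "continuous_on UNIV ?f'"
        by (intro continuous_intros continuous_rot_section rot_s_continuous smooth_continuous_on sX sK)
      show "?f s = 0" if "2 * R \<le> \<bar>s\<bar>" for s
        using that norm_rot[of s t] R(2)[of "rot (s, t)"] by simp
    qed (use R in simp)
    finally show ?thesis by simp
  qed
  show "(LINT p|lborel. indicator (Omega d) p *\<^sub>R h p) = 0"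
    unfolding rot_integral(2)[OF m] plane_Fubini(2)[OF I'] inner by simp
qed

text \<open>For s > 2 d the section is all of -d < t < d. The end terms remain because
  \<open>K\<close> need not vanish on the Dirichlet boundary.\<close>

lemma green_t:
  fixes d :: real
  assumes d: "0 < d" and X: "smooth_compact X" "\<forall>s\<le>2 * d. X s = 0" and Y: "smooth_compact Y" and K: "K \<in> test_functions UNIV"
  defines "h \<equiv> \<lambda>p. prodf X (vd Y) p * cnj (rot_t K p) + prodf X (vd (vd Y)) p * cnj (K p)"
  shows "integrable lborel (\<lambda>p. indicator (Omega d) p *\<^sub>R h p)"
    "(LINT p|lborel. indicator (Omega d) p *\<^sub>R h p)
      = (1/2) * (LINT s|lborel. X s * (vd Y d * cnj (K (rot (s, d))) - vd Y (- d) * cnj (K (rot (s, - d)))))"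
proof -
  have sK: "smooth K" by (rule test_smooth[OF K])
  have sX: "smooth X" "smooth Y" "smooth (vd Y)" "smooth (vd (vd Y))"
    using X(1) Y by (auto intro: smooth_vd smooth_compact_smooth)
  obtain R where R: "R > 0" "\<And>p. R \<le> norm p \<Longrightarrow> K p = 0" "\<And>p. R \<le> norm p \<Longrightarrow> rot_t K p = 0"
    using test_grad_zero[OF K] by metis
  have "continuous_on UNIV h" unfolding h_def
    by (intro continuous_intros smooth_continuous_on smooth_prodf rot_t_continuous sX sK)
  then show I: "integrable lborel (\<lambda>p. indicator (Omega d) p *\<^sub>R h p)"
    by (rule integrable_indicator_test[OF Omega_borel, where R=R]) (use R in \<open>simp add: h_def\<close>)
  have m: "(\<lambda>p. indicator (Omega d) p *\<^sub>R h p) \<in> borel_measurable borel" using I by auto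
  have I': "integrable lborel (\<lambda>p. indicator (Omega d) (rot p) *\<^sub>R h (rot p))" using I rot_integral(1)[OF m] by simp
  have inner: "(LINT t|lborel. indicator (Omega d) (rot (s, t)) *\<^sub>R h (rot (s, t)))
     = X s * (vd Y d * cnj (K (rot (s, d))) - vd Y (- d) * cnj (K (rot (s, - d))))" for s
  proof -
    let ?f = "\<lambda>t. vd Y t * cnj (K (rot (s, t)))"
    let ?f' = "\<lambda>t. vd Y t * cnj (rot_t K (rot (s, t))) + vd (vd Y) t * cnj (K (rot (s, t)))"
    have "indicator (Omega d) (rot (s, t)) *\<^sub>R h (rot (s, t)) = X s * (indicator {- d<..<d} t *\<^sub>R ?f' t)" for t
    proof (cases "s \<le> 2 * d")
      case True then show ?thesis by (simp add: h_def prodf_rot X)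
    next
      case False
      then have "rot (s, t) \<in> Omega d \<longleftrightarrow> t \<in> {- d<..<d}" using d by (auto simp: rot_mem_Omega abs_less_iff)
      then have i: "indicator (Omega d) (rot (s, t)) = (indicator {- d<..<d} t :: real)" by (simp add: indicator_def)
      show ?thesis unfolding i h_def prodf_rot by (simp add: scaleR_conv_of_real algebra_simps)
    qed
    then have "(LINT t|lborel. indicator (Omega d) (rot (s, t)) *\<^sub>R h (rot (s, t))) = (LINT t|lborel. X s * (indicator {- d<..<d} t *\<^sub>R ?f' t))"
      by (simp only:)
    also have "\<dots> = X s * (LINT t|lborel. indicator {- d<..<d} t *\<^sub>R ?f' t)" by (rule integral_mult_right_zero)
    also have "(LINT t|lborel. indicator {- d<..<d} t *\<^sub>R ?f' t) = integral {- d..d} ?f'"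
    proof (rule interval_integral)
      show "continuous_on UNIV ?f'"
        by (intro continuous_intros continuous_rot_section rot_t_continuous smooth_continuous_on sX sK)
    qed auto
    also have "\<dots> = ?f d - ?f (- d)"
    proof (rule integral_unique[OF fundamental_theorem_of_calculus])
      show "(?f has_vector_derivative ?f' t) (at t within {- d..d})" for t
        by (intro has_vector_derivative_mult has_vector_derivative_cnj has_vector_derivative_at_within[OF rot_derivative] sK
            has_vector_derivative_at_within[OF smooth_vector_derivative] sX)
    qed (use d in simp)
    finally show ?thesis .
  qed
  show "(LINT p|lborel. indicator (Omega d) p *\<^sub>R h p)
      = (1/2) * (LINT s|lborel. X s * (vd Y d * cnj (K (rot (s, d))) - vd Y (- d) * cnj (K (rot (s, - d)))))"
    unfolding rot_integral(2)[OF m] plane_Fubini(1)[OF I'] inner by (simp add: scaleR_conv_of_real)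
qed

lemma green:
  assumes d: "0 < d" and X: "smooth_compact X" "\<forall>s\<le>2 * d. X s = 0" and Y: "smooth_compact Y" and K: "K \<in> test_functions UNIV"
  shows "dirichlet_form (Omega d) K (prodf X Y) - l2_inner (lebesgue_on (Omega d)) K (minus_laplace X Y)
      = (LINT s|lborel. X s * (vd Y d * cnj (K (rot (s, d))) - vd Y (- d) * cnj (K (rot (s, - d)))))"
proof -
  let ?M = "lebesgue_on (Omega d)"
  let ?F = "prodf X Y"
  let ?h1 = "\<lambda>p. prodf (vd X) Y p * cnj (rot_s K p) + prodf (vd (vd X)) Y p * cnj (K p)"
  let ?h2 = "\<lambda>p. prodf X (vd Y) p * cnj (rot_t K p) + prodf X (vd (vd Y)) p * cnj (K p)"
  have T: "?F \<in> test_functions UNIV" by (rule test_prodf[OF X(1) Y])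
  have T': "minus_laplace X Y \<in> test_functions UNIV"
    unfolding minus_laplace_def by (intro test_comb test_prodf smooth_compact_vd X(1) Y)
  have sX: "smooth X" "smooth Y" using X(1) Y by (simp_all add: smooth_compact_smooth)
  have b: "(1, 0) \<in> (Basis :: plane set)" "(0, 1) \<in> (Basis :: plane set)" by (auto simp: Basis_plane)
  have g: "integrable lborel (\<lambda>p. indicator (Omega d) p *\<^sub>R ?h1 p)" "(LINT p|lborel. indicator (Omega d) p *\<^sub>R ?h1 p) = 0"
    "integrable lborel (\<lambda>p. indicator (Omega d) p *\<^sub>R ?h2 p)"
    "(LINT p|lborel. indicator (Omega d) p *\<^sub>R ?h2 p)
      = (1/2) * (LINT s|lborel. X s * (vd Y d * cnj (K (rot (s, d))) - vd Y (- d) * cnj (K (rot (s, - d)))))"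
    by (rule green_s[OF d X Y K] green_t[OF d X Y K])+
  note L = test_L2[OF _ Omega_borel, of _ UNIV d]
  have i1: "integrable ?M (\<lambda>p. cnj (pd (1, 0) K p) * pd (1, 0) ?F p + cnj (pd (0, 1) K p) * pd (0, 1) ?F p)"
    by (intro Bochner_Integration.integrable_add L2_prod_integrable(2) L test_pd K T b)
  have i2: "integrable ?M (\<lambda>p. cnj (K p) * minus_laplace X Y p)"
    by (intro L2_prod_integrable(2) L K T')
  have "dirichlet_form (Omega d) K ?F - l2_inner ?M K (minus_laplace X Y)
     = (LINT p|?M. (cnj (pd (1, 0) K p) * pd (1, 0) ?F p + cnj (pd (0, 1) K p) * pd (0, 1) ?F p) - cnj (K p) * minus_laplace X Y p)"
    unfolding dirichlet_form_test[OF open_Omega K T] l2_inner_def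
    by (rule Bochner_Integration.integral_diff[OF i1 i2, symmetric])
  also have "\<dots> = (LINT p|?M. 2 * ?h1 p + 2 * ?h2 p)"
  proof (rule Bochner_Integration.integral_cong[OF refl])
    fix p
    have A: "cnj u * (a + b) + cnj v * (a - b) - cnj k * (- 2 * x + - 2 * y)
       = 2 * (a * cnj ((1/2) *\<^sub>R u + (1/2) *\<^sub>R v) + x * cnj k) + 2 * (b * cnj ((1/2) *\<^sub>R u + (- 1/2) *\<^sub>R v) + y * cnj k)"
      for u v a b k x y :: complex
      by (simp add: scaleR_conv_of_real algebra_simps)
    show "(cnj (pd (1, 0) K p) * pd (1, 0) ?F p + cnj (pd (0, 1) K p) * pd (0, 1) ?F p) - cnj (K p) * minus_laplace X Y p
       = 2 * ?h1 p + 2 * ?h2 p"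
      unfolding pd_prodf[OF sX] minus_laplace_def rot_s_def rot_t_def by (rule A)
  qed
  also have "\<dots> = (LINT p|lborel. 2 * (indicator (Omega d) p *\<^sub>R ?h1 p) + 2 * (indicator (Omega d) p *\<^sub>R ?h2 p))"
  proof -
    have c: "continuous_on UNIV (\<lambda>p. 2 * ?h1 p + 2 * ?h2 p)"
      by (intro continuous_intros smooth_continuous_on smooth_prodf rot_t_continuous rot_s_continuous smooth_vd sX test_smooth[OF K])
    have A: "2 * (r *\<^sub>R x) + 2 * (r *\<^sub>R y) = r *\<^sub>R (2 * x + 2 * y)" for r and x y :: complex
      by (simp add: scaleR_conv_of_real algebra_simps)
    from integral_lebesgue_on_borel(1)[OF Omega_borel borel_measurable_continuous_onI[OF c]]
    show ?thesis unfolding A .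
  qed
  also have "\<dots> = 2 * (LINT p|lborel. indicator (Omega d) p *\<^sub>R ?h1 p) + 2 * (LINT p|lborel. indicator (Omega d) p *\<^sub>R ?h2 p)"
    unfolding Bochner_Integration.integral_add[OF integrable_mult_right[OF g(1)] integrable_mult_right[OF g(3)]]
      integral_mult_right_zero ..
  also have "\<dots> = (LINT s|lborel. X s * (vd Y d * cnj (K (rot (s, d))) - vd Y (- d) * cnj (K (rot (s, - d)))))"
    unfolding g(2,4) by simp
  finally show ?thesis .
qed

text \<open>Cauchy-Schwarz on each boundary ray: the integral is at most a constant times the square
  root of the boundary integral of \<open>F n\<close>. As \<open>X\<close> vanishes for s \<le> 2 d,
  the restriction to s > d in \<open>bdry\<close> loses nothing.\<close>

lemma boundary_term_vanishes:
  assumes d: "0 < d" and X: "smooth_compact X" "\<forall>s\<le>2 * d. X s = 0" and F: "approximates d f F"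
  shows "(\<lambda>n. LINT s|lborel. X s * (a * cnj (F n (rot (s, d))) - b * cnj (F n (rot (s, - d))))) \<longlonglongrightarrow> 0"
proof -
  have T: "F n \<in> test_functions UNIV" for n using F by (simp add: approximates_def)
  have B: "(\<lambda>n. LINT s|lborel. bdry d (F n) s) \<longlonglongrightarrow> 0" using F by (simp add: approximates_def)
  define u where "u n e s = indicator {d<..} s *\<^sub>R F n (rot (s, e))" for n e s
  have XL: "X \<in> L2 lborel"
  proof -
    obtain R where "\<And>t. R \<le> \<bar>t\<bar> \<Longrightarrow> X t = 0" using X(1) by (auto simp: smooth_compact_def)
    then have "integrable lborel (\<lambda>s. (cmod (X s))\<^sup>2)"
      by (intro integrable_compact_support[where R=R] continuous_intros smooth_continuous_on smooth_compact_smooth X(1)) simp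
    then show ?thesis by (simp add: L2_def smooth_measurable smooth_compact_smooth X(1))
  qed
  have uL: "u n e \<in> L2 lborel" and ub: "Re (l2_inner lborel (u n e) (u n e)) \<le> (LINT s|lborel. bdry d (F n) s)"
    if e: "e = d \<or> e = - d" for n e
  proof -
    have s: "smooth (F n)" by (rule test_smooth[OF T])
    obtain R where R: "R > 0" "\<And>p. R \<le> norm p \<Longrightarrow> F n p = 0" using test_support[OF T] by blast
    have sq: "(cmod (u n e s))\<^sup>2 = indicator {d<..} s *\<^sub>R (cmod (F n (rot (s, e))))\<^sup>2" for s
      by (simp add: u_def indicator_def)
    have i: "integrable lborel (\<lambda>s. indicator {d<..} s *\<^sub>R (cmod (F n (rot (s, e))))\<^sup>2)"
      by (rule rot_section_integrable[where R=R and h="\<lambda>p. (cmod (F n p))\<^sup>2"])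
        (use R in \<open>auto intro!: continuous_intros smooth_continuous_on s\<close>)
    have "integrable lborel (u n e)" unfolding u_def[abs_def]
      by (rule rot_section_integrable[where R=R]) (use R in \<open>auto intro!: smooth_continuous_on s\<close>)
    then show "u n e \<in> L2 lborel" using i by (simp add: L2_def sq)
    have "(LINT s|lborel. indicator {d<..} s *\<^sub>R (cmod (F n (rot (s, e))))\<^sup>2) \<le> (LINT s|lborel. bdry d (F n) s)"
      by (rule integral_mono[OF i bdry_integrable[OF T]]) (use e in \<open>auto simp: bdry_def indicator_def\<close>)
    then show "Re (l2_inner lborel (u n e) (u n e)) \<le> (LINT s|lborel. bdry d (F n) s)"
      unfolding l2_inner_self sq .
  qed
  have lim: "(\<lambda>n. l2_inner lborel (u n e) X) \<longlonglongrightarrow> 0" if e: "e = d \<or> e = - d" for e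
  proof (rule Lim_null_comparison)
    show "(\<lambda>n. sqrt (LINT s|lborel. bdry d (F n) s) * sqrt (Re (l2_inner lborel X X))) \<longlonglongrightarrow> 0"
      using tendsto_mult[OF tendsto_real_sqrt[OF B] tendsto_const] by (simp only: real_sqrt_zero mult_zero_left)
    have "norm (l2_inner lborel (u n e) X) \<le> sqrt (LINT s|lborel. bdry d (F n) s) * sqrt (Re (l2_inner lborel X X))" for n
      by (rule order_trans[OF L2.cauchy_schwarz[OF uL[OF e] XL]])
        (intro mult_right_mono real_sqrt_le_mono ub[OF e] real_sqrt_ge_zero L2.pos[OF XL])
    then show "\<forall>\<^sub>F n in sequentially. norm (l2_inner lborel (u n e) X) \<le> sqrt (LINT s|lborel. bdry d (F n) s) * sqrt (Re (l2_inner lborel X X))"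
      by (rule always_eventually[OF allI])
  qed
  have eq: "(LINT s|lborel. X s * (a * cnj (F n (rot (s, d))) - b * cnj (F n (rot (s, - d)))))
     = a * l2_inner lborel (u n d) X - b * l2_inner lborel (u n (- d)) X" for n
  proof -
    have I: "integrable lborel (\<lambda>s. cnj (u n e s) * X s)" if "e = d \<or> e = - d" for e
      by (rule L2_prod_integrable(2)[OF uL[OF that] XL])
    have "a * l2_inner lborel (u n d) X - b * l2_inner lborel (u n (- d)) X
      = (LINT s|lborel. a * (cnj (u n d s) * X s)) - (LINT s|lborel. b * (cnj (u n (- d) s) * X s))"
      unfolding l2_inner_def by simp
    also have "\<dots> = (LINT s|lborel. a * (cnj (u n d s) * X s) - b * (cnj (u n (- d) s) * X s))"
      by (rule Bochner_Integration.integral_diff[symmetric]; rule integrable_mult_right[OF I]; simp)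
    also have "\<dots> = (LINT s|lborel. X s * (a * cnj (F n (rot (s, d))) - b * cnj (F n (rot (s, - d)))))"
    proof (rule Bochner_Integration.integral_cong[OF refl])
      fix s :: real
      show "a * (cnj (u n d s) * X s) - b * (cnj (u n (- d) s) * X s) = X s * (a * cnj (F n (rot (s, d))) - b * cnj (F n (rot (s, - d))))"
      proof (cases "d < s")
        case True then show ?thesis by (simp add: u_def algebra_simps)
      next
        case False then show ?thesis using d X(2) by simp
      qed
    qed
    finally show ?thesis by simp
  qed
  show ?thesis unfolding eq
    using tendsto_diff[OF tendsto_mult[OF tendsto_const[of a] lim[of d]] tendsto_mult[OF tendsto_const[of b] lim[of "- d"]]] by simp
qed

text \<open>Green's formula holds against the approximants of \<open>f\<close> up to a boundary
  term. Both sides are continuous for the convergence of the approximants, and the boundary term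
  tends to 0.\<close>

lemma prodf_operator:
  assumes d: "0 < d" and X: "smooth_compact X" "\<forall>s\<le>2 * d. X s = 0" and Y: "smooth_compact Y" and f: "f \<in> form_domain d j"
  shows "dirichlet_form (Omega d) f (prodf X Y) = l2_inner (lebesgue_on (Omega d)) f (minus_laplace X Y)"
proof -
  let ?M = "lebesgue_on (Omega d)"
  let ?F = "prodf X Y"
  have T: "?F \<in> test_functions UNIV" by (rule test_prodf[OF X(1) Y])
  have T': "minus_laplace X Y \<in> test_functions UNIV"
    unfolding minus_laplace_def by (intro test_comb test_prodf smooth_compact_vd X(1) Y)
  obtain F where fH: "f \<in> H1 (Omega d)" and F: "approximates d f F" using f by (auto simp: form_domain_iff)
  have TF: "F n \<in> test_functions UNIV" for n using F by (simp add: approximates_def)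
  have "(\<lambda>n. dirichlet_form (Omega d) (F n) ?F) \<longlonglongrightarrow> dirichlet_form (Omega d) f ?F"
    by (rule A.tendsto_left[OF test_in_H1[OF TF] fH test_in_H1[OF T] approximates_tendsto(4)[OF fH F]])
  moreover have "(\<lambda>n. l2_inner ?M (F n) (minus_laplace X Y)) \<longlonglongrightarrow> l2_inner ?M f (minus_laplace X Y)"
    by (rule L2.tendsto_left[OF test_L2[OF TF Omega_borel] H1_L2[OF fH] test_L2[OF T' Omega_borel] approximates_tendsto(2)[OF fH F]])
  ultimately have "(\<lambda>n. dirichlet_form (Omega d) (F n) ?F - l2_inner ?M (F n) (minus_laplace X Y))
      \<longlonglongrightarrow> dirichlet_form (Omega d) f ?F - l2_inner ?M f (minus_laplace X Y)" by (rule tendsto_diff)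
  then have "dirichlet_form (Omega d) f ?F - l2_inner ?M f (minus_laplace X Y) = 0"
    unfolding green[OF d X Y TF] by (rule LIMSEQ_unique[OF _ boundary_term_vanishes[OF d X F]])
  then show ?thesis by simp
qed

section \<open>The spectrum above the threshold\<close>

lemma prodf_norm:
  assumes d: "0 < d" and X: "smooth_compact X" "\<forall>s\<le>2 * d. X s = 0" and Y: "smooth_compact Y"
  shows "Re (l2_inner (lebesgue_on (Omega d)) (prodf X Y) (prodf X Y))
      = (1/2) * (LINT s|lborel. (cmod (X s))\<^sup>2) * integral {- d..d} (\<lambda>t. (cmod (Y t))\<^sup>2)"
proof -
  let ?F = "prodf X Y"
  let ?h = "\<lambda>p. indicator (Omega d) p * (cmod (?F p))\<^sup>2"
  have T: "?F \<in> test_functions UNIV" by (rule test_prodf[OF X(1) Y])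
  have ih: "integrable lborel ?h" by (rule test_integrable_sets(1)[OF T Omega_borel])
  have mh: "?h \<in> borel_measurable borel" using ih by auto
  have ih': "integrable lborel (\<lambda>p. ?h (rot p))" using ih rot_integral(1)[OF mh] by simp
  have inner: "(LINT t|lborel. ?h (rot (s, t))) = (cmod (X s))\<^sup>2 * integral {- d..d} (\<lambda>t. (cmod (Y t))\<^sup>2)" for s
  proof -
    have "?h (rot (s, t)) = (cmod (X s))\<^sup>2 * (indicator {- d<..<d} t *\<^sub>R (cmod (Y t))\<^sup>2)" for t
    proof (cases "s \<le> 2 * d")
      case True then show ?thesis by (simp add: prodf_rot X)
    next
      case False
      then have "rot (s, t) \<in> Omega d \<longleftrightarrow> t \<in> {- d<..<d}" using d by (auto simp: rot_mem_Omega abs_less_iff)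
      then have i: "indicator (Omega d) (rot (s, t)) = (indicator {- d<..<d} t :: real)" by (simp add: indicator_def)
      show ?thesis unfolding i prodf_rot by (simp add: norm_mult power_mult_distrib)
    qed
    then have "(LINT t|lborel. ?h (rot (s, t))) = (LINT t|lborel. (cmod (X s))\<^sup>2 * (indicator {- d<..<d} t *\<^sub>R (cmod (Y t))\<^sup>2))"
      by (simp only:)
    also have "\<dots> = (cmod (X s))\<^sup>2 * (LINT t|lborel. indicator {- d<..<d} t *\<^sub>R (cmod (Y t))\<^sup>2)" by (rule integral_mult_right_zero)
    also have "(LINT t|lborel. indicator {- d<..<d} t *\<^sub>R (cmod (Y t))\<^sup>2) = integral {- d..d} (\<lambda>t. (cmod (Y t))\<^sup>2)"
      by (rule interval_integral) (auto intro!: continuous_intros smooth_continuous_on smooth_compact_smooth Y)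
    finally show ?thesis .
  qed
  show ?thesis unfolding test_norm[OF T] rot_integral(2)[OF mh] plane_Fubini(1)[OF ih'] inner by simp
qed

text \<open>The packet has frequency \<open>k\<close> and width \<open>N\<close>, so that its residual is of order \<open>1 / N\<close> relative to
  its norm.\<close>

lemma wave_packet:
  "\<exists>M m :: real. 0 < m \<and>
    (\<forall>N\<ge>1. \<exists>X. smooth_compact X \<and> (\<forall>s\<le>c. X s = 0) \<and> N / 2 * m\<^sup>2 \<le> (LINT s|lborel. (cmod (X s))\<^sup>2)
       \<and> (LINT s|lborel. (cmod (vd (vd X) s + of_real (k\<^sup>2) * X s))\<^sup>2) \<le> M\<^sup>2 / N)"
proof -
  define B where "B t = complex_of_real (bump t)" for t
  have cB: "smooth_compact B" unfolding B_def by (rule smooth_compactI[where R=1]) (auto simp: smooth_bump bump_zero abs_if split: if_splits)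
  obtain M1 where M1: "0 \<le> M1" "\<And>t. cmod (vd B t) \<le> M1" using smooth_compact_bounded[OF smooth_compact_vd[OF cB]] by blast
  obtain M2 where M2: "0 \<le> M2" "\<And>t. cmod (vd (vd B) t) \<le> M2" using smooth_compact_bounded[OF smooth_compact_vd[OF smooth_compact_vd[OF cB]]] by blast
  \<comment> \<open>With X = e v the residual is e (v'' + 2 i k v'), where |v'| \<le> M1 / N and
    |v''| \<le> M2 / N^2 \<le> M2 / N.\<close>
  define M where "M = 2 * \<bar>k\<bar> * M1 + M2"
  \<comment> \<open>The positive minimum \<open>m\<close> of the bump over the middle half of its
    support gives the lower bound for the norm of the packet.\<close>
  have "\<exists>x\<in>{1/4..3/4::real}. \<forall>y\<in>{1/4..3/4}. bump x \<le> bump y"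
    by (rule continuous_attains_inf) (auto intro: continuous_on_bump)
  then obtain x :: real where x: "x \<in> {1/4..3/4}" "\<And>y. y \<in> {1/4..3/4} \<Longrightarrow> bump x \<le> bump y" by blast
  define m where "m = bump x"
  have m: "0 < m" using x(1) bump_pos[of x] by (simp add: m_def)
  show ?thesis
  proof (rule exI[of _ M], rule exI[of _ m], intro conjI m allI impI)
    fix N :: real assume N: "1 \<le> N"
    define v where "v s = B (1 / N * s + - c / N)" for s
    define e where "e s = exp (\<i> * of_real k * of_real s)" for s :: real
    define X where "X s = e s * v s" for s
    have se: "smooth e" unfolding e_def[abs_def] by (rule smooth_exp)
    have sv: "smooth v" unfolding v_def[abs_def] by (rule smooth_affine[OF smooth_compact_smooth[OF cB]])
    have arg: "1 / N * s + - c / N = (s - c) / N" for s using N by (simp add: field_simps)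
    have v0: "v s = 0" if "s \<le> c \<or> c + N \<le> s" for s
      unfolding v_def arg B_def using that N by (auto intro!: bump_zero simp: divide_le_0_iff le_divide_eq)
    have cX: "smooth_compact X"
      by (rule smooth_compactI[where R="\<bar>c\<bar> + N"]) (use se sv v0 N in \<open>auto simp: X_def[abs_def] abs_if intro: smooth_mult split: if_splits\<close>)
    have dv: "vd (\<lambda>s. W (1 / N * s + - c / N)) s = (1 / N) *\<^sub>R vd W (1 / N * s + - c / N)" if W: "smooth W" for W :: "real \<Rightarrow> complex" and s
    proof -
      have "((\<lambda>s. 1 / N * s + - c / N) has_real_derivative 1 / N) (at s)" using N by (auto intro!: derivative_eq_intros)
      from vector_diff_chain_at[OF this[unfolded has_real_derivative_iff_has_vector_derivative] smooth_vector_derivative[OF W]]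
      show ?thesis by (intro vector_derivative_at) (simp only: o_def)
    qed
    have dv1: "vd v = (\<lambda>s. (1 / N) *\<^sub>R vd B (1 / N * s + - c / N))"
      unfolding v_def[abs_def] using dv[OF smooth_compact_smooth[OF cB]] by blast
    have dv2: "vd (vd v) s = (1 / N) *\<^sub>R ((1 / N) *\<^sub>R vd (vd B) (1 / N * s + - c / N))" for s
    proof -
      have "((\<lambda>s. vd B (1 / N * s + - c / N)) has_vector_derivative (1 / N) *\<^sub>R vd (vd B) (1 / N * s + - c / N)) (at s)"
        using smooth_vector_derivative[OF smooth_affine[OF smooth_vd[OF smooth_compact_smooth[OF cB]]], of "1 / N" "- c / N" s]
        unfolding dv[OF smooth_vd[OF smooth_compact_smooth[OF cB]]] .
      then show ?thesis unfolding dv1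
        by (intro vector_derivative_at bounded_linear.has_vector_derivative[OF bounded_linear_scaleR_right])
    qed
    have de: "(e has_vector_derivative \<i> * of_real k * e s) (at s)" for s
    proof -
      have "((\<lambda>z. exp (\<i> * of_real k * z)) has_field_derivative \<i> * of_real k * exp (\<i> * of_real k * of_real s)) (at (of_real s))"
        by (auto intro!: derivative_eq_intros)
      from has_vector_derivative_real_field[OF this] show ?thesis by (simp add: e_def[abs_def])
    qed
    have dX1: "vd X = (\<lambda>s. e s * vd v s + \<i> * of_real k * e s * v s)"
      unfolding X_def[abs_def]
      by (intro ext vector_derivative_at has_vector_derivative_mult de smooth_vector_derivative sv)
    have dX2: "vd (vd X) s = e s * vd (vd v) s + \<i> * of_real k * e s * vd v s
        + (\<i> * of_real k * e s * vd v s + \<i> * of_real k * (\<i> * of_real k * e s) * v s)" for s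
      unfolding dX1
      by (intro vector_derivative_at has_vector_derivative_add has_vector_derivative_mult has_vector_derivative_mult_right de
          smooth_vector_derivative sv smooth_vd)
    let ?r = "\<lambda>s. vd (vd X) s + of_real (k\<^sup>2) * X s"
    have r: "?r s = e s * (vd (vd v) s + 2 * \<i> * of_real k * vd v s)" for s
      unfolding dX2 by (simp add: X_def power2_eq_square algebra_simps)
    have ne: "cmod (e s) = 1" for s
    proof -
      have "e s = exp (\<i> * of_real (k * s))" by (simp add: e_def mult.assoc)
      then show ?thesis by (simp only: norm_exp_i_times)
    qed
    have rb: "cmod (?r s) \<le> M / N" for s
    proof -
      have "cmod (?r s) \<le> cmod (vd (vd v) s) + cmod (2 * \<i> * of_real k * vd v s)"
        unfolding r norm_mult ne using norm_triangle_ineq[of "vd (vd v) s" "2 * \<i> * of_real k * vd v s"] by (simp add: norm_mult)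
      also have "cmod (2 * \<i> * of_real k * vd v s) = 2 * \<bar>k\<bar> * cmod (vd B (1 / N * s + - c / N)) / N"
        unfolding fun_cong[OF dv1] using N by (simp add: norm_mult)
      also have "cmod (vd (vd v) s) = cmod (vd (vd B) (1 / N * s + - c / N)) / N / N"
        unfolding dv2 using N by simp
      also have "cmod (vd (vd B) (1 / N * s + - c / N)) / N / N \<le> M2 / N"
      proof -
        have "M2 * 1 \<le> M2 * N" using M2(1) N by (intro mult_left_mono)
        then have "cmod (vd (vd B) (1 / N * s + - c / N)) \<le> M2 * N" using M2(2)[of "1 / N * s + - c / N"] by linarith
        then have "cmod (vd (vd B) (1 / N * s + - c / N)) / N \<le> M2" using N by (subst pos_divide_le_eq) auto
        then show ?thesis using N by (intro divide_right_mono) auto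
      qed
      also have "2 * \<bar>k\<bar> * cmod (vd B (1 / N * s + - c / N)) / N \<le> 2 * \<bar>k\<bar> * M1 / N"
        using N by (intro divide_right_mono mult_left_mono M1) auto
      finally show ?thesis by (simp add: M_def add_divide_distrib add.commute)
    qed
    have r0: "?r s = 0" if "s < c \<or> c + N < s" for s
    proof -
      have z1: "vd v s = 0" if "s \<in> {..<c} \<union> {c + N<..}" for s
        by (rule vd_zero[OF sv, where S="{..<c} \<union> {c + N<..}" and c=0]) (use that v0 in auto)
      have "vd (vd v) s = 0"
        by (rule vd_zero[OF smooth_vd[OF sv], where S="{..<c} \<union> {c + N<..}" and c=0]) (use that z1 in auto)
      moreover have "vd v s = 0" using that by (intro z1) auto
      ultimately show ?thesis unfolding r by simp
    qed
    obtain R where R: "\<And>t. R \<le> \<bar>t\<bar> \<Longrightarrow> X t = 0" using cX by (auto simp: smooth_compact_def)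
    have iX: "integrable lborel (\<lambda>s. (cmod (X s))\<^sup>2)"
      by (rule integrable_compact_support[where R=R]) (use R in \<open>auto intro!: continuous_intros smooth_continuous_on smooth_compact_smooth cX\<close>)
    have cr: "smooth_compact ?r" by (intro smooth_compact_add smooth_compact_mult smooth_const smooth_compact_vd cX)
    obtain R' where R': "\<And>t. R' \<le> \<bar>t\<bar> \<Longrightarrow> ?r t = 0" using cr unfolding smooth_compact_def by blast
    have ir: "integrable lborel (\<lambda>s. (cmod (?r s))\<^sup>2)"
    proof (rule integrable_compact_support[where R=R'])
      show "continuous_on UNIV (\<lambda>s. (cmod (?r s))\<^sup>2)" by (intro continuous_intros smooth_continuous_on smooth_compact_smooth cX smooth_vd)
      show "(cmod (?r s))\<^sup>2 = 0" if "R' \<le> norm s" for s using R'[of s] that by simp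
    qed
    have iI: "integrable lborel (\<lambda>s. indicator {a..b} s * u)" for a b u :: real
      using borel_integrable_atLeastAtMost'[of a b "\<lambda>_. u"] by (simp add: set_integrable_def)
    have "N / 2 * m\<^sup>2 = (LINT s|lborel. indicator {c + N / 4..c + 3 / 4 * N} s * m\<^sup>2)" using N by simp
    also have "\<dots> \<le> (LINT s|lborel. (cmod (X s))\<^sup>2)"
    proof (rule integral_mono[OF iI iX])
      fix s
      show "indicator {c + N / 4..c + 3 / 4 * N} s * m\<^sup>2 \<le> (cmod (X s))\<^sup>2"
      proof (cases "s \<in> {c + N / 4..c + 3 / 4 * N}")
        case True
        then have "(s - c) / N \<in> {1/4..3/4}" using N by (simp add: field_simps)
        then have "m \<le> bump ((s - c) / N)" unfolding m_def by (rule x(2))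
        moreover have "cmod (X s) = bump ((s - c) / N)"
          unfolding X_def norm_mult ne v_def arg B_def by (simp add: bump_nonneg)
        ultimately show ?thesis using True m by (simp add: power_mono)
      qed simp
    qed
    finally have lo: "N / 2 * m\<^sup>2 \<le> (LINT s|lborel. (cmod (X s))\<^sup>2)" .
    have "(LINT s|lborel. (cmod (?r s))\<^sup>2) \<le> (LINT s|lborel. indicator {c..c + N} s * (M / N)\<^sup>2)"
    proof (rule integral_mono[OF ir iI])
      fix s
      show "(cmod (?r s))\<^sup>2 \<le> indicator {c..c + N} s * (M / N)\<^sup>2"
      proof (cases "s \<in> {c..c + N}")
        case True
        have "(cmod (?r s))\<^sup>2 \<le> (M / N)\<^sup>2" by (intro power_mono rb) simp
        then show ?thesis using True by simp
      next
        case False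
        then have "?r s = 0" by (intro r0) auto
        then show ?thesis by simp
      qed
    qed
    also have "\<dots> = M\<^sup>2 / N" using N by (simp add: power2_eq_square)
    finally have hi: "(LINT s|lborel. (cmod (?r s))\<^sup>2) \<le> M\<^sup>2 / N" .
    have X0: "\<forall>s\<le>c. X s = 0" using v0 by (simp add: X_def)
    show "\<exists>X. smooth_compact X \<and> (\<forall>s\<le>c. X s = 0) \<and> N / 2 * m\<^sup>2 \<le> (LINT s|lborel. (cmod (X s))\<^sup>2)
       \<and> (LINT s|lborel. (cmod (vd (vd X) s + of_real (k\<^sup>2) * X s))\<^sup>2) \<le> M\<^sup>2 / N"
      by (intro exI[of _ X] conjI cX X0 lo hi)
  qed
qed

lemma mode_norm_pos:
  assumes d: "0 < d" shows "0 < integral {- d..d} (\<lambda>t. (cmod (mode d j t))\<^sup>2)"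
proof -
  let ?f = "\<lambda>t. (cmod (mode d j t))\<^sup>2"
  define t0 where "t0 = (if j = Sector_a then d / 2 else 0)"
  have c: "continuous_on {- d..d} ?f" by (intro continuous_intros smooth_continuous_on smooth_compact_smooth smooth_compact_mode)
  have t0: "t0 \<in> {- d..d}" using d by (simp add: t0_def)
  have "trig d j t0 = 1" using d by (cases "j = Sector_a") (simp_all add: trig_def t0_def freq_def)
  moreover have "plateau (d + 1) t0 = 1" using d by (intro plateau_one) (simp add: t0_def)
  ultimately have m: "mode d j t0 = 1" by (simp add: mode_def)
  have "0 \<le> integral {- d..d} ?f" by (rule integral_nonneg[OF integrable_continuous_interval[OF c]]) simp
  moreover have "integral {- d..d} ?f \<noteq> 0"
  proof
    assume "integral {- d..d} ?f = 0"
    then have "(?f has_integral 0) (cbox (- d) d)"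
      using integrable_integral[OF integrable_continuous_interval[OF c]] by (simp add: cbox_interval)
    then have "?f t0 = 0"
      using c t0 d by (intro has_integral_0_cbox_imp_0[of "- d" d ?f]) (auto simp: cbox_interval)
    then show False by (simp add: m)
  qed
  ultimately show ?thesis by linarith
qed

text \<open>The equation Y'' = - \<omega>^2 Y holds near the strip, while further out the mode is
  cut off. \<open>\<eta>\<close> is written with the mode itself, whose parity shows that it lies in
  the sector; on the half-strip it agrees with \<open>minus_laplace\<close>.\<close>

lemma prodf_mode_in_H_op:
  fixes d :: real and j :: sector
  assumes d: "0 < d" and X: "smooth_compact X" "\<forall>s\<le>2 * d. X s = 0"
  defines "F \<equiv> prodf X (mode d j)"
    and "\<eta> \<equiv> fcomb (- 2) (prodf (vd (vd X)) (mode d j)) (2 * of_real ((freq d j)\<^sup>2)) (prodf X (mode d j))"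
  shows "(F, \<eta>) \<in> H_op d j"
proof -
  let ?M = "lebesgue_on (Omega d)"
  have D: "prodf W (mode d j) \<in> form_domain d j" if "smooth_compact W" for W
    by (rule prodf_form_domain[OF that smooth_compact_mode mode_boundary[OF d] mode_parity])
  have FD: "F \<in> form_domain d j" unfolding F_def by (rule D[OF X(1)])
  have D2: "prodf (vd (vd X)) (mode d j) \<in> form_domain d j" by (rule D[OF smooth_compact_vd[OF smooth_compact_vd[OF X(1)]]])
  have "\<eta> \<in> L2 ?M" unfolding \<eta>_def
    using D[OF X(1)] D2 by (intro L2_fcomb H1_L2) (simp_all add: form_domain_iff)
  moreover have "has_sector_symmetry d j \<eta>" unfolding \<eta>_def
    using D[OF X(1)] D2 by (intro sector_symmetry_comb) (simp_all add: form_domain_iff)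
  moreover have "dirichlet_form (Omega d) f F = l2_inner ?M f \<eta>" if f: "f \<in> form_domain d j" for f
  proof -
    have "dirichlet_form (Omega d) f F = l2_inner ?M f (minus_laplace X (mode d j))"
      unfolding F_def by (rule prodf_operator[OF d X smooth_compact_mode f])
    also have "\<dots> = l2_inner ?M f \<eta>" unfolding l2_inner_def
    proof (rule Bochner_Integration.integral_cong[OF refl])
      fix p assume "p \<in> space ?M"
      then have "p \<in> Omega d" by simp
      then have "\<bar>fst p - snd p\<bar> < d + 1" by (auto simp: Omega_alt abs_less_iff)
      from mode_derivatives(2)[OF this]
      show "cnj (f p) * minus_laplace X (mode d j) p = cnj (f p) * \<eta> p"
        by (simp add: minus_laplace_def \<eta>_def prodf_def)
    qed
    finally show ?thesis .
  qed
  ultimately show ?thesis using FD unfolding H_op_def form_operator_def L2_sector_def Omega_measure_def by simp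
qed

text \<open>A Weyl sequence: packets of width N have residuals smaller than their norms by a factor
  of order 1 / N, which contradicts the estimate in \<open>resolvent_set\<close> for large
  N.\<close>

lemma spectrum_above:
  assumes d: "0 < d" and z: "2 * (freq d j)\<^sup>2 \<le> z"
  shows "complex_of_real z \<in> spectrum (Omega_measure d) (L2_sector d j) (H_op d j)"
proof (rule ccontr)
  let ?M = "lebesgue_on (Omega d)"
  assume "complex_of_real z \<notin> spectrum (Omega_measure d) (L2_sector d j) (H_op d j)"
  then obtain C where C: "\<forall>(\<phi>, \<psi>)\<in>H_op d j. l2_norm ?M \<phi> \<le> C * l2_norm ?M (\<lambda>p. \<psi> p - z * \<phi> p)"
    unfolding spectrum_def resolvent_set_def Omega_measure_def by blast
  \<comment> \<open>The cross section accounts for the part 2 \<omega>^2 of \<open>z\<close>; the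
    motion along the strip has to supply 2 k^2.\<close>
  define k where "k = sqrt ((z - 2 * (freq d j)\<^sup>2) / 2)"
  have k: "2 * k\<^sup>2 = z - 2 * (freq d j)\<^sup>2" using z by (simp add: k_def)
  define W where "W = integral {- d..d} (\<lambda>t. (cmod (mode d j t))\<^sup>2)"
  have W: "0 < W" unfolding W_def by (rule mode_norm_pos[OF d])
  obtain M m :: real where m: "0 < m" and packet: "\<forall>N\<ge>1. \<exists>X. smooth_compact X \<and> (\<forall>s\<le>2 * d. X s = 0) \<and> N / 2 * m\<^sup>2 \<le> (LINT s|lborel. (cmod (X s))\<^sup>2)
       \<and> (LINT s|lborel. (cmod (vd (vd X) s + of_real (k\<^sup>2) * X s))\<^sup>2) \<le> M\<^sup>2 / N"
    using wave_packet[of "2 * d" k] by (elim exE conjE) (rule that)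
  have bound: "N * N * m\<^sup>2 \<le> 8 * C\<^sup>2 * M\<^sup>2" if N: "1 \<le> N" for N :: real
  proof -
    obtain X where X: "smooth_compact X" "\<forall>s\<le>2 * d. X s = 0" and lo: "N / 2 * m\<^sup>2 \<le> (LINT s|lborel. (cmod (X s))\<^sup>2)"
      and hi: "(LINT s|lborel. (cmod (vd (vd X) s + of_real (k\<^sup>2) * X s))\<^sup>2) \<le> M\<^sup>2 / N"
      using packet[rule_format, OF N] by (elim exE conjE) (rule that)
    define r where "r s = vd (vd X) s + of_real (k\<^sup>2) * X s" for s
    have cr: "smooth_compact r" unfolding r_def[abs_def] by (intro smooth_compact_add smooth_compact_mult smooth_const smooth_compact_vd X)
    \<comment> \<open>The point s = 2 d is not in the open half-line on which the derivatives of
      \<open>X\<close> vanish trivially; continuity gives the value there.\<close>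
    have r0: "\<forall>s\<le>2 * d. r s = 0"
    proof -
      have z1: "vd X s = 0" if "s < 2 * d" for s
        by (rule vd_zero[OF smooth_compact_smooth[OF X(1)], where S="{..<2 * d}" and c=0]) (use that X(2) in auto)
      have z2: "r s = 0" if "s < 2 * d" for s
      proof -
        have "vd (vd X) s = 0"
          by (rule vd_zero[OF smooth_vd[OF smooth_compact_smooth[OF X(1)]], where S="{..<2 * d}" and c=0]) (use that z1 in auto)
        then show ?thesis using X(2) that by (simp add: r_def)
      qed
      have "closed {s. r s = 0}"
        by (intro closed_Collect_eq continuous_intros smooth_continuous_on smooth_compact_smooth cr)
      moreover have "{..<2 * d} \<subseteq> {s. r s = 0}" using z2 by auto
      ultimately have "closure {..<2 * d} \<subseteq> {s. r s = 0}" by (rule closure_minimal[rotated])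
      then show ?thesis by auto
    qed
    let ?F = "prodf X (mode d j)"
    let ?R = "prodf r (mode d j)"
    define \<eta> where "\<eta> = fcomb (- 2) (prodf (vd (vd X)) (mode d j)) (2 * of_real ((freq d j)\<^sup>2)) ?F"
    have "(?F, \<eta>) \<in> H_op d j" unfolding \<eta>_def by (rule prodf_mode_in_H_op[OF d X])
    then have le: "l2_norm ?M ?F \<le> C * l2_norm ?M (\<lambda>p. \<eta> p - z * ?F p)" using C by blast
    have zc: "complex_of_real z = 2 * of_real ((freq d j)\<^sup>2) + 2 * of_real (k\<^sup>2)"
    proof -
      have "z = 2 * (freq d j)\<^sup>2 + 2 * k\<^sup>2" using k by simp
      then show ?thesis by (simp only: of_real_add of_real_mult of_real_numeral)
    qed
    have res: "(cmod (\<eta> p - z * ?F p))\<^sup>2 = 4 * (cmod (?R p))\<^sup>2" for p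
    proof -
      have "\<eta> p - z * ?F p = - 2 * ?R p" unfolding zc by (simp add: \<eta>_def r_def prodf_def algebra_simps)
      then show ?thesis by (simp add: norm_mult power_mult_distrib)
    qed
    have nF: "(l2_norm ?M ?F)\<^sup>2 = (1/2) * (LINT s|lborel. (cmod (X s))\<^sup>2) * W"
      unfolding l2_norm_sq W_def by (simp only: prodf_norm[OF d X smooth_compact_mode, symmetric] l2_inner_self)
    have nR: "(l2_norm ?M (\<lambda>p. \<eta> p - z * ?F p))\<^sup>2 = 4 * ((1/2) * (LINT s|lborel. (cmod (r s))\<^sup>2) * W)"
      unfolding l2_norm_sq res W_def by (simp only: prodf_norm[OF d cr r0 smooth_compact_mode, symmetric] l2_inner_self integral_mult_right_zero)
    have "0 \<le> l2_norm ?M ?F" by (simp add: l2_norm_def)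
    from power_mono[OF le this, of 2]
    have "(1/2) * (LINT s|lborel. (cmod (X s))\<^sup>2) * W \<le> C\<^sup>2 * (4 * ((1/2) * (LINT s|lborel. (cmod (r s))\<^sup>2) * W))"
      unfolding power_mult_distrib nF nR .
    then have "((1/2) * (LINT s|lborel. (cmod (X s))\<^sup>2)) * W \<le> (2 * C\<^sup>2 * (LINT s|lborel. (cmod (r s))\<^sup>2)) * W"
      by (simp add: algebra_simps)
    then have "(1/2) * (LINT s|lborel. (cmod (X s))\<^sup>2) \<le> 2 * C\<^sup>2 * (LINT s|lborel. (cmod (r s))\<^sup>2)"
      using W by (rule mult_right_le_imp_le)
    also have "\<dots> \<le> 2 * C\<^sup>2 * (M\<^sup>2 / N)" using hi unfolding r_def by (intro mult_left_mono) auto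
    finally have "N / 2 * m\<^sup>2 \<le> 4 * C\<^sup>2 * (M\<^sup>2 / N)" using lo by linarith
    then have "N / 2 * m\<^sup>2 * N \<le> 4 * C\<^sup>2 * (M\<^sup>2 / N) * N" using N by (intro mult_right_mono) auto
    then show ?thesis using N by (simp add: algebra_simps)
  qed
  \<comment> \<open>By \<open>bound\<close> and N \<le> N^2, every N \<ge> 1 would be at most 8 C^2
    M^2 / m^2; this one exceeds that by 1.\<close>
  define N where "N = 1 + 8 * C\<^sup>2 * M\<^sup>2 / m\<^sup>2"
  have x: "0 \<le> 8 * C\<^sup>2 * M\<^sup>2 / m\<^sup>2" by simp
  then have N: "1 \<le> N" by (simp add: N_def)
  have "N * 1 \<le> N * N" using N by (intro mult_left_mono) auto
  then have "N * m\<^sup>2 \<le> N * N * m\<^sup>2" by (intro mult_right_mono) auto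
  then have "N * m\<^sup>2 \<le> 8 * C\<^sup>2 * M\<^sup>2" using bound[OF N] by linarith
  then have "N \<le> 8 * C\<^sup>2 * M\<^sup>2 / m\<^sup>2" using m by (simp add: pos_le_divide_eq)
  then show False by (simp add: N_def)
qed

section \<open>The discrete spectrum\<close>

lemma L2_sector_fcomb: "f \<in> L2_sector d j \<Longrightarrow> h \<in> L2_sector d j \<Longrightarrow> fcomb a f b h \<in> L2_sector d j"
  unfolding L2_sector_def Omega_measure_def by (simp add: L2_fcomb sector_symmetry_comb)

lemma hyperplane_bound:
  assumes d: "0 < d"
  shows "\<exists>g\<in>L2 (lebesgue_on (Omega d)). \<forall>f\<in>form_domain d j. l2_inner (lebesgue_on (Omega d)) g f = 0 \<longrightarrow>
    2 * (freq d j)\<^sup>2 * Re (l2_inner (lebesgue_on (Omega d)) f f) \<le> Re (dirichlet_form (Omega d) f f)"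
proof (cases "j = Sector_a")
  case True
  have "indicator_fun (slanted_box d) \<in> L2 (lebesgue_on (Omega d))" by (rule indicator_fun_L2[OF slanted_box_borel slanted_box_bounded[OF d]])
  then show ?thesis using hyperplane_bound_antisymmetric[OF d] by (intro bexI[of _ "indicator_fun (slanted_box d)"]) (simp_all add: True freq_def)
next
  case False
  have "indicator_fun (box (0, 0) (d, d)) \<in> L2 (lebesgue_on (Omega d))" by (rule indicator_fun_L2) (auto intro: bounded_box)
  then show ?thesis using hyperplane_bound_square[OF d] False by (intro bexI[of _ "indicator_fun (box (0, 0) (d, d))"]) (simp_all add: freq_def)
qed

theorem theorem1:
  fixes d :: real
  assumes "d > 0"
  shows "\<forall>j :: sector. \<exists>E :: real. E \<ge> 0 \<and>
           discrete_spectrum (Omega_measure d) (L2_sector d j) (H_op d j) = {complex_of_real E} \<and>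
           is_eigenvalue (Omega_measure d) (H_op d j) (complex_of_real E) \<and>
           has_multiplicity (Omega_measure d) (H_op d j) (complex_of_real E) 1"
proof
  fix j
  define M where "M = lebesgue_on (Omega d)"
  define \<Lambda> where "\<Lambda> = 2 * (freq d j)\<^sup>2"
  define H where "H = H_op d j"
  define D where "D = form_domain d j"
  let ?a = "dirichlet_form (Omega d)"
  have M: "Omega_measure d = M" by (simp add: M_def Omega_measure_def)
  obtain g where g: "g \<in> L2 M" "\<forall>f\<in>D. l2_inner M g f = 0 \<longrightarrow> \<Lambda> * Re (l2_inner M f f) \<le> Re (?a f f)"
    using hyperplane_bound[OF assms, of j] unfolding M_def \<Lambda>_def D_def by blast
  obtain w where w: "w \<in> D" "Re (?a w w) < \<Lambda> * Re (l2_inner M w w)"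
    using energy_below_threshold[OF assms, of j] unfolding M_def \<Lambda>_def D_def by blast
  interpret F: form_space fcomb "L2 M" D "l2_inner M" ?a
    unfolding M_def D_def by (rule form_space_sector)
  interpret G: gap_form fcomb "L2 M" D "l2_inner M" ?a g \<Lambda> w
    by standard (use g w in auto)
  have DL: "f \<in> L2_sector d j" "f \<in> L2 M" if "f \<in> D" for f
    using that unfolding D_def M_def form_domain_def L2_sector_def Omega_measure_def by auto
  have HI: "(\<phi>, \<psi>) \<in> H" if "\<phi> \<in> D" "\<psi> \<in> L2_sector d j" "\<forall>f\<in>D. ?a f \<phi> = l2_inner M f \<psi>" for \<phi> \<psi>
    using that unfolding H_def H_op_def form_operator_def D_def M_def Omega_measure_def by simp
  have HG: "(\<phi>, \<psi>) \<in> G.form_graph" if "(\<phi>, \<psi>) \<in> H" for \<phi> \<psi>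
    using that unfolding G.form_graph_def unfolding H_def H_op_def form_operator_def D_def M_def L2_sector_def Omega_measure_def by simp
  have H1: "\<phi> \<in> D" "\<psi> \<in> L2 M" "\<And>f. f \<in> D \<Longrightarrow> ?a f \<phi> = l2_inner M f \<psi>" if "(\<phi>, \<psi>) \<in> H" for \<phi> \<psi>
    using HG[OF that] by (auto simp: G.form_graph_def)
  have zero: "(AE p in M. f p = 0) \<longleftrightarrow> Re (l2_inner M f f) = 0" if "f \<in> L2 M" for f
    using l2_norm_zero_iff[OF that] by (simp add: l2_norm_inner)
  let ?E = "complex_of_real G.E0"
  have u0L: "G.u0 \<in> L2 M" by (rule DL(2)[OF G.u0(1)])
  have u0n: "\<not> (AE p in M. G.u0 p = 0)" unfolding zero[OF u0L] G.u0(2) by simp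
  have scale: "l2_inner M f (fcomb c h 0 h) = c * l2_inner M f h" if "f \<in> L2 M" "h \<in> L2 M" for f h c
    using L2.lin[OF that(1,2,2), of c 0] by simp
  have u0H: "(G.u0, fcomb ?E G.u0 0 G.u0) \<in> H"
  proof (intro HI G.u0(1) L2_sector_fcomb DL ballI)
    fix f assume f: "f \<in> D"
    show "?a f G.u0 = l2_inner M f (fcomb ?E G.u0 0 G.u0)"
      unfolding scale[OF DL(2)[OF f] u0L] by (rule G.u0(3)[OF f])
  qed
  have u0E: "G.u0 \<in> eigenspace M H ?E"
    unfolding eigenspace_def mem_Collect_eq
    by (intro exI[of _ "fcomb ?E G.u0 0 G.u0"] conjI u0H AE_I2) simp
  have ev: "is_eigenvalue M H ?E" unfolding is_eigenvalue_def using u0n u0E by blast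
  have eig: "l2_inner M f \<psi> = z * l2_inner M f \<phi>" if "(\<phi>, \<psi>) \<in> H" "AE p in M. \<psi> p = z * \<phi> p" "f \<in> L2 M" for \<phi> \<psi> z f
  proof -
    have L: "\<phi> \<in> L2 M" "\<psi> \<in> L2 M" using H1[OF that(1)] DL(2) by auto
    have "l2_inner M f \<psi> = l2_inner M f (fcomb z \<phi> 0 \<phi>)"
      by (rule l2_inner_cong[OF L(2) L2_fcomb[OF L(1) L(1)] that(3) that(3)]) (use that(2) in auto)
    also have "\<dots> = z * l2_inner M f \<phi>" by (rule scale[OF that(3) L(1)])
    finally show ?thesis .
  qed
  have mult: "has_multiplicity M H ?E 1" unfolding has_multiplicity_def has_dim_ae_def
  proof (intro exI[of _ "\<lambda>_. G.u0"] conjI allI impI ballI)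
    show "G.u0 \<in> eigenspace M H ?E" by (rule u0E)
    show "c i = 0" if "AE p in M. (\<Sum>i<1. c i * G.u0 p) = 0" "i < 1" for c :: "nat \<Rightarrow> complex" and i
    proof (rule ccontr)
      assume "c i \<noteq> 0"
      then have "c 0 \<noteq> 0" using that(2) by simp
      then show False using that(1) u0n by simp
    qed
    show "\<exists>c :: nat \<Rightarrow> complex. AE p in M. \<phi> p = (\<Sum>i<1. c i * G.u0 p)" if \<phi>: "\<phi> \<in> eigenspace M H ?E" for \<phi>
    proof -
      obtain \<psi> where \<psi>: "(\<phi>, \<psi>) \<in> H" "AE p in M. \<psi> p = ?E * \<phi> p"
        using \<phi> unfolding eigenspace_def by blast
      define c where "c = l2_inner M G.u0 \<phi>"
      have L: "\<phi> \<in> L2 M" by (rule DL(2)[OF H1(1)[OF \<psi>(1)]])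
      have "Re (l2_inner M (fcomb 1 \<phi> (- c) G.u0) (fcomb 1 \<phi> (- c) G.u0)) = 0"
        unfolding c_def by (rule G.eigen_below(1)[OF HG[OF \<psi>(1)] eig[OF \<psi> DL(2)] G.E0(2)])
      then have "AE p in M. fcomb 1 \<phi> (- c) G.u0 p = 0" by (subst zero[OF L2_fcomb[OF L u0L]])
      then have "AE p in M. \<phi> p = (\<Sum>i<1::nat. c * G.u0 p)" by eventually_elim simp
      then show ?thesis by (rule exI[of _ "\<lambda>_. c"])
    qed
  qed
  have inS: "?E \<in> spectrum M (L2_sector d j) H"
  proof (rule ccontr)
    assume "?E \<notin> spectrum M (L2_sector d j) H"
    then obtain C where C: "\<forall>(\<phi>, \<psi>)\<in>H. l2_norm M \<phi> \<le> C * l2_norm M (\<lambda>p. \<psi> p - ?E * \<phi> p)"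
      unfolding spectrum_def resolvent_set_def by blast
    \<comment> \<open>The pair of \<open>u0\<close> has residual 0, so the resolvent estimate would
      make \<open>u0\<close> vanish.\<close>
    have "l2_norm M G.u0 \<le> 0" using bspec[OF C u0H] by (simp add: l2_norm_def)
    then show False unfolding l2_norm_inner G.u0(2) by simp
  qed
  have res: "z \<notin> spectrum M (L2_sector d j) H" if z: "cmod (z - ?E) < (\<Lambda> - G.E0) / 2" "z \<noteq> ?E" for z
  proof -
    have "\<exists>(\<phi>, \<psi>)\<in>H. AE p in M. \<psi> p - z * \<phi> p = \<eta> p" if \<eta>: "\<eta> \<in> L2_sector d j" for \<eta>
    proof -
      have "\<eta> \<in> L2 M" using \<eta> by (simp add: L2_sector_def M)
      then obtain \<phi> where \<phi>: "\<phi> \<in> D" "\<forall>f\<in>D. ?a f \<phi> = l2_inner M f (fcomb 1 \<eta> z \<phi>)" using G.solvable[OF z] by blast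
      \<comment> \<open>\<open>\<eta>\<close> and \<open>\<phi>\<close> lie in the sector, hence so
        does the image, of which the abstract result knows only that it is in L2.\<close>
      have "(\<phi>, fcomb 1 \<eta> z \<phi>) \<in> H" by (rule HI[OF \<phi>(1) L2_sector_fcomb[OF \<eta> DL(1)[OF \<phi>(1)]] \<phi>(2)])
      then show ?thesis by (rule rev_bexI) simp
    qed
    moreover have "\<exists>C. \<forall>(\<phi>, \<psi>)\<in>H. l2_norm M \<phi> \<le> C * l2_norm M (\<lambda>p. \<psi> p - z * \<phi> p)"
    proof -
      obtain C where C: "\<forall>(\<phi>, \<psi>)\<in>G.form_graph. sqrt (Re (l2_inner M \<phi> \<phi>)) \<le> C * sqrt (Re (l2_inner M (fcomb 1 \<psi> (- z) \<phi>) (fcomb 1 \<psi> (- z) \<phi>)))"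
        using G.lower_bound[OF z] by (elim exE) (rule that)
      have "l2_norm M \<phi> \<le> C * l2_norm M (\<lambda>p. \<psi> p - z * \<phi> p)" if "(\<phi>, \<psi>) \<in> H" for \<phi> \<psi>
      proof -
        have "(\<lambda>p. \<psi> p - z * \<phi> p) = fcomb 1 \<psi> (- z) \<phi>" by simp
        then show ?thesis using C HG[OF that] unfolding l2_norm_inner by (simp only:) blast
      qed
      then show ?thesis by blast
    qed
    ultimately show ?thesis unfolding spectrum_def resolvent_set_def by simp
  qed
  have iso: "?E isolated_in spectrum M (L2_sector d j) H"
  proof -
    have "ball ?E ((\<Lambda> - G.E0) / 2) \<inter> spectrum M (L2_sector d j) H = {?E}"
    proof (intro equalityI subsetI)
      fix z assume "z \<in> ball ?E ((\<Lambda> - G.E0) / 2) \<inter> spectrum M (L2_sector d j) H"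
      then show "z \<in> {?E}" using res[of z] by (auto simp: dist_norm norm_minus_commute)
    qed (use inS G.E0(2) in auto)
    then show ?thesis unfolding isolated_in_def using inS open_ball by blast
  qed
  have uniq: "z = ?E" if z: "z isolated_in spectrum M (L2_sector d j) H" "is_eigenvalue M H z" for z
  proof -
    obtain \<phi> \<psi> where \<phi>: "(\<phi>, \<psi>) \<in> H" "AE p in M. \<psi> p = z * \<phi> p" "\<not> (AE p in M. \<phi> p = 0)"
      using z(2) unfolding is_eigenvalue_def eigenspace_def by blast
    have \<phi>D: "\<phi> \<in> D" by (rule H1(1)[OF \<phi>(1)])
    have \<phi>L: "\<phi> \<in> L2 M" by (rule DL(2)[OF \<phi>D])
    define n where "n = Re (l2_inner M \<phi> \<phi>)"
    \<comment> \<open>The Rayleigh quotient of the eigenfunction; it turns out to be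
      \<open>z\<close>, which is therefore real.\<close>
    define \<mu> where "\<mu> = Re (?a \<phi> \<phi>) / n"
    have n: "0 < n" using L2.pos[OF \<phi>L] \<phi>(3) zero[OF \<phi>L] unfolding n_def by linarith
    have "?a \<phi> \<phi> = z * l2_inner M \<phi> \<phi>" using H1(3)[OF \<phi>(1) \<phi>D] eig[OF \<phi>(1,2) \<phi>L] by simp
    moreover have "l2_inner M \<phi> \<phi> = of_real n" unfolding n_def by (rule L2.im0[OF \<phi>L])
    moreover have "?a \<phi> \<phi> = of_real (\<mu> * n)"
    proof -
      have "\<mu> * n = Re (?a \<phi> \<phi>)" using n by (simp add: \<mu>_def)
      then show ?thesis using F.A.im0[OF \<phi>D] by (simp only:)
    qed
    ultimately have "of_real \<mu> * complex_of_real n = z * of_real n" by simp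
    then have z\<mu>: "z = of_real \<mu>" using n by simp
    \<comment> \<open>From the threshold on, the points \<mu> + e / 2 belong to the spectrum for
      every e > 0, so \<mu> would not be isolated.\<close>
    have "\<mu> < \<Lambda>"
    proof (rule ccontr)
      assume "\<not> \<mu> < \<Lambda>"
      obtain T where T: "open T" "T \<inter> spectrum M (L2_sector d j) H = {z}" using z(1) by (auto simp: isolated_in_def)
      then have "z \<in> T" by blast
      then obtain e where e: "0 < e" "ball z e \<subseteq> T" using T(1) open_contains_ball by blast
      have "complex_of_real (\<mu> + e / 2) \<in> ball z e" using e by (simp add: z\<mu> dist_norm)
      moreover have "complex_of_real (\<mu> + e / 2) \<in> spectrum M (L2_sector d j) H"
        using spectrum_above[OF assms, of j "\<mu> + e / 2"] \<open>\<not> \<mu> < \<Lambda>\<close> e unfolding M H_def \<Lambda>_def by simp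
      ultimately have "complex_of_real (\<mu> + e / 2) = z" using e(2) T(2) by blast
      then show False using e(1) unfolding z\<mu> of_real_eq_iff by simp
    qed
    have "\<mu> = G.E0 \<or> Re (l2_inner M \<phi> \<phi>) = 0"
      by (rule G.eigen_below(2)[OF HG[OF \<phi>(1)] eig[OF \<phi>(1) \<phi>(2)[unfolded z\<mu>] DL(2)] \<open>\<mu> < \<Lambda>\<close>])
    then show ?thesis using n by (simp add: z\<mu> n_def)
  qed
  have "discrete_spectrum M (L2_sector d j) H = {?E}"
    unfolding discrete_spectrum_def
  proof (intro equalityI subsetI)
    fix z assume "z \<in> {?E}"
    then show "z \<in> {z. z isolated_in spectrum M (L2_sector d j) H \<and> is_eigenvalue M H z \<and> (\<exists>n. has_multiplicity M H z n)}"
      using iso ev mult by blast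
  qed (use uniq in blast)
  then show "\<exists>E\<ge>0. discrete_spectrum (Omega_measure d) (L2_sector d j) (H_op d j) = {complex_of_real E} \<and>
           is_eigenvalue (Omega_measure d) (H_op d j) (complex_of_real E) \<and>
           has_multiplicity (Omega_measure d) (H_op d j) (complex_of_real E) 1"
    unfolding M H_def[symmetric] using G.E0(1) ev mult by blast
qed

end
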